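(* (1) Let $(H,m)$ be a braided (unital) algebra and $k\in\mathbb Z$. Then $m_k:=m\,\Psi_{HH}^k:H\otimes H\to H$ defines a product on $H$ turning it again into a braided (unital) algebra (with the same unit element and the braiding $\Psi_{HH}$). If $V$ is a left or right $H$-braided vector space such that the braiding is compatible with the multiplication $m$ on $H$, then the braiding is also compatible with the multiplication $m_k$. (2) Let $(H,\Delta,\varepsilon)$ be a braided coalgebra and $n\in\mathbb Z$. Then $\Delta_n:=\Psi_{HH}^n\,\Delta:H\to H\otimes H$ defines a coproduct on $H$ turning it again into a braided coalgebra with the same counit (and the braiding $\Psi_{HH}$). If $V$ is a left or right $H$-braided vector space such that the braiding is compatible with the comultiplication $\Delta$ of $H$, then the braiding is also compatible with the coproduct $\Delta_n$. (3) Let $H$ be a braided bialgebra and let $H^{(k,n)}$ denote the linear space $H$ equipped with the product $m_k$, the unmodified unit element, the coproduct $\Delta_n$ and the unmodified counit. Then, for all $n\in\mathbb Z$, $H^{(n,-n)}$ is a braided bialgebra with respect to the braiding $\Psi_{HH}$, and $H^{(n-1,-n)}$ is a braided bialgebra with respect to the braiding $\Psi_{HH}^{-1}$. (4) If $H$ is a braided Hopf algebra with antipode $S$, then all $H^{(n,-n)}$, $n\in\mathbb Z$, are braided Hopf algebras with the unmodified antipode $S$. If $S$ is invertible, then all $H^{(n-1,-n)}$, $n\in\mathbb Z$, are braided Hopf algebras with antipode $S^{-1}$.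
   Context: All vector spaces are over a fixed field $\mathbb K$, $\otimes$ is the algebraic tensor product, and composition of maps is written by juxtaposition. A braiding on $V$ is a bijective linear map $\Psi_{VV}:V\otimes V\to V\otimes V$ with $(\Psi_{VV}\otimes\mathrm{id})(\mathrm{id}\otimes\Psi_{VV})(\Psi_{VV}\otimes\mathrm{id})=(\mathrm{id}\otimes\Psi_{VV})(\Psi_{VV}\otimes\mathrm{id})(\mathrm{id}\otimes\Psi_{VV})$; $V$ is then a braided vector space. Let $\Psi_{VW}:V\otimes W\to W\otimes V$ be bijective and linear. If $V$ is braided, $W$ is a left $V$-braided vector space if $(\Psi_{VW}\otimes\mathrm{id})(\mathrm{id}\otimes\Psi_{VW})(\Psi_{VV}\otimes\mathrm{id})=(\mathrm{id}\otimes\Psi_{VV})(\Psi_{VW}\otimes\mathrm{id})(\mathrm{id}\otimes\Psi_{VW})$. If $W$ is braided, $V$ is a right $W$-braided vector space if $(\mathrm{id}\otimes\Psi_{VW})(\Psi_{VW}\otimes\mathrm{id})(\mathrm{id}\otimes\Psi_{WW})=(\Psi_{WW}\otimes\mathrm{id})(\mathrm{id}\otimes\Psi_{VW})(\Psi_{VW}\otimes\mathrm{id})$. Compatibility of $\Psi=\Psi_{VW}$: with the multiplication of an algebra $V$: $\Psi(m_V\otimes\mathrm{id})=(\mathrm{id}\otimes m_V)(\Psi\otimes\mathrm{id})(\mathrm{id}\otimes\Psi)$ and $\Psi(1\otimes w)=w\otimes1$ if $1\in V$; with the multiplication of an algebra $W$: $\Psi(\mathrm{id}\otimes m_W)=(m_W\otimes\mathrm{id})(\mathrm{id}\otimes\Psi)(\Psi\otimes\mathrm{id})$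 and $\Psi(v\otimes1)=1\otimes v$ if $1\in W$; with the comultiplication of a coalgebra $V$: $(\mathrm{id}\otimes\Delta)\Psi=(\Psi\otimes\mathrm{id})(\mathrm{id}\otimes\Psi)(\Delta\otimes\mathrm{id})$ and $(\mathrm{id}\otimes\varepsilon)\Psi=\varepsilon\otimes\mathrm{id}$; with the comultiplication of a coalgebra $W$: $(\Delta\otimes\mathrm{id})\Psi=(\mathrm{id}\otimes\Psi)(\Psi\otimes\mathrm{id})(\mathrm{id}\otimes\Delta)$ and $(\varepsilon\otimes\mathrm{id})\Psi=\mathrm{id}\otimes\varepsilon$. A braided (co)algebra is a (co)algebra with a braiding satisfying both compatibility conditions with its (co)multiplication. A braided bialgebra is a unital algebra $(H,m)$ with a coalgebra structure $(\Delta,\varepsilon)$ and a braiding $\Psi_{HH}$ making it a braided algebra and a braided coalgebra, such that the coproduct is an algebra homomorphism from $H$ to $H\otimes H$ equipped with the product $(m\otimes m)(\mathrm{id}\otimes\Psi_{HH}\otimes\mathrm{id})$, i.e. $\Delta m=(m\otimes m)(\mathrm{id}\otimes\Psi_{HH}\otimes\mathrm{id})(\Delta\otimes\Delta)$. It is a braided Hopf algebra if the identity map has a convolution inverse $S:H\to H$ (antipode), i.e. a linear map $S$ with $m(S\otimes\mathrm{id})\Delta=1\varepsilon=m(\mathrm{id}\otimes S)\Delta$. *)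

theory Defs
  imports "HOL-Algebra.Module" "HOL-Algebra.AbelCoset"
begin

section \<open>Tensor products of vector spaces\<close>

text \<open>
  A vector space over a field K is a record V with \<open>module K V\<close>.  The ring multiplication and unit
  which the record type contains play no role; in the vector spaces constructed below they are
  left undefined.
\<close>

definition free_module :: "('k, 'r) ring_scheme \<Rightarrow> 'x set \<Rightarrow> ('k, 'x \<Rightarrow> 'k) module" where
  "free_module K X =
    \<lparr>carrier = {f \<in> X \<rightarrow>\<^sub>E carrier K. finite {x \<in> X. f x \<noteq> \<zero>\<^bsub>K\<^esub>}},
     mult = undefined, one = undefined,
     zero = (\<lambda>x\<in>X. \<zero>\<^bsub>K\<^esub>),
     add = (\<lambda>f g. \<lambda>x\<in>X. f x \<oplus>\<^bsub>K\<^esub> g x),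
     smult = (\<lambda>c f. \<lambda>x\<in>X. c \<otimes>\<^bsub>K\<^esub> f x)\<rparr>"

definition free_gen :: "('k, 'r) ring_scheme \<Rightarrow> 'x set \<Rightarrow> 'x \<Rightarrow> 'x \<Rightarrow> 'k" where
  "free_gen K X a = (\<lambda>x\<in>X. if x = a then \<one>\<^bsub>K\<^esub> else \<zero>\<^bsub>K\<^esub>)"

definition submodule_span :: "('k, 'r) ring_scheme \<Rightarrow> ('k, 'a) module \<Rightarrow> 'a set \<Rightarrow> 'a set" where
  "submodule_span K M B = \<Inter> {N. submodule N K M \<and> B \<subseteq> N}"

definition quotient_module :: "('k, 'a) module \<Rightarrow> 'a set \<Rightarrow> ('k, 'a set) module" where
  "quotient_module M N =
    \<lparr>carrier = a_rcosets\<^bsub>M\<^esub> N,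
     mult = undefined, one = undefined,
     zero = N,
     add = set_add M,
     smult = (\<lambda>c A. \<Union>x\<in>A. N +>\<^bsub>M\<^esub> (c \<odot>\<^bsub>M\<^esub> x))\<rparr>"

definition tensor_relations ::
  "('k, 'r) ring_scheme \<Rightarrow> ('k, 'a) module \<Rightarrow> ('k, 'b) module \<Rightarrow> ('a \<times> 'b \<Rightarrow> 'k) set" where
  "tensor_relations K V W =
    (let F = free_module K (carrier V \<times> carrier W);
         e = (\<lambda>v w. free_gen K (carrier V \<times> carrier W) (v, w))
     in {e (v \<oplus>\<^bsub>V\<^esub> v') w \<ominus>\<^bsub>F\<^esub> (e v w \<oplus>\<^bsub>F\<^esub> e v' w) | v v' w.
           v \<in> carrier V \<and> v' \<in> carrier V \<and> w \<in> carrier W} \<union>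
        {e v (w \<oplus>\<^bsub>W\<^esub> w') \<ominus>\<^bsub>F\<^esub> (e v w \<oplus>\<^bsub>F\<^esub> e v w') | v w w'.
           v \<in> carrier V \<and> w \<in> carrier W \<and> w' \<in> carrier W} \<union>
        {e (c \<odot>\<^bsub>V\<^esub> v) w \<ominus>\<^bsub>F\<^esub> (c \<odot>\<^bsub>F\<^esub> e v w) | c v w.
           c \<in> carrier K \<and> v \<in> carrier V \<and> w \<in> carrier W} \<union>
        {e v (c \<odot>\<^bsub>W\<^esub> w) \<ominus>\<^bsub>F\<^esub> (c \<odot>\<^bsub>F\<^esub> e v w) | c v w.
           c \<in> carrier K \<and> v \<in> carrier V \<and> w \<in> carrier W})"

definition tensor_null ::
  "('k, 'r) ring_scheme \<Rightarrow> ('k, 'a) module \<Rightarrow> ('k, 'b) module \<Rightarrow> ('a \<times> 'b \<Rightarrow> 'k) set" where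
  "tensor_null K V W =
    submodule_span K (free_module K (carrier V \<times> carrier W)) (tensor_relations K V W)"

definition tensor ::
  "('k, 'r) ring_scheme \<Rightarrow> ('k, 'a) module \<Rightarrow> ('k, 'b) module \<Rightarrow> ('k, ('a \<times> 'b \<Rightarrow> 'k) set) module"
  where
  "tensor K V W = quotient_module (free_module K (carrier V \<times> carrier W)) (tensor_null K V W)"

definition pure_tensor ::
  "('k, 'r) ring_scheme \<Rightarrow> ('k, 'a) module \<Rightarrow> ('k, 'b) module \<Rightarrow> 'a \<Rightarrow> 'b \<Rightarrow> ('a \<times> 'b \<Rightarrow> 'k) set"
  where
  "pure_tensor K V W v w =
    tensor_null K V W +>\<^bsub>free_module K (carrier V \<times> carrier W)\<^esub>
      free_gen K (carrier V \<times> carrier W) (v, w)"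

definition ground_module :: "('k, 'r) ring_scheme \<Rightarrow> ('k, 'k) module" where
  "ground_module K =
    \<lparr>carrier = carrier K, mult = undefined, one = undefined,
     zero = \<zero>\<^bsub>K\<^esub>, add = (\<lambda>a b. a \<oplus>\<^bsub>K\<^esub> b), smult = (\<lambda>a b. a \<otimes>\<^bsub>K\<^esub> b)\<rparr>"


section \<open>Linear maps with domain and codomain\<close>

text \<open>
  The underlying function is undefined outside the domain, so that equality of two records is
  equality of linear maps.
\<close>

record ('k, 'a, 'b) lmap =
  src :: "('k, 'a) module"
  tgt :: "('k, 'b) module"
  app :: "'a \<Rightarrow> 'b"

definition lin_maps ::
  "('k, 'r) ring_scheme \<Rightarrow> ('k, 'a) module \<Rightarrow> ('k, 'b) module \<Rightarrow> ('k, 'a, 'b) lmap set" where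
  "lin_maps K V W =
    {f. src f = V \<and> tgt f = W \<and> app f \<in> carrier V \<rightarrow>\<^sub>E carrier W \<and>
        (\<forall>x\<in>carrier V. \<forall>y\<in>carrier V. app f (x \<oplus>\<^bsub>V\<^esub> y) = app f x \<oplus>\<^bsub>W\<^esub> app f y) \<and>
        (\<forall>c\<in>carrier K. \<forall>x\<in>carrier V. app f (c \<odot>\<^bsub>V\<^esub> x) = c \<odot>\<^bsub>W\<^esub> app f x)}"

definition lbij :: "('k, 'a, 'b) lmap \<Rightarrow> bool" where
  "lbij f \<longleftrightarrow> bij_betw (app f) (carrier (src f)) (carrier (tgt f))"

definition lid :: "('k, 'a) module \<Rightarrow> ('k, 'a, 'a) lmap" where
  "lid V = \<lparr>src = V, tgt = V, app = (\<lambda>x\<in>carrier V. x)\<rparr>"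

definition lcomp :: "('k, 'b, 'c) lmap \<Rightarrow> ('k, 'a, 'b) lmap \<Rightarrow> ('k, 'a, 'c) lmap"
    (infixr "\<cdot>" 70) where
  "g \<cdot> f = \<lparr>src = src f, tgt = tgt g, app = compose (carrier (src f)) (app g) (app f)\<rparr>"

definition linv :: "('k, 'a, 'b) lmap \<Rightarrow> ('k, 'b, 'a) lmap" where
  "linv f = \<lparr>src = tgt f, tgt = src f,
     app = (\<lambda>y\<in>carrier (tgt f). inv_into (carrier (src f)) (app f) y)\<rparr>"

definition lpow :: "('k, 'a, 'a) lmap \<Rightarrow> int \<Rightarrow> ('k, 'a, 'a) lmap" where
  "lpow f k =
    (if 0 \<le> k then (lcomp f ^^ nat k) (lid (src f))
     else (lcomp (linv f) ^^ nat (- k)) (lid (src f)))"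

definition tensor_map ::
  "('k, 'a, 'c) lmap \<Rightarrow> ('k, 'r) ring_scheme \<Rightarrow> ('k, 'b, 'd) lmap \<Rightarrow>
   ('k, ('a \<times> 'b \<Rightarrow> 'k) set, ('c \<times> 'd \<Rightarrow> 'k) set) lmap"
    ("_ \<boxtimes>\<^bsub>_\<^esub> _" [76, 0, 76] 75) where
  "f \<boxtimes>\<^bsub>K\<^esub> g =
    (THE h. h \<in> lin_maps K (tensor K (src f) (src g)) (tensor K (tgt f) (tgt g)) \<and>
       (\<forall>v\<in>carrier (src f). \<forall>w\<in>carrier (src g).
          app h (pure_tensor K (src f) (src g) v w) =
            pure_tensor K (tgt f) (tgt g) (app f v) (app g w)))"

text \<open>
  The canonical isomorphisms that are usually suppressed: \<open>(U \<otimes> V) \<otimes> W \<rightarrow> U \<otimes> (V \<otimes> W)\<close>,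
  \<open>K \<otimes> V \<rightarrow> V\<close> and \<open>V \<otimes> K \<rightarrow> V\<close>.
\<close>

definition lassoc ::
  "('k, 'r) ring_scheme \<Rightarrow> ('k, 'a) module \<Rightarrow> ('k, 'b) module \<Rightarrow> ('k, 'c) module \<Rightarrow>
   ('k, (('a \<times> 'b \<Rightarrow> 'k) set \<times> 'c \<Rightarrow> 'k) set, ('a \<times> ('b \<times> 'c \<Rightarrow> 'k) set \<Rightarrow> 'k) set) lmap"
  where
  "lassoc K U V W =
    (THE h. h \<in> lin_maps K (tensor K (tensor K U V) W) (tensor K U (tensor K V W)) \<and>
       (\<forall>u\<in>carrier U. \<forall>v\<in>carrier V. \<forall>w\<in>carrier W.
          app h (pure_tensor K (tensor K U V) W (pure_tensor K U V u v) w) =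
            pure_tensor K U (tensor K V W) u (pure_tensor K V W v w)))"

definition lunit_l ::
  "('k, 'r) ring_scheme \<Rightarrow> ('k, 'a) module \<Rightarrow> ('k, ('k \<times> 'a \<Rightarrow> 'k) set, 'a) lmap" where
  "lunit_l K V =
    (THE h. h \<in> lin_maps K (tensor K (ground_module K) V) V \<and>
       (\<forall>c\<in>carrier K. \<forall>v\<in>carrier V.
          app h (pure_tensor K (ground_module K) V c v) = c \<odot>\<^bsub>V\<^esub> v))"

definition lunit_r ::
  "('k, 'r) ring_scheme \<Rightarrow> ('k, 'a) module \<Rightarrow> ('k, ('a \<times> 'k \<Rightarrow> 'k) set, 'a) lmap" where
  "lunit_r K V =
    (THE h. h \<in> lin_maps K (tensor K V (ground_module K)) V \<and>
       (\<forall>v\<in>carrier V. \<forall>c\<in>carrier K.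
          app h (pure_tensor K V (ground_module K) v c) = c \<odot>\<^bsub>V\<^esub> v))"


section \<open>Braidings\<close>

definition lin_bij ::
  "('k, 'r) ring_scheme \<Rightarrow> ('k, 'a) module \<Rightarrow> ('k, 'b) module \<Rightarrow> ('k, 'a, 'b) lmap \<Rightarrow> bool" where
  "lin_bij K V W f \<longleftrightarrow> f \<in> lin_maps K V W \<and> lbij f"

definition braided_space ::
  "('k, 'r) ring_scheme \<Rightarrow> ('k, 'a) module \<Rightarrow>
   ('k, ('a \<times> 'a \<Rightarrow> 'k) set, ('a \<times> 'a \<Rightarrow> 'k) set) lmap \<Rightarrow> bool" where
  "braided_space K V \<Psi> \<longleftrightarrow>
     module K V \<and> lin_bij K (tensor K V V) (tensor K V V) \<Psi> \<and>
     (let \<alpha> = lassoc K V V V;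
          \<Psi>12 = \<Psi> \<boxtimes>\<^bsub>K\<^esub> lid V;
          \<Psi>23 = linv \<alpha> \<cdot> (lid V \<boxtimes>\<^bsub>K\<^esub> \<Psi>) \<cdot> \<alpha>
      in \<Psi>12 \<cdot> \<Psi>23 \<cdot> \<Psi>12 = \<Psi>23 \<cdot> \<Psi>12 \<cdot> \<Psi>23)"

text \<open>W is a left V-braided vector space with respect to \<open>\<Psi> : V \<otimes> V \<rightarrow> V \<otimes> V\<close> and
  \<open>\<Phi> : V \<otimes> W \<rightarrow> W \<otimes> V\<close>; both sides of the equation are maps
  \<open>(V \<otimes> V) \<otimes> W \<rightarrow> (W \<otimes> V) \<otimes> V\<close>.\<close>

definition left_braided_space ::
  "('k, 'r) ring_scheme \<Rightarrow> ('k, 'a) module \<Rightarrow>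
   ('k, ('a \<times> 'a \<Rightarrow> 'k) set, ('a \<times> 'a \<Rightarrow> 'k) set) lmap \<Rightarrow> ('k, 'b) module \<Rightarrow>
   ('k, ('a \<times> 'b \<Rightarrow> 'k) set, ('b \<times> 'a \<Rightarrow> 'k) set) lmap \<Rightarrow> bool" where
  "left_braided_space K V \<Psi> W \<Phi> \<longleftrightarrow>
     braided_space K V \<Psi> \<and> module K W \<and> lin_bij K (tensor K V W) (tensor K W V) \<Phi> \<and>
     (\<Phi> \<boxtimes>\<^bsub>K\<^esub> lid V) \<cdot> linv (lassoc K V W V) \<cdot> (lid V \<boxtimes>\<^bsub>K\<^esub> \<Phi>) \<cdot> lassoc K V V W \<cdot> (\<Psi> \<boxtimes>\<^bsub>K\<^esub> lid W) =
     linv (lassoc K W V V) \<cdot> (lid W \<boxtimes>\<^bsub>K\<^esub> \<Psi>) \<cdot> lassoc K W V V \<cdot> (\<Phi> \<boxtimes>\<^bsub>K\<^esub> lid V) \<cdot>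
       linv (lassoc K V W V) \<cdot> (lid V \<boxtimes>\<^bsub>K\<^esub> \<Phi>) \<cdot> lassoc K V V W"

text \<open>V is a right W-braided vector space with respect to \<open>\<Psi> : W \<otimes> W \<rightarrow> W \<otimes> W\<close> and
  \<open>\<Phi> : V \<otimes> W \<rightarrow> W \<otimes> V\<close>; both sides of the equation are maps
  \<open>V \<otimes> (W \<otimes> W) \<rightarrow> W \<otimes> (W \<otimes> V)\<close>.\<close>

definition right_braided_space ::
  "('k, 'r) ring_scheme \<Rightarrow> ('k, 'b) module \<Rightarrow>
   ('k, ('b \<times> 'b \<Rightarrow> 'k) set, ('b \<times> 'b \<Rightarrow> 'k) set) lmap \<Rightarrow> ('k, 'a) module \<Rightarrow>
   ('k, ('a \<times> 'b \<Rightarrow> 'k) set, ('b \<times> 'a \<Rightarrow> 'k) set) lmap \<Rightarrow> bool" where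
  "right_braided_space K W \<Psi> V \<Phi> \<longleftrightarrow>
     braided_space K W \<Psi> \<and> module K V \<and> lin_bij K (tensor K V W) (tensor K W V) \<Phi> \<and>
     (lid W \<boxtimes>\<^bsub>K\<^esub> \<Phi>) \<cdot> lassoc K W V W \<cdot> (\<Phi> \<boxtimes>\<^bsub>K\<^esub> lid W) \<cdot> linv (lassoc K V W W) \<cdot> (lid V \<boxtimes>\<^bsub>K\<^esub> \<Psi>) =
     lassoc K W W V \<cdot> (\<Psi> \<boxtimes>\<^bsub>K\<^esub> lid V) \<cdot> linv (lassoc K W W V) \<cdot> (lid W \<boxtimes>\<^bsub>K\<^esub> \<Phi>) \<cdot>
       lassoc K W V W \<cdot> (\<Phi> \<boxtimes>\<^bsub>K\<^esub> lid W) \<cdot> linv (lassoc K V W W)"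


section \<open>Algebras and coalgebras\<close>

text \<open>Algebras are associative and need not have a unit.\<close>

definition assoc_algebra ::
  "('k, 'r) ring_scheme \<Rightarrow> ('k, 'a) module \<Rightarrow> ('k, ('a \<times> 'a \<Rightarrow> 'k) set, 'a) lmap \<Rightarrow> bool" where
  "assoc_algebra K H m \<longleftrightarrow>
     module K H \<and> m \<in> lin_maps K (tensor K H H) H \<and>
     m \<cdot> (m \<boxtimes>\<^bsub>K\<^esub> lid H) = m \<cdot> (lid H \<boxtimes>\<^bsub>K\<^esub> m) \<cdot> lassoc K H H H"

definition is_unit ::
  "('k, 'r) ring_scheme \<Rightarrow> ('k, 'a) module \<Rightarrow> ('k, ('a \<times> 'a \<Rightarrow> 'k) set, 'a) lmap \<Rightarrow> 'a \<Rightarrow> bool"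
  where
  "is_unit K H m u \<longleftrightarrow>
     u \<in> carrier H \<and>
     (\<forall>x\<in>carrier H. app m (pure_tensor K H H u x) = x \<and> app m (pure_tensor K H H x u) = x)"

definition coalgebra ::
  "('k, 'r) ring_scheme \<Rightarrow> ('k, 'a) module \<Rightarrow> ('k, 'a, ('a \<times> 'a \<Rightarrow> 'k) set) lmap \<Rightarrow>
   ('k, 'a, 'k) lmap \<Rightarrow> bool" where
  "coalgebra K H \<Delta> \<epsilon> \<longleftrightarrow>
     module K H \<and> \<Delta> \<in> lin_maps K H (tensor K H H) \<and> \<epsilon> \<in> lin_maps K H (ground_module K) \<and>
     lassoc K H H H \<cdot> (\<Delta> \<boxtimes>\<^bsub>K\<^esub> lid H) \<cdot> \<Delta> = (lid H \<boxtimes>\<^bsub>K\<^esub> \<Delta>) \<cdot> \<Delta> \<and>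
     lunit_l K H \<cdot> (\<epsilon> \<boxtimes>\<^bsub>K\<^esub> lid H) \<cdot> \<Delta> = lid H \<and>
     lunit_r K H \<cdot> (lid H \<boxtimes>\<^bsub>K\<^esub> \<epsilon>) \<cdot> \<Delta> = lid H"

text \<open>
  Compatibility of \<open>\<Phi> : V \<otimes> W \<rightarrow> W \<otimes> V\<close> with a (co)multiplication of the left factor V
  (suffix l) or of the right factor W (suffix r).  The condition on the unit only takes effect
  if the algebra has one.
\<close>

definition mult_compat_l ::
  "('k, 'r) ring_scheme \<Rightarrow> ('k, 'a) module \<Rightarrow> ('k, 'b) module \<Rightarrow>
   ('k, ('a \<times> 'a \<Rightarrow> 'k) set, 'a) lmap \<Rightarrow>
   ('k, ('a \<times> 'b \<Rightarrow> 'k) set, ('b \<times> 'a \<Rightarrow> 'k) set) lmap \<Rightarrow> bool" where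
  "mult_compat_l K V W m \<Phi> \<longleftrightarrow>
     \<Phi> \<cdot> (m \<boxtimes>\<^bsub>K\<^esub> lid W) =
       (lid W \<boxtimes>\<^bsub>K\<^esub> m) \<cdot> lassoc K W V V \<cdot> (\<Phi> \<boxtimes>\<^bsub>K\<^esub> lid V) \<cdot> linv (lassoc K V W V) \<cdot>
         (lid V \<boxtimes>\<^bsub>K\<^esub> \<Phi>) \<cdot> lassoc K V V W \<and>
     (\<forall>u. is_unit K V m u \<longrightarrow>
       (\<forall>w\<in>carrier W. app \<Phi> (pure_tensor K V W u w) = pure_tensor K W V w u))"

definition mult_compat_r ::
  "('k, 'r) ring_scheme \<Rightarrow> ('k, 'a) module \<Rightarrow> ('k, 'b) module \<Rightarrow>
   ('k, ('b \<times> 'b \<Rightarrow> 'k) set, 'b) lmap \<Rightarrow>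
   ('k, ('a \<times> 'b \<Rightarrow> 'k) set, ('b \<times> 'a \<Rightarrow> 'k) set) lmap \<Rightarrow> bool" where
  "mult_compat_r K V W m \<Phi> \<longleftrightarrow>
     \<Phi> \<cdot> (lid V \<boxtimes>\<^bsub>K\<^esub> m) =
       (m \<boxtimes>\<^bsub>K\<^esub> lid V) \<cdot> linv (lassoc K W W V) \<cdot> (lid W \<boxtimes>\<^bsub>K\<^esub> \<Phi>) \<cdot> lassoc K W V W \<cdot>
         (\<Phi> \<boxtimes>\<^bsub>K\<^esub> lid W) \<cdot> linv (lassoc K V W W) \<and>
     (\<forall>u. is_unit K W m u \<longrightarrow>
       (\<forall>v\<in>carrier V. app \<Phi> (pure_tensor K V W v u) = pure_tensor K W V u v))"

definition comult_compat_l ::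
  "('k, 'r) ring_scheme \<Rightarrow> ('k, 'a) module \<Rightarrow> ('k, 'b) module \<Rightarrow>
   ('k, 'a, ('a \<times> 'a \<Rightarrow> 'k) set) lmap \<Rightarrow> ('k, 'a, 'k) lmap \<Rightarrow>
   ('k, ('a \<times> 'b \<Rightarrow> 'k) set, ('b \<times> 'a \<Rightarrow> 'k) set) lmap \<Rightarrow> bool" where
  "comult_compat_l K V W \<Delta> \<epsilon> \<Phi> \<longleftrightarrow>
     (lid W \<boxtimes>\<^bsub>K\<^esub> \<Delta>) \<cdot> \<Phi> =
       lassoc K W V V \<cdot> (\<Phi> \<boxtimes>\<^bsub>K\<^esub> lid V) \<cdot> linv (lassoc K V W V) \<cdot> (lid V \<boxtimes>\<^bsub>K\<^esub> \<Phi>) \<cdot>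
         lassoc K V V W \<cdot> (\<Delta> \<boxtimes>\<^bsub>K\<^esub> lid W) \<and>
     lunit_r K W \<cdot> (lid W \<boxtimes>\<^bsub>K\<^esub> \<epsilon>) \<cdot> \<Phi> = lunit_l K W \<cdot> (\<epsilon> \<boxtimes>\<^bsub>K\<^esub> lid W)"

definition comult_compat_r ::
  "('k, 'r) ring_scheme \<Rightarrow> ('k, 'a) module \<Rightarrow> ('k, 'b) module \<Rightarrow>
   ('k, 'b, ('b \<times> 'b \<Rightarrow> 'k) set) lmap \<Rightarrow> ('k, 'b, 'k) lmap \<Rightarrow>
   ('k, ('a \<times> 'b \<Rightarrow> 'k) set, ('b \<times> 'a \<Rightarrow> 'k) set) lmap \<Rightarrow> bool" where
  "comult_compat_r K V W \<Delta> \<epsilon> \<Phi> \<longleftrightarrow>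
     (\<Delta> \<boxtimes>\<^bsub>K\<^esub> lid V) \<cdot> \<Phi> =
       linv (lassoc K W W V) \<cdot> (lid W \<boxtimes>\<^bsub>K\<^esub> \<Phi>) \<cdot> lassoc K W V W \<cdot> (\<Phi> \<boxtimes>\<^bsub>K\<^esub> lid W) \<cdot>
         linv (lassoc K V W W) \<cdot> (lid V \<boxtimes>\<^bsub>K\<^esub> \<Delta>) \<and>
     lunit_l K V \<cdot> (\<epsilon> \<boxtimes>\<^bsub>K\<^esub> lid V) \<cdot> \<Phi> = lunit_r K V \<cdot> (lid V \<boxtimes>\<^bsub>K\<^esub> \<epsilon>)"

definition braided_algebra ::
  "('k, 'r) ring_scheme \<Rightarrow> ('k, 'a) module \<Rightarrow> ('k, ('a \<times> 'a \<Rightarrow> 'k) set, 'a) lmap \<Rightarrow>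
   ('k, ('a \<times> 'a \<Rightarrow> 'k) set, ('a \<times> 'a \<Rightarrow> 'k) set) lmap \<Rightarrow> bool" where
  "braided_algebra K H m \<Psi> \<longleftrightarrow>
     assoc_algebra K H m \<and> braided_space K H \<Psi> \<and>
     mult_compat_l K H H m \<Psi> \<and> mult_compat_r K H H m \<Psi>"

definition braided_unital_algebra ::
  "('k, 'r) ring_scheme \<Rightarrow> ('k, 'a) module \<Rightarrow> ('k, ('a \<times> 'a \<Rightarrow> 'k) set, 'a) lmap \<Rightarrow> 'a \<Rightarrow>
   ('k, ('a \<times> 'a \<Rightarrow> 'k) set, ('a \<times> 'a \<Rightarrow> 'k) set) lmap \<Rightarrow> bool" where
  "braided_unital_algebra K H m u \<Psi> \<longleftrightarrow> braided_algebra K H m \<Psi> \<and> is_unit K H m u"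

definition braided_coalgebra ::
  "('k, 'r) ring_scheme \<Rightarrow> ('k, 'a) module \<Rightarrow> ('k, 'a, ('a \<times> 'a \<Rightarrow> 'k) set) lmap \<Rightarrow>
   ('k, 'a, 'k) lmap \<Rightarrow> ('k, ('a \<times> 'a \<Rightarrow> 'k) set, ('a \<times> 'a \<Rightarrow> 'k) set) lmap \<Rightarrow> bool" where
  "braided_coalgebra K H \<Delta> \<epsilon> \<Psi> \<longleftrightarrow>
     coalgebra K H \<Delta> \<epsilon> \<and> braided_space K H \<Psi> \<and>
     comult_compat_l K H H \<Delta> \<epsilon> \<Psi> \<and> comult_compat_r K H H \<Delta> \<epsilon> \<Psi>"


section \<open>Braided bialgebras and Hopf algebras\<close>

text \<open>\<open>id \<otimes> \<Psi> \<otimes> id\<close> as an endomorphism of \<open>(H \<otimes> H) \<otimes> (H \<otimes> H)\<close>.\<close>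

definition middle_map ::
  "('k, 'r) ring_scheme \<Rightarrow> ('k, 'a) module \<Rightarrow>
   ('k, ('a \<times> 'a \<Rightarrow> 'k) set, ('a \<times> 'a \<Rightarrow> 'k) set) lmap \<Rightarrow>
   ('k, (('a \<times> 'a \<Rightarrow> 'k) set \<times> ('a \<times> 'a \<Rightarrow> 'k) set \<Rightarrow> 'k) set,
        (('a \<times> 'a \<Rightarrow> 'k) set \<times> ('a \<times> 'a \<Rightarrow> 'k) set \<Rightarrow> 'k) set) lmap" where
  "middle_map K H \<Psi> =
    (let \<beta> = (lid H \<boxtimes>\<^bsub>K\<^esub> linv (lassoc K H H H)) \<cdot> lassoc K H H (tensor K H H)
     in linv \<beta> \<cdot> (lid H \<boxtimes>\<^bsub>K\<^esub> (\<Psi> \<boxtimes>\<^bsub>K\<^esub> lid H)) \<cdot> \<beta>)"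

definition braided_bialgebra ::
  "('k, 'r) ring_scheme \<Rightarrow> ('k, 'a) module \<Rightarrow> ('k, ('a \<times> 'a \<Rightarrow> 'k) set, 'a) lmap \<Rightarrow> 'a \<Rightarrow>
   ('k, 'a, ('a \<times> 'a \<Rightarrow> 'k) set) lmap \<Rightarrow> ('k, 'a, 'k) lmap \<Rightarrow>
   ('k, ('a \<times> 'a \<Rightarrow> 'k) set, ('a \<times> 'a \<Rightarrow> 'k) set) lmap \<Rightarrow> bool" where
  "braided_bialgebra K H m u \<Delta> \<epsilon> \<Psi> \<longleftrightarrow>
     braided_unital_algebra K H m u \<Psi> \<and> braided_coalgebra K H \<Delta> \<epsilon> \<Psi> \<and>
     \<Delta> \<cdot> m = (m \<boxtimes>\<^bsub>K\<^esub> m) \<cdot> middle_map K H \<Psi> \<cdot> (\<Delta> \<boxtimes>\<^bsub>K\<^esub> \<Delta>)"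

definition unit_counit :: "('k, 'a) module \<Rightarrow> 'a \<Rightarrow> ('k, 'a, 'k) lmap \<Rightarrow> ('k, 'a, 'a) lmap" where
  "unit_counit H u \<epsilon> = \<lparr>src = H, tgt = H, app = (\<lambda>x\<in>carrier H. app \<epsilon> x \<odot>\<^bsub>H\<^esub> u)\<rparr>"

definition braided_hopf_algebra ::
  "('k, 'r) ring_scheme \<Rightarrow> ('k, 'a) module \<Rightarrow> ('k, ('a \<times> 'a \<Rightarrow> 'k) set, 'a) lmap \<Rightarrow> 'a \<Rightarrow>
   ('k, 'a, ('a \<times> 'a \<Rightarrow> 'k) set) lmap \<Rightarrow> ('k, 'a, 'k) lmap \<Rightarrow>
   ('k, ('a \<times> 'a \<Rightarrow> 'k) set, ('a \<times> 'a \<Rightarrow> 'k) set) lmap \<Rightarrow> ('k, 'a, 'a) lmap \<Rightarrow> bool" where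
  "braided_hopf_algebra K H m u \<Delta> \<epsilon> \<Psi> S \<longleftrightarrow>
     braided_bialgebra K H m u \<Delta> \<epsilon> \<Psi> \<and> S \<in> lin_maps K H H \<and>
     m \<cdot> (S \<boxtimes>\<^bsub>K\<^esub> lid H) \<cdot> \<Delta> = unit_counit H u \<epsilon> \<and>
     m \<cdot> (lid H \<boxtimes>\<^bsub>K\<^esub> S) \<cdot> \<Delta> = unit_counit H u \<epsilon>"

definition twisted_mult ::
  "('k, ('a \<times> 'a \<Rightarrow> 'k) set, ('a \<times> 'a \<Rightarrow> 'k) set) lmap \<Rightarrow> ('k, ('a \<times> 'a \<Rightarrow> 'k) set, 'a) lmap \<Rightarrow>
   int \<Rightarrow> ('k, ('a \<times> 'a \<Rightarrow> 'k) set, 'a) lmap" where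
  "twisted_mult \<Psi> m k = m \<cdot> lpow \<Psi> k"

definition twisted_comult ::
  "('k, ('a \<times> 'a \<Rightarrow> 'k) set, ('a \<times> 'a \<Rightarrow> 'k) set) lmap \<Rightarrow> ('k, 'a, ('a \<times> 'a \<Rightarrow> 'k) set) lmap \<Rightarrow>
   int \<Rightarrow> ('k, 'a, ('a \<times> 'a \<Rightarrow> 'k) set) lmap" where
  "twisted_comult \<Psi> \<Delta> n = lpow \<Psi> n \<cdot> \<Delta>"

end

theory Submission
  imports Defs
begin

text \<open>
  Suppressing associators, let \<open>X\<close> and \<open>Y\<close> be the braiding \<open>\<Psi>\<close> on the first two and on the last two
  factors of \<open>H \<otimes> H \<otimes> H\<close>. For a braided algebra the compatibility conditions read
  \<open>\<Psi> (m \<otimes> id) = (id \<otimes> m) X Y\<close> and \<open>\<Psi> (id \<otimes> m) = (m \<otimes> id) Y X\<close>. Hence the two bracketings of the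
  product \<open>m \<Psi>\<close> are \<open>m (id \<otimes> m) X Y X\<close> and \<open>m (m \<otimes> id) Y X Y\<close>, and associativity of \<open>m\<close> together
  with the braid equation \<open>X Y X = Y X Y\<close> makes them equal (\<open>braided_algebra_twist\<close>). All axioms are
  stable under passing to \<open>\<Psi>\<^sup>-\<^sup>1\<close>, which exchanges left and right compatibility, so \<open>m \<Psi>\<^sup>-\<^sup>1\<close> is covered
  as well and the general power follows by induction. Coalgebras are treated dually. That a unit of
  a twisted product is compatible with a braiding follows from its bijectivity (\<open>unit_left\<close>).

  For bialgebras, every twist is a composite of two moves, the opposite and the coopposite bialgebra:
  \<open>(m, \<Delta>, \<Psi>)\<close> becomes \<open>(m \<Psi>\<^sup>-\<^sup>1, \<Delta>, \<Psi>\<^sup>-\<^sup>1)\<close> or \<open>(m, \<Psi>\<^sup>-\<^sup>1 \<Delta>, \<Psi>\<^sup>-\<^sup>1)\<close>. Multiplicativity of the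
  coproduct survives each move because \<open>\<Psi>\<close> slides through \<open>\<Delta> \<otimes> \<Delta>\<close> and \<open>m \<otimes> m\<close> as the crossing of two
  strands over two, which cancels against the braidings of the move. Opposite after coopposite is the
  step from \<open>H\<close> to \<open>H\<^sup>(\<^sup>1\<^sup>,\<^sup>-\<^sup>1\<^sup>)\<close>, coopposite after opposite is the reverse step, and the opposite of
  \<open>H\<^sup>(\<^sup>n\<^sup>,\<^sup>-\<^sup>n\<^sup>)\<close> is \<open>H\<^sup>(\<^sup>n\<^sup>-\<^sup>1\<^sup>,\<^sup>-\<^sup>n\<^sup>)\<close>.

  For the antipode two facts are needed. First, \<open>\<Psi> (S \<otimes> id) = (id \<otimes> S) \<Psi>\<close> and its mirror image, since
  both sides are inverse to \<open>\<Psi>\<close> under a convolution product (\<open>A_P\<close>); this preserves \<open>S\<close> under the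
  twists \<open>(n, -n)\<close>. Second, \<open>S m = m (S \<otimes> S) \<Psi>\<close> (\<open>M_A\<close>), which makes \<open>S\<^sup>-\<^sup>1\<close> an antipode of the
  opposite bialgebra. The latter rests on the identity \<open>galois_identity\<close>, without braiding
  \<open>\<Delta> (x y\<^sub>1) (1 \<otimes> S y\<^sub>2) = x\<^sub>1 y \<otimes> x\<^sub>2\<close>, from which multiplicativity of the counit is derived too.

  The bialgebra and antipode arguments involve up to five tensor factors. They are carried out on
  multilinear forms instead of iterated tensor products: a linear map between tensor powers acts by
  precomposition on any block of neighbouring arguments of a form. On forms there are no associators,
  maps on disjoint blocks commute (\<open>strand_interchange\<close>), and a relation that holds on its own
  arguments holds in the middle of any longer word (\<open>run_lift\<close>). The resulting operators obey the
  rules of string diagrams.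
\<close>

section \<open>Free modules and quotient modules\<close>

text \<open>
  The function underlying a linear map, with no condition on its values off the carrier; pointwise
  sums and composites of such functions need no restriction to the domain.
\<close>

definition linear_fun ::
  "('k, 'r) ring_scheme \<Rightarrow> ('k, 'a) module \<Rightarrow> ('k, 'b) module \<Rightarrow> ('a \<Rightarrow> 'b) \<Rightarrow> bool" where
  "linear_fun K V W h \<longleftrightarrow>
     h \<in> carrier V \<rightarrow> carrier W \<and>
     (\<forall>x\<in>carrier V. \<forall>y\<in>carrier V. h (x \<oplus>\<^bsub>V\<^esub> y) = h x \<oplus>\<^bsub>W\<^esub> h y) \<and>
     (\<forall>c\<in>carrier K. \<forall>x\<in>carrier V. h (c \<odot>\<^bsub>V\<^esub> x) = c \<odot>\<^bsub>W\<^esub> h x)"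

lemma linear_funI:
  assumes "\<And>x. x \<in> carrier V \<Longrightarrow> h x \<in> carrier W"
    and "\<And>x y. x \<in> carrier V \<Longrightarrow> y \<in> carrier V \<Longrightarrow> h (x \<oplus>\<^bsub>V\<^esub> y) = h x \<oplus>\<^bsub>W\<^esub> h y"
    and "\<And>c x. c \<in> carrier K \<Longrightarrow> x \<in> carrier V \<Longrightarrow> h (c \<odot>\<^bsub>V\<^esub> x) = c \<odot>\<^bsub>W\<^esub> h x"
  shows "linear_fun K V W h"
  using assms by (auto simp: linear_fun_def)

lemma linear_funD:
  assumes "linear_fun K V W h"
  shows "x \<in> carrier V \<Longrightarrow> h x \<in> carrier W"
    and "x \<in> carrier V \<Longrightarrow> y \<in> carrier V \<Longrightarrow> h (x \<oplus>\<^bsub>V\<^esub> y) = h x \<oplus>\<^bsub>W\<^esub> h y"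
    and "c \<in> carrier K \<Longrightarrow> x \<in> carrier V \<Longrightarrow> h (c \<odot>\<^bsub>V\<^esub> x) = c \<odot>\<^bsub>W\<^esub> h x"
  using assms by (auto simp: linear_fun_def)

lemma linear_fun_cong:
  assumes "module K V" "\<And>x. x \<in> carrier V \<Longrightarrow> h x = h' x"
  shows "linear_fun K V W h \<longleftrightarrow> linear_fun K V W h'"
proof -
  interpret module K V by fact
  show ?thesis using assms(2) by (auto simp: linear_fun_def Pi_iff)
qed

lemma linear_fun_comp:
  "linear_fun K V W h \<Longrightarrow> linear_fun K U V g \<Longrightarrow> linear_fun K U W (\<lambda>x. h (g x))"
  by (rule linear_funI) (simp_all add: linear_funD)

lemma linear_fun_zero:
  assumes "module K V" "module K W" "linear_fun K V W h"
  shows "h \<zero>\<^bsub>V\<^esub> = \<zero>\<^bsub>W\<^esub>"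
proof -
  interpret V: module K V by fact
  interpret W: module K W by fact
  have "h \<zero>\<^bsub>V\<^esub> = h (\<zero>\<^bsub>K\<^esub> \<odot>\<^bsub>V\<^esub> \<zero>\<^bsub>V\<^esub>)" by simp
  also have "\<dots> = \<zero>\<^bsub>K\<^esub> \<odot>\<^bsub>W\<^esub> h \<zero>\<^bsub>V\<^esub>" using linear_funD(3)[OF assms(3)] by blast
  also have "\<dots> = \<zero>\<^bsub>W\<^esub>" using linear_funD(1)[OF assms(3)] by simp
  finally show ?thesis .
qed

lemma linear_fun_uminus:
  assumes "module K V" "module K W" "linear_fun K V W h" "x \<in> carrier V"
  shows "h (\<ominus>\<^bsub>V\<^esub> x) = \<ominus>\<^bsub>W\<^esub> h x"
proof -
  interpret V: module K V by fact
  interpret W: module K W by fact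
  have c: "h x \<in> carrier W" "h (\<ominus>\<^bsub>V\<^esub> x) \<in> carrier W"
    using assms(4) linear_funD(1)[OF assms(3)] by auto
  have "h (\<ominus>\<^bsub>V\<^esub> x) \<oplus>\<^bsub>W\<^esub> h x = h (\<ominus>\<^bsub>V\<^esub> x \<oplus>\<^bsub>V\<^esub> x)"
    using assms(4) by (simp add: linear_funD(2)[OF assms(3)])
  also have "\<dots> = \<zero>\<^bsub>W\<^esub>" using assms(4) by (simp add: V.l_neg linear_fun_zero[OF assms(1-3)])
  finally show ?thesis using c W.minus_equality by metis
qed

lemma free_module_carrier:
  "f \<in> carrier (free_module K X) \<longleftrightarrow> f \<in> X \<rightarrow>\<^sub>E carrier K \<and> finite {x \<in> X. f x \<noteq> \<zero>\<^bsub>K\<^esub>}"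
  by (simp add: free_module_def)

lemma free_module_module:
  fixes X :: "'b set"
  assumes "cring K"
  shows "module K (free_module K X)"
proof -
  interpret K: cring K by fact
  let ?F = "free_module K X"
  have closed: "f x \<in> carrier K" if "f \<in> carrier ?F" "x \<in> X" for f x
    using that by (auto simp: free_module_carrier)
  have ext: "f = g" if "f \<in> carrier ?F" "g \<in> carrier ?F" "\<And>x. x \<in> X \<Longrightarrow> f x = g x" for f g
    using that by (auto simp: free_module_carrier PiE_iff intro: extensionalityI)
  have supp: "(\<lambda>x\<in>X. h x) \<in> carrier ?F"
    if "\<And>x. x \<in> X \<Longrightarrow> h x \<in> carrier K" "finite A" "\<And>x. x \<in> X \<Longrightarrow> x \<notin> A \<Longrightarrow> h x = \<zero>\<^bsub>K\<^esub>"
    for h and A :: "'b set"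
  proof -
    have "{x \<in> X. (\<lambda>x\<in>X. h x) x \<noteq> \<zero>\<^bsub>K\<^esub>} \<subseteq> A" using that(3) by auto
    hence "finite {x \<in> X. (\<lambda>x\<in>X. h x) x \<noteq> \<zero>\<^bsub>K\<^esub>}" using that(2) by (rule finite_subset)
    thus ?thesis using that(1) by (simp add: free_module_carrier)
  qed
  have fin: "finite {x \<in> X. f x \<noteq> \<zero>\<^bsub>K\<^esub>}" if "f \<in> carrier ?F" for f
    using that by (simp add: free_module_carrier)
  have add_app: "(f \<oplus>\<^bsub>?F\<^esub> g) x = f x \<oplus>\<^bsub>K\<^esub> g x" if "x \<in> X" for f g x
    using that by (simp add: free_module_def)
  have smult_app: "(c \<odot>\<^bsub>?F\<^esub> f) x = c \<otimes>\<^bsub>K\<^esub> f x" if "x \<in> X" for c f x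
    using that by (simp add: free_module_def)
  have zero_app: "\<zero>\<^bsub>?F\<^esub> x = \<zero>\<^bsub>K\<^esub>" if "x \<in> X" for x
    using that by (simp add: free_module_def)
  have add_closed: "f \<oplus>\<^bsub>?F\<^esub> g \<in> carrier ?F" if "f \<in> carrier ?F" "g \<in> carrier ?F" for f g
  proof -
    have "(\<lambda>x\<in>X. f x \<oplus>\<^bsub>K\<^esub> g x) \<in> carrier ?F"
      by (rule supp[OF _ finite_UnI[OF fin[OF that(1)] fin[OF that(2)]]]) (use closed that in auto)
    thus ?thesis by (simp add: free_module_def)
  qed
  have smult_closed: "c \<odot>\<^bsub>?F\<^esub> f \<in> carrier ?F" if "c \<in> carrier K" "f \<in> carrier ?F" for c f
  proof -
    have "(\<lambda>x\<in>X. c \<otimes>\<^bsub>K\<^esub> f x) \<in> carrier ?F"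
      by (rule supp[OF _ fin[OF that(2)]]) (use closed that in auto)
    thus ?thesis by (simp add: free_module_def)
  qed
  have zero_closed: "\<zero>\<^bsub>?F\<^esub> \<in> carrier ?F"
    using supp[of "\<lambda>_. \<zero>\<^bsub>K\<^esub>" "{}"] by (simp add: free_module_def)
  note clo = add_closed smult_closed zero_closed
  note app = add_app smult_app zero_app closed
  show ?thesis
  proof (rule moduleI)
    show "cring K" by fact
    show "abelian_group ?F"
    proof (rule abelian_groupI)
      fix f assume f: "f \<in> carrier ?F"
      have g: "(\<lambda>x\<in>X. \<ominus>\<^bsub>K\<^esub> f x) \<in> carrier ?F"
        by (rule supp[OF _ fin[OF f]]) (use closed f in auto)
      moreover have "(\<lambda>x\<in>X. \<ominus>\<^bsub>K\<^esub> f x) \<oplus>\<^bsub>?F\<^esub> f = \<zero>\<^bsub>?F\<^esub>"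
        by (rule ext[OF add_closed[OF g f] zero_closed]) (simp add: app f K.l_neg)
      ultimately show "\<exists>g\<in>carrier ?F. g \<oplus>\<^bsub>?F\<^esub> f = \<zero>\<^bsub>?F\<^esub>" by blast
      show "\<zero>\<^bsub>?F\<^esub> \<oplus>\<^bsub>?F\<^esub> f = f"
        by (rule ext[OF add_closed[OF zero_closed f] f]) (simp add: app f)
      fix g assume g: "g \<in> carrier ?F"
      show "f \<oplus>\<^bsub>?F\<^esub> g \<in> carrier ?F" by (rule add_closed[OF f g])
      show "f \<oplus>\<^bsub>?F\<^esub> g = g \<oplus>\<^bsub>?F\<^esub> f"
        by (rule ext[OF add_closed[OF f g] add_closed[OF g f]]) (simp add: app f g K.a_comm)
      fix h assume h: "h \<in> carrier ?F"
      show "f \<oplus>\<^bsub>?F\<^esub> g \<oplus>\<^bsub>?F\<^esub> h = f \<oplus>\<^bsub>?F\<^esub> (g \<oplus>\<^bsub>?F\<^esub> h)"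
        by (rule ext) (simp_all add: clo f g h, simp add: app f g h K.a_assoc)
    qed (rule zero_closed)
  next
    fix a f assume a: "a \<in> carrier K" and f: "f \<in> carrier ?F"
    show "a \<odot>\<^bsub>?F\<^esub> f \<in> carrier ?F" by (rule smult_closed[OF a f])
    show "(a \<oplus>\<^bsub>K\<^esub> b) \<odot>\<^bsub>?F\<^esub> f = a \<odot>\<^bsub>?F\<^esub> f \<oplus>\<^bsub>?F\<^esub> b \<odot>\<^bsub>?F\<^esub> f" if b: "b \<in> carrier K" for b
      by (rule ext) (simp_all add: clo a b f, simp add: app a b f K.l_distr)
    show "(a \<otimes>\<^bsub>K\<^esub> b) \<odot>\<^bsub>?F\<^esub> f = a \<odot>\<^bsub>?F\<^esub> (b \<odot>\<^bsub>?F\<^esub> f)" if b: "b \<in> carrier K" for b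
      by (rule ext) (simp_all add: clo a b f, simp add: app a b f K.m_assoc)
    show "a \<odot>\<^bsub>?F\<^esub> (f \<oplus>\<^bsub>?F\<^esub> g) = a \<odot>\<^bsub>?F\<^esub> f \<oplus>\<^bsub>?F\<^esub> a \<odot>\<^bsub>?F\<^esub> g" if g: "g \<in> carrier ?F" for g
      by (rule ext) (simp_all add: clo a f g, simp add: app a f g K.r_distr)
  next
    fix f assume f: "f \<in> carrier ?F"
    show "\<one>\<^bsub>K\<^esub> \<odot>\<^bsub>?F\<^esub> f = f"
      by (rule ext) (simp_all add: clo f, simp add: app f)
  qed
qed

lemma free_gen_carrier:
  assumes "cring K" "a \<in> X"
  shows "free_gen K X a \<in> carrier (free_module K X)"
proof -
  interpret cring K by fact
  have "{x \<in> X. free_gen K X a x \<noteq> \<zero>\<^bsub>K\<^esub>} \<subseteq> {a}" by (auto simp: free_gen_def)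
  hence "finite {x \<in> X. free_gen K X a x \<noteq> \<zero>\<^bsub>K\<^esub>}" by (rule finite_subset) simp
  thus ?thesis by (auto simp: free_module_carrier free_gen_def)
qed

text \<open>
  Peeling off one point of the support at a time reduces the support to the empty set.
\<close>

lemma free_module_induct [consumes 2, case_names zero add]:
  assumes "cring K" "f \<in> carrier (free_module K X)"
    and zero: "P \<zero>\<^bsub>free_module K X\<^esub>"
    and step: "\<And>f c a. f \<in> carrier (free_module K X) \<Longrightarrow> c \<in> carrier K \<Longrightarrow> a \<in> X \<Longrightarrow> P f \<Longrightarrow>
       P ((c \<odot>\<^bsub>free_module K X\<^esub> free_gen K X a) \<oplus>\<^bsub>free_module K X\<^esub> f)"
  shows "P f"
proof -
  interpret K: cring K by fact
  let ?F = "free_module K X"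
  have "P f" if "finite A" "f \<in> carrier ?F" "{x \<in> X. f x \<noteq> \<zero>\<^bsub>K\<^esub>} = A" for A f
    using that
  proof (induction A arbitrary: f rule: finite_induct)
    case empty
    hence "f = \<zero>\<^bsub>?F\<^esub>" by (auto simp: free_module_def fun_eq_iff PiE_iff extensional_def)
    thus ?case using zero by simp
  next
    case (insert a A)
    define g where "g = (\<lambda>x\<in>X. if x = a then \<zero>\<^bsub>K\<^esub> else f x)"
    have fc: "\<And>x. x \<in> X \<Longrightarrow> f x \<in> carrier K" "f \<in> extensional X"
      using insert.prems by (auto simp: free_module_carrier PiE_iff)
    have aX: "a \<in> X" using insert.prems by blast
    have sg: "{x \<in> X. g x \<noteq> \<zero>\<^bsub>K\<^esub>} = A" using insert by (auto simp: g_def)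
    have "finite {x \<in> X. g x \<noteq> \<zero>\<^bsub>K\<^esub>}" using sg insert.hyps by simp
    moreover have "g \<in> X \<rightarrow>\<^sub>E carrier K" using fc by (auto simp: g_def)
    ultimately have gc: "g \<in> carrier ?F" by (simp add: free_module_carrier)
    have "f = (f a \<odot>\<^bsub>?F\<^esub> free_gen K X a) \<oplus>\<^bsub>?F\<^esub> g"
      using fc aX by (auto simp: free_module_def free_gen_def g_def fun_eq_iff extensional_def)
    moreover have "P ((f a \<odot>\<^bsub>?F\<^esub> free_gen K X a) \<oplus>\<^bsub>?F\<^esub> g)"
      by (rule step) (use gc fc aX insert.IH[OF gc sg] in auto)
    ultimately show ?case by metis
  qed
  from this[of "{x \<in> X. f x \<noteq> \<zero>\<^bsub>K\<^esub>}" f] show ?thesis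
    using assms(2) by (simp add: free_module_carrier)
qed

text \<open>
  The extension is a sum over the support. It is additive because the sum may be taken over any
  finite set that contains the support.
\<close>

lemma free_module_lift:
  assumes "module K M" "g \<in> X \<rightarrow> carrier M"
  obtains h where "linear_fun K (free_module K X) M h" "\<And>a. a \<in> X \<Longrightarrow> h (free_gen K X a) = g a"
proof -
  interpret M: module K M by fact
  let ?F = "free_module K X"
  define h where "h f = (\<Oplus>\<^bsub>M\<^esub>x\<in>{x \<in> X. f x \<noteq> \<zero>\<^bsub>K\<^esub>}. f x \<odot>\<^bsub>M\<^esub> g x)" for f
  have h_eq: "h f = (\<Oplus>\<^bsub>M\<^esub>x\<in>A. f x \<odot>\<^bsub>M\<^esub> g x)"
    if "f \<in> carrier ?F" "finite A" "A \<subseteq> X" "{x \<in> X. f x \<noteq> \<zero>\<^bsub>K\<^esub>} \<subseteq> A" for f A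
    unfolding h_def
    by (rule M.add.finprod_mono_neutral_cong_left)
      (use that assms(2) in \<open>auto simp: free_module_carrier Pi_iff PiE_iff\<close>)
  have lin: "linear_fun K ?F M h"
  proof (rule linear_funI)
    fix f assume "f \<in> carrier ?F"
    thus "h f \<in> carrier M" unfolding h_def using assms(2)
      by (intro M.finsum_closed) (auto simp: free_module_carrier Pi_iff PiE_iff)
  next
    fix f f' assume f: "f \<in> carrier ?F" "f' \<in> carrier ?F"
    interpret F: module K ?F by (rule free_module_module) (rule M.R.is_cring)
    let ?A = "{x \<in> X. f x \<noteq> \<zero>\<^bsub>K\<^esub>} \<union> {x \<in> X. f' x \<noteq> \<zero>\<^bsub>K\<^esub>}"
    have fin: "finite ?A" using f by (auto simp: free_module_carrier)
    have fc: "\<And>x. x \<in> X \<Longrightarrow> f x \<in> carrier K" "\<And>x. x \<in> X \<Longrightarrow> f' x \<in> carrier K"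
      "\<And>x. x \<in> X \<Longrightarrow> g x \<in> carrier M" 
      using f assms(2) by (auto simp: free_module_carrier)
    have "h (f \<oplus>\<^bsub>?F\<^esub> f') = (\<Oplus>\<^bsub>M\<^esub>x\<in>?A. (f \<oplus>\<^bsub>?F\<^esub> f') x \<odot>\<^bsub>M\<^esub> g x)"
      by (rule h_eq) (use f fin F.a_closed[OF f] in \<open>auto simp: free_module_def\<close>)
    also have "\<dots> = (\<Oplus>\<^bsub>M\<^esub>x\<in>?A. f x \<odot>\<^bsub>M\<^esub> g x \<oplus>\<^bsub>M\<^esub> f' x \<odot>\<^bsub>M\<^esub> g x)"
      by (rule M.finsum_cong') (auto simp: free_module_def fc M.smult_l_distr)
    also have "\<dots> = (\<Oplus>\<^bsub>M\<^esub>x\<in>?A. f x \<odot>\<^bsub>M\<^esub> g x) \<oplus>\<^bsub>M\<^esub> (\<Oplus>\<^bsub>M\<^esub>x\<in>?A. f' x \<odot>\<^bsub>M\<^esub> g x)"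
      by (rule M.finsum_addf) (auto simp: fc)
    also have "\<dots> = h f \<oplus>\<^bsub>M\<^esub> h f'" using f fin by (subst (1 2) h_eq[of _ ?A]) auto
    finally show "h (f \<oplus>\<^bsub>?F\<^esub> f') = h f \<oplus>\<^bsub>M\<^esub> h f'" .
  next
    fix c f assume f: "c \<in> carrier K" "f \<in> carrier ?F"
    interpret F: module K ?F by (rule free_module_module) (rule M.R.is_cring)
    let ?A = "{x \<in> X. f x \<noteq> \<zero>\<^bsub>K\<^esub>}"
    have fin: "finite ?A" using f by (auto simp: free_module_carrier)
    have fc: "\<And>x. x \<in> X \<Longrightarrow> f x \<in> carrier K" "\<And>x. x \<in> X \<Longrightarrow> g x \<in> carrier M" 
      using f assms(2) by (auto simp: free_module_carrier)
    have "h (c \<odot>\<^bsub>?F\<^esub> f) = (\<Oplus>\<^bsub>M\<^esub>x\<in>?A. (c \<odot>\<^bsub>?F\<^esub> f) x \<odot>\<^bsub>M\<^esub> g x)"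
      by (rule h_eq) (use f fin F.smult_closed[OF f] in \<open>auto simp: free_module_def\<close>)
    also have "\<dots> = (\<Oplus>\<^bsub>M\<^esub>x\<in>?A. c \<odot>\<^bsub>M\<^esub> (f x \<odot>\<^bsub>M\<^esub> g x))"
      by (rule M.finsum_cong') (auto simp: free_module_def fc f M.smult_assoc1)
    also have "\<dots> = c \<odot>\<^bsub>M\<^esub> h f" unfolding h_def
      using M.finsum_smult_ldistr[OF fin f(1), of "\<lambda>x. f x \<odot>\<^bsub>M\<^esub> g x"] fc by auto
    finally show "h (c \<odot>\<^bsub>?F\<^esub> f) = c \<odot>\<^bsub>M\<^esub> h f" .
  qed
  have "h (free_gen K X a) = g a" if "a \<in> X" for a
  proof -
    have ga: "g a \<in> carrier M" using assms(2) that by auto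
    have "h (free_gen K X a) = (\<Oplus>\<^bsub>M\<^esub>x\<in>{a}. free_gen K X a x \<odot>\<^bsub>M\<^esub> g x)"
      by (rule h_eq) (use that free_gen_carrier[OF M.R.is_cring that] in \<open>auto simp: free_gen_def\<close>)
    also have "\<dots> = g a"
      using that ga by (subst M.finsum_insert) (auto simp: free_gen_def)
    finally show ?thesis .
  qed
  with lin show ?thesis by (rule that)
qed

lemma submodule_kernel:
  assumes "module K V" "module K W" "linear_fun K V W h"
  shows "submodule {x \<in> carrier V. h x = \<zero>\<^bsub>W\<^esub>} K V"
proof -
  interpret V: module K V by fact
  interpret W: module K W by fact
  show ?thesis
    by (rule V.submoduleI)
      (auto simp: linear_fun_zero[OF assms] linear_fun_uminus[OF assms] linear_funD[OF assms(3)])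
qed

lemma submodule_span_submodule:
  assumes "module K M" "B \<subseteq> carrier M"
  shows "submodule (submodule_span K M B) K M"
proof -
  interpret M: module K M by fact
  let ?N = "submodule_span K M B"
  have sub: "N \<subseteq> carrier M" "\<zero>\<^bsub>M\<^esub> \<in> N" if "submodule N K M" for N
    using M.submoduleE(1)[OF that] subgroup.one_closed[OF submodule.axioms(1)[OF that]] by simp_all
  show ?thesis
  proof (rule M.submoduleI)
    show "?N \<subseteq> carrier M"
      using M.carrier_is_submodule assms(2) by (auto simp: submodule_span_def)
    show "\<zero>\<^bsub>M\<^esub> \<in> ?N" using sub by (simp add: submodule_span_def)
    show "\<ominus>\<^bsub>M\<^esub> a \<in> ?N" if "a \<in> ?N" for a
      using that M.submoduleE(3) by (simp add: submodule_span_def)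
    show "a \<oplus>\<^bsub>M\<^esub> b \<in> ?N" if "a \<in> ?N" "b \<in> ?N" for a b
      using that M.submoduleE(5) by (simp add: submodule_span_def)
    show "a \<odot>\<^bsub>M\<^esub> x \<in> ?N" if "a \<in> carrier K" "x \<in> ?N" for a x
      using that M.submoduleE(4) by (simp add: submodule_span_def)
  qed
qed

lemma submodule_span_base: "B \<subseteq> submodule_span K M B"
  by (auto simp: submodule_span_def)

lemma submodule_span_least: "submodule N K M \<Longrightarrow> B \<subseteq> N \<Longrightarrow> submodule_span K M B \<subseteq> N"
  by (auto simp: submodule_span_def)

context
  fixes K :: "('k, 'r) ring_scheme" and M :: "('k, 'a) module" and N
  assumes mod: "module K M" and sub: "submodule N K M"
begin

interpretation M: module K M by (rule mod)

interpretation N: abelian_subgroup N M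
  using submodule.axioms(1)[OF sub]
  by (auto intro!: abelian_subgroupI3 additive_subgroup.intro M.abelian_group_axioms)

lemma coset_carrier: "x \<in> carrier M \<Longrightarrow> N +>\<^bsub>M\<^esub> x \<in> carrier (quotient_module M N)"
  by (auto simp: quotient_module_def A_RCOSETS_def')

lemma coset_exhaust:
  assumes "A \<in> carrier (quotient_module M N)"
  obtains x where "x \<in> carrier M" "A = N +>\<^bsub>M\<^esub> x"
  using assms by (auto simp: quotient_module_def A_RCOSETS_def')

lemma coset_add:
  "x \<in> carrier M \<Longrightarrow> y \<in> carrier M \<Longrightarrow>
   (N +>\<^bsub>M\<^esub> x) \<oplus>\<^bsub>quotient_module M N\<^esub> (N +>\<^bsub>M\<^esub> y) = N +>\<^bsub>M\<^esub> (x \<oplus>\<^bsub>M\<^esub> y)"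
  by (simp add: quotient_module_def N.a_rcos_sum)

lemma coset_zero: "\<zero>\<^bsub>quotient_module M N\<^esub> = N +>\<^bsub>M\<^esub> \<zero>\<^bsub>M\<^esub>"
  using N.a_subset by (simp add: quotient_module_def)

text \<open>
  Scalar multiplication of the quotient is a union over representatives; as N is stable under
  scalars, all representatives contribute the same coset.
\<close>

lemma coset_smult:
  assumes c: "c \<in> carrier K" and x: "x \<in> carrier M"
  shows "c \<odot>\<^bsub>quotient_module M N\<^esub> (N +>\<^bsub>M\<^esub> x) = N +>\<^bsub>M\<^esub> (c \<odot>\<^bsub>M\<^esub> x)"
proof -
  have cos: "N +>\<^bsub>M\<^esub> (c \<odot>\<^bsub>M\<^esub> y) = N +>\<^bsub>M\<^esub> (c \<odot>\<^bsub>M\<^esub> x)" if y: "y \<in> N +>\<^bsub>M\<^esub> x" for y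
  proof -
    obtain n where n: "n \<in> N" and yn: "y = n \<oplus>\<^bsub>M\<^esub> x" using y unfolding a_r_coset_def' by blast
    have nM: "n \<in> carrier M" using n N.a_subset by blast
    have "c \<odot>\<^bsub>M\<^esub> n \<in> N" using c n by (rule submodule.smult_closed[OF sub])
    hence "c \<odot>\<^bsub>M\<^esub> n \<oplus>\<^bsub>M\<^esub> c \<odot>\<^bsub>M\<^esub> x \<in> N +>\<^bsub>M\<^esub> (c \<odot>\<^bsub>M\<^esub> x)"
      unfolding a_r_coset_def' by blast
    hence "c \<odot>\<^bsub>M\<^esub> y \<in> N +>\<^bsub>M\<^esub> (c \<odot>\<^bsub>M\<^esub> x)"
      unfolding yn M.smult_r_distr[OF c nM x] .
    from N.a_repr_independence'[OF this M.smult_closed[OF c x]] show ?thesis by (rule sym)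
  qed
  have "(\<Union>y\<in>N +>\<^bsub>M\<^esub> x. N +>\<^bsub>M\<^esub> (c \<odot>\<^bsub>M\<^esub> y)) = (\<Union>y\<in>N +>\<^bsub>M\<^esub> x. N +>\<^bsub>M\<^esub> (c \<odot>\<^bsub>M\<^esub> x))"
    by (rule SUP_cong[OF refl cos])
  also have "\<dots> = N +>\<^bsub>M\<^esub> (c \<odot>\<^bsub>M\<^esub> x)"
    using N.a_rcos_self[OF x] by blast
  finally show ?thesis by (simp add: quotient_module_def)
qed

lemma quotient_module_module: "module K (quotient_module M N)"
proof (rule moduleI)
  let ?Q = "quotient_module M N"
  show "cring K" by (rule M.R.is_cring)
  show "abelian_group ?Q"
  proof (rule abelian_groupI)
    fix A assume "A \<in> carrier ?Q"
    then obtain x where x: "x \<in> carrier M" "A = N +>\<^bsub>M\<^esub> x" by (rule coset_exhaust)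
    hence "(N +>\<^bsub>M\<^esub> (\<ominus>\<^bsub>M\<^esub> x)) \<oplus>\<^bsub>?Q\<^esub> A = \<zero>\<^bsub>?Q\<^esub>"
      by (simp add: coset_add coset_zero M.l_neg)
    thus "\<exists>B\<in>carrier ?Q. B \<oplus>\<^bsub>?Q\<^esub> A = \<zero>\<^bsub>?Q\<^esub>" using x coset_carrier by blast
  qed ((elim coset_exhaust)?, simp add: coset_add coset_zero coset_carrier M.a_ac)+
next
  let ?Q = "quotient_module M N"
  show "a \<odot>\<^bsub>?Q\<^esub> A \<in> carrier ?Q" if "a \<in> carrier K" "A \<in> carrier ?Q" for a A
    using that(2) by (rule coset_exhaust) (use that(1) in \<open>simp add: coset_smult coset_carrier\<close>)
  show "(a \<oplus>\<^bsub>K\<^esub> b) \<odot>\<^bsub>?Q\<^esub> A = a \<odot>\<^bsub>?Q\<^esub> A \<oplus>\<^bsub>?Q\<^esub> b \<odot>\<^bsub>?Q\<^esub> A"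
    if "a \<in> carrier K" "b \<in> carrier K" "A \<in> carrier ?Q" for a b A
    using that(3) by (rule coset_exhaust)
      (use that in \<open>simp add: coset_add coset_smult M.smult_l_distr\<close>)
  show "a \<odot>\<^bsub>?Q\<^esub> (A \<oplus>\<^bsub>?Q\<^esub> B) = a \<odot>\<^bsub>?Q\<^esub> A \<oplus>\<^bsub>?Q\<^esub> a \<odot>\<^bsub>?Q\<^esub> B"
    if a: "a \<in> carrier K" and A: "A \<in> carrier ?Q" and B: "B \<in> carrier ?Q" for a A B
  proof -
    obtain x where x: "x \<in> carrier M" "A = N +>\<^bsub>M\<^esub> x" using A by (rule coset_exhaust)
    obtain y where y: "y \<in> carrier M" "B = N +>\<^bsub>M\<^esub> y" using B by (rule coset_exhaust)
    show ?thesis using a x y by (simp add: coset_add coset_smult M.smult_r_distr)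
  qed
  show "(a \<otimes>\<^bsub>K\<^esub> b) \<odot>\<^bsub>?Q\<^esub> A = a \<odot>\<^bsub>?Q\<^esub> (b \<odot>\<^bsub>?Q\<^esub> A)"
    if "a \<in> carrier K" "b \<in> carrier K" "A \<in> carrier ?Q" for a b A
    using that(3) by (rule coset_exhaust)
      (use that in \<open>simp add: coset_smult M.smult_assoc1\<close>)
  show "\<one>\<^bsub>K\<^esub> \<odot>\<^bsub>?Q\<^esub> A = A" if "A \<in> carrier ?Q" for A
    using that by (rule coset_exhaust) (simp add: coset_smult)
qed

lemma coset_linear: "linear_fun K M (quotient_module M N) (\<lambda>x. N +>\<^bsub>M\<^esub> x)"
proof (rule linear_funI)
  show "N +>\<^bsub>M\<^esub> x \<in> carrier (quotient_module M N)" if "x \<in> carrier M" for x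
    using that by (rule coset_carrier)
  show "N +>\<^bsub>M\<^esub> (x \<oplus>\<^bsub>M\<^esub> y) = (N +>\<^bsub>M\<^esub> x) \<oplus>\<^bsub>quotient_module M N\<^esub> (N +>\<^bsub>M\<^esub> y)"
    if "x \<in> carrier M" "y \<in> carrier M" for x y
    using coset_add[OF that] by simp
  show "N +>\<^bsub>M\<^esub> (c \<odot>\<^bsub>M\<^esub> x) = c \<odot>\<^bsub>quotient_module M N\<^esub> (N +>\<^bsub>M\<^esub> x)"
    if "c \<in> carrier K" "x \<in> carrier M" for c x
    using coset_smult[OF that] by simp
qed

text \<open>
  The value at a coset is read off at a chosen representative, which is harmless since \<open>h\<close> vanishes
  on N.
\<close>

lemma quotient_module_lift:
  assumes "module K W" "linear_fun K M W h" "\<And>x. x \<in> N \<Longrightarrow> h x = \<zero>\<^bsub>W\<^esub>"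
  obtains h' where "linear_fun K (quotient_module M N) W h'"
    "\<And>x. x \<in> carrier M \<Longrightarrow> h' (N +>\<^bsub>M\<^esub> x) = h x"
proof -
  interpret W: module K W by fact
  define h' where "h' A = h (SOME x. x \<in> A)" for A
  have eq: "h' (N +>\<^bsub>M\<^esub> x) = h x" if x: "x \<in> carrier M" for x
  proof -
    have "(SOME y. y \<in> N +>\<^bsub>M\<^esub> x) \<in> N +>\<^bsub>M\<^esub> x"
      using N.a_rcos_self[OF x] by (rule someI)
    then obtain n where n: "n \<in> N" "(SOME y. y \<in> N +>\<^bsub>M\<^esub> x) = n \<oplus>\<^bsub>M\<^esub> x"
      by (auto simp: a_r_coset_def')
    have "h' (N +>\<^bsub>M\<^esub> x) = h n \<oplus>\<^bsub>W\<^esub> h x"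
      unfolding h'_def n(2) using n(1) x by (simp add: linear_funD(2)[OF assms(2)])
    thus ?thesis using n(1) x assms(3) by (simp add: linear_funD(1)[OF assms(2)])
  qed
  have "linear_fun K (quotient_module M N) W h'"
  proof (rule linear_funI)
    let ?Q = "quotient_module M N"
    show "h' A \<in> carrier W" if "A \<in> carrier ?Q" for A
      using that by (rule coset_exhaust) (simp add: eq linear_funD(1)[OF assms(2)])
    show "h' (A \<oplus>\<^bsub>?Q\<^esub> B) = h' A \<oplus>\<^bsub>W\<^esub> h' B" if A: "A \<in> carrier ?Q" and B: "B \<in> carrier ?Q" for A B
    proof -
      obtain x where x: "x \<in> carrier M" "A = N +>\<^bsub>M\<^esub> x" using A by (rule coset_exhaust)
      obtain y where y: "y \<in> carrier M" "B = N +>\<^bsub>M\<^esub> y" using B by (rule coset_exhaust)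
      show ?thesis using x y by (simp add: coset_add eq linear_funD(2)[OF assms(2)])
    qed
    show "h' (c \<odot>\<^bsub>?Q\<^esub> A) = c \<odot>\<^bsub>W\<^esub> h' A" if "c \<in> carrier K" "A \<in> carrier ?Q" for c A
      using that(2) by (rule coset_exhaust)
        (use that(1) in \<open>simp add: coset_smult eq linear_funD(3)[OF assms(2)]\<close>)
  qed
  thus ?thesis using eq by (rule that)
qed

end

section \<open>The universal property of the tensor product\<close>

definition bilinear_fun ::
  "('k, 'r) ring_scheme \<Rightarrow> ('k, 'a) module \<Rightarrow> ('k, 'b) module \<Rightarrow> ('k, 'c) module \<Rightarrow>
   ('a \<Rightarrow> 'b \<Rightarrow> 'c) \<Rightarrow> bool" where
  "bilinear_fun K V W X B \<longleftrightarrow>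
     (\<forall>v\<in>carrier V. linear_fun K W X (B v)) \<and> (\<forall>w\<in>carrier W. linear_fun K V X (\<lambda>v. B v w))"

lemma linear_fun_eq_of_diff:
  assumes "module K V" "module K W" "linear_fun K V W h" "x \<in> carrier V" "y \<in> carrier V"
    "h (x \<ominus>\<^bsub>V\<^esub> y) = \<zero>\<^bsub>W\<^esub>"
  shows "h x = h y"
proof -
  interpret V: module K V by fact
  interpret W: module K W by fact
  have "h x = h ((x \<ominus>\<^bsub>V\<^esub> y) \<oplus>\<^bsub>V\<^esub> y)"
    using assms(4,5) by (simp add: V.minus_eq V.a_assoc V.l_neg)
  also have "\<dots> = h (x \<ominus>\<^bsub>V\<^esub> y) \<oplus>\<^bsub>W\<^esub> h y"
    using assms(4,5) by (simp add: linear_funD(2)[OF assms(3)])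
  finally show ?thesis using assms(5,6) linear_funD(1)[OF assms(3)] by simp
qed

lemma linear_fun_diff_zero:
  assumes "module K V" "module K W" "linear_fun K V W h" "x \<in> carrier V" "y \<in> carrier V" "h x = h y"
  shows "h (x \<ominus>\<^bsub>V\<^esub> y) = \<zero>\<^bsub>W\<^esub>"
proof -
  interpret V: module K V by fact
  interpret W: module K W by fact
  show ?thesis
    using assms(4-) linear_funD(1)[OF assms(3)]
    by (simp add: V.minus_eq linear_funD(2)[OF assms(3)] linear_fun_uminus[OF assms(1-3)] W.r_neg)
qed

context
  fixes K :: "('k, 'r) ring_scheme" and V :: "('k, 'a) module" and W :: "('k, 'b) module"
  assumes V: "module K V" and W: "module K W"
begin

interpretation V: module K V by (rule V)
interpretation W: module K W by (rule W)

abbreviation (input) "pair_module \<equiv> free_module K (carrier V \<times> carrier W)"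
abbreviation (input) "pair_gen v w \<equiv> free_gen K (carrier V \<times> carrier W) (v, w)"

lemma pair_module_module: "module K pair_module"
  by (rule free_module_module) (rule V.R.is_cring)

interpretation F: module K pair_module by (rule pair_module_module)

lemma pair_gen_closed: "v \<in> carrier V \<Longrightarrow> w \<in> carrier W \<Longrightarrow> pair_gen v w \<in> carrier pair_module"
  by (rule free_gen_carrier) (auto intro: V.R.is_cring)

lemma tensor_relations_carrier: "tensor_relations K V W \<subseteq> carrier pair_module"
  unfolding tensor_relations_def Let_def
  by (auto intro!: F.minus_closed F.a_closed F.smult_closed pair_gen_closed)

lemma tensor_null_submodule: "submodule (tensor_null K V W) K pair_module"
  unfolding tensor_null_def by (rule submodule_span_submodule[OF pair_module_module tensor_relations_carrier])

lemma tensor_module: "module K (tensor K V W)"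
  unfolding tensor_def by (rule quotient_module_module[OF pair_module_module tensor_null_submodule])

interpretation T: module K "tensor K V W" by (rule tensor_module)

abbreviation (input) "pair_class f \<equiv> tensor_null K V W +>\<^bsub>pair_module\<^esub> f"

lemma pair_class_linear: "linear_fun K pair_module (tensor K V W) (\<lambda>f. pair_class f)"
  unfolding tensor_def by (rule coset_linear[OF pair_module_module tensor_null_submodule])

lemma pair_class_eqI:
  assumes "x \<ominus>\<^bsub>pair_module\<^esub> y \<in> tensor_relations K V W" "x \<in> carrier pair_module" "y \<in> carrier pair_module"
  shows "pair_class x = pair_class y"
proof (rule linear_fun_eq_of_diff[OF pair_module_module tensor_module pair_class_linear assms(2,3)])
  have N: "x \<ominus>\<^bsub>pair_module\<^esub> y \<in> tensor_null K V W"
    unfolding tensor_null_def by (rule subsetD[OF submodule_span_base assms(1)])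
  have "pair_class (x \<ominus>\<^bsub>pair_module\<^esub> y) = tensor_null K V W"
    by (rule F.a_coset_join2[OF _ submodule.axioms(1)[OF tensor_null_submodule] N])
      (rule F.minus_closed[OF assms(2,3)])
  also have "\<dots> = \<zero>\<^bsub>tensor K V W\<^esub>" by (simp add: tensor_def quotient_module_def)
  finally show "pair_class (x \<ominus>\<^bsub>pair_module\<^esub> y) = \<zero>\<^bsub>tensor K V W\<^esub>" .
qed

lemma pure_tensor_closed:
  "v \<in> carrier V \<Longrightarrow> w \<in> carrier W \<Longrightarrow> pure_tensor K V W v w \<in> carrier (tensor K V W)"
  unfolding pure_tensor_def by (rule linear_funD(1)[OF pair_class_linear pair_gen_closed])

lemma pure_tensor_add_left:
  assumes "v \<in> carrier V" "v' \<in> carrier V" "w \<in> carrier W"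
  shows "pure_tensor K V W (v \<oplus>\<^bsub>V\<^esub> v') w =
    pure_tensor K V W v w \<oplus>\<^bsub>tensor K V W\<^esub> pure_tensor K V W v' w"
proof -
  have "pair_class (pair_gen (v \<oplus>\<^bsub>V\<^esub> v') w) = pair_class (pair_gen v w \<oplus>\<^bsub>pair_module\<^esub> pair_gen v' w)"
  proof (rule pair_class_eqI)
    show "pair_gen (v \<oplus>\<^bsub>V\<^esub> v') w \<ominus>\<^bsub>pair_module\<^esub> (pair_gen v w \<oplus>\<^bsub>pair_module\<^esub> pair_gen v' w) \<in> tensor_relations K V W"
      unfolding tensor_relations_def Let_def
      by (rule UnI1, rule UnI1, rule UnI1, rule CollectI, (rule exI)+, rule conjI[OF refl])
        (use assms in simp)
  qed (auto intro!: F.a_closed pair_gen_closed assms)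
  also have "\<dots> = pair_class (pair_gen v w) \<oplus>\<^bsub>tensor K V W\<^esub> pair_class (pair_gen v' w)"
    by (rule linear_funD(2)[OF pair_class_linear]) (auto intro!: pair_gen_closed assms)
  finally show ?thesis by (simp add: pure_tensor_def)
qed

lemma pure_tensor_add_right:
  assumes "v \<in> carrier V" "w \<in> carrier W" "w' \<in> carrier W"
  shows "pure_tensor K V W v (w \<oplus>\<^bsub>W\<^esub> w') =
    pure_tensor K V W v w \<oplus>\<^bsub>tensor K V W\<^esub> pure_tensor K V W v w'"
proof -
  have "pair_class (pair_gen v (w \<oplus>\<^bsub>W\<^esub> w')) = pair_class (pair_gen v w \<oplus>\<^bsub>pair_module\<^esub> pair_gen v w')"
  proof (rule pair_class_eqI)
    show "pair_gen v (w \<oplus>\<^bsub>W\<^esub> w') \<ominus>\<^bsub>pair_module\<^esub> (pair_gen v w \<oplus>\<^bsub>pair_module\<^esub> pair_gen v w') \<in> tensor_relations K V W"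
      unfolding tensor_relations_def Let_def
      by (rule UnI1, rule UnI1, rule UnI2, rule CollectI, (rule exI)+, rule conjI[OF refl])
        (use assms in simp)
  qed (auto intro!: F.a_closed pair_gen_closed assms)
  also have "\<dots> = pair_class (pair_gen v w) \<oplus>\<^bsub>tensor K V W\<^esub> pair_class (pair_gen v w')"
    by (rule linear_funD(2)[OF pair_class_linear]) (auto intro!: pair_gen_closed assms)
  finally show ?thesis by (simp add: pure_tensor_def)
qed

lemma pure_tensor_smult_left:
  assumes "c \<in> carrier K" "v \<in> carrier V" "w \<in> carrier W"
  shows "pure_tensor K V W (c \<odot>\<^bsub>V\<^esub> v) w = c \<odot>\<^bsub>tensor K V W\<^esub> pure_tensor K V W v w"
proof -
  have "pair_class (pair_gen (c \<odot>\<^bsub>V\<^esub> v) w) = pair_class (c \<odot>\<^bsub>pair_module\<^esub> pair_gen v w)"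
  proof (rule pair_class_eqI)
    show "pair_gen (c \<odot>\<^bsub>V\<^esub> v) w \<ominus>\<^bsub>pair_module\<^esub> (c \<odot>\<^bsub>pair_module\<^esub> pair_gen v w) \<in> tensor_relations K V W"
      unfolding tensor_relations_def Let_def
      by (rule UnI1, rule UnI2, rule CollectI, (rule exI)+, rule conjI[OF refl])
        (use assms in simp)
  qed (auto intro!: F.smult_closed pair_gen_closed assms)
  also have "\<dots> = c \<odot>\<^bsub>tensor K V W\<^esub> pair_class (pair_gen v w)"
    by (rule linear_funD(3)[OF pair_class_linear]) (auto intro!: pair_gen_closed assms)
  finally show ?thesis by (simp add: pure_tensor_def)
qed

lemma pure_tensor_smult_right:
  assumes "c \<in> carrier K" "v \<in> carrier V" "w \<in> carrier W"
  shows "pure_tensor K V W v (c \<odot>\<^bsub>W\<^esub> w) = c \<odot>\<^bsub>tensor K V W\<^esub> pure_tensor K V W v w"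
proof -
  have "pair_class (pair_gen v (c \<odot>\<^bsub>W\<^esub> w)) = pair_class (c \<odot>\<^bsub>pair_module\<^esub> pair_gen v w)"
  proof (rule pair_class_eqI)
    show "pair_gen v (c \<odot>\<^bsub>W\<^esub> w) \<ominus>\<^bsub>pair_module\<^esub> (c \<odot>\<^bsub>pair_module\<^esub> pair_gen v w) \<in> tensor_relations K V W"
      unfolding tensor_relations_def Let_def
      by (rule UnI2, rule CollectI, (rule exI)+, rule conjI[OF refl])
        (use assms in simp)
  qed (auto intro!: F.smult_closed pair_gen_closed assms)
  also have "\<dots> = c \<odot>\<^bsub>tensor K V W\<^esub> pair_class (pair_gen v w)"
    by (rule linear_funD(3)[OF pair_class_linear]) (auto intro!: pair_gen_closed assms)
  finally show ?thesis by (simp add: pure_tensor_def)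
qed

lemma pure_tensor_linear_right:
  "v \<in> carrier V \<Longrightarrow> linear_fun K W (tensor K V W) (pure_tensor K V W v)"
  by (rule linear_funI)
    (simp_all add: pure_tensor_closed pure_tensor_add_right pure_tensor_smult_right)

lemma pure_tensor_linear_left:
  "w \<in> carrier W \<Longrightarrow> linear_fun K V (tensor K V W) (\<lambda>v. pure_tensor K V W v w)"
  by (rule linear_funI)
    (simp_all add: pure_tensor_closed pure_tensor_add_left pure_tensor_smult_left)

text \<open>
  Bilinearity of B says that its linear extension to the free module kills the four families of
  relations, hence the submodule that they span.
\<close>

lemma tensor_lift:
  assumes X: "module K X" and B: "bilinear_fun K V W X B"
  obtains h where "linear_fun K (tensor K V W) X h"
    "\<And>v w. v \<in> carrier V \<Longrightarrow> w \<in> carrier W \<Longrightarrow> h (pure_tensor K V W v w) = B v w"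
proof -
  interpret X: module K X by (rule X)
  have Bl: "linear_fun K W X (B v)" if "v \<in> carrier V" for v
    using B that by (simp add: bilinear_fun_def)
  have Br: "linear_fun K V X (\<lambda>v. B v w)" if "w \<in> carrier W" for w
    using B that by (simp add: bilinear_fun_def)
  have Bc: "B v w \<in> carrier X" if "v \<in> carrier V" "w \<in> carrier W" for v w
    using linear_funD(1)[OF Bl] that by blast
  obtain g where g: "linear_fun K pair_module X g"
    and gB: "\<And>p. p \<in> carrier V \<times> carrier W \<Longrightarrow> g (free_gen K (carrier V \<times> carrier W) p) = (case p of (v, w) \<Rightarrow> B v w)"
    by (rule free_module_lift[OF X, of "\<lambda>(v, w). B v w" "carrier V \<times> carrier W"])
      (use Bc in auto)
  have ge: "g (pair_gen v w) = B v w" if "v \<in> carrier V" "w \<in> carrier W" for v w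
    using gB[of "(v, w)"] that by simp
  have g_eq: "g (x \<ominus>\<^bsub>pair_module\<^esub> y) = \<zero>\<^bsub>X\<^esub>"
    if "x \<in> carrier pair_module" "y \<in> carrier pair_module" "g x = g y" for x y
    by (rule linear_fun_diff_zero[where h = g, OF pair_module_module X g that])
  have "tensor_relations K V W \<subseteq> {x \<in> carrier pair_module. g x = \<zero>\<^bsub>X\<^esub>}"
  proof
    fix x assume x: "x \<in> tensor_relations K V W"
    note D = linear_funD[OF g]
    have "g x = \<zero>\<^bsub>X\<^esub>"
      using x unfolding tensor_relations_def Let_def
    proof (elim UnE CollectE exE conjE)
      fix v v' w assume [simp]: "v \<in> carrier V" "v' \<in> carrier V" "w \<in> carrier W"
        and x: "x = pair_gen (v \<oplus>\<^bsub>V\<^esub> v') w \<ominus>\<^bsub>pair_module\<^esub> (pair_gen v w \<oplus>\<^bsub>pair_module\<^esub> pair_gen v' w)"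
      show ?thesis unfolding x
        by (rule g_eq) (simp_all add: pair_gen_closed D ge linear_funD(2)[OF Br])
    next
      fix v w w' assume [simp]: "v \<in> carrier V" "w \<in> carrier W" "w' \<in> carrier W"
        and x: "x = pair_gen v (w \<oplus>\<^bsub>W\<^esub> w') \<ominus>\<^bsub>pair_module\<^esub> (pair_gen v w \<oplus>\<^bsub>pair_module\<^esub> pair_gen v w')"
      show ?thesis unfolding x
        by (rule g_eq) (simp_all add: pair_gen_closed D ge linear_funD(2)[OF Bl])
    next
      fix c v w assume [simp]: "c \<in> carrier K" "v \<in> carrier V" "w \<in> carrier W"
        and x: "x = pair_gen (c \<odot>\<^bsub>V\<^esub> v) w \<ominus>\<^bsub>pair_module\<^esub> (c \<odot>\<^bsub>pair_module\<^esub> pair_gen v w)"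
      show ?thesis unfolding x
        by (rule g_eq) (simp_all add: pair_gen_closed D ge linear_funD(3)[OF Br])
    next
      fix c v w assume [simp]: "c \<in> carrier K" "v \<in> carrier V" "w \<in> carrier W"
        and x: "x = pair_gen v (c \<odot>\<^bsub>W\<^esub> w) \<ominus>\<^bsub>pair_module\<^esub> (c \<odot>\<^bsub>pair_module\<^esub> pair_gen v w)"
      show ?thesis unfolding x
        by (rule g_eq) (simp_all add: pair_gen_closed D ge linear_funD(3)[OF Bl])
    qed
    thus "x \<in> {x \<in> carrier pair_module. g x = \<zero>\<^bsub>X\<^esub>}" using x tensor_relations_carrier by blast
  qed
  hence "tensor_null K V W \<subseteq> {x \<in> carrier pair_module. g x = \<zero>\<^bsub>X\<^esub>}"
    unfolding tensor_null_def by (rule submodule_span_least[OF submodule_kernel[OF pair_module_module X g]])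
  then obtain h where h: "linear_fun K (tensor K V W) X h"
    and hq: "\<And>x. x \<in> carrier pair_module \<Longrightarrow> h (pair_class x) = g x"
    unfolding tensor_def
    using quotient_module_lift[OF pair_module_module tensor_null_submodule X g] by blast
  have "h (pure_tensor K V W v w) = B v w" if "v \<in> carrier V" "w \<in> carrier W" for v w
    using that by (simp add: pure_tensor_def hq pair_gen_closed ge)
  with h show ?thesis by (rule that)
qed

text \<open>
  Coefficients of generators are absorbed in the first factor, so sums of pure tensors suffice.
\<close>

lemma tensor_ind [consumes 1, case_names zero add]:
  assumes t: "t \<in> carrier (tensor K V W)"
    and zero: "P \<zero>\<^bsub>tensor K V W\<^esub>"
    and add: "\<And>v w t. v \<in> carrier V \<Longrightarrow> w \<in> carrier W \<Longrightarrow> t \<in> carrier (tensor K V W) \<Longrightarrow> P t \<Longrightarrow>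
        P (pure_tensor K V W v w \<oplus>\<^bsub>tensor K V W\<^esub> t)"
  shows "P t"
proof -
  obtain f where f: "f \<in> carrier pair_module" "t = pair_class f"
    using t coset_exhaust[OF pair_module_module tensor_null_submodule] unfolding tensor_def by metis
  have "pair_class f \<in> carrier (tensor K V W) \<and> P (pair_class f)"
    using V.R.is_cring f(1)
  proof (induction f rule: free_module_induct)
    case zero
    have "pair_class \<zero>\<^bsub>pair_module\<^esub> = \<zero>\<^bsub>tensor K V W\<^esub>"
      by (rule linear_fun_zero[OF pair_module_module tensor_module pair_class_linear])
    thus ?case using assms(2) by simp
  next
    case (add f c a)
    obtain v w where a: "a = (v, w)" "v \<in> carrier V" "w \<in> carrier W" using add(3) by auto
    have "pair_class ((c \<odot>\<^bsub>pair_module\<^esub> free_gen K (carrier V \<times> carrier W) a) \<oplus>\<^bsub>pair_module\<^esub> f) =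
      pure_tensor K V W (c \<odot>\<^bsub>V\<^esub> v) w \<oplus>\<^bsub>tensor K V W\<^esub> pair_class f"
      using add a
      by (simp add: linear_funD[OF pair_class_linear] pair_gen_closed pure_tensor_smult_left)
        (simp add: pure_tensor_def)
    thus ?case using add a assms(3) by (simp add: pure_tensor_closed)
  qed
  thus ?thesis using f by simp
qed

lemma tensor_ext:
  assumes X: "module K X" and h: "linear_fun K (tensor K V W) X h"
    and h': "linear_fun K (tensor K V W) X h'"
    and eq: "\<And>v w. v \<in> carrier V \<Longrightarrow> w \<in> carrier W \<Longrightarrow>
      h (pure_tensor K V W v w) = h' (pure_tensor K V W v w)"
    and t: "t \<in> carrier (tensor K V W)"
  shows "h t = h' t"
  using t
proof (induction t rule: tensor_ind)
  case zero
  show ?case by (simp add: linear_fun_zero[OF tensor_module X h] linear_fun_zero[OF tensor_module X h'])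
next
  case (add v w t)
  thus ?case by (simp add: linear_funD(2)[OF h] linear_funD(2)[OF h'] pure_tensor_closed eq)
qed

lemma tensor_sum_pure:
  assumes "t \<in> carrier (tensor K V W)"
  obtains ps where "set ps \<subseteq> carrier V \<times> carrier W"
    "t = foldr (\<lambda>(v, w) s. pure_tensor K V W v w \<oplus>\<^bsub>tensor K V W\<^esub> s) ps \<zero>\<^bsub>tensor K V W\<^esub>"
proof -
  have "\<exists>ps. set ps \<subseteq> carrier V \<times> carrier W \<and>
    t = foldr (\<lambda>(v, w) s. pure_tensor K V W v w \<oplus>\<^bsub>tensor K V W\<^esub> s) ps \<zero>\<^bsub>tensor K V W\<^esub>"
    using assms
  proof (induction t rule: tensor_ind)
    case zero
    show ?case by (rule exI[of _ "[]"]) simp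
  next
    case (add v w t)
    then obtain ps where "set ps \<subseteq> carrier V \<times> carrier W"
      "t = foldr (\<lambda>(v, w) s. pure_tensor K V W v w \<oplus>\<^bsub>tensor K V W\<^esub> s) ps \<zero>\<^bsub>tensor K V W\<^esub>" by blast
    thus ?case using add(1,2) by (intro exI[of _ "(v, w) # ps"]) simp
  qed
  thus ?thesis using that by blast
qed

end

lemma ground_module_module: "cring K \<Longrightarrow> module K (ground_module K)"
proof -
  assume "cring K"
  then interpret K: cring K .
  show ?thesis
  proof (rule moduleI)
    show "cring K" by (rule K.is_cring)
    show "abelian_group (ground_module K)"
    proof (rule abelian_groupI)
      fix x assume "x \<in> carrier (ground_module K)"
      thus "\<exists>y\<in>carrier (ground_module K). y \<oplus>\<^bsub>ground_module K\<^esub> x = \<zero>\<^bsub>ground_module K\<^esub>"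
        by (intro bexI[of _ "\<ominus>\<^bsub>K\<^esub> x"]) (simp_all add: ground_module_def K.l_neg)
    qed (simp_all add: ground_module_def K.a_ac)
  qed (simp_all add: ground_module_def K.l_distr K.r_distr K.m_assoc)
qed

lemma linear_fun_plus:
  assumes "module K X" "linear_fun K V X h" "linear_fun K V X h'"
  shows "linear_fun K V X (\<lambda>x. h x \<oplus>\<^bsub>X\<^esub> h' x)"
proof -
  interpret module K X by fact
  show ?thesis
    by (rule linear_funI)
      (simp_all add: linear_funD[OF assms(2)] linear_funD[OF assms(3)] M.a_ac smult_r_distr)
qed

lemma linear_fun_smult:
  assumes "module K X" "linear_fun K V X h" "c \<in> carrier K"
  shows "linear_fun K V X (\<lambda>x. c \<odot>\<^bsub>X\<^esub> h x)"
proof -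
  interpret module K X by fact
  show ?thesis
  proof (rule linear_funI)
    fix d x assume d: "d \<in> carrier K" and x: "x \<in> carrier V"
    have "c \<odot>\<^bsub>X\<^esub> h (d \<odot>\<^bsub>V\<^esub> x) = (c \<otimes>\<^bsub>K\<^esub> d) \<odot>\<^bsub>X\<^esub> h x"
      using d x assms(3) by (simp add: linear_funD[OF assms(2)] smult_assoc1)
    also have "\<dots> = (d \<otimes>\<^bsub>K\<^esub> c) \<odot>\<^bsub>X\<^esub> h x" using R.m_comm[OF assms(3) d] by simp
    also have "\<dots> = d \<odot>\<^bsub>X\<^esub> (c \<odot>\<^bsub>X\<^esub> h x)"
      using d x assms(3) by (simp add: linear_funD[OF assms(2)] smult_assoc1)
    finally show "c \<odot>\<^bsub>X\<^esub> h (d \<odot>\<^bsub>V\<^esub> x) = d \<odot>\<^bsub>X\<^esub> (c \<odot>\<^bsub>X\<^esub> h x)" .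
  qed (use assms(3) in \<open>simp_all add: linear_funD[OF assms(2)] smult_r_distr\<close>)
qed

lemma linear_fun_id:
  "module K V \<Longrightarrow> linear_fun K V V (\<lambda>x. x)"
  by (rule linear_funI) simp_all

lemma linear_fun_app_pure_left:
  assumes "module K V" "module K W" "linear_fun K (tensor K V W) X h" "w \<in> carrier W"
  shows "linear_fun K V X (\<lambda>v. h (pure_tensor K V W v w))"
  using linear_fun_comp[OF assms(3) pure_tensor_linear_left[OF assms(1,2,4)]] .

lemma linear_fun_app_pure_right:
  assumes "module K V" "module K W" "linear_fun K (tensor K V W) X h" "v \<in> carrier V"
  shows "linear_fun K W X (\<lambda>w. h (pure_tensor K V W v w))"
  using linear_fun_comp[OF assms(3) pure_tensor_linear_right[OF assms(1,2,4)]] .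

lemma tensor_ext_left:
  assumes U: "module K U" and V: "module K V" and W: "module K W" and X: "module K X"
    and h: "linear_fun K (tensor K (tensor K U V) W) X h"
    and h': "linear_fun K (tensor K (tensor K U V) W) X h'"
    and eq: "\<And>u v w. u \<in> carrier U \<Longrightarrow> v \<in> carrier V \<Longrightarrow> w \<in> carrier W \<Longrightarrow>
      h (pure_tensor K (tensor K U V) W (pure_tensor K U V u v) w) =
      h' (pure_tensor K (tensor K U V) W (pure_tensor K U V u v) w)"
    and t: "t \<in> carrier (tensor K (tensor K U V) W)"
  shows "h t = h' t"
proof (rule tensor_ext[OF tensor_module[OF U V] W X h h' _ t])
  fix s w assume s: "s \<in> carrier (tensor K U V)" and w: "w \<in> carrier W"
  note UV = tensor_module[OF U V]
  show "h (pure_tensor K (tensor K U V) W s w) = h' (pure_tensor K (tensor K U V) W s w)"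
    by (rule tensor_ext[OF U V X linear_fun_app_pure_left[OF UV W h w]
          linear_fun_app_pure_left[OF UV W h' w] _ s]) (rule eq[OF _ _ w])
qed

lemma tensor_ext_right:
  assumes U: "module K U" and V: "module K V" and W: "module K W" and X: "module K X"
    and h: "linear_fun K (tensor K U (tensor K V W)) X h"
    and h': "linear_fun K (tensor K U (tensor K V W)) X h'"
    and eq: "\<And>u v w. u \<in> carrier U \<Longrightarrow> v \<in> carrier V \<Longrightarrow> w \<in> carrier W \<Longrightarrow>
      h (pure_tensor K U (tensor K V W) u (pure_tensor K V W v w)) =
      h' (pure_tensor K U (tensor K V W) u (pure_tensor K V W v w))"
    and t: "t \<in> carrier (tensor K U (tensor K V W))"
  shows "h t = h' t"
proof (rule tensor_ext[OF U tensor_module[OF V W] X h h' _ t])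
  fix u s assume u: "u \<in> carrier U" and s: "s \<in> carrier (tensor K V W)"
  note VW = tensor_module[OF V W]
  show "h (pure_tensor K U (tensor K V W) u s) = h' (pure_tensor K U (tensor K V W) u s)"
    by (rule tensor_ext[OF V W X linear_fun_app_pure_right[OF U VW h u]
          linear_fun_app_pure_right[OF U VW h' u] _ s]) (rule eq[OF u])
qed

text \<open>
  By uniqueness the lift of a bilinear map depends linearly on any parameter on which the bilinear
  map depends linearly. This turns trilinear maps into linear maps on iterated tensor products.
\<close>

lemma tensor_lift_family:
  assumes V: "module K V" and W: "module K W" and Y: "module K Y" and X: "module K X"
    and BY: "\<And>v w. v \<in> carrier V \<Longrightarrow> w \<in> carrier W \<Longrightarrow> linear_fun K Y X (\<lambda>y. B y v w)"
    and BT: "\<And>y. y \<in> carrier Y \<Longrightarrow> bilinear_fun K V W X (B y)"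
  obtains h where "\<And>y. y \<in> carrier Y \<Longrightarrow> linear_fun K (tensor K V W) X (h y)"
    "\<And>t. t \<in> carrier (tensor K V W) \<Longrightarrow> linear_fun K Y X (\<lambda>y. h y t)"
    "\<And>y v w. y \<in> carrier Y \<Longrightarrow> v \<in> carrier V \<Longrightarrow> w \<in> carrier W \<Longrightarrow>
      h y (pure_tensor K V W v w) = B y v w"
proof -
  interpret X: module K X by (rule X)
  interpret Y: module K Y by (rule Y)
  have "\<forall>y\<in>carrier Y. \<exists>h. linear_fun K (tensor K V W) X h \<and>
    (\<forall>v\<in>carrier V. \<forall>w\<in>carrier W. h (pure_tensor K V W v w) = B y v w)"
    using tensor_lift[OF V W X BT] by metis
  then obtain h where h: "\<And>y. y \<in> carrier Y \<Longrightarrow> linear_fun K (tensor K V W) X (h y)"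
    and hB: "\<And>y v w. y \<in> carrier Y \<Longrightarrow> v \<in> carrier V \<Longrightarrow> w \<in> carrier W \<Longrightarrow>
      h y (pure_tensor K V W v w) = B y v w"
    by (metis (no_types, lifting))
  have "linear_fun K Y X (\<lambda>y. h y t)" if t: "t \<in> carrier (tensor K V W)" for t
  proof (rule linear_funI)
    show "h y t \<in> carrier X" if "y \<in> carrier Y" for y using linear_funD(1)[OF h[OF that] t] .
    show "h (y \<oplus>\<^bsub>Y\<^esub> y') t = h y t \<oplus>\<^bsub>X\<^esub> h y' t" if y: "y \<in> carrier Y" "y' \<in> carrier Y" for y y'
      by (rule tensor_ext[OF V W X h linear_fun_plus[OF X h h] _ t])
        (simp_all add: y hB linear_funD(2)[OF BY])
    show "h (c \<odot>\<^bsub>Y\<^esub> y) t = c \<odot>\<^bsub>X\<^esub> h y t" if y: "c \<in> carrier K" "y \<in> carrier Y" for c y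
      by (rule tensor_ext[OF V W X h linear_fun_smult[OF X h] _ t])
        (simp_all add: y hB linear_funD(3)[OF BY])
  qed
  with h hB show ?thesis using that by blast
qed

section \<open>Composition of linear maps\<close>

definition linear_map :: "('k, 'r) ring_scheme \<Rightarrow> ('k, 'a, 'b) lmap \<Rightarrow> bool" where
  "linear_map K f \<longleftrightarrow> module K (src f) \<and> module K (tgt f) \<and> f \<in> lin_maps K (src f) (tgt f)"

lemma linear_mapI:
  assumes "module K V" "module K W" "f \<in> lin_maps K V W"
  shows "linear_map K f" "src f = V" "tgt f = W"
  using assms by (auto simp: linear_map_def lin_maps_def)

lemma linear_map_linear: "linear_map K f \<Longrightarrow> linear_fun K (src f) (tgt f) (app f)"
  by (auto simp: linear_map_def lin_maps_def linear_fun_def)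

lemma linear_map_modules: "linear_map K f \<Longrightarrow> module K (src f)" "linear_map K f \<Longrightarrow> module K (tgt f)"
  by (auto simp: linear_map_def)

lemma linear_map_in: "linear_map K f \<Longrightarrow> src f = V \<Longrightarrow> tgt f = W \<Longrightarrow> f \<in> lin_maps K V W"
  by (auto simp: linear_map_def)

lemma linear_map_iff:
  "linear_map K f \<longleftrightarrow> module K (src f) \<and> module K (tgt f) \<and>
     linear_fun K (src f) (tgt f) (app f) \<and> app f \<in> extensional (carrier (src f))"
  by (auto simp: linear_map_def lin_maps_def linear_fun_def PiE_def)

lemma app_closed: "linear_map K f \<Longrightarrow> x \<in> carrier (src f) \<Longrightarrow> app f x \<in> carrier (tgt f)"
  using linear_funD(1)[OF linear_map_linear] .

lemma lmap_eqI:
  assumes "linear_map K f" "linear_map K g" "src f = src g" "tgt f = tgt g"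
    "\<And>x. x \<in> carrier (src g) \<Longrightarrow> app f x = app g x"
  shows "f = g"
proof -
  have "app f = app g"
    using assms by (intro extensionalityI[of _ "carrier (src g)"]) (auto simp: linear_map_iff)
  thus ?thesis using assms(3,4) by simp
qed

definition mk_lmap :: "('k, 'a) module \<Rightarrow> ('k, 'b) module \<Rightarrow> ('a \<Rightarrow> 'b) \<Rightarrow> ('k, 'a, 'b) lmap" where
  "mk_lmap V W h = \<lparr>src = V, tgt = W, app = restrict h (carrier V)\<rparr>"

lemma mk_lmap_simps [simp]: "src (mk_lmap V W h) = V" "tgt (mk_lmap V W h) = W"
  "x \<in> carrier V \<Longrightarrow> app (mk_lmap V W h) x = h x"
  by (simp_all add: mk_lmap_def)

lemma mk_lmap_linear:
  assumes "module K V" "module K W" "linear_fun K V W h"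
  shows "linear_map K (mk_lmap V W h)"
  using assms linear_fun_cong[of K V "restrict h (carrier V)" h W]
  by (simp add: linear_map_iff) (simp add: mk_lmap_def)

lemma lid_simps [simp]: "src (lid V) = V" "tgt (lid V) = V"
  "x \<in> carrier V \<Longrightarrow> app (lid V) x = x"
  by (simp_all add: lid_def)

lemma lid_linear: "module K V \<Longrightarrow> linear_map K (lid V)"
  using mk_lmap_linear[OF _ _ linear_fun_id, of K V] by (simp add: lid_def mk_lmap_def)

lemma lcomp_simps [simp]: "src (g \<cdot> f) = src f" "tgt (g \<cdot> f) = tgt g"
  "x \<in> carrier (src f) \<Longrightarrow> app (g \<cdot> f) x = app g (app f x)"
  by (simp_all add: lcomp_def compose_def)

lemma lcomp_linear:
  assumes "linear_map K g" "linear_map K f" "src g = tgt f"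
  shows "linear_map K (g \<cdot> f)"
proof -
  have "linear_fun K (src f) (tgt g) (\<lambda>x. app g (app f x))"
    using linear_fun_comp[OF linear_map_linear[OF assms(1)]] linear_map_linear[OF assms(2)] assms(3)
    by metis
  hence "linear_fun K (src f) (tgt g) (app (g \<cdot> f))"
    using linear_fun_cong[OF linear_map_modules(1)[OF assms(2)], of "app (g \<cdot> f)" "\<lambda>x. app g (app f x)" "tgt g"]
    by simp
  thus ?thesis using assms by (simp add: linear_map_iff) (simp add: lcomp_def compose_def)
qed

text \<open>
  A composite is restricted to the source of its first factor, so only the first factor has to be
  a linear map into the source of the second.
\<close>

lemma lcomp_assoc:
  assumes "linear_map K f" "src g = tgt f"
  shows "(h \<cdot> g) \<cdot> f = h \<cdot> g \<cdot> f"
  using app_closed[OF assms(1)] assms(2) by (auto simp: lcomp_def compose_def fun_eq_iff)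

lemma lid_lcomp: "linear_map K f \<Longrightarrow> tgt f = V \<Longrightarrow> lid V \<cdot> f = f"
  by (rule lmap_eqI[of K]) (auto simp: lid_linear lcomp_linear linear_map_modules app_closed)

lemma lcomp_lid: "linear_map K f \<Longrightarrow> src f = V \<Longrightarrow> f \<cdot> lid V = f"
  by (rule lmap_eqI[of K]) (auto simp: lid_linear lcomp_linear linear_map_modules)

lemma lbij_lid: "lbij (lid V)"
  by (simp add: lbij_def lid_def bij_betw_def inj_on_def)

lemma linv_simps [simp]: "src (linv f) = tgt f" "tgt (linv f) = src f"
  by (simp_all add: linv_def)

lemma
  assumes "lbij f"
  shows linv_app_app: "x \<in> carrier (src f) \<Longrightarrow> app (linv f) (app f x) = x"
    and app_linv_app: "y \<in> carrier (tgt f) \<Longrightarrow> app f (app (linv f) y) = y"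
    and linv_app_closed: "y \<in> carrier (tgt f) \<Longrightarrow> app (linv f) y \<in> carrier (src f)"
    and lbij_linv: "lbij (linv f)"
proof -
  have b: "bij_betw (app f) (carrier (src f)) (carrier (tgt f))" using assms by (simp add: lbij_def)
  show "app (linv f) (app f x) = x" if "x \<in> carrier (src f)"
    using bij_betw_inv_into_left[OF b that] bij_betwE[OF b] that by (simp add: linv_def)
  show "app f (app (linv f) y) = y" if "y \<in> carrier (tgt f)"
    using bij_betw_inv_into_right[OF b that] that by (simp add: linv_def)
  show "app (linv f) y \<in> carrier (src f)" if "y \<in> carrier (tgt f)"
    using bij_betwE[OF bij_betw_inv_into[OF b]] that by (simp add: linv_def)
  show "lbij (linv f)"
    using bij_betw_inv_into[OF b]
      bij_betw_cong[of "carrier (tgt f)" "app (linv f)" "inv_into (carrier (src f)) (app f)"]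
    by (simp add: lbij_def) (simp add: linv_def)
qed

lemma linv_linear:
  assumes "linear_map K f" "lbij f"
  shows "linear_map K (linv f)"
proof -
  note D = linear_funD[OF linear_map_linear[OF assms(1)]]
  note C = linv_app_closed[OF assms(2)]
  interpret S: module K "src f" by (rule linear_map_modules[OF assms(1)])
  interpret T: module K "tgt f" by (rule linear_map_modules[OF assms(1)])
  have inj: "x = y" if "x \<in> carrier (src f)" "y \<in> carrier (src f)" "app f x = app f y" for x y
    using assms(2) that by (auto simp: lbij_def bij_betw_def inj_on_def)
  have "linear_fun K (tgt f) (src f) (app (linv f))"
  proof (rule linear_funI)
    show "app (linv f) (x \<oplus>\<^bsub>tgt f\<^esub> y) = app (linv f) x \<oplus>\<^bsub>src f\<^esub> app (linv f) y"
      if "x \<in> carrier (tgt f)" "y \<in> carrier (tgt f)" for x y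
      by (rule inj) (simp_all add: that C D app_linv_app[OF assms(2)])
    show "app (linv f) (c \<odot>\<^bsub>tgt f\<^esub> x) = c \<odot>\<^bsub>src f\<^esub> app (linv f) x"
      if "c \<in> carrier K" "x \<in> carrier (tgt f)" for c x
      by (rule inj) (simp_all add: that C D app_linv_app[OF assms(2)])
  qed (rule C)
  thus ?thesis
    using linear_map_modules[OF assms(1)] by (simp add: linear_map_iff) (simp add: linv_def)
qed

lemma linv_lcomp:
  assumes "linear_map K f" "lbij f"
  shows "linv f \<cdot> f = lid (src f)"
  by (rule lmap_eqI[of K])
    (simp_all add: assms linv_linear lcomp_linear lid_linear linear_map_modules linv_app_app)

lemma lcomp_linv:
  assumes "linear_map K f" "lbij f"
  shows "f \<cdot> linv f = lid (tgt f)"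
  by (rule lmap_eqI[of K])
    (simp_all add: assms linv_linear lcomp_linear lid_linear linear_map_modules app_linv_app)

lemma linv_lcomp_cancel:
  assumes "linear_map K f" "lbij f" "linear_map K g" "tgt g = src f"
  shows "linv f \<cdot> f \<cdot> g = g"
proof -
  have "linv f \<cdot> f \<cdot> g = (linv f \<cdot> f) \<cdot> g"
    by (rule lcomp_assoc[symmetric]) (use assms in simp_all)
  thus ?thesis using assms by (simp add: linv_lcomp[OF assms(1,2)] lid_lcomp)
qed

lemma lcomp_linv_cancel:
  assumes "linear_map K f" "lbij f" "linear_map K g" "tgt g = tgt f"
  shows "f \<cdot> linv f \<cdot> g = g"
proof -
  have "f \<cdot> linv f \<cdot> g = (f \<cdot> linv f) \<cdot> g"
    by (rule lcomp_assoc[symmetric]) (use assms in simp_all)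
  thus ?thesis using assms by (simp add: lcomp_linv[OF assms(1,2)] lid_lcomp)
qed

lemma lbijI:
  assumes "linear_map K f" "linear_map K g" "src g = tgt f" "tgt g = src f"
    and "g \<cdot> f = lid (src f)" "f \<cdot> g = lid (tgt f)"
  shows "lbij f" "linv f = g"
proof -
  have gf: "app g (app f x) = x" if "x \<in> carrier (src f)" for x
    using arg_cong[OF assms(5), of "\<lambda>h. app h x"] that by simp
  have fg: "app f (app g y) = y" if "y \<in> carrier (tgt f)" for y
    using arg_cong[OF assms(6), of "\<lambda>h. app h y"] that assms(3) by simp
  show b: "lbij f" unfolding lbij_def
    by (rule bij_betw_byWitness[of _ "app g"])
      (use gf fg app_closed[OF assms(1)] app_closed[OF assms(2)] assms(3,4) in auto)
  show "linv f = g"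
  proof (rule lmap_eqI[of K])
    fix y assume "y \<in> carrier (src g)"
    hence y: "y \<in> carrier (tgt f)" using assms(3) by simp
    have "app g y = app (linv f) (app f (app g y))"
      using linv_app_app[OF b] app_closed[OF assms(2)] y assms(3,4) by simp
    thus "app (linv f) y = app g y" using fg[OF y] by simp
  qed (use assms linv_linear[OF _ b] in simp_all)
qed

lemma linv_linv:
  assumes "linear_map K f" "lbij f"
  shows "linv (linv f) = f"
  using lbijI(2)[OF linv_linear[OF assms] assms(1)] linv_lcomp[OF assms] lcomp_linv[OF assms] by simp

lemma lbij_lcomp:
  assumes "linear_map K f" "linear_map K g" "lbij f" "lbij g" "src g = tgt f"
  shows "lbij (g \<cdot> f)"
proof -
  have "bij_betw (app g \<circ> app f) (carrier (src f)) (carrier (tgt g))"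
    using assms(3-5) bij_betw_trans unfolding lbij_def by metis
  thus ?thesis using bij_betw_cong[of "carrier (src f)" "app (g \<cdot> f)" "app g \<circ> app f"]
    by (simp add: lbij_def)
qed

lemma lcomp_left_cancel:
  assumes "linear_map K f" "lbij f" "linear_map K g" "linear_map K h" "tgt g = src f" "tgt h = src f"
    "f \<cdot> g = f \<cdot> h"
  shows "g = h"
  using assms linv_lcomp_cancel by metis

lemma lcomp_right_cancel:
  assumes "linear_map K f" "lbij f" "linear_map K g" "linear_map K h" "src g = tgt f" "src h = tgt f"
    "g \<cdot> f = h \<cdot> f"
  shows "g = h"
proof -
  have "g = (g \<cdot> f) \<cdot> linv f"
    using assms by (subst lcomp_assoc[of K]) (simp_all add: linv_linear lcomp_linv lcomp_lid)
  also have "\<dots> = h" using assms(7)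
    using assms by (simp, subst lcomp_assoc[of K]) (simp_all add: linv_linear lcomp_linv lcomp_lid)
  finally show ?thesis .
qed

section \<open>Tensor products of linear maps\<close>

lemma lmap_tensor_eqI:
  assumes "module K V" "module K W" "linear_map K f" "linear_map K g"
    "src f = tensor K V W" "src g = tensor K V W" "tgt f = tgt g"
    "\<And>v w. v \<in> carrier V \<Longrightarrow> w \<in> carrier W \<Longrightarrow>
       app f (pure_tensor K V W v w) = app g (pure_tensor K V W v w)"
  shows "f = g"
proof (rule lmap_eqI[OF assms(3,4)])
  fix x assume "x \<in> carrier (src g)"
  thus "app f x = app g x"
    using tensor_ext[OF assms(1,2) linear_map_modules(2)[OF assms(4)], of "app f" "app g" x]
      linear_map_linear[OF assms(3)] linear_map_linear[OF assms(4)] assms(5-8) by simp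
qed (use assms in simp_all)

lemma lmap_tensor_eqI_left:
  assumes "module K U" "module K V" "module K W" "linear_map K f" "linear_map K g"
    "src f = tensor K (tensor K U V) W" "src g = tensor K (tensor K U V) W" "tgt f = tgt g"
    "\<And>u v w. u \<in> carrier U \<Longrightarrow> v \<in> carrier V \<Longrightarrow> w \<in> carrier W \<Longrightarrow>
       app f (pure_tensor K (tensor K U V) W (pure_tensor K U V u v) w) =
       app g (pure_tensor K (tensor K U V) W (pure_tensor K U V u v) w)"
  shows "f = g"
proof (rule lmap_eqI[OF assms(4,5)])
  fix x assume "x \<in> carrier (src g)"
  thus "app f x = app g x"
    using tensor_ext_left[OF assms(1-3) linear_map_modules(2)[OF assms(5)], of "app f" "app g" x]
      linear_map_linear[OF assms(4)] linear_map_linear[OF assms(5)] assms(6-9) by simp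
qed (use assms in simp_all)

lemma lmap_tensor_eqI_right:
  assumes "module K U" "module K V" "module K W" "linear_map K f" "linear_map K g"
    "src f = tensor K U (tensor K V W)" "src g = tensor K U (tensor K V W)" "tgt f = tgt g"
    "\<And>u v w. u \<in> carrier U \<Longrightarrow> v \<in> carrier V \<Longrightarrow> w \<in> carrier W \<Longrightarrow>
       app f (pure_tensor K U (tensor K V W) u (pure_tensor K V W v w)) =
       app g (pure_tensor K U (tensor K V W) u (pure_tensor K V W v w))"
  shows "f = g"
proof (rule lmap_eqI[OF assms(4,5)])
  fix x assume "x \<in> carrier (src g)"
  thus "app f x = app g x"
    using tensor_ext_right[OF assms(1-3) linear_map_modules(2)[OF assms(5)], of "app f" "app g" x]
      linear_map_linear[OF assms(4)] linear_map_linear[OF assms(5)] assms(6-9) by simp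
qed (use assms in simp_all)

lemma tensor_lmap_ex1:
  assumes V: "module K V" and W: "module K W" and X: "module K X" and B: "bilinear_fun K V W X B"
  shows "\<exists>!h. h \<in> lin_maps K (tensor K V W) X \<and>
    (\<forall>v\<in>carrier V. \<forall>w\<in>carrier W. app h (pure_tensor K V W v w) = B v w)"
proof -
  note T = tensor_module[OF V W]
  obtain h where h: "linear_fun K (tensor K V W) X h"
    "\<And>v w. v \<in> carrier V \<Longrightarrow> w \<in> carrier W \<Longrightarrow> h (pure_tensor K V W v w) = B v w"
    by (rule tensor_lift[OF assms]) blast
  show ?thesis
  proof (rule ex1I[of _ "mk_lmap (tensor K V W) X h"])
    show "mk_lmap (tensor K V W) X h \<in> lin_maps K (tensor K V W) X \<and>
      (\<forall>v\<in>carrier V. \<forall>w\<in>carrier W.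
         app (mk_lmap (tensor K V W) X h) (pure_tensor K V W v w) = B v w)"
      using linear_map_in[OF mk_lmap_linear[OF T X h(1)]] h(2)
      by (simp add: pure_tensor_closed[OF V W])
    fix f assume f: "f \<in> lin_maps K (tensor K V W) X \<and>
      (\<forall>v\<in>carrier V. \<forall>w\<in>carrier W. app f (pure_tensor K V W v w) = B v w)"
    hence "linear_map K f" "src f = tensor K V W" "tgt f = X"
      using linear_mapI[OF T X] by auto
    thus "f = mk_lmap (tensor K V W) X h"
      by (intro lmap_tensor_eqI[OF V W _ mk_lmap_linear[OF T X h(1)]])
        (use f h(2) in \<open>simp_all add: pure_tensor_closed[OF V W]\<close>)
  qed
qed

lemma tensor_map_props:
  assumes f: "linear_map K f" and g: "linear_map K g"
  shows tensor_map_linear: "linear_map K (f \<boxtimes>\<^bsub>K\<^esub> g)"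
    and tensor_map_src: "src (f \<boxtimes>\<^bsub>K\<^esub> g) = tensor K (src f) (src g)"
    and tensor_map_tgt: "tgt (f \<boxtimes>\<^bsub>K\<^esub> g) = tensor K (tgt f) (tgt g)"
    and tensor_map_pure: "v \<in> carrier (src f) \<Longrightarrow> w \<in> carrier (src g) \<Longrightarrow>
      app (f \<boxtimes>\<^bsub>K\<^esub> g) (pure_tensor K (src f) (src g) v w) =
      pure_tensor K (tgt f) (tgt g) (app f v) (app g w)"
proof -
  note mf = linear_map_modules[OF f] and mg = linear_map_modules[OF g]
  note lf = linear_map_linear[OF f] and lg = linear_map_linear[OF g]
  have "bilinear_fun K (src f) (src g) (tensor K (tgt f) (tgt g))
    (\<lambda>v w. pure_tensor K (tgt f) (tgt g) (app f v) (app g w))"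
    unfolding bilinear_fun_def
    using linear_fun_comp[OF pure_tensor_linear_right[OF mf(2) mg(2)] lg]
      linear_fun_comp[OF pure_tensor_linear_left[OF mf(2) mg(2)] lf] app_closed[OF f] app_closed[OF g]
    by blast
  from theI'[OF tensor_lmap_ex1[OF mf(1) mg(1) tensor_module[OF mf(2) mg(2)] this]]
  have *: "(f \<boxtimes>\<^bsub>K\<^esub> g) \<in> lin_maps K (tensor K (src f) (src g)) (tensor K (tgt f) (tgt g))"
    "\<forall>v\<in>carrier (src f). \<forall>w\<in>carrier (src g).
      app (f \<boxtimes>\<^bsub>K\<^esub> g) (pure_tensor K (src f) (src g) v w) =
      pure_tensor K (tgt f) (tgt g) (app f v) (app g w)"
    unfolding tensor_map_def[symmetric] by blast+
  show "linear_map K (f \<boxtimes>\<^bsub>K\<^esub> g)" "src (f \<boxtimes>\<^bsub>K\<^esub> g) = tensor K (src f) (src g)"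
    "tgt (f \<boxtimes>\<^bsub>K\<^esub> g) = tensor K (tgt f) (tgt g)"
    using linear_mapI[OF tensor_module[OF mf(1) mg(1)] tensor_module[OF mf(2) mg(2)] *(1)] .
  show "v \<in> carrier (src f) \<Longrightarrow> w \<in> carrier (src g) \<Longrightarrow>
      app (f \<boxtimes>\<^bsub>K\<^esub> g) (pure_tensor K (src f) (src g) v w) =
      pure_tensor K (tgt f) (tgt g) (app f v) (app g w)"
    using *(2) by blast
qed

lemma lassoc_props:
  assumes U: "module K U" and V: "module K V" and W: "module K W"
  shows lassoc_linear: "linear_map K (lassoc K U V W)"
    and lassoc_src: "src (lassoc K U V W) = tensor K (tensor K U V) W"
    and lassoc_tgt: "tgt (lassoc K U V W) = tensor K U (tensor K V W)"
    and lassoc_pure: "u \<in> carrier U \<Longrightarrow> v \<in> carrier V \<Longrightarrow> w \<in> carrier W \<Longrightarrow>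
      app (lassoc K U V W) (pure_tensor K (tensor K U V) W (pure_tensor K U V u v) w) =
      pure_tensor K U (tensor K V W) u (pure_tensor K V W v w)"
proof -
  note UV = tensor_module[OF U V] and VW = tensor_module[OF V W]
  let ?S = "tensor K (tensor K U V) W" and ?T = "tensor K U (tensor K V W)"
  note S = tensor_module[OF UV W] and T = tensor_module[OF U VW]
  have lu: "linear_fun K U ?T (\<lambda>u. pure_tensor K U (tensor K V W) u (pure_tensor K V W v w))"
    if "v \<in> carrier V" "w \<in> carrier W" for v w
    by (rule pure_tensor_linear_left[OF U VW pure_tensor_closed[OF V W that]])
  have lv: "linear_fun K V ?T (\<lambda>v. pure_tensor K U (tensor K V W) u (pure_tensor K V W v w))"
    if "u \<in> carrier U" "w \<in> carrier W" for u w
    by (rule linear_fun_comp[OF pure_tensor_linear_right[OF U VW that(1)] pure_tensor_linear_left[OF V W that(2)]])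
  have lw: "linear_fun K W ?T (\<lambda>w. pure_tensor K U (tensor K V W) u (pure_tensor K V W v w))"
    if "u \<in> carrier U" "v \<in> carrier V" for u v
    by (rule linear_fun_comp[OF pure_tensor_linear_right[OF U VW that(1)] pure_tensor_linear_right[OF V W that(2)]])
  have bil: "bilinear_fun K U V ?T (\<lambda>u v. pure_tensor K U (tensor K V W) u (pure_tensor K V W v w))"
    if "w \<in> carrier W" for w using that lu lv by (simp add: bilinear_fun_def)
  obtain h where h: "\<And>w. w \<in> carrier W \<Longrightarrow> linear_fun K (tensor K U V) ?T (h w)"
    "\<And>t. t \<in> carrier (tensor K U V) \<Longrightarrow> linear_fun K W ?T (\<lambda>w. h w t)"
    "\<And>w u v. w \<in> carrier W \<Longrightarrow> u \<in> carrier U \<Longrightarrow> v \<in> carrier V \<Longrightarrow>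
      h w (pure_tensor K U V u v) = pure_tensor K U (tensor K V W) u (pure_tensor K V W v w)"
    using tensor_lift_family[OF U V W T lw bil] by blast
  have "bilinear_fun K (tensor K U V) W ?T (\<lambda>t w. h w t)"
    using h by (simp add: bilinear_fun_def)
  from tensor_lmap_ex1[OF UV W T this] obtain a where a: "a \<in> lin_maps K ?S ?T"
    "\<And>t w. t \<in> carrier (tensor K U V) \<Longrightarrow> w \<in> carrier W \<Longrightarrow>
       app a (pure_tensor K (tensor K U V) W t w) = h w t" by blast
  have "\<exists>!a. a \<in> lin_maps K ?S ?T \<and> (\<forall>u\<in>carrier U. \<forall>v\<in>carrier V. \<forall>w\<in>carrier W.
          app a (pure_tensor K (tensor K U V) W (pure_tensor K U V u v) w) =
            pure_tensor K U (tensor K V W) u (pure_tensor K V W v w))"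
  proof (rule ex1I[of _ a])
    fix b assume b: "b \<in> lin_maps K ?S ?T \<and> (\<forall>u\<in>carrier U. \<forall>v\<in>carrier V. \<forall>w\<in>carrier W.
          app b (pure_tensor K (tensor K U V) W (pure_tensor K U V u v) w) =
            pure_tensor K U (tensor K V W) u (pure_tensor K V W v w))"
    hence "b \<in> lin_maps K ?S ?T" by blast
    note B = linear_mapI[OF S T this] and A = linear_mapI[OF S T a(1)]
    show "b = a"
      by (rule lmap_tensor_eqI_left[OF U V W B(1) A(1) B(2) A(2)])
        (use b in \<open>simp_all add: A B a(2) h(3) pure_tensor_closed[OF U V]\<close>)
  qed (simp add: a h(3) pure_tensor_closed[OF U V])
  from theI'[OF this]
  have *: "lassoc K U V W \<in> lin_maps K ?S ?T"
    "\<forall>u\<in>carrier U. \<forall>v\<in>carrier V. \<forall>w\<in>carrier W.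
      app (lassoc K U V W) (pure_tensor K (tensor K U V) W (pure_tensor K U V u v) w) =
            pure_tensor K U (tensor K V W) u (pure_tensor K V W v w)"
    unfolding lassoc_def[symmetric] by blast+
  show "linear_map K (lassoc K U V W)" "src (lassoc K U V W) = ?S" "tgt (lassoc K U V W) = ?T"
    using linear_mapI[OF S T *(1)] .
  show "u \<in> carrier U \<Longrightarrow> v \<in> carrier V \<Longrightarrow> w \<in> carrier W \<Longrightarrow>
      app (lassoc K U V W) (pure_tensor K (tensor K U V) W (pure_tensor K U V u v) w) =
      pure_tensor K U (tensor K V W) u (pure_tensor K V W v w)"
    using *(2) by blast
qed

text \<open>
  The inverse comes from the universal property as well; both composites fix pure tensors.
\<close>

lemma lassoc_lbij:
  assumes U: "module K U" and V: "module K V" and W: "module K W"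
  shows "lbij (lassoc K U V W)"
proof -
  note UV = tensor_module[OF U V] and VW = tensor_module[OF V W]
  let ?S = "tensor K (tensor K U V) W" and ?T = "tensor K U (tensor K V W)"
  note S = tensor_module[OF UV W] and T = tensor_module[OF U VW]
  note A = lassoc_linear[OF U V W] lassoc_src[OF U V W] lassoc_tgt[OF U V W]
  have lw: "linear_fun K W ?S (\<lambda>w. pure_tensor K (tensor K U V) W (pure_tensor K U V u v) w)"
    if "u \<in> carrier U" "v \<in> carrier V" for u v
    by (rule pure_tensor_linear_right[OF UV W pure_tensor_closed[OF U V that]])
  have lv: "linear_fun K V ?S (\<lambda>v. pure_tensor K (tensor K U V) W (pure_tensor K U V u v) w)"
    if "u \<in> carrier U" "w \<in> carrier W" for u w
    by (rule linear_fun_comp[OF pure_tensor_linear_left[OF UV W that(2)] pure_tensor_linear_right[OF U V that(1)]])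
  have lu: "linear_fun K U ?S (\<lambda>u. pure_tensor K (tensor K U V) W (pure_tensor K U V u v) w)"
    if "v \<in> carrier V" "w \<in> carrier W" for v w
    by (rule linear_fun_comp[OF pure_tensor_linear_left[OF UV W that(2)] pure_tensor_linear_left[OF U V that(1)]])
  have bil: "bilinear_fun K V W ?S (\<lambda>v w. pure_tensor K (tensor K U V) W (pure_tensor K U V u v) w)"
    if "u \<in> carrier U" for u using that lv lw by (simp add: bilinear_fun_def)
  obtain h where h: "\<And>u. u \<in> carrier U \<Longrightarrow> linear_fun K (tensor K V W) ?S (h u)"
    "\<And>t. t \<in> carrier (tensor K V W) \<Longrightarrow> linear_fun K U ?S (\<lambda>u. h u t)"
    "\<And>u v w. u \<in> carrier U \<Longrightarrow> v \<in> carrier V \<Longrightarrow> w \<in> carrier W \<Longrightarrow>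
      h u (pure_tensor K V W v w) = pure_tensor K (tensor K U V) W (pure_tensor K U V u v) w"
    using tensor_lift_family[OF V W U S lu bil] by blast
  have "bilinear_fun K U (tensor K V W) ?S h"
    using h by (simp add: bilinear_fun_def)
  from tensor_lmap_ex1[OF U VW S this] obtain b where b: "b \<in> lin_maps K ?T ?S"
    "\<And>u t. u \<in> carrier U \<Longrightarrow> t \<in> carrier (tensor K V W) \<Longrightarrow>
       app b (pure_tensor K U (tensor K V W) u t) = h u t" by blast
  note B = linear_mapI[OF T S b(1)]
  have "b \<cdot> lassoc K U V W = lid ?S"
    by (rule lmap_tensor_eqI_left[OF U V W])
      (simp_all add: A B lcomp_linear lid_linear S pure_tensor_closed[OF UV W]
        pure_tensor_closed[OF U V] pure_tensor_closed[OF V W] lassoc_pure[OF U V W] b h)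
  moreover have "lassoc K U V W \<cdot> b = lid ?T"
    by (rule lmap_tensor_eqI_right[OF U V W])
      (simp_all add: A B lcomp_linear lid_linear T pure_tensor_closed[OF U VW]
        pure_tensor_closed[OF U V] pure_tensor_closed[OF V W] lassoc_pure[OF U V W] b h)
  ultimately show ?thesis using lbijI(1)[OF A(1) B(1)] A B by simp
qed

lemma lunit_l_props:
  assumes V: "module K V"
  shows lunit_l_linear: "linear_map K (lunit_l K V)"
    and lunit_l_src: "src (lunit_l K V) = tensor K (ground_module K) V"
    and lunit_l_tgt: "tgt (lunit_l K V) = V"
    and lunit_l_pure: "c \<in> carrier K \<Longrightarrow> v \<in> carrier V \<Longrightarrow>
      app (lunit_l K V) (pure_tensor K (ground_module K) V c v) = c \<odot>\<^bsub>V\<^esub> v"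
proof -
  interpret V: module K V by fact
  have G: "module K (ground_module K)" by (rule ground_module_module) (rule V.R.is_cring)
  have Gc: "carrier (ground_module K) = carrier K" by (simp add: ground_module_def)
  have "bilinear_fun K (ground_module K) V V (\<lambda>c v. c \<odot>\<^bsub>V\<^esub> v)"
    unfolding bilinear_fun_def
  proof (intro conjI ballI)
    show "linear_fun K V V (\<lambda>v. c \<odot>\<^bsub>V\<^esub> v)" if "c \<in> carrier (ground_module K)" for c
      using linear_fun_smult[OF V linear_fun_id[OF V], of c] that Gc by simp
    show "linear_fun K (ground_module K) V (\<lambda>c. c \<odot>\<^bsub>V\<^esub> v)" if "v \<in> carrier V" for v
      by (rule linear_funI)
        (use that in \<open>simp_all add: ground_module_def V.smult_l_distr V.smult_assoc1\<close>)
  qed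
  from theI'[OF tensor_lmap_ex1[OF G V V this]]
  have *: "lunit_l K V \<in> lin_maps K (tensor K (ground_module K) V) V"
    "\<forall>c\<in>carrier K. \<forall>v\<in>carrier V.
      app (lunit_l K V) (pure_tensor K (ground_module K) V c v) = c \<odot>\<^bsub>V\<^esub> v"
    unfolding Gc lunit_l_def[symmetric] by blast+
  show "linear_map K (lunit_l K V)" "src (lunit_l K V) = tensor K (ground_module K) V"
    "tgt (lunit_l K V) = V" using linear_mapI[OF tensor_module[OF G V] V *(1)] .
  show "c \<in> carrier K \<Longrightarrow> v \<in> carrier V \<Longrightarrow>
      app (lunit_l K V) (pure_tensor K (ground_module K) V c v) = c \<odot>\<^bsub>V\<^esub> v" using *(2) by blast
qed

lemma lunit_r_props:
  assumes V: "module K V"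
  shows lunit_r_linear: "linear_map K (lunit_r K V)"
    and lunit_r_src: "src (lunit_r K V) = tensor K V (ground_module K)"
    and lunit_r_tgt: "tgt (lunit_r K V) = V"
    and lunit_r_pure: "v \<in> carrier V \<Longrightarrow> c \<in> carrier K \<Longrightarrow>
      app (lunit_r K V) (pure_tensor K V (ground_module K) v c) = c \<odot>\<^bsub>V\<^esub> v"
proof -
  interpret V: module K V by fact
  have G: "module K (ground_module K)" by (rule ground_module_module) (rule V.R.is_cring)
  have Gc: "carrier (ground_module K) = carrier K" by (simp add: ground_module_def)
  have "bilinear_fun K V (ground_module K) V (\<lambda>v c. c \<odot>\<^bsub>V\<^esub> v)"
    unfolding bilinear_fun_def
  proof (intro conjI ballI)
    show "linear_fun K V V (\<lambda>v. c \<odot>\<^bsub>V\<^esub> v)" if "c \<in> carrier (ground_module K)" for c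
      using linear_fun_smult[OF V linear_fun_id[OF V], of c] that Gc by simp
    show "linear_fun K (ground_module K) V (\<lambda>c. c \<odot>\<^bsub>V\<^esub> v)" if "v \<in> carrier V" for v
      by (rule linear_funI)
        (use that in \<open>simp_all add: ground_module_def V.smult_l_distr V.smult_assoc1\<close>)
  qed
  from theI'[OF tensor_lmap_ex1[OF V G V this]]
  have *: "lunit_r K V \<in> lin_maps K (tensor K V (ground_module K)) V"
    "\<forall>v\<in>carrier V. \<forall>c\<in>carrier K.
      app (lunit_r K V) (pure_tensor K V (ground_module K) v c) = c \<odot>\<^bsub>V\<^esub> v"
    unfolding Gc lunit_r_def[symmetric] by blast+
  show "linear_map K (lunit_r K V)" "src (lunit_r K V) = tensor K V (ground_module K)"
    "tgt (lunit_r K V) = V" using linear_mapI[OF tensor_module[OF V G] V *(1)] .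
  show "v \<in> carrier V \<Longrightarrow> c \<in> carrier K \<Longrightarrow>
      app (lunit_r K V) (pure_tensor K V (ground_module K) v c) = c \<odot>\<^bsub>V\<^esub> v" using *(2) by blast
qed

lemmas lmap_typing = tensor_module lid_linear lcomp_linear linv_linear tensor_map_linear tensor_map_src
  tensor_map_tgt lassoc_linear lassoc_src lassoc_tgt lassoc_lbij lbij_lid

lemma tensor_map_lcomp:
  assumes "linear_map K f" "linear_map K f'" "linear_map K g" "linear_map K g'"
    "src f = tgt f'" "src g = tgt g'"
  shows "(f \<boxtimes>\<^bsub>K\<^esub> g) \<cdot> (f' \<boxtimes>\<^bsub>K\<^esub> g') = (f \<cdot> f') \<boxtimes>\<^bsub>K\<^esub> (g \<cdot> g')"
proof (rule lmap_tensor_eqI[OF linear_map_modules(1)[OF assms(2)] linear_map_modules(1)[OF assms(4)]])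
  fix v w assume v: "v \<in> carrier (src f')" and w: "w \<in> carrier (src g')"
  have "app ((f \<cdot> f') \<boxtimes>\<^bsub>K\<^esub> (g \<cdot> g')) (pure_tensor K (src f') (src g') v w) =
    pure_tensor K (tgt f) (tgt g) (app f (app f' v)) (app g (app g' w))"
    using tensor_map_pure[OF lcomp_linear[OF assms(1,2,5)] lcomp_linear[OF assms(3,4,6)], of v w] v w
    by simp
  moreover have "app (f \<boxtimes>\<^bsub>K\<^esub> g) (pure_tensor K (tgt f') (tgt g') (app f' v) (app g' w)) =
    pure_tensor K (tgt f) (tgt g) (app f (app f' v)) (app g (app g' w))"
    using tensor_map_pure[OF assms(1,3), of "app f' v" "app g' w"] assms(5,6)
      app_closed[OF assms(2) v] app_closed[OF assms(4) w] by simp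
  ultimately show "app ((f \<boxtimes>\<^bsub>K\<^esub> g) \<cdot> (f' \<boxtimes>\<^bsub>K\<^esub> g')) (pure_tensor K (src f') (src g') v w) =
    app ((f \<cdot> f') \<boxtimes>\<^bsub>K\<^esub> (g \<cdot> g')) (pure_tensor K (src f') (src g') v w)"
    using v w assms pure_tensor_closed[OF linear_map_modules(1)[OF assms(2)] linear_map_modules(1)[OF assms(4)] v w]
    by (simp add: lmap_typing tensor_map_pure)
qed (use assms in \<open>simp_all add: lmap_typing\<close>)

lemma tensor_map_lid:
  assumes "module K V" "module K W"
  shows "lid V \<boxtimes>\<^bsub>K\<^esub> lid W = lid (tensor K V W)"
proof (rule lmap_tensor_eqI[OF assms])
  fix v w assume v: "v \<in> carrier V" and w: "w \<in> carrier W"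
  show "app (lid V \<boxtimes>\<^bsub>K\<^esub> lid W) (pure_tensor K V W v w) = app (lid (tensor K V W)) (pure_tensor K V W v w)"
    using tensor_map_pure[OF lid_linear[OF assms(1)] lid_linear[OF assms(2)], of v w] v w
      pure_tensor_closed[OF assms v w] by simp
qed (use assms in \<open>simp_all add: lmap_typing\<close>)

lemma tensor_map_bij:
  assumes "linear_map K f" "linear_map K g" "lbij f" "lbij g"
  shows tensor_map_lbij: "lbij (f \<boxtimes>\<^bsub>K\<^esub> g)"
    and tensor_map_linv: "linv (f \<boxtimes>\<^bsub>K\<^esub> g) = linv f \<boxtimes>\<^bsub>K\<^esub> linv g"
proof -
  note m = linear_map_modules[OF assms(1)] linear_map_modules[OF assms(2)]
  have 1: "(linv f \<boxtimes>\<^bsub>K\<^esub> linv g) \<cdot> (f \<boxtimes>\<^bsub>K\<^esub> g) = lid (src (f \<boxtimes>\<^bsub>K\<^esub> g))"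
    using assms m by (subst tensor_map_lcomp) (simp_all add: lmap_typing linv_lcomp tensor_map_lid)
  have 2: "(f \<boxtimes>\<^bsub>K\<^esub> g) \<cdot> (linv f \<boxtimes>\<^bsub>K\<^esub> linv g) = lid (tgt (f \<boxtimes>\<^bsub>K\<^esub> g))"
    using assms m by (subst tensor_map_lcomp) (simp_all add: lmap_typing lcomp_linv tensor_map_lid)
  show "lbij (f \<boxtimes>\<^bsub>K\<^esub> g)" "linv (f \<boxtimes>\<^bsub>K\<^esub> g) = linv f \<boxtimes>\<^bsub>K\<^esub> linv g"
    using lbijI[of K "f \<boxtimes>\<^bsub>K\<^esub> g" "linv f \<boxtimes>\<^bsub>K\<^esub> linv g", OF _ _ _ _ 1 2] assms
    by (simp_all add: lmap_typing)
qed

section \<open>Crossing one strand over two\<close>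

text \<open>
  The maps \<open>(V \<otimes> V) \<otimes> W \<rightarrow> W \<otimes> (V \<otimes> V)\<close> and \<open>V \<otimes> (W \<otimes> W) \<rightarrow> (W \<otimes> W) \<otimes> V\<close> that carry one strand over
  two. In terms of them, compatibility with a (co)multiplication and the conditions on left and right
  braided spaces all say that some map slides through a crossing, and associators disappear.
\<close>

definition cross_l where
  "cross_l K V W \<Phi> = lassoc K W V V \<cdot> (\<Phi> \<boxtimes>\<^bsub>K\<^esub> lid V) \<cdot> linv (lassoc K V W V) \<cdot>
     (lid V \<boxtimes>\<^bsub>K\<^esub> \<Phi>) \<cdot> lassoc K V V W"

definition cross_r where
  "cross_r K V W \<Phi> = linv (lassoc K W W V) \<cdot> (lid W \<boxtimes>\<^bsub>K\<^esub> \<Phi>) \<cdot> lassoc K W V W \<cdot>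
     (\<Phi> \<boxtimes>\<^bsub>K\<^esub> lid W) \<cdot> linv (lassoc K V W W)"

lemma lin_bijD:
  assumes "module K V" "module K W" "lin_bij K V W f"
  shows "linear_map K f" "src f = V" "tgt f = W" "lbij f"
  using linear_mapI[OF assms(1,2)] assms(3) by (auto simp: lin_bij_def)

lemma lin_bij_linv:
  assumes "module K V" "module K W" "lin_bij K V W f"
  shows "lin_bij K W V (linv f)"
  using lin_bijD[OF assms] assms(1,2)
  by (simp add: lin_bij_def lbij_linv linear_map_in linv_linear)

lemma lcomp_extend:
  assumes "f \<cdot> g = h" "linear_map K t" "linear_map K g" "src g = tgt t" "src f = tgt g"
  shows "f \<cdot> g \<cdot> t = h \<cdot> t"
  using lcomp_assoc[OF assms(2,4), of f] assms(1) by simp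

text \<open>
  An intertwining relation may be inverted; statements about the inverse braiding are obtained from
  those about the braiding in this way.
\<close>

lemma intertwine_linv:
  assumes "linear_map K \<Phi>" "linear_map K \<Phi>'" "linear_map K a" "linear_map K b"
    "lbij \<Phi>" "lbij \<Phi>'" "tgt a = src \<Phi>" "src b = tgt \<Phi>'" "src a = src \<Phi>'" "tgt b = tgt \<Phi>"
    and eq: "\<Phi> \<cdot> a = b \<cdot> \<Phi>'"
  shows "linv \<Phi> \<cdot> b = a \<cdot> linv \<Phi>'"
proof -
  have b: "b \<cdot> \<Phi>' \<cdot> linv \<Phi>' = \<Phi> \<cdot> a \<cdot> linv \<Phi>'"
    using lcomp_assoc[of K "linv \<Phi>'" \<Phi>' b] lcomp_assoc[of K "linv \<Phi>'" a \<Phi>] assms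
    by (simp add: linv_linear)
  have "linv \<Phi> \<cdot> b = linv \<Phi> \<cdot> b \<cdot> \<Phi>' \<cdot> linv \<Phi>'"
    using assms by (simp add: lcomp_linv lcomp_lid)
  also have "\<dots> = linv \<Phi> \<cdot> \<Phi> \<cdot> a \<cdot> linv \<Phi>'" by (simp only: b)
  also have "\<dots> = a \<cdot> linv \<Phi>'"
    using assms by (intro linv_lcomp_cancel[of K]) (simp_all add: linv_linear lcomp_linear)
  finally show ?thesis .
qed

locale crossing =
  fixes K :: "('k, 'r) ring_scheme" and V :: "('k, 'a) module" and W :: "('k, 'b) module"
    and \<Phi> :: "('k, ('a \<times> 'b \<Rightarrow> 'k) set, ('b \<times> 'a \<Rightarrow> 'k) set) lmap"
  assumes V [simp]: "module K V" and W [simp]: "module K W"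
    and bij: "lin_bij K (tensor K V W) (tensor K W V) \<Phi>"
begin

lemma \<Phi> [simp]: "linear_map K \<Phi>" "src \<Phi> = tensor K V W" "tgt \<Phi> = tensor K W V" "lbij \<Phi>"
  by (rule lin_bijD[OF tensor_module tensor_module bij], simp_all)+

lemmas typing [simp] = lmap_typing

lemma inverse: "crossing K W V (linv \<Phi>)"
  by (rule crossing.intro) (simp_all add: lin_bij_linv[OF _ _ bij])

lemma cross_l [simp]: "linear_map K (cross_l K V W \<Phi>)"
  "src (cross_l K V W \<Phi>) = tensor K (tensor K V V) W"
  "tgt (cross_l K V W \<Phi>) = tensor K W (tensor K V V)"
  "lbij (cross_l K V W \<Phi>)"
  by (simp_all add: cross_l_def lbij_lcomp[of K] lbij_linv tensor_map_lbij)

lemma cross_r [simp]: "linear_map K (cross_r K V W \<Phi>)"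
  "src (cross_r K V W \<Phi>) = tensor K V (tensor K W W)"
  "tgt (cross_r K V W \<Phi>) = tensor K (tensor K W W) V"
  "lbij (cross_r K V W \<Phi>)"
  by (simp_all add: cross_r_def lbij_lcomp[of K] lbij_linv tensor_map_lbij)

lemma linv_lcomp_bij:
  assumes "linear_map K f" "linear_map K g" "lbij f" "lbij g" "src g = tgt f"
  shows "linv (g \<cdot> f) = linv f \<cdot> linv g"
proof (rule lbijI(2)[of K])
  show "(linv f \<cdot> linv g) \<cdot> g \<cdot> f = lid (src (g \<cdot> f))"
    using assms by (simp add: lcomp_assoc[of K] linv_lcomp_cancel[of K] linv_lcomp)
  show "(g \<cdot> f) \<cdot> linv f \<cdot> linv g = lid (tgt (g \<cdot> f))"
    using assms by (simp add: lcomp_assoc[of K] lcomp_linv_cancel[of K] lcomp_linv)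
qed (use assms in simp_all)

lemma linv_lid [simp]: "module K X \<Longrightarrow> linv (lid X) = lid X"
  by (rule lbijI(2)[of K]) (simp_all add: lid_lcomp[of K])

text \<open>
  Read backwards, carrying a strand over two strands from one side is carrying it from the other side;
  so properties on the left for \<open>\<Phi>\<close> are properties on the right for \<open>\<Phi>\<^sup>-\<^sup>1\<close>.
\<close>

lemma linv_cross_l: "linv (cross_l K V W \<Phi>) = cross_r K W V (linv \<Phi>)"
  unfolding cross_l_def cross_r_def
  by (simp add: linv_lcomp_bij lbij_lcomp[of K] lbij_linv tensor_map_lbij lcomp_assoc[of K]
      tensor_map_linv linv_linv[of K])

lemma linv_cross_r: "linv (cross_r K V W \<Phi>) = cross_l K W V (linv \<Phi>)"
  unfolding cross_l_def cross_r_def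
  by (simp add: linv_lcomp_bij lbij_lcomp[of K] lbij_linv tensor_map_lbij lcomp_assoc[of K]
      tensor_map_linv linv_linv[of K])

end

lemma lcomp_tensor_left:
  assumes "module K W" "linear_map K f" "linear_map K g" "src f = tgt g"
  shows "(f \<cdot> g) \<boxtimes>\<^bsub>K\<^esub> lid W = (f \<boxtimes>\<^bsub>K\<^esub> lid W) \<cdot> (g \<boxtimes>\<^bsub>K\<^esub> lid W)"
  using assms by (simp add: tensor_map_lcomp lid_linear lid_lcomp[of K])

lemma lcomp_tensor_right:
  assumes "module K W" "linear_map K f" "linear_map K g" "src f = tgt g"
  shows "lid W \<boxtimes>\<^bsub>K\<^esub> (f \<cdot> g) = (lid W \<boxtimes>\<^bsub>K\<^esub> f) \<cdot> (lid W \<boxtimes>\<^bsub>K\<^esub> g)"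
  using assms by (simp add: tensor_map_lcomp lid_linear lid_lcomp[of K])

context crossing
begin

text \<open>
  The map \<open>e(t) = (id \<otimes> m) (\<Phi> \<otimes> id) (u \<otimes> t)\<close> satisfies \<open>e \<Phi> = \<Phi>\<close>, by compatibility and \<open>u x = x\<close>. As \<open>\<Phi>\<close> is
  surjective, \<open>e\<close> is the identity, while \<open>e(w \<otimes> u) = \<Phi>(u \<otimes> w)\<close> because \<open>x u = x\<close>. This provides the
  clause on units in the compatibility of a twisted product, whose units need not be known in advance
  to be units of the original product.
\<close>

lemma unit_left:
  assumes m [simp]: "linear_map K m" "src m = tensor K V V" "tgt m = V"
    and eq: "\<Phi> \<cdot> (m \<boxtimes>\<^bsub>K\<^esub> lid W) = (lid W \<boxtimes>\<^bsub>K\<^esub> m) \<cdot> cross_l K V W \<Phi>"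
    and u: "is_unit K V m u" and w: "w \<in> carrier W"
  shows "app \<Phi> (pure_tensor K V W u w) = pure_tensor K W V w u"
proof -
  have uV [simp]: "u \<in> carrier V" using u by (simp add: is_unit_def)
  note pc [simp] = pure_tensor_closed
  define f where "f = (lid W \<boxtimes>\<^bsub>K\<^esub> m) \<cdot> lassoc K W V V \<cdot> (\<Phi> \<boxtimes>\<^bsub>K\<^esub> lid V) \<cdot> linv (lassoc K V W V)"
  have f: "linear_map K f" "src f = tensor K V (tensor K W V)" "tgt f = tensor K W V"
    by (simp_all add: f_def)
  \<comment> \<open>\<open>f\<close> is what remains of the right-hand side of \<open>eq\<close> when the first use of \<open>\<Phi>\<close> is split off.\<close>
  define e where "e t = app f (pure_tensor K V (tensor K W V) u t)" for t
  have e: "linear_fun K (tensor K W V) (tensor K W V) e"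
    unfolding e_def
    by (rule linear_fun_comp[OF linear_map_linear[OF f(1), unfolded f] pure_tensor_linear_right]) simp_all
  have pt: "app (lid V \<boxtimes>\<^bsub>K\<^esub> \<Phi>) (pure_tensor K V (tensor K V W) x t) =
    pure_tensor K V (tensor K W V) x (app \<Phi> t)" if "x \<in> carrier V" "t \<in> carrier (tensor K V W)" for x t
    using tensor_map_pure[of K "lid V" \<Phi> x t] that by simp
  have pm: "app (m \<boxtimes>\<^bsub>K\<^esub> lid W) (pure_tensor K (tensor K V V) W t y) =
    pure_tensor K V W (app m t) y" if "y \<in> carrier W" "t \<in> carrier (tensor K V V)" for y t
    using tensor_map_pure[of K m "lid W" t y] that by simp
  have e\<Phi>: "e (app \<Phi> t) = app \<Phi> t" if t: "t \<in> carrier (tensor K V W)" for t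
  proof (rule tensor_ext[OF V W tensor_module[OF W V] _ _ _ t])
    show "linear_fun K (tensor K V W) (tensor K W V) (app \<Phi>)"
      using linear_map_linear[OF \<Phi>(1)] by simp
    from linear_fun_comp[OF e this]
    show "linear_fun K (tensor K V W) (tensor K W V) (\<lambda>t. e (app \<Phi> t))" .
    fix x y assume x: "x \<in> carrier V" and y: "y \<in> carrier W"
    let ?t = "pure_tensor K (tensor K V V) W (pure_tensor K V V u x) y"
    have "app (\<Phi> \<cdot> (m \<boxtimes>\<^bsub>K\<^esub> lid W)) ?t = app \<Phi> (pure_tensor K V W x y)"
      using x y u by (simp add: pm) (simp add: is_unit_def)
    moreover have "(lid W \<boxtimes>\<^bsub>K\<^esub> m) \<cdot> cross_l K V W \<Phi> = f \<cdot> (lid V \<boxtimes>\<^bsub>K\<^esub> \<Phi>) \<cdot> lassoc K V V W"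
      unfolding f_def cross_l_def by (simp add: lcomp_assoc[of K])
    moreover have "app (f \<cdot> (lid V \<boxtimes>\<^bsub>K\<^esub> \<Phi>) \<cdot> lassoc K V V W) ?t = e (app \<Phi> (pure_tensor K V W x y))"
      using x y by (simp add: lassoc_pure pt e_def)
    ultimately show "e (app \<Phi> (pure_tensor K V W x y)) = app \<Phi> (pure_tensor K V W x y)"
      using eq by simp
  qed
  have e_id: "e t = t" if "t \<in> carrier (tensor K W V)" for t
    using e\<Phi>[of "app (linv \<Phi>) t"] app_linv_app[OF \<Phi>(4)] linv_app_closed[OF \<Phi>(4)] that by simp
  have mu: "app ((lid W \<boxtimes>\<^bsub>K\<^esub> m) \<cdot> lassoc K W V V) (pure_tensor K (tensor K W V) V s u) = s"
    if s: "s \<in> carrier (tensor K W V)" for s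
  proof (rule tensor_ext[OF W V tensor_module[OF W V] _ linear_fun_id[OF tensor_module[OF W V]] _ s])
    have "linear_map K ((lid W \<boxtimes>\<^bsub>K\<^esub> m) \<cdot> lassoc K W V V)" by simp
    from linear_fun_comp[OF linear_map_linear[OF this] , of "tensor K W V" "\<lambda>s. pure_tensor K (tensor K W V) V s u"]
    show "linear_fun K (tensor K W V) (tensor K W V)
      (\<lambda>s. app ((lid W \<boxtimes>\<^bsub>K\<^esub> m) \<cdot> lassoc K W V V) (pure_tensor K (tensor K W V) V s u))"
      using pure_tensor_linear_left[of K "tensor K W V" V u] by simp
    fix x y assume x: "x \<in> carrier W" and y: "y \<in> carrier V"
    show "app ((lid W \<boxtimes>\<^bsub>K\<^esub> m) \<cdot> lassoc K W V V) (pure_tensor K (tensor K W V) V (pure_tensor K W V x y) u) =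
      pure_tensor K W V x y"
      using x y u tensor_map_pure[of K "lid W" m x "pure_tensor K V V y u"]
      by (simp add: lassoc_pure is_unit_def)
  qed
  have li: "app (linv (lassoc K V W V)) (pure_tensor K V (tensor K W V) u (pure_tensor K W V w u)) =
    pure_tensor K (tensor K V W) V (pure_tensor K V W u w) u"
    using linv_app_app[OF lassoc_lbij[of K V W V], of "pure_tensor K (tensor K V W) V (pure_tensor K V W u w) u"] w
    by (simp add: lassoc_pure)
  have "pure_tensor K W V w u = e (pure_tensor K W V w u)" using w by (simp add: e_id)
  also have "\<dots> = app ((lid W \<boxtimes>\<^bsub>K\<^esub> m) \<cdot> lassoc K W V V)
      (pure_tensor K (tensor K W V) V (app \<Phi> (pure_tensor K V W u w)) u)"
    using w tensor_map_pure[of K \<Phi> "lid V" "pure_tensor K V W u w" u] app_closed[OF \<Phi>(1), of "pure_tensor K V W u w"]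
    by (simp add: e_def f_def li)
  also have "\<dots> = app \<Phi> (pure_tensor K V W u w)"
    using mu app_closed[OF \<Phi>(1), of "pure_tensor K V W u w"] w by simp
  finally show ?thesis by simp
qed

lemma unit_right:
  assumes m [simp]: "linear_map K m" "src m = tensor K W W" "tgt m = W"
    and eq: "\<Phi> \<cdot> (lid V \<boxtimes>\<^bsub>K\<^esub> m) = (m \<boxtimes>\<^bsub>K\<^esub> lid V) \<cdot> cross_r K V W \<Phi>"
    and u: "is_unit K W m u" and v: "v \<in> carrier V"
  shows "app \<Phi> (pure_tensor K V W v u) = pure_tensor K W V u v"
proof -
  interpret I: crossing K W V "linv \<Phi>" by (rule inverse)
  have "linv \<Phi> \<cdot> (m \<boxtimes>\<^bsub>K\<^esub> lid V) = (lid V \<boxtimes>\<^bsub>K\<^esub> m) \<cdot> cross_l K W V (linv \<Phi>)"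
    unfolding linv_cross_r[symmetric] by (rule intertwine_linv[of K, OF _ _ _ _ _ _ _ _ _ _ eq]) simp_all
  from I.unit_left[OF m this u v]
  have "app \<Phi> (pure_tensor K V W v u) = app \<Phi> (app (linv \<Phi>) (pure_tensor K W V u v))" by simp
  also have "\<dots> = pure_tensor K W V u v"
    using v u by (intro app_linv_app) (simp_all add: pure_tensor_closed is_unit_def)
  finally show ?thesis .
qed

lemma mult_compat_l_iff:
  assumes "linear_map K m" "src m = tensor K V V" "tgt m = V"
  shows "mult_compat_l K V W m \<Phi> \<longleftrightarrow> \<Phi> \<cdot> (m \<boxtimes>\<^bsub>K\<^esub> lid W) = (lid W \<boxtimes>\<^bsub>K\<^esub> m) \<cdot> cross_l K V W \<Phi>"
  unfolding mult_compat_l_def cross_l_def[symmetric] using unit_left[OF assms] by blast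

lemma mult_compat_r_iff:
  assumes "linear_map K m" "src m = tensor K W W" "tgt m = W"
  shows "mult_compat_r K V W m \<Phi> \<longleftrightarrow> \<Phi> \<cdot> (lid V \<boxtimes>\<^bsub>K\<^esub> m) = (m \<boxtimes>\<^bsub>K\<^esub> lid V) \<cdot> cross_r K V W \<Phi>"
  unfolding mult_compat_r_def cross_r_def[symmetric] using unit_right[OF assms] by blast

lemma comult_compat_l_iff:
  assumes "linear_map K \<Delta>" "src \<Delta> = V" "tgt \<Delta> = tensor K V V"
  shows "comult_compat_l K V W \<Delta> \<epsilon> \<Phi> \<longleftrightarrow>
    (lid W \<boxtimes>\<^bsub>K\<^esub> \<Delta>) \<cdot> \<Phi> = cross_l K V W \<Phi> \<cdot> (\<Delta> \<boxtimes>\<^bsub>K\<^esub> lid W) \<and>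
    lunit_r K W \<cdot> (lid W \<boxtimes>\<^bsub>K\<^esub> \<epsilon>) \<cdot> \<Phi> = lunit_l K W \<cdot> (\<epsilon> \<boxtimes>\<^bsub>K\<^esub> lid W)"
  using assms by (simp add: comult_compat_l_def cross_l_def lcomp_assoc[of K])

lemma comult_compat_r_iff:
  assumes "linear_map K \<Delta>" "src \<Delta> = W" "tgt \<Delta> = tensor K W W"
  shows "comult_compat_r K V W \<Delta> \<epsilon> \<Phi> \<longleftrightarrow>
    (\<Delta> \<boxtimes>\<^bsub>K\<^esub> lid V) \<cdot> \<Phi> = cross_r K V W \<Phi> \<cdot> (lid V \<boxtimes>\<^bsub>K\<^esub> \<Delta>) \<and>
    lunit_l K V \<cdot> (\<epsilon> \<boxtimes>\<^bsub>K\<^esub> lid V) \<cdot> \<Phi> = lunit_r K V \<cdot> (lid V \<boxtimes>\<^bsub>K\<^esub> \<epsilon>)"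
  using assms by (simp add: comult_compat_r_def cross_r_def lcomp_assoc[of K])

end

text \<open>
  Moving the outer associator across the defining equation turns it into naturality of the crossing.
\<close>

lemma left_braided_space_iff:
  assumes Psi: "braided_space K V \<Psi>"
  shows "left_braided_space K V \<Psi> W \<Phi> \<longleftrightarrow> crossing K V W \<Phi> \<and>
    cross_l K V W \<Phi> \<cdot> (\<Psi> \<boxtimes>\<^bsub>K\<^esub> lid W) = (lid W \<boxtimes>\<^bsub>K\<^esub> \<Psi>) \<cdot> cross_l K V W \<Phi>"
proof (cases "crossing K V W \<Phi>")
  case True
  then interpret crossing K V W \<Phi> .
  have [simp]: "linear_map K \<Psi>" "src \<Psi> = tensor K V V" "tgt \<Psi> = tensor K V V" "lbij \<Psi>"
    using lin_bijD[OF tensor_module tensor_module, of K V V V V \<Psi>] Psi by (simp_all add: braided_space_def)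
  let ?X = "(\<Phi> \<boxtimes>\<^bsub>K\<^esub> lid V) \<cdot> linv (lassoc K V W V) \<cdot> (lid V \<boxtimes>\<^bsub>K\<^esub> \<Phi>) \<cdot> lassoc K V V W"
  let ?a = "lassoc K W V V"
  have c: "cross_l K V W \<Phi> = ?a \<cdot> ?X" by (simp add: cross_l_def)
  have 1: "linv ?a \<cdot> cross_l K V W \<Phi> \<cdot> (\<Psi> \<boxtimes>\<^bsub>K\<^esub> lid W) = ?X \<cdot> (\<Psi> \<boxtimes>\<^bsub>K\<^esub> lid W)"
    unfolding c by (simp add: lcomp_assoc[of K] linv_lcomp_cancel[of K])
  have "cross_l K V W \<Phi> \<cdot> (\<Psi> \<boxtimes>\<^bsub>K\<^esub> lid W) = (lid W \<boxtimes>\<^bsub>K\<^esub> \<Psi>) \<cdot> cross_l K V W \<Phi> \<longleftrightarrow>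
    ?X \<cdot> (\<Psi> \<boxtimes>\<^bsub>K\<^esub> lid W) = linv ?a \<cdot> (lid W \<boxtimes>\<^bsub>K\<^esub> \<Psi>) \<cdot> ?a \<cdot> ?X"
    unfolding 1[symmetric] c[symmetric]
    using lcomp_left_cancel[of K "linv ?a" "cross_l K V W \<Phi> \<cdot> (\<Psi> \<boxtimes>\<^bsub>K\<^esub> lid W)"
        "(lid W \<boxtimes>\<^bsub>K\<^esub> \<Psi>) \<cdot> cross_l K V W \<Phi>"] by (auto simp: lbij_linv)
  thus ?thesis using True bij
    by (simp add: left_braided_space_def Psi lcomp_assoc[of K])
next
  case False
  thus ?thesis using Psi by (auto simp: left_braided_space_def crossing_def braided_space_def)
qed

lemma right_braided_space_iff:
  assumes Psi: "braided_space K W \<Psi>"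
  shows "right_braided_space K W \<Psi> V \<Phi> \<longleftrightarrow> crossing K V W \<Phi> \<and>
    cross_r K V W \<Phi> \<cdot> (lid V \<boxtimes>\<^bsub>K\<^esub> \<Psi>) = (\<Psi> \<boxtimes>\<^bsub>K\<^esub> lid V) \<cdot> cross_r K V W \<Phi>"
proof (cases "crossing K V W \<Phi>")
  case True
  then interpret crossing K V W \<Phi> .
  have [simp]: "linear_map K \<Psi>" "src \<Psi> = tensor K W W" "tgt \<Psi> = tensor K W W" "lbij \<Psi>"
    using lin_bijD[OF tensor_module tensor_module, of K W W W W \<Psi>] Psi by (simp_all add: braided_space_def)
  let ?X = "(lid W \<boxtimes>\<^bsub>K\<^esub> \<Phi>) \<cdot> lassoc K W V W \<cdot> (\<Phi> \<boxtimes>\<^bsub>K\<^esub> lid W) \<cdot> linv (lassoc K V W W)"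
  let ?a = "lassoc K W W V"
  have c: "cross_r K V W \<Phi> = linv ?a \<cdot> ?X" by (simp add: cross_r_def)
  have 1: "?a \<cdot> cross_r K V W \<Phi> \<cdot> (lid V \<boxtimes>\<^bsub>K\<^esub> \<Psi>) = ?X \<cdot> (lid V \<boxtimes>\<^bsub>K\<^esub> \<Psi>)"
    unfolding c by (simp add: lcomp_assoc[of K] lcomp_linv_cancel[of K])
  have "cross_r K V W \<Phi> \<cdot> (lid V \<boxtimes>\<^bsub>K\<^esub> \<Psi>) = (\<Psi> \<boxtimes>\<^bsub>K\<^esub> lid V) \<cdot> cross_r K V W \<Phi> \<longleftrightarrow>
    ?X \<cdot> (lid V \<boxtimes>\<^bsub>K\<^esub> \<Psi>) = ?a \<cdot> (\<Psi> \<boxtimes>\<^bsub>K\<^esub> lid V) \<cdot> linv ?a \<cdot> ?X"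
    unfolding 1[symmetric] c[symmetric]
    using lcomp_left_cancel[of K ?a "cross_r K V W \<Phi> \<cdot> (lid V \<boxtimes>\<^bsub>K\<^esub> \<Psi>)"
        "(\<Psi> \<boxtimes>\<^bsub>K\<^esub> lid V) \<cdot> cross_r K V W \<Phi>"] by auto
  thus ?thesis using True bij
    by (simp add: right_braided_space_def Psi lcomp_assoc[of K])
next
  case False
  thus ?thesis using Psi by (auto simp: right_braided_space_def crossing_def braided_space_def)
qed

section \<open>Twisting products and coproducts by powers of the braiding\<close>

context crossing
begin

text \<open>
  A map that slides through the crossing may be composed with a product or coproduct that does.
\<close>

lemma mult_compat_l_twist:
  assumes m: "linear_map K m" "src m = tensor K V V" "tgt m = V"
    and f: "linear_map K f" "src f = tensor K V V" "tgt f = tensor K V V"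
    and nat: "cross_l K V W \<Phi> \<cdot> (f \<boxtimes>\<^bsub>K\<^esub> lid W) = (lid W \<boxtimes>\<^bsub>K\<^esub> f) \<cdot> cross_l K V W \<Phi>"
    and compat: "mult_compat_l K V W m \<Phi>"
  shows "mult_compat_l K V W (m \<cdot> f) \<Phi>"
proof -
  note [simp] = m f
  have "\<Phi> \<cdot> ((m \<cdot> f) \<boxtimes>\<^bsub>K\<^esub> lid W) = \<Phi> \<cdot> (m \<boxtimes>\<^bsub>K\<^esub> lid W) \<cdot> (f \<boxtimes>\<^bsub>K\<^esub> lid W)"
    by (simp add: lcomp_tensor_left)
  also have "\<dots> = ((lid W \<boxtimes>\<^bsub>K\<^esub> m) \<cdot> cross_l K V W \<Phi>) \<cdot> (f \<boxtimes>\<^bsub>K\<^esub> lid W)"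
    using compat[unfolded mult_compat_l_iff[OF m]] by (rule lcomp_extend[where K = K]) simp_all
  also have "\<dots> = (lid W \<boxtimes>\<^bsub>K\<^esub> m) \<cdot> (lid W \<boxtimes>\<^bsub>K\<^esub> f) \<cdot> cross_l K V W \<Phi>"
    by (simp add: lcomp_assoc[of K] nat)
  also have "\<dots> = (lid W \<boxtimes>\<^bsub>K\<^esub> (m \<cdot> f)) \<cdot> cross_l K V W \<Phi>"
    by (simp add: lcomp_assoc[of K] lcomp_tensor_right)
  finally show ?thesis by (simp add: mult_compat_l_iff)
qed

lemma mult_compat_r_twist:
  assumes m: "linear_map K m" "src m = tensor K W W" "tgt m = W"
    and f: "linear_map K f" "src f = tensor K W W" "tgt f = tensor K W W"
    and nat: "cross_r K V W \<Phi> \<cdot> (lid V \<boxtimes>\<^bsub>K\<^esub> f) = (f \<boxtimes>\<^bsub>K\<^esub> lid V) \<cdot> cross_r K V W \<Phi>"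
    and compat: "mult_compat_r K V W m \<Phi>"
  shows "mult_compat_r K V W (m \<cdot> f) \<Phi>"
proof -
  note [simp] = m f
  have "\<Phi> \<cdot> (lid V \<boxtimes>\<^bsub>K\<^esub> (m \<cdot> f)) = \<Phi> \<cdot> (lid V \<boxtimes>\<^bsub>K\<^esub> m) \<cdot> (lid V \<boxtimes>\<^bsub>K\<^esub> f)"
    by (simp add: lcomp_tensor_right)
  also have "\<dots> = ((m \<boxtimes>\<^bsub>K\<^esub> lid V) \<cdot> cross_r K V W \<Phi>) \<cdot> (lid V \<boxtimes>\<^bsub>K\<^esub> f)"
    using compat[unfolded mult_compat_r_iff[OF m]] by (rule lcomp_extend[where K = K]) simp_all
  also have "\<dots> = (m \<boxtimes>\<^bsub>K\<^esub> lid V) \<cdot> (f \<boxtimes>\<^bsub>K\<^esub> lid V) \<cdot> cross_r K V W \<Phi>"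
    by (simp add: lcomp_assoc[of K] nat)
  also have "\<dots> = ((m \<cdot> f) \<boxtimes>\<^bsub>K\<^esub> lid V) \<cdot> cross_r K V W \<Phi>"
    by (simp add: lcomp_assoc[of K] lcomp_tensor_left)
  finally show ?thesis by (simp add: mult_compat_r_iff)
qed

lemma comult_compat_l_twist:
  assumes d: "linear_map K \<Delta>" "src \<Delta> = V" "tgt \<Delta> = tensor K V V"
    and f: "linear_map K f" "src f = tensor K V V" "tgt f = tensor K V V"
    and nat: "cross_l K V W \<Phi> \<cdot> (f \<boxtimes>\<^bsub>K\<^esub> lid W) = (lid W \<boxtimes>\<^bsub>K\<^esub> f) \<cdot> cross_l K V W \<Phi>"
    and compat: "comult_compat_l K V W \<Delta> \<epsilon> \<Phi>"
  shows "comult_compat_l K V W (f \<cdot> \<Delta>) \<epsilon> \<Phi>"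
proof -
  note [simp] = d f
  note C = compat[unfolded comult_compat_l_iff[OF d]]
  have "(lid W \<boxtimes>\<^bsub>K\<^esub> (f \<cdot> \<Delta>)) \<cdot> \<Phi> = (lid W \<boxtimes>\<^bsub>K\<^esub> f) \<cdot> cross_l K V W \<Phi> \<cdot> (\<Delta> \<boxtimes>\<^bsub>K\<^esub> lid W)"
    using C by (simp add: lcomp_tensor_right lcomp_assoc[of K])
  also have "\<dots> = (cross_l K V W \<Phi> \<cdot> (f \<boxtimes>\<^bsub>K\<^esub> lid W)) \<cdot> (\<Delta> \<boxtimes>\<^bsub>K\<^esub> lid W)"
    using nat[symmetric] by (rule lcomp_extend[where K = K]) simp_all
  also have "\<dots> = cross_l K V W \<Phi> \<cdot> ((f \<cdot> \<Delta>) \<boxtimes>\<^bsub>K\<^esub> lid W)"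
    by (simp add: lcomp_assoc[of K] lcomp_tensor_left)
  finally show ?thesis using C by (simp add: comult_compat_l_iff)
qed

lemma comult_compat_r_twist:
  assumes d: "linear_map K \<Delta>" "src \<Delta> = W" "tgt \<Delta> = tensor K W W"
    and f: "linear_map K f" "src f = tensor K W W" "tgt f = tensor K W W"
    and nat: "cross_r K V W \<Phi> \<cdot> (lid V \<boxtimes>\<^bsub>K\<^esub> f) = (f \<boxtimes>\<^bsub>K\<^esub> lid V) \<cdot> cross_r K V W \<Phi>"
    and compat: "comult_compat_r K V W \<Delta> \<epsilon> \<Phi>"
  shows "comult_compat_r K V W (f \<cdot> \<Delta>) \<epsilon> \<Phi>"
proof -
  note [simp] = d f
  note C = compat[unfolded comult_compat_r_iff[OF d]]
  have "((f \<cdot> \<Delta>) \<boxtimes>\<^bsub>K\<^esub> lid V) \<cdot> \<Phi> = (f \<boxtimes>\<^bsub>K\<^esub> lid V) \<cdot> cross_r K V W \<Phi> \<cdot> (lid V \<boxtimes>\<^bsub>K\<^esub> \<Delta>)"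
    using C by (simp add: lcomp_tensor_left lcomp_assoc[of K])
  also have "\<dots> = (cross_r K V W \<Phi> \<cdot> (lid V \<boxtimes>\<^bsub>K\<^esub> f)) \<cdot> (lid V \<boxtimes>\<^bsub>K\<^esub> \<Delta>)"
    using nat[symmetric] by (rule lcomp_extend[where K = K]) simp_all
  also have "\<dots> = cross_r K V W \<Phi> \<cdot> (lid V \<boxtimes>\<^bsub>K\<^esub> (f \<cdot> \<Delta>))"
    by (simp add: lcomp_assoc[of K] lcomp_tensor_right)
  finally show ?thesis using C by (simp add: comult_compat_r_iff)
qed

lemma mult_compat_l_inverse:
  assumes m: "linear_map K m" "src m = tensor K V V" "tgt m = V"
    and "mult_compat_l K V W m \<Phi>"
  shows "mult_compat_r K W V m (linv \<Phi>)"
proof -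
  interpret I: crossing K W V "linv \<Phi>" by (rule inverse)
  have "linv \<Phi> \<cdot> (lid W \<boxtimes>\<^bsub>K\<^esub> m) = (m \<boxtimes>\<^bsub>K\<^esub> lid W) \<cdot> cross_r K W V (linv \<Phi>)"
    unfolding linv_cross_l[symmetric]
    by (rule intertwine_linv[of K, OF _ _ _ _ _ _ _ _ _ _ assms(4)[unfolded mult_compat_l_iff[OF m]]])
      (simp_all add: m)
  thus ?thesis by (simp add: I.mult_compat_r_iff m)
qed

lemma mult_compat_r_inverse:
  assumes m: "linear_map K m" "src m = tensor K W W" "tgt m = W"
    and "mult_compat_r K V W m \<Phi>"
  shows "mult_compat_l K W V m (linv \<Phi>)"
proof -
  interpret I: crossing K W V "linv \<Phi>" by (rule inverse)
  have "linv \<Phi> \<cdot> (m \<boxtimes>\<^bsub>K\<^esub> lid V) = (lid V \<boxtimes>\<^bsub>K\<^esub> m) \<cdot> cross_l K W V (linv \<Phi>)"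
    unfolding linv_cross_r[symmetric]
    by (rule intertwine_linv[of K, OF _ _ _ _ _ _ _ _ _ _ assms(4)[unfolded mult_compat_r_iff[OF m]]])
      (simp_all add: m)
  thus ?thesis by (simp add: I.mult_compat_l_iff m)
qed

lemma comp_linv_eq:
  assumes "a \<cdot> \<Phi> = b" "linear_map K a" "src a = tensor K W V"
  shows "b \<cdot> linv \<Phi> = a"
  using assms by (simp add: assms(1)[symmetric] lcomp_assoc[of K] lcomp_linv[of K] lcomp_lid[of K])

lemma comult_compat_l_inverse:
  assumes d: "linear_map K \<Delta>" "src \<Delta> = V" "tgt \<Delta> = tensor K V V"
    and e: "linear_map K \<epsilon>" "src \<epsilon> = V" "tgt \<epsilon> = ground_module K"
    and compat: "comult_compat_l K V W \<Delta> \<epsilon> \<Phi>"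
  shows "comult_compat_r K W V \<Delta> \<epsilon> (linv \<Phi>)"
proof -
  interpret I: crossing K W V "linv \<Phi>" by (rule inverse)
  note C = compat[unfolded comult_compat_l_iff[OF d]]
  have "(\<Delta> \<boxtimes>\<^bsub>K\<^esub> lid W) \<cdot> linv \<Phi> = cross_r K W V (linv \<Phi>) \<cdot> (lid W \<boxtimes>\<^bsub>K\<^esub> \<Delta>)"
    unfolding linv_cross_l[symmetric]
    by (rule intertwine_linv[of K, OF _ _ _ _ _ _ _ _ _ _ conjunct1[OF C, symmetric], symmetric])
      (simp_all add: d)
  moreover have "(lunit_l K W \<cdot> (\<epsilon> \<boxtimes>\<^bsub>K\<^esub> lid W)) \<cdot> linv \<Phi> = lunit_r K W \<cdot> (lid W \<boxtimes>\<^bsub>K\<^esub> \<epsilon>)"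
    by (rule comp_linv_eq) (use C in \<open>simp_all add: e lcomp_assoc[of K] lunit_r_linear lunit_r_src\<close>)
  ultimately show ?thesis by (simp add: I.comult_compat_r_iff d e lcomp_assoc[of K])
qed

lemma comult_compat_r_inverse:
  assumes d: "linear_map K \<Delta>" "src \<Delta> = W" "tgt \<Delta> = tensor K W W"
    and e: "linear_map K \<epsilon>" "src \<epsilon> = W" "tgt \<epsilon> = ground_module K"
    and compat: "comult_compat_r K V W \<Delta> \<epsilon> \<Phi>"
  shows "comult_compat_l K W V \<Delta> \<epsilon> (linv \<Phi>)"
proof -
  interpret I: crossing K W V "linv \<Phi>" by (rule inverse)
  note C = compat[unfolded comult_compat_r_iff[OF d]]
  have "(lid V \<boxtimes>\<^bsub>K\<^esub> \<Delta>) \<cdot> linv \<Phi> = cross_l K W V (linv \<Phi>) \<cdot> (\<Delta> \<boxtimes>\<^bsub>K\<^esub> lid V)"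
    unfolding linv_cross_r[symmetric]
    by (rule intertwine_linv[of K, OF _ _ _ _ _ _ _ _ _ _ conjunct1[OF C, symmetric], symmetric])
      (simp_all add: d)
  moreover have "(lunit_r K V \<cdot> (lid V \<boxtimes>\<^bsub>K\<^esub> \<epsilon>)) \<cdot> linv \<Phi> = lunit_l K V \<cdot> (\<epsilon> \<boxtimes>\<^bsub>K\<^esub> lid V)"
    by (rule comp_linv_eq) (use C in \<open>simp_all add: e lcomp_assoc[of K] lunit_l_linear lunit_l_src\<close>)
  ultimately show ?thesis by (simp add: I.comult_compat_l_iff d e lcomp_assoc[of K])
qed

end

section \<open>Braided vector spaces\<close>

lemma braided_space_crossing:
  "braided_space K H \<Psi> \<Longrightarrow> crossing K H H \<Psi>"
  by (rule crossing.intro) (simp_all add: braided_space_def)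

text \<open>
  The braid equation says that the braiding slides through a crossing of one strand over two, that is,
  H is a left (and, by the next lemma, a right) H-braided space by its own braiding.
\<close>

lemma braided_space_iff_left:
  assumes "crossing K H H \<Psi>"
  shows "braided_space K H \<Psi> \<longleftrightarrow>
    cross_l K H H \<Psi> \<cdot> (\<Psi> \<boxtimes>\<^bsub>K\<^esub> lid H) = (lid H \<boxtimes>\<^bsub>K\<^esub> \<Psi>) \<cdot> cross_l K H H \<Psi>"
proof -
  interpret crossing K H H \<Psi> by fact
  let ?a = "lassoc K H H H"
  let ?X = "\<Psi> \<boxtimes>\<^bsub>K\<^esub> lid H" and ?Y = "linv ?a \<cdot> (lid H \<boxtimes>\<^bsub>K\<^esub> \<Psi>) \<cdot> ?a"
  have "?a \<cdot> ?X \<cdot> ?Y \<cdot> ?X = cross_l K H H \<Psi> \<cdot> ?X"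
    by (simp add: cross_l_def lcomp_assoc[of K])
  moreover have "?a \<cdot> ?Y \<cdot> ?X \<cdot> ?Y = (lid H \<boxtimes>\<^bsub>K\<^esub> \<Psi>) \<cdot> cross_l K H H \<Psi>"
    by (simp add: cross_l_def lcomp_assoc[of K] lcomp_linv_cancel[of K])
  moreover have "?X \<cdot> ?Y \<cdot> ?X = ?Y \<cdot> ?X \<cdot> ?Y \<longleftrightarrow> ?a \<cdot> ?X \<cdot> ?Y \<cdot> ?X = ?a \<cdot> ?Y \<cdot> ?X \<cdot> ?Y"
    using lcomp_left_cancel[of K ?a "?X \<cdot> ?Y \<cdot> ?X" "?Y \<cdot> ?X \<cdot> ?Y"] by auto
  ultimately show ?thesis using bij by (simp add: braided_space_def Let_def)
qed

lemma braided_space_iff_right: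
  assumes "crossing K H H \<Psi>"
  shows "braided_space K H \<Psi> \<longleftrightarrow>
    cross_r K H H \<Psi> \<cdot> (lid H \<boxtimes>\<^bsub>K\<^esub> \<Psi>) = (\<Psi> \<boxtimes>\<^bsub>K\<^esub> lid H) \<cdot> cross_r K H H \<Psi>"
proof -
  interpret crossing K H H \<Psi> by fact
  let ?a = "lassoc K H H H"
  let ?X = "\<Psi> \<boxtimes>\<^bsub>K\<^esub> lid H" and ?Y = "linv ?a \<cdot> (lid H \<boxtimes>\<^bsub>K\<^esub> \<Psi>) \<cdot> ?a"
  have 1: "(?X \<cdot> ?Y \<cdot> ?X) \<cdot> linv ?a = ?X \<cdot> cross_r K H H \<Psi>"
    by (simp add: cross_r_def lcomp_assoc[of K])
  have 2: "(?Y \<cdot> ?X \<cdot> ?Y) \<cdot> linv ?a = cross_r K H H \<Psi> \<cdot> (lid H \<boxtimes>\<^bsub>K\<^esub> \<Psi>)"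
    by (simp add: cross_r_def lcomp_assoc[of K] lcomp_linv[of K] lcomp_lid[of K])
  have "?X \<cdot> ?Y \<cdot> ?X = ?Y \<cdot> ?X \<cdot> ?Y \<longleftrightarrow> (?X \<cdot> ?Y \<cdot> ?X) \<cdot> linv ?a = (?Y \<cdot> ?X \<cdot> ?Y) \<cdot> linv ?a"
    using lcomp_right_cancel[of K "linv ?a" "?X \<cdot> ?Y \<cdot> ?X" "?Y \<cdot> ?X \<cdot> ?Y"] by (auto simp: lbij_linv)
  thus ?thesis unfolding 1 2 using bij by (auto simp: braided_space_def Let_def)
qed

text \<open>
  Inverting both sides of the braid equation exchanges its two crossings.
\<close>

lemma braided_space_linv:
  assumes "braided_space K H \<Psi>"
  shows "braided_space K H (linv \<Psi>)"
proof -
  interpret crossing K H H \<Psi> by (rule braided_space_crossing) fact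
  interpret I: crossing K H H "linv \<Psi>" by (rule inverse)
  have "linv (cross_l K H H \<Psi> \<cdot> (\<Psi> \<boxtimes>\<^bsub>K\<^esub> lid H)) = linv ((lid H \<boxtimes>\<^bsub>K\<^esub> \<Psi>) \<cdot> cross_l K H H \<Psi>)"
    using assms by (simp add: braided_space_iff_left[OF crossing_axioms])
  hence "cross_r K H H (linv \<Psi>) \<cdot> (lid H \<boxtimes>\<^bsub>K\<^esub> linv \<Psi>) = (linv \<Psi> \<boxtimes>\<^bsub>K\<^esub> lid H) \<cdot> cross_r K H H (linv \<Psi>)"
    by (simp add: linv_lcomp_bij tensor_map_lbij tensor_map_linv linv_cross_l)
  thus ?thesis by (simp add: braided_space_iff_right[OF I.crossing_axioms])
qed

section \<open>Integer powers of an automorphism\<close>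

context
  fixes K :: "('k, 'r) ring_scheme" and f :: "('k, 'a, 'a) lmap"
  assumes f [simp]: "linear_map K f" "tgt f = src f" "lbij f"
begin

lemma linear_map_funpow_lcomp:
  assumes "linear_map K g" "src g = V" "tgt g = V" "linear_map K h" "src h = V" "tgt h = V"
  shows "linear_map K ((lcomp g ^^ n) h) \<and> src ((lcomp g ^^ n) h) = V \<and> tgt ((lcomp g ^^ n) h) = V"
  by (induction n) (use assms in \<open>simp_all add: lcomp_linear\<close>)

lemma lpow_typing [simp]:
  "linear_map K (lpow f k)" "src (lpow f k) = src f" "tgt (lpow f k) = src f"
  using linear_map_funpow_lcomp[of f "src f" "lid (src f)"]
    linear_map_funpow_lcomp[of "linv f" "src f" "lid (src f)"]
  by (simp_all add: lpow_def linv_linear lid_linear linear_map_modules)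

lemma lpow_0: "lpow f 0 = lid (src f)"
  by (simp add: lpow_def)

lemma lpow_add1: "lpow f (k + 1) = f \<cdot> lpow f k"
proof (cases "k \<ge> 0")
  case True
  hence "nat (k + 1) = Suc (nat k)" by simp
  thus ?thesis using True by (simp add: lpow_def)
next
  case False
  define n where "n = nat (- k - 1)"
  have k: "k = - int n - 1" using False by (simp add: n_def)
  have "nat (- k) = Suc n" by (simp add: k)
  hence "lpow f k = linv f \<cdot> (lcomp (linv f) ^^ n) (lid (src f))" using False by (simp add: lpow_def)
  moreover have "lpow f (k + 1) = (lcomp (linv f) ^^ n) (lid (src f))"
    by (cases n) (simp_all add: k lpow_def nat_add_distrib)
  moreover have "f \<cdot> linv f \<cdot> lpow f (k + 1) = lpow f (k + 1)"
    by (rule lcomp_linv_cancel[of K]) simp_all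
  ultimately show ?thesis by simp
qed

lemma lpow_diff1: "lpow f (k - 1) = linv f \<cdot> lpow f k"
  using lpow_add1[of "k - 1"] linv_lcomp_cancel[of K f "lpow f (k - 1)"] by simp

lemma lpow_induct [case_names id comp inv]:
  assumes "P (lid (src f))"
    and "\<And>g. linear_map K g \<Longrightarrow> src g = src f \<Longrightarrow> tgt g = src f \<Longrightarrow> P g \<Longrightarrow> P (f \<cdot> g)"
    and "\<And>g. linear_map K g \<Longrightarrow> src g = src f \<Longrightarrow> tgt g = src f \<Longrightarrow> P g \<Longrightarrow> P (linv f \<cdot> g)"
  shows "P (lpow f k)"
proof (induction k rule: int_induct[of _ 0])
  case base
  show ?case by (simp add: lpow_0 assms(1))
next
  case (step1 i)
  thus ?case using assms(2)[of "lpow f i"] by (simp add: lpow_add1)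
next
  case (step2 i)
  thus ?case using assms(3)[of "lpow f i"] by (simp add: lpow_diff1)
qed

lemma lpow_commute: "f \<cdot> lpow f k = lpow f k \<cdot> f"
proof (induction rule: lpow_induct)
  case id
  show ?case by (simp add: lcomp_lid[of K] lid_lcomp[of K])
next
  case (comp g)
  show ?case by (subst comp(4)) (simp add: comp(1-3) lcomp_assoc[of K])
next
  case (inv g)
  have "f \<cdot> linv f \<cdot> g = linv f \<cdot> f \<cdot> g"
    using inv(1-3) by (simp add: lcomp_linv_cancel[of K] linv_lcomp_cancel[of K])
  also have "\<dots> = (linv f \<cdot> g) \<cdot> f"
    by (simp add: inv(1-3) inv(4)[symmetric] lcomp_assoc[of K])
  finally show ?case .
qed

lemma lpow_commute_linv: "linv f \<cdot> lpow f k = lpow f k \<cdot> linv f"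
  by (rule intertwine_linv[of K]) (simp_all add: lpow_commute)

end

text \<open>
  Maps that slide through the crossing are closed under composition and inversion.
\<close>

lemma cross_l_lpow:
  assumes c: "crossing K V W \<Phi>" and b: "braided_space K V \<Psi>"
    and eq: "cross_l K V W \<Phi> \<cdot> (\<Psi> \<boxtimes>\<^bsub>K\<^esub> lid W) = (lid W \<boxtimes>\<^bsub>K\<^esub> \<Psi>) \<cdot> cross_l K V W \<Phi>"
  shows "cross_l K V W \<Phi> \<cdot> (lpow \<Psi> k \<boxtimes>\<^bsub>K\<^esub> lid W) = (lid W \<boxtimes>\<^bsub>K\<^esub> lpow \<Psi> k) \<cdot> cross_l K V W \<Phi>"
proof -
  interpret crossing K V W \<Phi> by fact
  interpret P: crossing K V V \<Psi> by (rule braided_space_crossing) fact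
  let ?C = "cross_l K V W \<Phi>"
  have step: "?C \<cdot> ((h \<cdot> g) \<boxtimes>\<^bsub>K\<^esub> lid W) = (lid W \<boxtimes>\<^bsub>K\<^esub> (h \<cdot> g)) \<cdot> ?C"
    if [simp]: "linear_map K g" "src g = tensor K V V" "tgt g = tensor K V V"
      "linear_map K h" "src h = tensor K V V" "tgt h = tensor K V V"
    and g: "?C \<cdot> (g \<boxtimes>\<^bsub>K\<^esub> lid W) = (lid W \<boxtimes>\<^bsub>K\<^esub> g) \<cdot> ?C"
    and h: "?C \<cdot> (h \<boxtimes>\<^bsub>K\<^esub> lid W) = (lid W \<boxtimes>\<^bsub>K\<^esub> h) \<cdot> ?C" for g h
  proof -
    have "?C \<cdot> ((h \<cdot> g) \<boxtimes>\<^bsub>K\<^esub> lid W) = ?C \<cdot> (h \<boxtimes>\<^bsub>K\<^esub> lid W) \<cdot> (g \<boxtimes>\<^bsub>K\<^esub> lid W)"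
      by (simp add: lcomp_tensor_left)
    also have "\<dots> = ((lid W \<boxtimes>\<^bsub>K\<^esub> h) \<cdot> ?C) \<cdot> (g \<boxtimes>\<^bsub>K\<^esub> lid W)"
      using h by (rule lcomp_extend[where K = K]) simp_all
    also have "\<dots> = (lid W \<boxtimes>\<^bsub>K\<^esub> (h \<cdot> g)) \<cdot> ?C"
      by (simp add: lcomp_assoc[of K] lcomp_tensor_right g)
    finally show ?thesis .
  qed
  have inv: "?C \<cdot> (linv \<Psi> \<boxtimes>\<^bsub>K\<^esub> lid W) = (lid W \<boxtimes>\<^bsub>K\<^esub> linv \<Psi>) \<cdot> ?C"
    using intertwine_linv[of K "lid W \<boxtimes>\<^bsub>K\<^esub> \<Psi>" "\<Psi> \<boxtimes>\<^bsub>K\<^esub> lid W" ?C ?C, OF _ _ _ _ _ _ _ _ _ _ eq[symmetric]]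
    by (simp add: tensor_map_lbij tensor_map_linv)
  have "src \<Psi> = tensor K V V" by simp
  show ?thesis
  proof (rule lpow_induct[of K \<Psi>])
    show "?C \<cdot> (lid (src \<Psi>) \<boxtimes>\<^bsub>K\<^esub> lid W) = (lid W \<boxtimes>\<^bsub>K\<^esub> lid (src \<Psi>)) \<cdot> ?C"
      by (simp add: tensor_map_lid lid_lcomp[of K] lcomp_lid[of K])
  qed (use step eq inv in simp_all)
qed

lemma cross_r_lpow:
  assumes c: "crossing K V W \<Phi>" and b: "braided_space K W \<Psi>"
    and eq: "cross_r K V W \<Phi> \<cdot> (lid V \<boxtimes>\<^bsub>K\<^esub> \<Psi>) = (\<Psi> \<boxtimes>\<^bsub>K\<^esub> lid V) \<cdot> cross_r K V W \<Phi>"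
  shows "cross_r K V W \<Phi> \<cdot> (lid V \<boxtimes>\<^bsub>K\<^esub> lpow \<Psi> k) = (lpow \<Psi> k \<boxtimes>\<^bsub>K\<^esub> lid V) \<cdot> cross_r K V W \<Phi>"
proof -
  interpret crossing K V W \<Phi> by fact
  interpret P: crossing K W W \<Psi> by (rule braided_space_crossing) fact
  interpret I: crossing K W V "linv \<Phi>" by (rule inverse)
  note swap = intertwine_linv[of K "cross_r K V W \<Phi>" "cross_r K V W \<Phi>"]
  have "cross_l K W V (linv \<Phi>) \<cdot> (\<Psi> \<boxtimes>\<^bsub>K\<^esub> lid V) = (lid V \<boxtimes>\<^bsub>K\<^esub> \<Psi>) \<cdot> cross_l K W V (linv \<Phi>)"
    unfolding linv_cross_r[symmetric] by (rule swap[OF _ _ _ _ _ _ _ _ _ _ eq]) simp_all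
  from cross_l_lpow[OF I.crossing_axioms b this, of k]
  have *: "(lid V \<boxtimes>\<^bsub>K\<^esub> lpow \<Psi> k) \<cdot> linv (cross_r K V W \<Phi>) = linv (cross_r K V W \<Phi>) \<cdot> (lpow \<Psi> k \<boxtimes>\<^bsub>K\<^esub> lid V)"
    unfolding linv_cross_r by simp
  have t: "linear_map K (lpow \<Psi> k)" "src (lpow \<Psi> k) = tensor K W W" "tgt (lpow \<Psi> k) = tensor K W W"
    using lpow_typing[of K \<Psi> k] by simp_all
  show ?thesis
    using intertwine_linv[of K "linv (cross_r K V W \<Phi>)" "linv (cross_r K V W \<Phi>)"
      "lpow \<Psi> k \<boxtimes>\<^bsub>K\<^esub> lid V" "lid V \<boxtimes>\<^bsub>K\<^esub> lpow \<Psi> k", OF _ _ _ _ _ _ _ _ _ _ *[symmetric]]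
    by (simp add: t lbij_linv linv_linv[of K])
qed

section \<open>Braided algebras and coalgebras under twisting\<close>

lemma braided_algebra_iff:
  assumes "braided_space K H \<Psi>"
  shows "braided_algebra K H m \<Psi> \<longleftrightarrow>
    linear_map K m \<and> src m = tensor K H H \<and> tgt m = H \<and>
    m \<cdot> (m \<boxtimes>\<^bsub>K\<^esub> lid H) = m \<cdot> (lid H \<boxtimes>\<^bsub>K\<^esub> m) \<cdot> lassoc K H H H \<and>
    mult_compat_l K H H m \<Psi> \<and> mult_compat_r K H H m \<Psi>"
  using assms linear_mapI[OF tensor_module, of K H H H m] linear_map_in[of K m "tensor K H H" H]
  by (auto simp: braided_algebra_def assoc_algebra_def braided_space_def)

lemma braided_coalgebra_iff:
  assumes "braided_space K H \<Psi>"
  shows "braided_coalgebra K H \<Delta> \<epsilon> \<Psi> \<longleftrightarrow>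
    linear_map K \<Delta> \<and> src \<Delta> = H \<and> tgt \<Delta> = tensor K H H \<and>
    linear_map K \<epsilon> \<and> src \<epsilon> = H \<and> tgt \<epsilon> = ground_module K \<and>
    lassoc K H H H \<cdot> (\<Delta> \<boxtimes>\<^bsub>K\<^esub> lid H) \<cdot> \<Delta> = (lid H \<boxtimes>\<^bsub>K\<^esub> \<Delta>) \<cdot> \<Delta> \<and>
    lunit_l K H \<cdot> (\<epsilon> \<boxtimes>\<^bsub>K\<^esub> lid H) \<cdot> \<Delta> = lid H \<and>
    lunit_r K H \<cdot> (lid H \<boxtimes>\<^bsub>K\<^esub> \<epsilon>) \<cdot> \<Delta> = lid H \<and>
    comult_compat_l K H H \<Delta> \<epsilon> \<Psi> \<and> comult_compat_r K H H \<Delta> \<epsilon> \<Psi>"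
proof -
  have H: "module K H" using assms by (simp add: braided_space_def)
  have G: "module K (ground_module K)"
    by (rule ground_module_module) (use H in \<open>simp add: module_def\<close>)
  show ?thesis
    using assms H linear_mapI[OF H tensor_module[OF H H], of \<Delta>] linear_map_in[of K \<Delta> H "tensor K H H"]
      linear_mapI[OF H G, of \<epsilon>] linear_map_in[of K \<epsilon> H "ground_module K"]
    by (auto simp: braided_coalgebra_def coalgebra_def)
qed

text \<open>
  Inversion exchanges compatibility from the left and from the right.
\<close>

lemma braided_algebra_linv:
  assumes "braided_algebra K H m \<Psi>"
  shows "braided_algebra K H m (linv \<Psi>)"
proof -
  have b: "braided_space K H \<Psi>" using assms by (simp add: braided_algebra_def)
  interpret crossing K H H \<Psi> by (rule braided_space_crossing[OF b])
  show ?thesis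
    using assms mult_compat_l_inverse mult_compat_r_inverse
    by (simp add: braided_algebra_iff[OF b] braided_algebra_iff[OF braided_space_linv[OF b]])
qed

lemma braided_coalgebra_linv:
  assumes "braided_coalgebra K H \<Delta> \<epsilon> \<Psi>"
  shows "braided_coalgebra K H \<Delta> \<epsilon> (linv \<Psi>)"
proof -
  have b: "braided_space K H \<Psi>" using assms by (simp add: braided_coalgebra_def)
  interpret crossing K H H \<Psi> by (rule braided_space_crossing[OF b])
  show ?thesis
    using assms comult_compat_l_inverse comult_compat_r_inverse
    by (simp add: braided_coalgebra_iff[OF b] braided_coalgebra_iff[OF braided_space_linv[OF b]])
qed

text \<open>
  With \<open>X\<close>, \<open>Y\<close> the braiding on the first and last two factors, compatibility moves \<open>\<Psi>\<close> to the right
  of both bracketings of \<open>m \<Psi>\<close>, which become \<open>m (id \<otimes> m) X Y X\<close> and \<open>m (m \<otimes> id) Y X Y\<close>.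
\<close>

lemma braided_algebra_twist:
  assumes "braided_algebra K H m \<Psi>"
  shows "braided_algebra K H (m \<cdot> \<Psi>) \<Psi>"
proof -
  have b: "braided_space K H \<Psi>" using assms by (simp add: braided_algebra_def)
  interpret crossing K H H \<Psi> by (rule braided_space_crossing[OF b])
  note bl = b[unfolded braided_space_iff_left[OF crossing_axioms]]
  note br = b[unfolded braided_space_iff_right[OF crossing_axioms]]
  have m [simp]: "linear_map K m" "src m = tensor K H H" "tgt m = H"
    and ass: "m \<cdot> (m \<boxtimes>\<^bsub>K\<^esub> lid H) = m \<cdot> (lid H \<boxtimes>\<^bsub>K\<^esub> m) \<cdot> lassoc K H H H"
    and cl: "mult_compat_l K H H m \<Psi>" and cr: "mult_compat_r K H H m \<Psi>"
    using assms by (simp_all add: braided_algebra_iff[OF b])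
  note Cl = cl[unfolded mult_compat_l_iff[OF m]] and Cr = cr[unfolded mult_compat_r_iff[OF m]]
  let ?a = "lassoc K H H H"
  let ?X = "\<Psi> \<boxtimes>\<^bsub>K\<^esub> lid H" and ?Z = "lid H \<boxtimes>\<^bsub>K\<^esub> \<Psi>"
  let ?L = "cross_l K H H \<Psi>" and ?R = "cross_r K H H \<Psi>"
  have "(m \<cdot> \<Psi>) \<cdot> ((m \<cdot> \<Psi>) \<boxtimes>\<^bsub>K\<^esub> lid H) = m \<cdot> (\<Psi> \<cdot> (m \<boxtimes>\<^bsub>K\<^esub> lid H)) \<cdot> ?X"
    by (simp add: lcomp_assoc[of K] lcomp_tensor_left)
  also have "\<dots> = m \<cdot> (lid H \<boxtimes>\<^bsub>K\<^esub> m) \<cdot> ?L \<cdot> ?X"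
    by (simp add: Cl lcomp_assoc[of K])
  also have "?L \<cdot> ?X = ?a \<cdot> ?R \<cdot> ?Z \<cdot> ?a"
    unfolding bl by (simp add: cross_l_def cross_r_def lcomp_assoc[of K] lcomp_linv_cancel[of K])
  also have "m \<cdot> (lid H \<boxtimes>\<^bsub>K\<^esub> m) \<cdot> ?a \<cdot> ?R \<cdot> ?Z \<cdot> ?a = (m \<cdot> (lid H \<boxtimes>\<^bsub>K\<^esub> m) \<cdot> ?a) \<cdot> ?R \<cdot> ?Z \<cdot> ?a"
    by (simp add: lcomp_assoc[of K])
  also have "\<dots> = m \<cdot> ((m \<boxtimes>\<^bsub>K\<^esub> lid H) \<cdot> ?R) \<cdot> ?Z \<cdot> ?a"
    unfolding ass[symmetric] by (simp add: lcomp_assoc[of K])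
  also have "\<dots> = (m \<cdot> \<Psi>) \<cdot> (lid H \<boxtimes>\<^bsub>K\<^esub> (m \<cdot> \<Psi>)) \<cdot> ?a"
    unfolding Cr[symmetric] by (simp add: lcomp_assoc[of K] lcomp_tensor_right)
  finally show ?thesis
    using mult_compat_l_twist[OF m _ _ _ bl cl] mult_compat_r_twist[OF m _ _ _ br cr]
    by (simp add: braided_algebra_iff[OF b])
qed

text \<open>
  The mirror image of the argument for algebras; counitality holds because \<open>\<epsilon>\<close> on one factor composed
  with \<open>\<Psi>\<close> is \<open>\<epsilon>\<close> on the other factor.
\<close>

lemma braided_coalgebra_twist:
  assumes "braided_coalgebra K H \<Delta> \<epsilon> \<Psi>"
  shows "braided_coalgebra K H (\<Psi> \<cdot> \<Delta>) \<epsilon> \<Psi>"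
proof -
  have b: "braided_space K H \<Psi>" using assms by (simp add: braided_coalgebra_def)
  interpret crossing K H H \<Psi> by (rule braided_space_crossing[OF b])
  note bl = b[unfolded braided_space_iff_left[OF crossing_axioms]]
  note br = b[unfolded braided_space_iff_right[OF crossing_axioms]]
  have d [simp]: "linear_map K \<Delta>" "src \<Delta> = H" "tgt \<Delta> = tensor K H H"
    and e [simp]: "linear_map K \<epsilon>" "src \<epsilon> = H" "tgt \<epsilon> = ground_module K"
    and ass: "lassoc K H H H \<cdot> (\<Delta> \<boxtimes>\<^bsub>K\<^esub> lid H) \<cdot> \<Delta> = (lid H \<boxtimes>\<^bsub>K\<^esub> \<Delta>) \<cdot> \<Delta>"
    and el: "lunit_l K H \<cdot> (\<epsilon> \<boxtimes>\<^bsub>K\<^esub> lid H) \<cdot> \<Delta> = lid H"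
    and er: "lunit_r K H \<cdot> (lid H \<boxtimes>\<^bsub>K\<^esub> \<epsilon>) \<cdot> \<Delta> = lid H"
    and cl: "comult_compat_l K H H \<Delta> \<epsilon> \<Psi>" and cr: "comult_compat_r K H H \<Delta> \<epsilon> \<Psi>"
    using assms by (simp_all add: braided_coalgebra_iff[OF b])
  note Cl = cl[unfolded comult_compat_l_iff[OF d]] and Cr = cr[unfolded comult_compat_r_iff[OF d]]
  let ?a = "lassoc K H H H"
  let ?X = "\<Psi> \<boxtimes>\<^bsub>K\<^esub> lid H" and ?Z = "lid H \<boxtimes>\<^bsub>K\<^esub> \<Psi>"
  let ?L = "cross_l K H H \<Psi>" and ?R = "cross_r K H H \<Psi>"
  have "?a \<cdot> ((\<Psi> \<cdot> \<Delta>) \<boxtimes>\<^bsub>K\<^esub> lid H) \<cdot> \<Psi> \<cdot> \<Delta> = ?a \<cdot> ?X \<cdot> ((\<Delta> \<boxtimes>\<^bsub>K\<^esub> lid H) \<cdot> \<Psi>) \<cdot> \<Delta>"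
    by (simp add: lcomp_assoc[of K] lcomp_tensor_left)
  also have "\<dots> = ?a \<cdot> ?X \<cdot> ?R \<cdot> ((lid H \<boxtimes>\<^bsub>K\<^esub> \<Delta>) \<cdot> \<Delta>)"
    by (simp add: Cr lcomp_assoc[of K])
  also have "\<dots> = (?a \<cdot> ?X \<cdot> ?R \<cdot> ?a) \<cdot> (\<Delta> \<boxtimes>\<^bsub>K\<^esub> lid H) \<cdot> \<Delta>"
    unfolding ass[symmetric] by (simp add: lcomp_assoc[of K])
  also have "?a \<cdot> ?X \<cdot> ?R \<cdot> ?a = ?L \<cdot> ?X"
    by (simp add: cross_l_def cross_r_def lcomp_assoc[of K] linv_lcomp[of K] lcomp_lid[of K])
  also have "(?L \<cdot> ?X) \<cdot> (\<Delta> \<boxtimes>\<^bsub>K\<^esub> lid H) \<cdot> \<Delta> = ?Z \<cdot> (?L \<cdot> (\<Delta> \<boxtimes>\<^bsub>K\<^esub> lid H)) \<cdot> \<Delta>"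
    unfolding bl by (simp add: lcomp_assoc[of K])
  also have "\<dots> = (lid H \<boxtimes>\<^bsub>K\<^esub> (\<Psi> \<cdot> \<Delta>)) \<cdot> \<Psi> \<cdot> \<Delta>"
    unfolding conjunct1[OF Cl, symmetric] by (simp add: lcomp_assoc[of K] lcomp_tensor_right)
  finally have 1: "?a \<cdot> ((\<Psi> \<cdot> \<Delta>) \<boxtimes>\<^bsub>K\<^esub> lid H) \<cdot> \<Psi> \<cdot> \<Delta> = (lid H \<boxtimes>\<^bsub>K\<^esub> (\<Psi> \<cdot> \<Delta>)) \<cdot> \<Psi> \<cdot> \<Delta>" .
  have "lunit_l K H \<cdot> (\<epsilon> \<boxtimes>\<^bsub>K\<^esub> lid H) \<cdot> \<Psi> \<cdot> \<Delta> = (lunit_l K H \<cdot> (\<epsilon> \<boxtimes>\<^bsub>K\<^esub> lid H) \<cdot> \<Psi>) \<cdot> \<Delta>"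
    by (simp add: lcomp_assoc[of K])
  also have "\<dots> = lid H" using Cr er by (simp add: lcomp_assoc[of K])
  finally have 2: "lunit_l K H \<cdot> (\<epsilon> \<boxtimes>\<^bsub>K\<^esub> lid H) \<cdot> \<Psi> \<cdot> \<Delta> = lid H" .
  have "lunit_r K H \<cdot> (lid H \<boxtimes>\<^bsub>K\<^esub> \<epsilon>) \<cdot> \<Psi> \<cdot> \<Delta> = (lunit_r K H \<cdot> (lid H \<boxtimes>\<^bsub>K\<^esub> \<epsilon>) \<cdot> \<Psi>) \<cdot> \<Delta>"
    by (simp add: lcomp_assoc[of K])
  also have "\<dots> = lid H" using Cl el by (simp add: lcomp_assoc[of K])
  finally have 3: "lunit_r K H \<cdot> (lid H \<boxtimes>\<^bsub>K\<^esub> \<epsilon>) \<cdot> \<Psi> \<cdot> \<Delta> = lid H" .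
  show ?thesis
    using comult_compat_l_twist[OF d _ _ _ bl cl] comult_compat_r_twist[OF d _ _ _ br cr] 1 2 3
    by (simp add: braided_coalgebra_iff[OF b])
qed

text \<open>
  Precomposing with the inverse braiding is a positive twist for the inverse braiding.
\<close>

lemma braided_algebra_untwist:
  assumes "braided_algebra K H m \<Psi>"
  shows "braided_algebra K H (m \<cdot> linv \<Psi>) (linv \<Psi>)"
  by (rule braided_algebra_twist[OF braided_algebra_linv[OF assms]])

lemma braided_coalgebra_untwist:
  assumes "braided_coalgebra K H \<Delta> \<epsilon> \<Psi>"
  shows "braided_coalgebra K H (linv \<Psi> \<cdot> \<Delta>) \<epsilon> (linv \<Psi>)"
  by (rule braided_coalgebra_twist[OF braided_coalgebra_linv[OF assms]])

lemma is_unit_twist: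
  assumes "braided_algebra K H m \<Psi>" "is_unit K H m u"
  shows "is_unit K H (m \<cdot> \<Psi>) u"
proof -
  have b: "braided_space K H \<Psi>" using assms by (simp add: braided_algebra_def)
  interpret crossing K H H \<Psi> by (rule braided_space_crossing[OF b])
  have "mult_compat_l K H H m \<Psi>" "mult_compat_r K H H m \<Psi>"
    using assms by (simp_all add: braided_algebra_def)
  thus ?thesis using assms(2) pure_tensor_closed[OF V V]
    by (auto simp: is_unit_def mult_compat_l_def mult_compat_r_def)
qed

lemma braided_algebra_twisted_mult:
  assumes "braided_algebra K H m \<Psi>"
  shows "braided_algebra K H (twisted_mult \<Psi> m k) \<Psi>"
    and "is_unit K H m u \<Longrightarrow> is_unit K H (twisted_mult \<Psi> m k) u"
proof -
  have b: "braided_space K H \<Psi>" using assms by (simp add: braided_algebra_def)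
  interpret crossing K H H \<Psi> by (rule braided_space_crossing[OF b])
  have P: "linear_map K \<Psi>" "tgt \<Psi> = src \<Psi>" "lbij \<Psi>" by simp_all
  have m [simp]: "linear_map K m" "src m = tensor K H H" "tgt m = H"
    using assms by (simp_all add: braided_algebra_iff[OF b])
  have "braided_algebra K H (twisted_mult \<Psi> m k) \<Psi> \<and>
    (is_unit K H m u \<longrightarrow> is_unit K H (twisted_mult \<Psi> m k) u)"
  proof (induction k rule: int_induct[of _ 0])
    case base
    show ?case using assms by (simp add: twisted_mult_def lpow_0[OF P] lcomp_lid[of K])
  next
    case (step1 i)
    have "twisted_mult \<Psi> m (i + 1) = twisted_mult \<Psi> m i \<cdot> \<Psi>"
      by (simp add: twisted_mult_def lpow_add1[OF P] lpow_commute[OF P] lcomp_assoc[of K] lpow_typing[OF P])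
    thus ?case using step1 braided_algebra_twist is_unit_twist by metis
  next
    case (step2 i)
    have "twisted_mult \<Psi> m (i - 1) = twisted_mult \<Psi> m i \<cdot> linv \<Psi>"
      by (simp add: twisted_mult_def lpow_diff1[OF P] lpow_commute_linv[OF P] lcomp_assoc[of K] lpow_typing[OF P])
    thus ?case using step2 braided_algebra_untwist is_unit_twist braided_algebra_linv linv_linv[OF \<Phi>(1,4)]
      by metis
  qed
  thus "braided_algebra K H (twisted_mult \<Psi> m k) \<Psi>"
    "is_unit K H m u \<Longrightarrow> is_unit K H (twisted_mult \<Psi> m k) u" by simp_all
qed

lemma braided_coalgebra_twisted_comult:
  assumes "braided_coalgebra K H \<Delta> \<epsilon> \<Psi>"
  shows "braided_coalgebra K H (twisted_comult \<Psi> \<Delta> n) \<epsilon> \<Psi>"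
proof -
  have b: "braided_space K H \<Psi>" using assms by (simp add: braided_coalgebra_def)
  interpret crossing K H H \<Psi> by (rule braided_space_crossing[OF b])
  have P: "linear_map K \<Psi>" "tgt \<Psi> = src \<Psi>" "lbij \<Psi>" by simp_all
  have d [simp]: "linear_map K \<Delta>" "src \<Delta> = H" "tgt \<Delta> = tensor K H H"
    using assms by (simp_all add: braided_coalgebra_iff[OF b])
  show ?thesis
  proof (induction n rule: int_induct[of _ 0])
    case base
    show ?case using assms by (simp add: twisted_comult_def lpow_0[OF P] lid_lcomp[of K])
  next
    case (step1 i)
    have "twisted_comult \<Psi> \<Delta> (i + 1) = \<Psi> \<cdot> twisted_comult \<Psi> \<Delta> i"
      by (simp add: twisted_comult_def lpow_add1[OF P] lcomp_assoc[of K] lpow_typing[OF P])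
    thus ?case using step1 braided_coalgebra_twist by metis
  next
    case (step2 i)
    have "twisted_comult \<Psi> \<Delta> (i - 1) = linv \<Psi> \<cdot> twisted_comult \<Psi> \<Delta> i"
      by (simp add: twisted_comult_def lpow_diff1[OF P] lcomp_assoc[of K] lpow_typing[OF P])
    thus ?case using step2 braided_coalgebra_untwist braided_coalgebra_linv linv_linv[OF \<Phi>(1,4)]
      by metis
  qed
qed

lemma twisted_mult_compat_l:
  assumes alg: "braided_algebra K H m \<Psi>" and l: "left_braided_space K H \<Psi> V \<Phi>"
    and compat: "mult_compat_l K H V m \<Phi>"
  shows "mult_compat_l K H V (twisted_mult \<Psi> m k) \<Phi>"
proof -
  have b: "braided_space K H \<Psi>" using alg by (simp add: braided_algebra_def)
  interpret P: crossing K H H \<Psi> by (rule braided_space_crossing[OF b])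
  interpret crossing K H V \<Phi> using l by (simp add: left_braided_space_iff[OF b])
  have P: "linear_map K \<Psi>" "tgt \<Psi> = src \<Psi>" "lbij \<Psi>" by simp_all
  show ?thesis unfolding twisted_mult_def
    by (rule mult_compat_l_twist[OF _ _ _ _ _ _ cross_l_lpow[OF crossing_axioms b] compat])
      (use alg l in \<open>simp_all add: braided_algebra_iff[OF b] left_braided_space_iff[OF b] lpow_typing[OF P]\<close>)
qed

lemma twisted_mult_compat_r:
  assumes alg: "braided_algebra K H m \<Psi>" and r: "right_braided_space K H \<Psi> V \<Phi>"
    and compat: "mult_compat_r K V H m \<Phi>"
  shows "mult_compat_r K V H (twisted_mult \<Psi> m k) \<Phi>"
proof -
  have b: "braided_space K H \<Psi>" using alg by (simp add: braided_algebra_def)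
  interpret P: crossing K H H \<Psi> by (rule braided_space_crossing[OF b])
  interpret crossing K V H \<Phi> using r by (simp add: right_braided_space_iff[OF b])
  have P: "linear_map K \<Psi>" "tgt \<Psi> = src \<Psi>" "lbij \<Psi>" by simp_all
  show ?thesis unfolding twisted_mult_def
    by (rule mult_compat_r_twist[OF _ _ _ _ _ _ cross_r_lpow[OF crossing_axioms b] compat])
      (use alg r in \<open>simp_all add: braided_algebra_iff[OF b] right_braided_space_iff[OF b] lpow_typing[OF P]\<close>)
qed

lemma twisted_comult_compat_l:
  assumes coalg: "braided_coalgebra K H \<Delta> \<epsilon> \<Psi>" and l: "left_braided_space K H \<Psi> V \<Phi>"
    and compat: "comult_compat_l K H V \<Delta> \<epsilon> \<Phi>"
  shows "comult_compat_l K H V (twisted_comult \<Psi> \<Delta> n) \<epsilon> \<Phi>"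
proof -
  have b: "braided_space K H \<Psi>" using coalg by (simp add: braided_coalgebra_def)
  interpret P: crossing K H H \<Psi> by (rule braided_space_crossing[OF b])
  interpret crossing K H V \<Phi> using l by (simp add: left_braided_space_iff[OF b])
  have P: "linear_map K \<Psi>" "tgt \<Psi> = src \<Psi>" "lbij \<Psi>" by simp_all
  show ?thesis unfolding twisted_comult_def
    by (rule comult_compat_l_twist[OF _ _ _ _ _ _ cross_l_lpow[OF crossing_axioms b] compat])
      (use coalg l in \<open>simp_all add: braided_coalgebra_iff[OF b] left_braided_space_iff[OF b] lpow_typing[OF P]\<close>)
qed

lemma twisted_comult_compat_r:
  assumes coalg: "braided_coalgebra K H \<Delta> \<epsilon> \<Psi>" and r: "right_braided_space K H \<Psi> V \<Phi>"
    and compat: "comult_compat_r K V H \<Delta> \<epsilon> \<Phi>"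
  shows "comult_compat_r K V H (twisted_comult \<Psi> \<Delta> n) \<epsilon> \<Phi>"
proof -
  have b: "braided_space K H \<Psi>" using coalg by (simp add: braided_coalgebra_def)
  interpret P: crossing K H H \<Psi> by (rule braided_space_crossing[OF b])
  interpret crossing K V H \<Phi> using r by (simp add: right_braided_space_iff[OF b])
  have P: "linear_map K \<Psi>" "tgt \<Psi> = src \<Psi>" "lbij \<Psi>" by simp_all
  show ?thesis unfolding twisted_comult_def
    by (rule comult_compat_r_twist[OF _ _ _ _ _ _ cross_r_lpow[OF crossing_axioms b] compat])
      (use coalg r in \<open>simp_all add: braided_coalgebra_iff[OF b] right_braided_space_iff[OF b] lpow_typing[OF P]\<close>)
qed

section \<open>Strand operators on multilinear forms\<close>

definition words :: "('k, 'h) module \<Rightarrow> nat \<Rightarrow> 'h list set" where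
  "words H n = {xs. length xs = n \<and> set xs \<subseteq> carrier H}"

text \<open>
  Multilinear forms vanish off the words of length n, so that they are determined as functions by
  their values on words.
\<close>

definition forms :: "('k, 'r) ring_scheme \<Rightarrow> ('k, 'h) module \<Rightarrow> ('k, 'x) module \<Rightarrow> nat \<Rightarrow> ('h list \<Rightarrow> 'x) set" where
  "forms K H X n = {\<phi>. (\<forall>xs. xs \<notin> words H n \<longrightarrow> \<phi> xs = \<zero>\<^bsub>X\<^esub>) \<and> (\<forall>xs\<in>words H n. \<phi> xs \<in> carrier X) \<and>
     (\<forall>xs\<in>words H n. \<forall>j<n. linear_fun K H X (\<lambda>x. \<phi> (xs[j := x])))}"

definition lincomb :: "('k, 'x) module \<Rightarrow> ('k \<times> 'w) list \<Rightarrow> ('w \<Rightarrow> 'x) \<Rightarrow> 'x" where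
  "lincomb X cs \<phi> = foldr (\<lambda>(c, w) s. (c \<odot>\<^bsub>X\<^esub> \<phi> w) \<oplus>\<^bsub>X\<^esub> s) cs \<zero>\<^bsub>X\<^esub>"

text \<open>
  The value of \<open>f\<close> at a word of length \<open>a\<close> is a formal linear combination of words; the operator
  replaces the arguments from position \<open>i\<close> on by this combination. Operators compose contravariantly:
  in \<open>strand \<dots> i (strand \<dots> j \<phi>)\<close> the outer one is applied to the arguments first, so that nested
  operators are read like a string diagram from top to bottom.
\<close>

definition strand ::
  "('k, 'h) module \<Rightarrow> ('k, 'x) module \<Rightarrow> nat \<Rightarrow> ('h list \<Rightarrow> ('k \<times> 'h list) list) \<Rightarrow> nat \<Rightarrow>
   ('h list \<Rightarrow> 'x) \<Rightarrow> 'h list \<Rightarrow> 'x" where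
  "strand H X a f i \<phi> xs = (if set xs \<subseteq> carrier H \<and> i + a \<le> length xs
     then lincomb X (f (take a (drop i xs))) (\<lambda>w. \<phi> (take i xs @ w @ drop (i + a) xs)) else \<zero>\<^bsub>X\<^esub>)"

lemma lincomb_simps [simp]: "lincomb X [] \<phi> = \<zero>\<^bsub>X\<^esub>"
  "lincomb X ((c, w) # cs) \<phi> = (c \<odot>\<^bsub>X\<^esub> \<phi> w) \<oplus>\<^bsub>X\<^esub> lincomb X cs \<phi>"
  by (simp_all add: lincomb_def)

lemma lincomb_cong:
  "(\<And>c w. (c, w) \<in> set cs \<Longrightarrow> \<phi> w = \<psi> w) \<Longrightarrow> lincomb X cs \<phi> = lincomb X cs \<psi>"
proof (induction cs)
  case (Cons a cs)
  obtain c w where a: "a = (c, w)" by force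
  have "lincomb X cs \<phi> = lincomb X cs \<psi>" by (rule Cons.IH) (use Cons.prems in auto)
  thus ?case using Cons.prems[of c w] by (simp add: a)
qed simp

lemma wordsI [intro]: "length xs = n \<Longrightarrow> set xs \<subseteq> carrier H \<Longrightarrow> xs \<in> words H n"
  by (simp add: words_def)

lemma words_split:
  assumes "xs \<in> words H (i + k + r)"
  obtains p us s where "xs = p @ us @ s" "p \<in> words H i" "us \<in> words H k" "s \<in> words H r"
proof
  show "xs = take i xs @ take k (drop i xs) @ drop (i + k) xs"
    by (metis append_take_drop_id drop_drop add.commute)
  show "take i xs \<in> words H i" "take k (drop i xs) \<in> words H k" "drop (i + k) xs \<in> words H r"
    using assms set_take_subset[of i xs] set_drop_subset[of i xs] set_take_subset[of k "drop i xs"]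
      set_drop_subset[of "i + k" xs]
    by (auto simp: words_def)
qed

locale forms_space =
  fixes K :: "('k, 'r) ring_scheme" and H :: "('k, 'h) module" and X :: "('k, 'x) module"
  assumes H: "module K H" and X: "module K X"
begin

sublocale H: module K H by (rule H)
sublocale X: module K X by (rule X)

abbreviation "F \<equiv> forms K H X"
abbreviation "W \<equiv> words H"

lemma lincomb_closed:
  "(\<And>c w. (c, w) \<in> set cs \<Longrightarrow> c \<in> carrier K \<and> \<phi> w \<in> carrier X) \<Longrightarrow> lincomb X cs \<phi> \<in> carrier X"
proof (induction cs)
  case (Cons a cs)
  obtain c w where a: "a = (c, w)" by force
  have "lincomb X cs \<phi> \<in> carrier X" by (rule Cons.IH) (use Cons.prems in auto)
  thus ?case using Cons.prems[of c w] by (simp add: a)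
qed simp

lemma lincomb_zero:
  "(\<And>c w. (c, w) \<in> set cs \<Longrightarrow> c \<in> carrier K \<and> \<phi> w = \<zero>\<^bsub>X\<^esub>) \<Longrightarrow> lincomb X cs \<phi> = \<zero>\<^bsub>X\<^esub>"
proof (induction cs)
  case (Cons a cs)
  obtain c w where a: "a = (c, w)" by force
  have "lincomb X cs \<phi> = \<zero>\<^bsub>X\<^esub>" by (rule Cons.IH) (use Cons.prems in auto)
  thus ?case using Cons.prems[of c w] by (simp add: a)
qed simp

lemma lincomb_plus:
  "(\<And>c w. (c, w) \<in> set cs \<Longrightarrow> c \<in> carrier K \<and> \<phi> w \<in> carrier X \<and> \<psi> w \<in> carrier X) \<Longrightarrow>
   lincomb X cs (\<lambda>w. \<phi> w \<oplus>\<^bsub>X\<^esub> \<psi> w) = lincomb X cs \<phi> \<oplus>\<^bsub>X\<^esub> lincomb X cs \<psi>"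
proof (induction cs)
  case (Cons a cs)
  obtain c w where a: "a = (c, w)" by force
  have "lincomb X cs \<phi> \<in> carrier X" "lincomb X cs \<psi> \<in> carrier X"
    using Cons.prems by (auto intro!: lincomb_closed)
  moreover have "c \<in> carrier K" "\<phi> w \<in> carrier X" "\<psi> w \<in> carrier X" using Cons.prems a by auto
  moreover have "lincomb X cs (\<lambda>w. \<phi> w \<oplus>\<^bsub>X\<^esub> \<psi> w) = lincomb X cs \<phi> \<oplus>\<^bsub>X\<^esub> lincomb X cs \<psi>"
    using Cons by auto
  ultimately show ?case by (simp add: a X.smult_r_distr X.M.a_ac)
qed simp

lemma lincomb_smult:
  assumes d: "d \<in> carrier K"
  shows "(\<And>c w. (c, w) \<in> set cs \<Longrightarrow> c \<in> carrier K \<and> \<phi> w \<in> carrier X) \<Longrightarrow>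
   lincomb X cs (\<lambda>w. d \<odot>\<^bsub>X\<^esub> \<phi> w) = d \<odot>\<^bsub>X\<^esub> lincomb X cs \<phi>"
proof (induction cs)
  case (Cons a cs)
  obtain c w where a: "a = (c, w)" by force
  have c: "c \<in> carrier K" "\<phi> w \<in> carrier X" using Cons.prems a by auto
  have "lincomb X cs \<phi> \<in> carrier X" using Cons.prems by (auto intro!: lincomb_closed)
  moreover have "lincomb X cs (\<lambda>w. d \<odot>\<^bsub>X\<^esub> \<phi> w) = d \<odot>\<^bsub>X\<^esub> lincomb X cs \<phi>" using Cons by auto
  moreover have "c \<odot>\<^bsub>X\<^esub> (d \<odot>\<^bsub>X\<^esub> \<phi> w) = d \<odot>\<^bsub>X\<^esub> (c \<odot>\<^bsub>X\<^esub> \<phi> w)"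
    using c d by (simp add: X.smult_assoc1[symmetric] H.R.m_comm)
  ultimately show ?case using c d by (simp add: a X.smult_r_distr)
qed (use d in simp)

text \<open>
  Interchanging the two finite sums is what makes operators on disjoint blocks commute.
\<close>

lemma lincomb_swap:
  assumes "\<And>c w. (c, w) \<in> set cs \<Longrightarrow> c \<in> carrier K" "\<And>d v. (d, v) \<in> set ds \<Longrightarrow> d \<in> carrier K"
    and "\<And>c w d v. (c, w) \<in> set cs \<Longrightarrow> (d, v) \<in> set ds \<Longrightarrow> \<phi> w v \<in> carrier X"
  shows "lincomb X cs (\<lambda>w. lincomb X ds (\<phi> w)) = lincomb X ds (\<lambda>v. lincomb X cs (\<lambda>w. \<phi> w v))"
  using assms
proof (induction cs)
  case Nil
  show ?case using Nil(2) by (simp add: lincomb_zero)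
next
  case (Cons a cs)
  obtain c w where a: "a = (c, w)" by force
  have cK: "c' \<in> carrier K" if "(c', w') \<in> set (a # cs)" for c' w' using Cons.prems(1)[OF that] .
  have dK: "d \<in> carrier K" if "(d, v) \<in> set ds" for d v using Cons.prems(2)[OF that] .
  have phi: "\<phi> w' v \<in> carrier X" if "(c', w') \<in> set (a # cs)" "(d, v) \<in> set ds" for c' w' d v
    using Cons.prems(3)[OF that] .
  have c: "c \<in> carrier K" using cK[of c w] a by simp
  have "lincomb X ds (\<lambda>v. lincomb X (a # cs) (\<lambda>w. \<phi> w v)) =
     lincomb X ds (\<lambda>v. c \<odot>\<^bsub>X\<^esub> \<phi> w v) \<oplus>\<^bsub>X\<^esub> lincomb X ds (\<lambda>v. lincomb X cs (\<lambda>w. \<phi> w v))"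
    unfolding a lincomb_simps
  proof (rule lincomb_plus)
    fix d v assume v: "(d, v) \<in> set ds"
    have "lincomb X cs (\<lambda>w. \<phi> w v) \<in> carrier X"
    proof (rule lincomb_closed)
      fix c' w' assume "(c', w') \<in> set cs"
      thus "c' \<in> carrier K \<and> \<phi> w' v \<in> carrier X" using cK[of c' w'] phi[of c' w' d v] v by simp
    qed
    thus "d \<in> carrier K \<and> c \<odot>\<^bsub>X\<^esub> \<phi> w v \<in> carrier X \<and> lincomb X cs (\<lambda>w. \<phi> w v) \<in> carrier X"
      using c dK[OF v] phi[of c w d v] v a by simp
  qed
  also have "lincomb X ds (\<lambda>v. c \<odot>\<^bsub>X\<^esub> \<phi> w v) = c \<odot>\<^bsub>X\<^esub> lincomb X ds (\<phi> w)"
  proof (rule lincomb_smult[OF c])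
    fix d v assume v: "(d, v) \<in> set ds"
    thus "d \<in> carrier K \<and> \<phi> w v \<in> carrier X" using dK[OF v] phi[of c w d v] a by simp
  qed
  also have "lincomb X ds (\<lambda>v. lincomb X cs (\<lambda>w. \<phi> w v)) = lincomb X cs (\<lambda>w. lincomb X ds (\<phi> w))"
    by (rule Cons.IH[symmetric]) (use cK dK phi in \<open>meson list.set_intros(2)\<close>)+
  finally show ?case by (simp add: a)
qed

lemma lincomb_linear:
  assumes "\<And>c w. (c, w) \<in> set cs \<Longrightarrow> c \<in> carrier K \<and> linear_fun K V X (\<lambda>x. \<phi> x w)"
  shows "linear_fun K V X (\<lambda>x. lincomb X cs (\<phi> x))"
  using assms
proof (induction cs)
  case Nil
  show ?case by (rule linear_funI) simp_all
next
  case (Cons a cs)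
  obtain c w where a: "a = (c, w)" by force
  have "linear_fun K V X (\<lambda>x. c \<odot>\<^bsub>X\<^esub> \<phi> x w)"
    using Cons.prems[of c w] by (simp add: a linear_fun_smult[OF X])
  moreover have "linear_fun K V X (\<lambda>x. lincomb X cs (\<phi> x))"
  proof (rule Cons.IH)
    fix c' w' assume "(c', w') \<in> set cs"
    thus "c' \<in> carrier K \<and> linear_fun K V X (\<lambda>x. \<phi> x w')" using Cons.prems[of c' w'] by simp
  qed
  ultimately have "linear_fun K V X (\<lambda>x. (c \<odot>\<^bsub>X\<^esub> \<phi> x w) \<oplus>\<^bsub>X\<^esub> lincomb X cs (\<phi> x))"
    by (rule linear_fun_plus[OF X])
  thus ?case by (simp only: a lincomb_simps)
qed

lemma forms_zero: "\<phi> \<in> F n \<Longrightarrow> xs \<notin> W n \<Longrightarrow> \<phi> xs = \<zero>\<^bsub>X\<^esub>"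
  by (simp add: forms_def)

lemma forms_closed: "\<phi> \<in> F n \<Longrightarrow> \<phi> xs \<in> carrier X"
  by (cases "xs \<in> W n") (simp_all add: forms_def)

lemma forms_linear: "\<phi> \<in> F n \<Longrightarrow> xs \<in> W n \<Longrightarrow> j < n \<Longrightarrow> linear_fun K H X (\<lambda>x. \<phi> (xs[j := x]))"
  by (simp add: forms_def)

lemma forms_eqI: "\<phi> \<in> F n \<Longrightarrow> \<psi> \<in> F n \<Longrightarrow> (\<And>xs. xs \<in> W n \<Longrightarrow> \<phi> xs = \<psi> xs) \<Longrightarrow> \<phi> = \<psi>"
  by (rule ext) (metis forms_zero)

lemma forms_context:
  assumes \<phi>: "\<phi> \<in> F (i + k + r)" and p: "p \<in> W i" and s: "s \<in> W r"
  shows "(\<lambda>us. \<phi> (p @ us @ s)) \<in> F k"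
proof -
  have iff: "p @ us @ s \<in> W (i + k + r) \<longleftrightarrow> us \<in> W k" for us using p s by (auto simp: words_def)
  have "linear_fun K H X (\<lambda>x. \<phi> (p @ us[j := x] @ s))" if "us \<in> W k" "j < k" for us j
  proof -
    have "(p @ us @ s)[i + j := x] = p @ us[j := x] @ s" for x
      using that p by (simp add: list_update_append words_def)
    moreover have "linear_fun K H X (\<lambda>x. \<phi> ((p @ us @ s)[i + j := x]))"
      by (rule forms_linear[OF \<phi>]) (use that iff in auto)
    ultimately show ?thesis by simp
  qed
  thus ?thesis using forms_closed[OF \<phi>] forms_zero[OF \<phi>] iff by (simp add: forms_def)
qed

lemma forms_eq_contextI:
  assumes "\<phi> \<in> F (i + k + r)" "\<psi> \<in> F (i + k + r)"
    and "\<And>p s. p \<in> W i \<Longrightarrow> s \<in> W r \<Longrightarrow> (\<lambda>us. \<phi> (p @ us @ s)) = (\<lambda>us. \<psi> (p @ us @ s))"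
  shows "\<phi> = \<psi>"
proof (rule forms_eqI[OF assms(1,2)])
  fix xs assume "xs \<in> W (i + k + r)"
  then obtain p us s where e: "xs = p @ us @ s" and p: "p \<in> W i" and s: "s \<in> W r"
    by (rule words_split)
  show "\<phi> xs = \<psi> xs" using fun_cong[OF assms(3)[OF p s], of us] by (simp add: e)
qed

text \<open>
  The formal combinations depend on choices of representatives and are not multilinear in the word
  themselves; what is required is that their values on multilinear forms are.
\<close>

definition generator :: "nat \<Rightarrow> nat \<Rightarrow> ('h list \<Rightarrow> ('k \<times> 'h list) list) \<Rightarrow> bool" where
  "generator a b f \<longleftrightarrow> (\<forall>us\<in>W a. \<forall>(c, w)\<in>set (f us). c \<in> carrier K \<and> w \<in> W b) \<and>
     (\<forall>\<phi>\<in>F b. strand H X a f 0 \<phi> \<in> F a)"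

lemma generatorD:
  assumes "generator a b f" "us \<in> W a" "(c, w) \<in> set (f us)"
  shows "c \<in> carrier K" "w \<in> W b"
  using assms by (auto simp: generator_def)

lemma strand_word:
  assumes "p \<in> W i" "us \<in> W a" "set s \<subseteq> carrier H"
  shows "strand H X a f i \<phi> (p @ us @ s) = lincomb X (f us) (\<lambda>w. \<phi> (p @ w @ s))"
  using assms by (simp add: strand_def words_def)

lemma strand_context:
  assumes f: "generator a b f" and \<phi>: "\<phi> \<in> F (i + b + r)" and p: "p \<in> W i" and s: "s \<in> W r" and us: "us \<in> W a"
  shows "strand H X a f i \<phi> (p @ us @ s) = strand H X a f 0 (\<lambda>w. \<phi> (p @ w @ s)) us"
  using strand_word[OF p us, of s f \<phi>] strand_word[of "[]" 0 us a "[]" f] us s by (auto simp: words_def)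

text \<open>
  A word of the wrong length stays of the wrong length when a block of \<open>a\<close> letters is replaced by
  \<open>b\<close> letters.
\<close>

lemma strand_zero:
  assumes f: "\<And>us c w. us \<in> W a \<Longrightarrow> (c, w) \<in> set (f us) \<Longrightarrow> c \<in> carrier K \<and> w \<in> W b"
    and \<phi>: "\<phi> \<in> F (i + b + r)" and xs: "xs \<notin> W (i + a + r)"
  shows "strand H X a f i \<phi> xs = \<zero>\<^bsub>X\<^esub>"
proof (cases "set xs \<subseteq> carrier H \<and> i + a \<le> length xs")
  case True
  hence len: "length xs \<noteq> i + a + r" using xs by (auto simp: words_def)
  have us: "take a (drop i xs) \<in> W a"
    using True set_take_subset[of a "drop i xs"] set_drop_subset[of i xs] by (auto simp: words_def)
  have "lincomb X (f (take a (drop i xs))) (\<lambda>w. \<phi> (take i xs @ w @ drop (i + a) xs)) = \<zero>\<^bsub>X\<^esub>"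
  proof (rule lincomb_zero)
    fix c w assume cw: "(c, w) \<in> set (f (take a (drop i xs)))"
    from f[OF us cw] show "c \<in> carrier K \<and> \<phi> (take i xs @ w @ drop (i + a) xs) = \<zero>\<^bsub>X\<^esub>"
      using True len by (auto intro!: forms_zero[OF \<phi>] simp: words_def)
  qed
  thus ?thesis by (simp add: strand_def)
qed (auto simp: strand_def)

lemma strand_eqI:
  assumes f: "\<And>us c w. us \<in> W a \<Longrightarrow> (c, w) \<in> set (f us) \<Longrightarrow> c \<in> carrier K \<and> w \<in> W b"
    and \<phi>: "\<phi> \<in> F (i + b + r)" and \<psi>: "\<psi> \<in> F (i + a + r)"
    and eq: "\<And>p us s. p \<in> W i \<Longrightarrow> us \<in> W a \<Longrightarrow> s \<in> W r \<Longrightarrow>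
      lincomb X (f us) (\<lambda>w. \<phi> (p @ w @ s)) = \<psi> (p @ us @ s)"
  shows "strand H X a f i \<phi> = \<psi>"
proof
  fix xs
  show "strand H X a f i \<phi> xs = \<psi> xs"
  proof (cases "xs \<in> W (i + a + r)")
    case True
    then obtain p us s where e: "xs = p @ us @ s" and p: "p \<in> W i" and us: "us \<in> W a" and s: "s \<in> W r"
      by (rule words_split)
    have "set s \<subseteq> carrier H" using s by (simp add: words_def)
    from strand_word[OF p us this, of f \<phi>] show ?thesis using eq[OF p us s] by (simp add: e)
  next
    case False
    thus ?thesis using strand_zero[OF f \<phi> False] forms_zero[OF \<psi> False] by simp
  qed
qed

lemma strand_forms:
  assumes f: "generator a b f" and \<phi>: "\<phi> \<in> F (i + b + r)"
  shows "strand H X a f i \<phi> \<in> F (i + a + r)"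
proof -
  let ?\<psi> = "strand H X a f i \<phi>"
  have 1: "?\<psi> xs = \<zero>\<^bsub>X\<^esub>" if xs: "xs \<notin> W (i + a + r)" for xs
    by (rule strand_zero[OF _ \<phi> xs]) (use generatorD[OF f] in blast)
  have 2: "linear_fun K H X (\<lambda>x. ?\<psi> (xs[j := x]))" if xs: "xs \<in> W (i + a + r)" and j: "j < i + a + r" for xs j
  proof -
    obtain p us s where e: "xs = p @ us @ s" and p: "p \<in> W i" and us: "us \<in> W a" and s: "s \<in> W r"
      using xs by (rule words_split)
    have W_upd: "ys[l := x] \<in> W n" if "ys \<in> W n" "x \<in> carrier H" for ys n l x
      using that set_update_subset_insert[of ys l x] by (auto simp: words_def)
    consider "j < i" | "i \<le> j" "j < i + a" | "i + a \<le> j" by linarith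
    thus ?thesis
    proof cases
      case 1
      have eq: "?\<psi> (xs[j := x]) = lincomb X (f us) (\<lambda>w. \<phi> ((p @ w @ s)[j := x]))" if x: "x \<in> carrier H" for x
        using strand_word[OF W_upd[OF p x] us, of s f \<phi> j] 1 s p by (simp add: e list_update_append words_def)
      have "linear_fun K H X (\<lambda>x. lincomb X (f us) (\<lambda>w. \<phi> ((p @ w @ s)[j := x])))"
      proof (rule lincomb_linear)
        fix c w assume cw: "(c, w) \<in> set (f us)"
        from generatorD[OF f us cw] show "c \<in> carrier K \<and> linear_fun K H X (\<lambda>x. \<phi> ((p @ w @ s)[j := x]))"
          using 1 p s by (auto intro!: forms_linear[OF \<phi>] simp: words_def)
      qed
      thus ?thesis by (rule iffD2[OF linear_fun_cong[OF H], rotated]) (rule eq)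
    next
      case 2
      hence ji: "i \<le> j" "j - i < a" by linarith+
      have eq: "?\<psi> (xs[j := x]) = strand H X a f 0 (\<lambda>w. \<phi> (p @ w @ s)) (us[j - i := x])" if x: "x \<in> carrier H" for x
        using strand_context[OF f \<phi> p s W_upd[OF us x], of "j - i"] ji s p us by (simp add: e list_update_append words_def)
      have "strand H X a f 0 (\<lambda>w. \<phi> (p @ w @ s)) \<in> F a"
        using f forms_context[OF \<phi> p s] by (simp add: generator_def)
      from forms_linear[OF this us, of "j - i"]
      have "linear_fun K H X (\<lambda>x. strand H X a f 0 (\<lambda>w. \<phi> (p @ w @ s)) (us[j - i := x]))" using 2 by auto
      thus ?thesis by (rule iffD2[OF linear_fun_cong[OF H], rotated]) (rule eq)
    next
      case 3
      define l where "l = j - i - a"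
      have l: "j = i + a + l" "l < r" using 3 j by (auto simp: l_def)
      have eq: "?\<psi> (xs[j := x]) = lincomb X (f us) (\<lambda>w. \<phi> ((p @ w @ s)[i + b + l := x]))" if x: "x \<in> carrier H" for x
      proof -
        have "xs[j := x] = p @ us @ s[l := x]" using p us l by (simp add: e list_update_append words_def)
        hence "?\<psi> (xs[j := x]) = lincomb X (f us) (\<lambda>w. \<phi> (p @ w @ s[l := x]))"
          using strand_word[OF p us, of "s[l := x]" f \<phi>] W_upd[OF s x] by (simp add: words_def)
        also have "\<dots> = lincomb X (f us) (\<lambda>w. \<phi> ((p @ w @ s)[i + b + l := x]))"
          by (rule lincomb_cong) (use generatorD(2)[OF f us] p in \<open>auto simp: list_update_append words_def\<close>)
        finally show ?thesis .
      qed
      have "linear_fun K H X (\<lambda>x. lincomb X (f us) (\<lambda>w. \<phi> ((p @ w @ s)[i + b + l := x])))"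
      proof (rule lincomb_linear)
        fix c w assume cw: "(c, w) \<in> set (f us)"
        from generatorD[OF f us cw] show "c \<in> carrier K \<and> linear_fun K H X (\<lambda>x. \<phi> ((p @ w @ s)[i + b + l := x]))"
          using l p s by (auto intro!: forms_linear[OF \<phi>] simp: words_def)
      qed
      thus ?thesis by (rule iffD2[OF linear_fun_cong[OF H], rotated]) (rule eq)
    qed
  qed
  have 3: "?\<psi> xs \<in> carrier X" if xs: "xs \<in> W (i + a + r)" for xs
  proof -
    obtain p us s where e: "xs = p @ us @ s" and p: "p \<in> W i" and us: "us \<in> W a" and s: "s \<in> W r"
      using xs by (rule words_split)
    have "lincomb X (f us) (\<lambda>w. \<phi> (p @ w @ s)) \<in> carrier X"
      by (rule lincomb_closed) (use generatorD[OF f us] forms_closed[OF \<phi>] in auto)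
    thus ?thesis using strand_word[OF p us, of s f \<phi>] s e by (simp add: words_def)
  qed
  show ?thesis using 1 2 3 by (simp add: forms_def)
qed

text \<open>
  Operators on disjoint blocks commute. The block on the right is shifted by the change \<open>b - a\<close> of the
  number of strands on the left.
\<close>

lemma strand_interchange:
  assumes f: "generator a b f" and g: "generator a' b' g" and \<phi>: "\<phi> \<in> F (i + b + q + b' + r)"
  shows "strand H X a f i (strand H X a' g (i + b + q) \<phi>) = strand H X a' g (i + a + q) (strand H X a f i \<phi>)"
proof (rule forms_eqI[of _ "i + a + (q + a' + r)"])
  have 1: "strand H X a' g (i + b + q) \<phi> \<in> F ((i + b + q) + a' + r)"
    using strand_forms[OF g, of \<phi> "i + b + q" r] \<phi> by simp
  thus "strand H X a f i (strand H X a' g (i + b + q) \<phi>) \<in> F (i + a + (q + a' + r))"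
    using strand_forms[OF f, of _ i "q + a' + r"] by (simp add: add.assoc)
  have 2: "strand H X a f i \<phi> \<in> F (i + a + (q + b' + r))"
    using strand_forms[OF f, of \<phi> i "q + b' + r"] \<phi> by (simp add: add.assoc)
  hence "strand H X a' g (i + a + q) (strand H X a f i \<phi>) \<in> F ((i + a + q) + a' + r)"
    using strand_forms[OF g, of _ "i + a + q" r] by (simp add: add.assoc)
  thus "strand H X a' g (i + a + q) (strand H X a f i \<phi>) \<in> F (i + a + (q + a' + r))"
    by (simp add: add.assoc)
  fix xs assume "xs \<in> W (i + a + (q + a' + r))"
  then obtain p us t where e: "xs = p @ us @ t" and p: "p \<in> W i" and us: "us \<in> W a" and t: "t \<in> W (q + a' + r)"
    by (rule words_split)
  from t obtain y vs s where t': "t = y @ vs @ s" and y: "y \<in> W q" and vs: "vs \<in> W a'" and s: "s \<in> W r"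
    by (rule words_split)
  have "strand H X a f i (strand H X a' g (i + b + q) \<phi>) xs =
    lincomb X (f us) (\<lambda>w. strand H X a' g (i + b + q) \<phi> (p @ w @ t))"
    unfolding e by (rule strand_word[OF p us]) (use t in \<open>simp add: words_def\<close>)
  also have "\<dots> = lincomb X (f us) (\<lambda>w. lincomb X (g vs) (\<lambda>v. \<phi> (p @ w @ y @ v @ s)))"
  proof (rule lincomb_cong)
    fix c w assume "(c, w) \<in> set (f us)"
    from generatorD(2)[OF f us this] have "p @ w @ y \<in> W (i + b + q)" using p y by (simp add: words_def)
    from strand_word[OF this vs, of s g \<phi>]
    show "strand H X a' g (i + b + q) \<phi> (p @ w @ t) = lincomb X (g vs) (\<lambda>v. \<phi> (p @ w @ y @ v @ s))"
      using s by (simp add: t' words_def)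
  qed
  also have "\<dots> = lincomb X (g vs) (\<lambda>v. lincomb X (f us) (\<lambda>w. \<phi> (p @ w @ y @ v @ s)))"
    by (rule lincomb_swap) (use generatorD[OF f us] generatorD[OF g vs] forms_closed[OF \<phi>] in auto)
  also have "\<dots> = lincomb X (g vs) (\<lambda>v. strand H X a f i \<phi> (p @ us @ y @ v @ s))"
  proof (rule lincomb_cong)
    fix c v assume "(c, v) \<in> set (g vs)"
    from generatorD(2)[OF g vs this] have "set (y @ v @ s) \<subseteq> carrier H" using y s by (simp add: words_def)
    from strand_word[OF p us this]
    show "lincomb X (f us) (\<lambda>w. \<phi> (p @ w @ y @ v @ s)) = strand H X a f i \<phi> (p @ us @ y @ v @ s)" by simp
  qed
  also have "\<dots> = strand H X a' g (i + a + q) (strand H X a f i \<phi>) xs"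
  proof -
    have "p @ us @ y \<in> W (i + a + q)" using p us y by (simp add: words_def)
    from strand_word[OF this vs, of s g] show ?thesis using s by (simp add: e t' words_def)
  qed
  finally show "strand H X a f i (strand H X a' g (i + b + q) \<phi>) xs =
    strand H X a' g (i + a + q) (strand H X a f i \<phi>) xs" .
qed

text \<open>
  Freezing the arguments \<open>p\<close> and \<open>s\<close> on both sides of the affected block leaves a shorter form, on which
  the same operator acts at a shifted position.
\<close>

lemma strand_localize:
  assumes f: "generator a b f" and \<phi>: "\<phi> \<in> F (i + (j + b + l) + r)" and p: "p \<in> W i" and s: "s \<in> W r"
  shows "(\<lambda>us. strand H X a f (i + j) \<phi> (p @ us @ s)) = strand H X a f j (\<lambda>us. \<phi> (p @ us @ s))"
proof (rule forms_eqI[of _ "j + a + l"])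
  have "strand H X a f (i + j) \<phi> \<in> F (i + (j + a + l) + r)"
    using strand_forms[OF f, of \<phi> "i + j" "l + r"] \<phi> by (simp add: add.assoc)
  from forms_context[OF this p s]
  show "(\<lambda>us. strand H X a f (i + j) \<phi> (p @ us @ s)) \<in> F (j + a + l)" .
  show "strand H X a f j (\<lambda>us. \<phi> (p @ us @ s)) \<in> F (j + a + l)"
    by (rule strand_forms[OF f forms_context[OF \<phi> p s]])
  fix us assume "us \<in> W (j + a + l)"
  then obtain q vs t where e: "us = q @ vs @ t" and q: "q \<in> W j" and vs: "vs \<in> W a" and t: "t \<in> W l"
    by (rule words_split)
  have pq: "p @ q \<in> W (i + j)" using p q by (simp add: words_def)
  show "strand H X a f (i + j) \<phi> (p @ us @ s) = strand H X a f j (\<lambda>us. \<phi> (p @ us @ s)) us"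
    using strand_word[OF pq vs, of "t @ s" f \<phi>] strand_word[OF q vs, of t f "\<lambda>us. \<phi> (p @ us @ s)"] t s
    by (simp add: e words_def)
qed


text \<open>
  Relations between operators are stated for words of them. Positions are relative to a base point \<open>i\<close>,
  so that one proof of a relation serves at all positions.
\<close>

primrec run :: "(nat \<times> nat \<times> ('h list \<Rightarrow> ('k \<times> 'h list) list) \<times> nat) list \<Rightarrow> nat \<Rightarrow>
    ('h list \<Rightarrow> 'x) \<Rightarrow> 'h list \<Rightarrow> 'x" where
  "run [] i \<phi> = \<phi>"
| "run (x # ops) i \<phi> = (case x of (a, b, f, j) \<Rightarrow> strand H X a f (i + j) (run ops i \<phi>))"

primrec typed where
  "typed k [] k' \<longleftrightarrow> k = k'"
| "typed k (x # ops) k' \<longleftrightarrow> (case x of (a, b, f, j) \<Rightarrow>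
     generator a b f \<and> j + a \<le> k' \<and> typed k ops (k' - a + b))"

lemma run_forms: "typed k ops k' \<Longrightarrow> \<phi> \<in> F (i + k + r) \<Longrightarrow> run ops i \<phi> \<in> F (i + k' + r)"
proof (induction ops arbitrary: k')
  case (Cons x ops)
  obtain a b f j where x: "x = (a, b, f, j)" by (cases x) auto
  from Cons.prems have f: "generator a b f" and j: "j + a \<le> k'" and "typed k ops (k' - a + b)" by (auto simp: x)
  define l where "l = k' - a - j"
  have l: "k' - a + b = j + b + l" "k' = j + a + l" using j by (auto simp: l_def)
  have "run ops i \<phi> \<in> F (i + j + b + (l + r))"
    using Cons.IH[OF \<open>typed k ops (k' - a + b)\<close> Cons.prems(2)] by (simp add: l add_ac)
  from strand_forms[OF f this] show ?case by (simp add: x l add.assoc)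
qed simp

lemma run_localize:
  assumes p: "p \<in> W i" and s: "s \<in> W r" and \<phi>: "\<phi> \<in> F (i + k + r)"
  shows "typed k ops k' \<Longrightarrow> (\<lambda>us. run ops i \<phi> (p @ us @ s)) = run ops 0 (\<lambda>us. \<phi> (p @ us @ s))"
proof (induction ops arbitrary: k')
  case (Cons x ops)
  obtain a b f j where x: "x = (a, b, f, j)" by (cases x) auto
  from Cons.prems have f: "generator a b f" and j: "j + a \<le> k'" and t: "typed k ops (k' - a + b)" by (auto simp: x)
  define l where "l = k' - a - j"
  have l: "k' - a + b = j + b + l" using j by (auto simp: l_def)
  have "run ops i \<phi> \<in> F (i + (j + b + l) + r)" using run_forms[OF t \<phi>] by (simp add: l)
  from strand_localize[OF f this p s] Cons.IH[OF t] show ?case by (simp add: x)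
qed simp

text \<open>
  Freezing the arguments outside the affected block reduces a relation at position \<open>i\<close> to position 0.
\<close>

lemma run_lift:
  assumes "typed k ops k'" "typed k ops' k'"
    and "\<And>\<phi>. \<phi> \<in> F k \<Longrightarrow> run ops 0 \<phi> = run ops' 0 \<phi>" and \<phi>: "\<phi> \<in> F (i + k + r)"
  shows "run ops i \<phi> = run ops' i \<phi>"
proof (rule forms_eq_contextI[OF run_forms[OF assms(1) \<phi>] run_forms[OF assms(2) \<phi>]])
  fix p s assume p: "p \<in> W i" and s: "s \<in> W r"
  show "(\<lambda>us. run ops i \<phi> (p @ us @ s)) = (\<lambda>us. run ops' i \<phi> (p @ us @ s))"
    unfolding run_localize[OF p s \<phi> assms(1)] run_localize[OF p s \<phi> assms(2)]
    by (rule assms(3)[OF forms_context[OF \<phi> p s]])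
qed

end

section \<open>Multilinear forms as linear maps on tensor powers\<close>

lemma words_0: "words H 0 = {[]}"
  by (auto simp: words_def)

lemma words_Suc: "xs \<in> words H (Suc n) \<longleftrightarrow> (\<exists>x ys. xs = x # ys \<and> x \<in> carrier H \<and> ys \<in> words H n)"
  by (cases xs) (auto simp: words_def)

lemmas words_num = words_0 words_Suc numeral_2_eq_2 numeral_3_eq_3 numeral_eq_Suc

text \<open>
  A chosen expression of a tensor as a sum of pure tensors.
\<close>

definition tensor_words :: "('k, 'r) ring_scheme \<Rightarrow> ('k, 'h) module \<Rightarrow> ('h \<times> 'h \<Rightarrow> 'k) set \<Rightarrow> ('k \<times> 'h list) list" where
  "tensor_words K H t = map (\<lambda>(x, y). (\<one>\<^bsub>K\<^esub>, [x, y])) (SOME ps. set ps \<subseteq> carrier H \<times> carrier H \<and>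
     t = foldr (\<lambda>(v, w) s. pure_tensor K H H v w \<oplus>\<^bsub>tensor K H H\<^esub> s) ps \<zero>\<^bsub>tensor K H H\<^esub>)"

definition end_gen where "end_gen K H f us = tensor_words K H (app f (pure_tensor K H H (us ! 0) (us ! 1)))"
definition comult_gen where "comult_gen K H \<Delta> us = tensor_words K H (app \<Delta> (us ! 0))"
definition mult_gen where "mult_gen K H m us = [(\<one>\<^bsub>K\<^esub>, [app m (pure_tensor K H H (us ! 0) (us ! 1))])]"
definition map_gen where "map_gen K S us = [(\<one>\<^bsub>K\<^esub>, [app S (us ! 0)])]"
definition counit_gen where "counit_gen \<epsilon> us = [(app \<epsilon> (us ! 0), [])]"
definition unit_gen where "unit_gen K u us = [(\<one>\<^bsub>K\<^esub>, [u])]"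

context forms_space
begin

abbreviation "T2 \<equiv> tensor K H H"
abbreviation "T3 \<equiv> tensor K T2 H"
abbreviation "T4 \<equiv> tensor K T2 T2"
abbreviation "pt \<equiv> pure_tensor K H H"

lemmas T_modules [simp] = H X tensor_module

lemma tensor_words_spec:
  assumes "t \<in> carrier T2"
  obtains ps where "tensor_words K H t = map (\<lambda>(x, y). (\<one>\<^bsub>K\<^esub>, [x, y])) ps"
    "set ps \<subseteq> carrier H \<times> carrier H" "t = foldr (\<lambda>(v, w) s. pt v w \<oplus>\<^bsub>T2\<^esub> s) ps \<zero>\<^bsub>T2\<^esub>"
proof -
  let ?Q = "\<lambda>ps. set ps \<subseteq> carrier H \<times> carrier H \<and> t = foldr (\<lambda>(v, w) s. pt v w \<oplus>\<^bsub>T2\<^esub> s) ps \<zero>\<^bsub>T2\<^esub>"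
  have "\<exists>ps. ?Q ps" using tensor_sum_pure[OF H H assms] by blast
  from someI_ex[OF this] show ?thesis by (intro that[of "SOME ps. ?Q ps"]) (simp_all add: tensor_words_def)
qed

lemma tensor_words_wf:
  assumes "t \<in> carrier T2" "(c, w) \<in> set (tensor_words K H t)"
  shows "c \<in> carrier K \<and> w \<in> W 2"
proof -
  obtain ps where ps: "tensor_words K H t = map (\<lambda>(x, y). (\<one>\<^bsub>K\<^esub>, [x, y])) ps" "set ps \<subseteq> carrier H \<times> carrier H"
    using assms(1) by (rule tensor_words_spec)
  obtain a where "a \<in> set ps" "(c, w) = (case a of (x, y) \<Rightarrow> (\<one>\<^bsub>K\<^esub>, [x, y]))"
    using assms(2) unfolding ps(1) by (auto simp del: split_paired_Ex)
  thus ?thesis using ps(2) by (cases a) (auto simp: words_def)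
qed

text \<open>
  Linearity of \<open>G\<close> makes the result independent of the chosen expression.
\<close>

lemma tensor_words_eval:
  assumes t: "t \<in> carrier T2" and G: "linear_fun K T2 X G"
    and eq: "\<And>x y. x \<in> carrier H \<Longrightarrow> y \<in> carrier H \<Longrightarrow> \<phi> [x, y] = G (pt x y)"
  shows "lincomb X (tensor_words K H t) \<phi> = G t"
proof -
  interpret T: module K T2 by simp
  obtain ps where ps: "tensor_words K H t = map (\<lambda>(x, y). (\<one>\<^bsub>K\<^esub>, [x, y])) ps"
    "set ps \<subseteq> carrier H \<times> carrier H" "t = foldr (\<lambda>(v, w) s. pt v w \<oplus>\<^bsub>T2\<^esub> s) ps \<zero>\<^bsub>T2\<^esub>"
    using t by (rule tensor_words_spec)
  have "foldr (\<lambda>(v, w) s. pt v w \<oplus>\<^bsub>T2\<^esub> s) qs \<zero>\<^bsub>T2\<^esub> \<in> carrier T2 \<and>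
    lincomb X (map (\<lambda>(x, y). (\<one>\<^bsub>K\<^esub>, [x, y])) qs) \<phi> =
    G (foldr (\<lambda>(v, w) s. pt v w \<oplus>\<^bsub>T2\<^esub> s) qs \<zero>\<^bsub>T2\<^esub>)" if "set qs \<subseteq> carrier H \<times> carrier H" for qs
    using that
  proof (induction qs)
    case Nil
    show ?case using linear_fun_zero[OF _ X G] by simp
  next
    case (Cons a qs)
    obtain x y where a: "a = (x, y)" "x \<in> carrier H" "y \<in> carrier H" using Cons.prems by auto
    have p: "pt x y \<in> carrier T2" using a by (simp add: pure_tensor_closed)
    show ?case using Cons a p linear_funD(1)[OF G p] by (simp add: eq linear_funD(2)[OF G])
  qed
  from this[OF ps(2)] show ?thesis by (simp add: ps(1) ps(3)[symmetric])
qed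

text \<open>
  A linear map on a tensor power is the same as a multilinear form. The four bracketings are those in
  which the axioms of braided bialgebras are stated.
\<close>

definition "form1 L xs = (if xs \<in> W 1 then app L (xs ! 0) else \<zero>\<^bsub>X\<^esub>)"
definition "form2 L xs = (if xs \<in> W 2 then app L (pt (xs ! 0) (xs ! 1)) else \<zero>\<^bsub>X\<^esub>)"
definition "form3 L xs = (if xs \<in> W 3 then
  app L (pure_tensor K T2 H (pt (xs ! 0) (xs ! 1)) (xs ! 2)) else \<zero>\<^bsub>X\<^esub>)"
definition "form4 L xs = (if xs \<in> W 4 then
  app L (pure_tensor K T2 T2 (pt (xs ! 0) (xs ! 1)) (pt (xs ! 2) (xs ! 3))) else \<zero>\<^bsub>X\<^esub>)"

lemma form1_app [simp]: "x \<in> carrier H \<Longrightarrow> form1 L [x] = app L x"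
  by (simp add: form1_def words_def)

lemma form2_app [simp]: "x \<in> carrier H \<Longrightarrow> y \<in> carrier H \<Longrightarrow> form2 L [x, y] = app L (pt x y)"
  by (simp add: form2_def words_def)

lemma form3_app [simp]: "x \<in> carrier H \<Longrightarrow> y \<in> carrier H \<Longrightarrow> z \<in> carrier H \<Longrightarrow>
    form3 L [x, y, z] = app L (pure_tensor K T2 H (pt x y) z)"
  by (simp add: form3_def words_def)

lemma form4_app [simp]: "x \<in> carrier H \<Longrightarrow> y \<in> carrier H \<Longrightarrow> z \<in> carrier H \<Longrightarrow> w \<in> carrier H \<Longrightarrow>
    form4 L [x, y, z, w] = app L (pure_tensor K T2 T2 (pt x y) (pt z w))"
  by (simp add: form4_def words_def)

lemmas pt_closed [simp] = pure_tensor_closed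

lemma lin_pure_left:
  "module K A \<Longrightarrow> module K B \<Longrightarrow> b \<in> carrier B \<Longrightarrow> linear_fun K V A g \<Longrightarrow>
   linear_fun K V (tensor K A B) (\<lambda>x. pure_tensor K A B (g x) b)"
  by (rule linear_fun_comp[OF pure_tensor_linear_left])

lemma lin_pure_right:
  "module K A \<Longrightarrow> module K B \<Longrightarrow> a \<in> carrier A \<Longrightarrow> linear_fun K V B g \<Longrightarrow>
   linear_fun K V (tensor K A B) (\<lambda>x. pure_tensor K A B a (g x))"
  by (rule linear_fun_comp[OF pure_tensor_linear_right])

lemma lin_app:
  "linear_map K L \<Longrightarrow> src L = A \<Longrightarrow> tgt L = B \<Longrightarrow> linear_fun K V A g \<Longrightarrow> linear_fun K V B (\<lambda>x. app L (g x))"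
  using linear_fun_comp linear_map_linear by metis

lemmas lin_intros = lin_pure_left lin_pure_right linear_fun_id

lemma formsI:
  assumes "\<And>xs. xs \<notin> W n \<Longrightarrow> \<phi> xs = \<zero>\<^bsub>X\<^esub>"
    and "\<And>xs. xs \<in> W n \<Longrightarrow> \<phi> xs \<in> carrier X"
    and "\<And>xs j. xs \<in> W n \<Longrightarrow> j < n \<Longrightarrow> \<exists>g. linear_fun K H X g \<and> (\<forall>x\<in>carrier H. \<phi> (xs[j := x]) = g x)"
  shows "\<phi> \<in> F n"
proof -
  have "linear_fun K H X (\<lambda>x. \<phi> (xs[j := x]))" if xs: "xs \<in> W n" and j: "j < n" for xs j
  proof -
    obtain g where g: "linear_fun K H X g" "\<And>x. x \<in> carrier H \<Longrightarrow> \<phi> (xs[j := x]) = g x"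
      using assms(3)[OF xs j] by blast
    show ?thesis using linear_fun_cong[OF H, of "\<lambda>x. \<phi> (xs[j := x])" g] g by simp
  qed
  thus ?thesis using assms(1,2) by (simp add: forms_def)
qed

lemma form1_forms:
  assumes "linear_map K L" "src L = H" "tgt L = X"
  shows "form1 L \<in> F 1"
proof (rule formsI)
  fix xs assume xs: "xs \<in> W 1"
  then obtain x where x: "xs = [x]" "x \<in> carrier H" by (auto simp: words_num)
  show "form1 L xs \<in> carrier X" using x app_closed[OF assms(1)] assms by simp
  fix j :: nat assume "j < 1"
  hence "j = 0" by simp
  thus "\<exists>g. linear_fun K H X g \<and> (\<forall>x\<in>carrier H. form1 L (xs[j := x]) = g x)"
    using linear_map_linear[OF assms(1)] assms(2,3) x by (intro exI[of _ "app L"]) simp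
qed (simp add: form1_def)

lemma form2_forms:
  assumes "linear_map K L" "src L = T2" "tgt L = X"
  shows "form2 L \<in> F 2"
proof (rule formsI)
  fix xs assume xs: "xs \<in> W 2"
  then obtain x y where x: "xs = [x, y]" "x \<in> carrier H" "y \<in> carrier H" by (auto simp: words_num)
  show "form2 L xs \<in> carrier X" using x app_closed[OF assms(1)] assms by simp
  fix j :: nat assume "j < 2"
  then consider "j = 0" | "j = 1" by linarith
  thus "\<exists>g. linear_fun K H X g \<and> (\<forall>x\<in>carrier H. form2 L (xs[j := x]) = g x)"
  proof cases
    case 1
    have "linear_fun K H X (\<lambda>x. app L (pt x y))" by (intro lin_app[OF assms] lin_intros) (use x in simp_all)
    with 1 x show ?thesis by (intro exI[of _ "\<lambda>x. app L (pt x y)"]) simp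
  next
    case 2
    have "linear_fun K H X (\<lambda>y. app L (pt x y))" by (intro lin_app[OF assms] lin_intros) (use x in simp_all)
    with 2 x show ?thesis by (intro exI[of _ "\<lambda>y. app L (pt x y)"]) simp
  qed
qed (simp add: form2_def)

lemma form3_forms:
  assumes "linear_map K L" "src L = T3" "tgt L = X"
  shows "form3 L \<in> F 3"
proof (rule formsI)
  fix xs assume xs: "xs \<in> W 3"
  then obtain x y z where x: "xs = [x, y, z]" "x \<in> carrier H" "y \<in> carrier H" "z \<in> carrier H"
    by (auto simp: words_num)
  show "form3 L xs \<in> carrier X" using x app_closed[OF assms(1)] assms by simp
  fix j :: nat assume "j < 3"
  then consider "j = 0" | "j = 1" | "j = 2" by linarith
  thus "\<exists>g. linear_fun K H X g \<and> (\<forall>x\<in>carrier H. form3 L (xs[j := x]) = g x)"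
  proof cases
    case 1
    let ?g = "\<lambda>x. app L (pure_tensor K T2 H (pt x y) z)"
    have "linear_fun K H X ?g" by (intro lin_app[OF assms] lin_intros) (use x in simp_all)
    with 1 x show ?thesis by (intro exI[of _ ?g]) simp
  next
    case 2
    let ?g = "\<lambda>y. app L (pure_tensor K T2 H (pt x y) z)"
    have "linear_fun K H X ?g" by (intro lin_app[OF assms] lin_intros) (use x in simp_all)
    with 2 x show ?thesis by (intro exI[of _ ?g]) simp
  next
    case 3
    let ?g = "\<lambda>z. app L (pure_tensor K T2 H (pt x y) z)"
    have "linear_fun K H X ?g" by (intro lin_app[OF assms] lin_intros) (use x in simp_all)
    with 3 x show ?thesis by (intro exI[of _ ?g]) (simp add: numeral_2_eq_2)
  qed
qed (simp add: form3_def)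

lemma form4_forms:
  assumes "linear_map K L" "src L = T4" "tgt L = X"
  shows "form4 L \<in> F 4"
proof (rule formsI)
  fix xs assume xs: "xs \<in> W 4"
  then obtain x y z w where x: "xs = [x, y, z, w]" "x \<in> carrier H" "y \<in> carrier H" "z \<in> carrier H" "w \<in> carrier H"
    by (auto simp: words_num)
  show "form4 L xs \<in> carrier X" using x app_closed[OF assms(1)] assms by simp
  let ?f = "\<lambda>x y z w. app L (pure_tensor K T2 T2 (pt x y) (pt z w))"
  fix j :: nat assume "j < 4"
  then consider "j = 0" | "j = 1" | "j = 2" | "j = 3" by linarith
  thus "\<exists>g. linear_fun K H X g \<and> (\<forall>x\<in>carrier H. form4 L (xs[j := x]) = g x)"
  proof cases
    case 1
    have "linear_fun K H X (\<lambda>x. ?f x y z w)" by (intro lin_app[OF assms] lin_intros) (use x in simp_all)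
    with 1 x show ?thesis by (intro exI[of _ "\<lambda>x. ?f x y z w"]) simp
  next
    case 2
    have "linear_fun K H X (\<lambda>y. ?f x y z w)" by (intro lin_app[OF assms] lin_intros) (use x in simp_all)
    with 2 x show ?thesis by (intro exI[of _ "\<lambda>y. ?f x y z w"]) simp
  next
    case 3
    have "linear_fun K H X (\<lambda>z. ?f x y z w)" by (intro lin_app[OF assms] lin_intros) (use x in simp_all)
    with 3 x show ?thesis by (intro exI[of _ "\<lambda>z. ?f x y z w"]) (simp add: numeral_2_eq_2)
  next
    case 4
    have "linear_fun K H X (\<lambda>w. ?f x y z w)" by (intro lin_app[OF assms] lin_intros) (use x in simp_all)
    with 4 x show ?thesis by (intro exI[of _ "\<lambda>w. ?f x y z w"]) (simp add: numeral_3_eq_3)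
  qed
qed (simp add: form4_def)

lemma forms1_cases:
  assumes "\<phi> \<in> F 1"
  obtains L where "linear_map K L" "src L = H" "tgt L = X" "\<phi> = form1 L"
proof
  have lin: "linear_fun K H X (\<lambda>x. \<phi> [x])"
    using forms_linear[OF assms, of "[\<zero>\<^bsub>H\<^esub>]" 0] by (simp add: words_def)
  let ?L = "mk_lmap H X (\<lambda>x. \<phi> [x])"
  show L: "linear_map K ?L" "src ?L = H" "tgt ?L = X" by (simp_all add: mk_lmap_linear[OF H X lin])
  show "\<phi> = form1 ?L"
    by (rule forms_eqI[OF assms form1_forms[OF L]]) (auto simp: words_num)
qed

lemma forms2_bilinear:
  assumes "\<phi> \<in> F 2"
  shows "bilinear_fun K H H X (\<lambda>x y. \<phi> [x, y])"
  unfolding bilinear_fun_def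
proof (intro conjI ballI)
  fix x assume x: "x \<in> carrier H"
  show "linear_fun K H X (\<lambda>y. \<phi> [x, y])" "linear_fun K H X (\<lambda>y. \<phi> [y, x])"
    using forms_linear[OF assms, of "[x, x]" 0] forms_linear[OF assms, of "[x, x]" 1] x by (simp_all add: words_def)
qed

lemma forms2_cases:
  assumes "\<phi> \<in> F 2"
  obtains L where "linear_map K L" "src L = T2" "tgt L = X" "\<phi> = form2 L"
proof -
  obtain h where h: "linear_fun K T2 X h"
    "\<And>x y. x \<in> carrier H \<Longrightarrow> y \<in> carrier H \<Longrightarrow> h (pt x y) = \<phi> [x, y]"
    using tensor_lift[OF H H X forms2_bilinear[OF assms]] by blast
  let ?L = "mk_lmap T2 X h"
  have L: "linear_map K ?L" "src ?L = T2" "tgt ?L = X" by (simp_all add: mk_lmap_linear h(1))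
  have "\<phi> = form2 ?L"
    by (rule forms_eqI[OF assms form2_forms[OF L]]) (auto simp: words_num h)
  with L show ?thesis by (rule that)
qed

text \<open>
  Lifting in the first two arguments gives a family of linear maps that is linear in the third.
\<close>

lemma forms3_cases:
  assumes "\<phi> \<in> F 3"
  obtains L where "linear_map K L" "src L = T3" "tgt L = X" "\<phi> = form3 L"
proof -
  have 1: "linear_fun K H X (\<lambda>z. \<phi> [x, y, z])" if "x \<in> carrier H" "y \<in> carrier H" for x y
    using forms_linear[OF assms, of "[x, y, x]" 2] that by (simp add: words_def numeral_2_eq_2)
  have 2: "bilinear_fun K H H X (\<lambda>x y. \<phi> [x, y, z])" if "z \<in> carrier H" for z
    using forms2_bilinear[OF forms_context[of \<phi> 0 2 1 "[]" "[z]"]] assms that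
    by (simp add: words_def numeral_3_eq_3)
  obtain h where h: "\<And>z. z \<in> carrier H \<Longrightarrow> linear_fun K T2 X (h z)"
    "\<And>t. t \<in> carrier T2 \<Longrightarrow> linear_fun K H X (\<lambda>z. h z t)"
    "\<And>z x y. z \<in> carrier H \<Longrightarrow> x \<in> carrier H \<Longrightarrow> y \<in> carrier H \<Longrightarrow> h z (pt x y) = \<phi> [x, y, z]"
    using tensor_lift_family[OF H H H X 1 2] by blast
  have "bilinear_fun K T2 H X (\<lambda>t z. h z t)" using h by (simp add: bilinear_fun_def)
  then obtain k where k: "linear_fun K T3 X k"
    "\<And>t z. t \<in> carrier T2 \<Longrightarrow> z \<in> carrier H \<Longrightarrow> k (pure_tensor K T2 H t z) = h z t"
    using tensor_lift[OF tensor_module[OF H H] H X, of "\<lambda>t z. h z t"] by blast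
  let ?L = "mk_lmap T3 X k"
  have L: "linear_map K ?L" "src ?L = T3" "tgt ?L = X" by (simp_all add: mk_lmap_linear k(1))
  have "\<phi> = form3 ?L"
    by (rule forms_eqI[OF assms form3_forms[OF L]]) (auto simp: words_num h k)
  with L show ?thesis by (rule that)
qed

end

section \<open>Strand operators as precomposition\<close>

lemma app_mem:
  "linear_map K f \<Longrightarrow> src f = A \<Longrightarrow> tgt f = B \<Longrightarrow> t \<in> carrier A \<Longrightarrow> app f t \<in> carrier B"
  using app_closed by metis

lemma tensor_map_pure_lid_right:
  "linear_map K f \<Longrightarrow> src f = A \<Longrightarrow> tgt f = B \<Longrightarrow> module K C \<Longrightarrow> t \<in> carrier A \<Longrightarrow> z \<in> carrier C \<Longrightarrow>
   app (f \<boxtimes>\<^bsub>K\<^esub> lid C) (pure_tensor K A C t z) = pure_tensor K B C (app f t) z"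
  using tensor_map_pure[of K f "lid C" t z] by (simp add: lid_linear)

lemma tensor_map_pure_lid_left:
  "linear_map K f \<Longrightarrow> src f = A \<Longrightarrow> tgt f = B \<Longrightarrow> module K C \<Longrightarrow> t \<in> carrier A \<Longrightarrow> z \<in> carrier C \<Longrightarrow>
   app (lid C \<boxtimes>\<^bsub>K\<^esub> f) (pure_tensor K C A z t) = pure_tensor K C B z (app f t)"
  using tensor_map_pure[of K "lid C" f z t] by (simp add: lid_linear)

lemma lassoc_inv_pure:
  assumes "module K U" "module K V" "module K W" "u \<in> carrier U" "v \<in> carrier V" "w \<in> carrier W"
  shows "app (linv (lassoc K U V W)) (pure_tensor K U (tensor K V W) u (pure_tensor K V W v w)) =
    pure_tensor K (tensor K U V) W (pure_tensor K U V u v) w"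
  using linv_app_app[OF lassoc_lbij[OF assms(1-3)], of "pure_tensor K (tensor K U V) W (pure_tensor K U V u v) w"] assms
  by (simp add: lassoc_src lassoc_pure pure_tensor_closed tensor_module)

context forms_space
begin

lemmas typing [simp] = lmap_typing lunit_l_linear lunit_l_src lunit_l_tgt lunit_r_linear lunit_r_src lunit_r_tgt
lemmas evals = app_mem tensor_map_pure_lid_right tensor_map_pure_lid_left lassoc_inv_pure lassoc_pure
  lunit_l_pure lunit_r_pure

lemmas form_forms = form1_forms form2_forms form3_forms form4_forms

lemma ground [simp]: "module K (ground_module K)" "carrier (ground_module K) = carrier K"
  by (rule ground_module_module[OF H.R.is_cring]) (simp add: ground_module_def)

context
  fixes f
  assumes f: "linear_map K f" "src f = T2" "tgt f = T2"
begin

lemma end_gen_wf: "us \<in> W 2 \<Longrightarrow> (c, w) \<in> set (end_gen K H f us) \<Longrightarrow> c \<in> carrier K \<and> w \<in> W 2"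
  by (rule tensor_words_wf[of "app f (pt (us ! 0) (us ! 1))"])
    (auto simp: words_num end_gen_def intro!: app_mem[OF f])

lemma end_gen_eval:
  assumes "x \<in> carrier H" "y \<in> carrier H" "linear_fun K T2 X G"
    "\<And>a b. a \<in> carrier H \<Longrightarrow> b \<in> carrier H \<Longrightarrow> \<phi> [a, b] = G (pt a b)"
  shows "lincomb X (end_gen K H f [x, y]) \<phi> = G (app f (pt x y))"
  unfolding end_gen_def using tensor_words_eval[of "app f (pt x y)" G \<phi>] assms app_mem[OF f] by simp

lemma strand_end_form2:
  assumes L: "linear_map K L" "src L = T2" "tgt L = X"
  shows "strand H X 2 (end_gen K H f) 0 (form2 L) = form2 (L \<cdot> f)"
proof (rule strand_eqI[where i = 0 and b = 2 and r = 0])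
  fix p us s assume "p \<in> W 0" "us \<in> W 2" "s \<in> W 0"
  then obtain x y where [simp]: "p = []" "us = [x, y]" "s = []" "x \<in> carrier H" "y \<in> carrier H"
    by (auto simp: words_num)
  have "lincomb X (end_gen K H f [x, y]) (\<lambda>w. form2 L (p @ w @ s)) = app L (app f (pt x y))"
    by (rule end_gen_eval) (use linear_map_linear[OF L(1)] L in simp_all)
  thus "lincomb X (end_gen K H f us) (\<lambda>w. form2 L (p @ w @ s)) = form2 (L \<cdot> f) (p @ us @ s)"
    by (simp add: f)
qed (use f L end_gen_wf form_forms in \<open>simp_all add: eval_nat_numeral\<close>)

lemma strand_end_form3_0:
  assumes L: "linear_map K L" "src L = T3" "tgt L = X"
  shows "strand H X 2 (end_gen K H f) 0 (form3 L) = form3 (L \<cdot> (f \<boxtimes>\<^bsub>K\<^esub> lid H))"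
proof (rule strand_eqI[where i = 0 and b = 2 and r = 1])
  fix p us s assume "p \<in> W 0" "us \<in> W 2" "s \<in> W 1"
  then obtain x y z where [simp]: "p = []" "us = [x, y]" "s = [z]" "x \<in> carrier H" "y \<in> carrier H" "z \<in> carrier H"
    by (auto simp: words_num)
  have "lincomb X (end_gen K H f [x, y]) (\<lambda>w. form3 L (p @ w @ s)) = app L (pure_tensor K T2 H (app f (pt x y)) z)"
    by (rule end_gen_eval) (simp_all, intro lin_app[OF L] lin_intros, simp_all)
  thus "lincomb X (end_gen K H f us) (\<lambda>w. form3 L (p @ w @ s)) = form3 (L \<cdot> (f \<boxtimes>\<^bsub>K\<^esub> lid H)) (p @ us @ s)"
    by (simp add: f evals)
qed (use f L end_gen_wf form_forms in \<open>simp_all add: eval_nat_numeral\<close>)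

lemma strand_end_form3_1:
  assumes L: "linear_map K L" "src L = T3" "tgt L = X"
  shows "strand H X 2 (end_gen K H f) 1 (form3 L) =
    form3 (L \<cdot> linv (lassoc K H H H) \<cdot> (lid H \<boxtimes>\<^bsub>K\<^esub> f) \<cdot> lassoc K H H H)"
proof (rule strand_eqI[where i = 1 and b = 2 and r = 0])
  fix p us s assume "p \<in> W 1" "us \<in> W 2" "s \<in> W 0"
  then obtain x y z where [simp]: "p = [x]" "us = [y, z]" "s = []" "x \<in> carrier H" "y \<in> carrier H" "z \<in> carrier H"
    by (auto simp: words_num)
  let ?a = "linv (lassoc K H H H)"
  have "lincomb X (end_gen K H f [y, z]) (\<lambda>w. form3 L (p @ w @ s)) =
    app L (app ?a (pure_tensor K H T2 x (app f (pt y z))))"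
    by (rule end_gen_eval) (simp_all add: evals, intro lin_app[OF L] lin_app[where L = ?a and A = "tensor K H T2"] lin_intros, simp_all)
  thus "lincomb X (end_gen K H f us) (\<lambda>w. form3 L (p @ w @ s)) =
     form3 (L \<cdot> ?a \<cdot> (lid H \<boxtimes>\<^bsub>K\<^esub> f) \<cdot> lassoc K H H H) (p @ us @ s)"
    by (simp add: f evals)
qed (use f L end_gen_wf form_forms in \<open>simp_all add: eval_nat_numeral\<close>)

lemma strand_end_form4_0:
  assumes L: "linear_map K L" "src L = T4" "tgt L = X"
  shows "strand H X 2 (end_gen K H f) 0 (form4 L) = form4 (L \<cdot> (f \<boxtimes>\<^bsub>K\<^esub> lid T2))"
proof (rule strand_eqI[where i = 0 and b = 2 and r = 2])
  fix p us s assume "p \<in> W 0" "us \<in> W 2" "s \<in> W 2"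
  then obtain x y z w where [simp]: "p = []" "us = [x, y]" "s = [z, w]" "x \<in> carrier H" "y \<in> carrier H"
    "z \<in> carrier H" "w \<in> carrier H"
    by (auto simp: words_num)
  have "lincomb X (end_gen K H f [x, y]) (\<lambda>w. form4 L (p @ w @ s)) =
    app L (pure_tensor K T2 T2 (app f (pt x y)) (pt z w))"
    by (rule end_gen_eval) (simp_all, intro lin_app[OF L] lin_intros, simp_all)
  thus "lincomb X (end_gen K H f us) (\<lambda>w. form4 L (p @ w @ s)) = form4 (L \<cdot> (f \<boxtimes>\<^bsub>K\<^esub> lid T2)) (p @ us @ s)"
    by (simp add: f evals)
qed (use f L end_gen_wf form_forms in \<open>simp_all add: eval_nat_numeral\<close>)

lemma strand_end_form4_2:
  assumes L: "linear_map K L" "src L = T4" "tgt L = X"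
  shows "strand H X 2 (end_gen K H f) 2 (form4 L) = form4 (L \<cdot> (lid T2 \<boxtimes>\<^bsub>K\<^esub> f))"
proof (rule strand_eqI[where i = 2 and b = 2 and r = 0])
  fix p us s assume "p \<in> W 2" "us \<in> W 2" "s \<in> W 0"
  then obtain x y z w where [simp]: "p = [x, y]" "us = [z, w]" "s = []" "x \<in> carrier H" "y \<in> carrier H"
    "z \<in> carrier H" "w \<in> carrier H"
    by (auto simp: words_num)
  have "lincomb X (end_gen K H f [z, w]) (\<lambda>w. form4 L (p @ w @ s)) =
    app L (pure_tensor K T2 T2 (pt x y) (app f (pt z w)))"
    by (rule end_gen_eval) (simp_all, intro lin_app[OF L] lin_intros, simp_all)
  thus "lincomb X (end_gen K H f us) (\<lambda>w. form4 L (p @ w @ s)) = form4 (L \<cdot> (lid T2 \<boxtimes>\<^bsub>K\<^esub> f)) (p @ us @ s)"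
    by (simp add: f evals)
qed (use f L end_gen_wf form_forms in \<open>simp_all add: eval_nat_numeral\<close>)

lemma middle_map_typing:
  "linear_map K (middle_map K H f)" "src (middle_map K H f) = T4" "tgt (middle_map K H f) = T4"
  using f by (simp_all add: middle_map_def Let_def lbij_lcomp[of K] lbij_linv tensor_map_lbij)

text \<open>
  The middle two strands belong to different factors of \<open>(H \<otimes> H) \<otimes> (H \<otimes> H)\<close>. The isomorphism \<open>?b\<close> that
  regroups them is the one in the definition of \<open>middle_map\<close>.
\<close>

lemma strand_end_form4_1:
  assumes L: "linear_map K L" "src L = T4" "tgt L = X"
  shows "strand H X 2 (end_gen K H f) 1 (form4 L) = form4 (L \<cdot> middle_map K H f)"
proof (rule strand_eqI[where i = 1 and b = 2 and r = 1])
  fix p us s assume "p \<in> W 1" "us \<in> W 2" "s \<in> W 1"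
  then obtain x y z w where [simp]: "p = [x]" "us = [y, z]" "s = [w]" "x \<in> carrier H" "y \<in> carrier H"
    "z \<in> carrier H" "w \<in> carrier H"
    by (auto simp: words_num)
  let ?b = "(lid H \<boxtimes>\<^bsub>K\<^esub> linv (lassoc K H H H)) \<cdot> lassoc K H H T2"
  have b: "lbij ?b" by (simp add: lbij_lcomp[of K] lbij_linv tensor_map_lbij)
  have bp: "app ?b (pure_tensor K T2 T2 (pt x y) (pt z w)) = pure_tensor K H T3 x (pure_tensor K T2 H (pt y z) w)"
    if "x \<in> carrier H" "y \<in> carrier H" "z \<in> carrier H" "w \<in> carrier H" for x y z w
    using that by (simp add: evals)
  have bi: "app (linv ?b) (pure_tensor K H T3 x (pure_tensor K T2 H (pt y z) w)) = pure_tensor K T2 T2 (pt x y) (pt z w)"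
    if "x \<in> carrier H" "y \<in> carrier H" "z \<in> carrier H" "w \<in> carrier H" for x y z w
    using linv_app_app[OF b, of "pure_tensor K T2 T2 (pt x y) (pt z w)"] that
    unfolding bp[OF that] by simp
  have "lincomb X (end_gen K H f [y, z]) (\<lambda>w. form4 L (p @ w @ s)) =
    app L (app (linv ?b) (pure_tensor K H T3 x (pure_tensor K T2 H (app f (pt y z)) w)))"
  proof (rule end_gen_eval)
    show "linear_fun K T2 X (\<lambda>t. app L (app (linv ?b) (pure_tensor K H T3 x (pure_tensor K T2 H t w))))"
      by (intro lin_app[OF L] lin_app[where L = "linv ?b" and A = "tensor K H T3"] lin_intros) (use b in simp_all)
  qed (simp_all add: bi)
  moreover have "app (middle_map K H f) (pure_tensor K T2 T2 (pt x y) (pt z w)) =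
    app (linv ?b) (pure_tensor K H T3 x (pure_tensor K T2 H (app f (pt y z)) w))"
  proof -
    have "app (middle_map K H f) (pure_tensor K T2 T2 (pt x y) (pt z w)) =
      app (linv ?b) (app (lid H \<boxtimes>\<^bsub>K\<^esub> (f \<boxtimes>\<^bsub>K\<^esub> lid H)) (app ?b (pure_tensor K T2 T2 (pt x y) (pt z w))))"
      by (simp add: middle_map_def Let_def f)
    also have "\<dots> = app (linv ?b) (pure_tensor K H T3 x (pure_tensor K T2 H (app f (pt y z)) w))"
      unfolding bp[OF \<open>x \<in> carrier H\<close> \<open>y \<in> carrier H\<close> \<open>z \<in> carrier H\<close> \<open>w \<in> carrier H\<close>]
      by (simp add: f evals)
    finally show ?thesis .
  qed
  ultimately show "lincomb X (end_gen K H f us) (\<lambda>w. form4 L (p @ w @ s)) = form4 (L \<cdot> middle_map K H f) (p @ us @ s)"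
    by (simp add: middle_map_typing)
qed (use f L end_gen_wf form_forms middle_map_typing in \<open>simp_all add: eval_nat_numeral\<close>)

lemma end_gen_generator: "generator 2 2 (end_gen K H f)"
proof -
  have "strand H X 2 (end_gen K H f) 0 \<phi> \<in> F 2" if "\<phi> \<in> F 2" for \<phi>
    using that by (rule forms2_cases) (simp add: strand_end_form2 form2_forms f)
  thus ?thesis using end_gen_wf by (auto simp: generator_def)
qed

end

context
  fixes d
  assumes d: "linear_map K d" "src d = H" "tgt d = T2"
begin

lemma comult_gen_wf: "us \<in> W 1 \<Longrightarrow> (c, w) \<in> set (comult_gen K H d us) \<Longrightarrow> c \<in> carrier K \<and> w \<in> W 2"
  by (rule tensor_words_wf[of "app d (us ! 0)"])
    (auto simp: words_num comult_gen_def intro!: app_mem[OF d])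

lemma comult_gen_eval:
  assumes "x \<in> carrier H" "linear_fun K T2 X G"
    "\<And>a b. a \<in> carrier H \<Longrightarrow> b \<in> carrier H \<Longrightarrow> \<phi> [a, b] = G (pt a b)"
  shows "lincomb X (comult_gen K H d [x]) \<phi> = G (app d x)"
  unfolding comult_gen_def using tensor_words_eval[of "app d x" G \<phi>] assms app_mem[OF d] by simp

lemma strand_comult_form2:
  assumes L: "linear_map K L" "src L = T2" "tgt L = X"
  shows "strand H X 1 (comult_gen K H d) 0 (form2 L) = form1 (L \<cdot> d)"
proof (rule strand_eqI[where i = 0 and b = 2 and r = 0])
  fix p us s assume "p \<in> W 0" "us \<in> W 1" "s \<in> W 0"
  then obtain x where [simp]: "p = []" "us = [x]" "s = []" "x \<in> carrier H"
    by (auto simp: words_num)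
  have "lincomb X (comult_gen K H d [x]) (\<lambda>w. form2 L (p @ w @ s)) = app L (app d x)"
    by (rule comult_gen_eval) (use linear_map_linear[OF L(1)] L in simp_all)
  thus "lincomb X (comult_gen K H d us) (\<lambda>w. form2 L (p @ w @ s)) = form1 (L \<cdot> d) (p @ us @ s)"
    by (simp add: d)
qed (use d L comult_gen_wf form_forms in \<open>simp_all add: eval_nat_numeral\<close>)

lemma strand_comult_form3_0:
  assumes L: "linear_map K L" "src L = T3" "tgt L = X"
  shows "strand H X 1 (comult_gen K H d) 0 (form3 L) = form2 (L \<cdot> (d \<boxtimes>\<^bsub>K\<^esub> lid H))"
proof (rule strand_eqI[where i = 0 and b = 2 and r = 1])
  fix p us s assume "p \<in> W 0" "us \<in> W 1" "s \<in> W 1"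
  then obtain x y where [simp]: "p = []" "us = [x]" "s = [y]" "x \<in> carrier H" "y \<in> carrier H"
    by (auto simp: words_num)
  have "lincomb X (comult_gen K H d [x]) (\<lambda>w. form3 L (p @ w @ s)) = app L (pure_tensor K T2 H (app d x) y)"
    by (rule comult_gen_eval) (simp_all, intro lin_app[OF L] lin_intros, simp_all)
  thus "lincomb X (comult_gen K H d us) (\<lambda>w. form3 L (p @ w @ s)) = form2 (L \<cdot> (d \<boxtimes>\<^bsub>K\<^esub> lid H)) (p @ us @ s)"
    by (simp add: d evals)
qed (use d L comult_gen_wf form_forms in \<open>simp_all add: eval_nat_numeral\<close>)

lemma strand_comult_form3_1:
  assumes L: "linear_map K L" "src L = T3" "tgt L = X"
  shows "strand H X 1 (comult_gen K H d) 1 (form3 L) = form2 (L \<cdot> linv (lassoc K H H H) \<cdot> (lid H \<boxtimes>\<^bsub>K\<^esub> d))"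
proof (rule strand_eqI[where i = 1 and b = 2 and r = 0])
  fix p us s assume "p \<in> W 1" "us \<in> W 1" "s \<in> W 0"
  then obtain x y where [simp]: "p = [x]" "us = [y]" "s = []" "x \<in> carrier H" "y \<in> carrier H"
    by (auto simp: words_num)
  let ?a = "linv (lassoc K H H H)"
  have "lincomb X (comult_gen K H d [y]) (\<lambda>w. form3 L (p @ w @ s)) =
     app L (app ?a (pure_tensor K H T2 x (app d y)))"
    by (rule comult_gen_eval) (simp_all add: evals, intro lin_app[OF L] lin_app[where L = ?a and A = "tensor K H T2"] lin_intros, simp_all)
  thus "lincomb X (comult_gen K H d us) (\<lambda>w. form3 L (p @ w @ s)) =
    form2 (L \<cdot> ?a \<cdot> (lid H \<boxtimes>\<^bsub>K\<^esub> d)) (p @ us @ s)"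
    by (simp add: d evals)
qed (use d L comult_gen_wf form_forms in \<open>simp_all add: eval_nat_numeral\<close>)

lemma strand_comult_generator: "generator 1 2 (comult_gen K H d)"
proof -
  have "strand H X 1 (comult_gen K H d) 0 \<phi> \<in> F 1" if phi: "\<phi> \<in> F 2" for \<phi>
  proof -
    obtain L where L: "linear_map K L" "src L = T2" "tgt L = X" "\<phi> = form2 L" using phi by (rule forms2_cases)
    show ?thesis unfolding L(4) strand_comult_form2[OF L(1-3)] by (rule form1_forms) (simp_all add: d L)
  qed
  thus ?thesis using comult_gen_wf by (auto simp: generator_def)
qed

lemma strand_comult_comult_form4:
  assumes L: "linear_map K L" "src L = T4" "tgt L = X"
  shows "strand H X 1 (comult_gen K H d) 0 (strand H X 1 (comult_gen K H d) 2 (form4 L)) = form2 (L \<cdot> (d \<boxtimes>\<^bsub>K\<^esub> d))"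
proof (rule strand_eqI[where i = 0 and b = 2 and r = 1])
  have L4: "form4 L \<in> F (2 + 2 + 0)" using form4_forms[OF L] by simp
  show "strand H X 1 (comult_gen K H d) 2 (form4 L) \<in> F (0 + 2 + 1)"
    using strand_forms[OF strand_comult_generator L4] by (simp add: eval_nat_numeral)
  fix p us s assume "p \<in> W 0" "us \<in> W 1" "s \<in> W 1"
  then obtain x y where [simp]: "p = []" "us = [x]" "s = [y]" "x \<in> carrier H" "y \<in> carrier H"
    by (auto simp: words_num)
  have inner: "strand H X 1 (comult_gen K H d) 2 (form4 L) [a, b, y] = app L (pure_tensor K T2 T2 (pt a b) (app d y))"
    if [simp]: "a \<in> carrier H" "b \<in> carrier H" for a b
  proof -
    have "strand H X 1 (comult_gen K H d) 2 (form4 L) ([a, b] @ [y] @ []) =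
      lincomb X (comult_gen K H d [y]) (\<lambda>w. form4 L ([a, b] @ w @ []))"
      by (rule strand_word) (auto simp: words_def)
    also have "\<dots> = app L (pure_tensor K T2 T2 (pt a b) (app d y))"
      by (rule comult_gen_eval) (simp_all, intro lin_app[OF L] lin_intros, simp_all)
    finally show ?thesis by simp
  qed
  have "lincomb X (comult_gen K H d [x]) (\<lambda>w. strand H X 1 (comult_gen K H d) 2 (form4 L) (p @ w @ s)) =
    app L (pure_tensor K T2 T2 (app d x) (app d y))"
    by (rule comult_gen_eval) (simp_all add: inner[unfolded One_nat_def], intro lin_app[OF L] lin_intros, simp_all add: app_mem[OF d])
  thus "lincomb X (comult_gen K H d us) (\<lambda>w. strand H X 1 (comult_gen K H d) 2 (form4 L) (p @ w @ s)) =
    form2 (L \<cdot> (d \<boxtimes>\<^bsub>K\<^esub> d)) (p @ us @ s)"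
    using tensor_map_pure[OF d(1) d(1), of x y] by (simp add: d)
qed (use d L comult_gen_wf form_forms in \<open>simp_all add: eval_nat_numeral\<close>)

end

context
  fixes m
  assumes m: "linear_map K m" "src m = T2" "tgt m = H"
begin

lemma mult_gen_wf: "us \<in> W 2 \<Longrightarrow> (c, w) \<in> set (mult_gen K H m us) \<Longrightarrow> c \<in> carrier K \<and> w \<in> W 1"
  by (auto simp: words_num mult_gen_def intro!: app_mem[OF m])

lemma mult_gen_eval:
  assumes "x \<in> carrier H" "y \<in> carrier H" "\<phi> [app m (pt x y)] \<in> carrier X"
  shows "lincomb X (mult_gen K H m [x, y]) \<phi> = \<phi> [app m (pt x y)]"
  using assms by (simp add: mult_gen_def)

lemma m_mem [simp]: "x \<in> carrier H \<Longrightarrow> y \<in> carrier H \<Longrightarrow> app m (pt x y) \<in> carrier H"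
  by (rule app_mem[OF m]) simp

lemma strand_mult_form1:
  assumes L: "linear_map K L" "src L = H" "tgt L = X"
  shows "strand H X 2 (mult_gen K H m) 0 (form1 L) = form2 (L \<cdot> m)"
proof (rule strand_eqI[where i = 0 and b = 1 and r = 0])
  fix p us s assume "p \<in> W 0" "us \<in> W 2" "s \<in> W 0"
  then obtain x y where [simp]: "p = []" "us = [x, y]" "s = []" "x \<in> carrier H" "y \<in> carrier H"
    by (auto simp: words_num)
  show "lincomb X (mult_gen K H m us) (\<lambda>w. form1 L (p @ w @ s)) = form2 (L \<cdot> m) (p @ us @ s)"
    using m by (simp add: mult_gen_eval app_mem[OF L])
qed (use m L mult_gen_wf form_forms in \<open>simp_all add: eval_nat_numeral\<close>)

lemma strand_mult_form2_0:
  assumes L: "linear_map K L" "src L = T2" "tgt L = X"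
  shows "strand H X 2 (mult_gen K H m) 0 (form2 L) = form3 (L \<cdot> (m \<boxtimes>\<^bsub>K\<^esub> lid H))"
proof (rule strand_eqI[where i = 0 and b = 1 and r = 1])
  fix p us s assume "p \<in> W 0" "us \<in> W 2" "s \<in> W 1"
  then obtain x y z where [simp]: "p = []" "us = [x, y]" "s = [z]" "x \<in> carrier H" "y \<in> carrier H" "z \<in> carrier H"
    by (auto simp: words_num)
  show "lincomb X (mult_gen K H m us) (\<lambda>w. form2 L (p @ w @ s)) = form3 (L \<cdot> (m \<boxtimes>\<^bsub>K\<^esub> lid H)) (p @ us @ s)"
    using m by (simp add: mult_gen_eval app_mem[OF L] evals)
qed (use m L mult_gen_wf form_forms in \<open>simp_all add: eval_nat_numeral\<close>)

lemma strand_mult_form2_1: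
  assumes L: "linear_map K L" "src L = T2" "tgt L = X"
  shows "strand H X 2 (mult_gen K H m) 1 (form2 L) = form3 (L \<cdot> (lid H \<boxtimes>\<^bsub>K\<^esub> m) \<cdot> lassoc K H H H)"
proof (rule strand_eqI[where i = 1 and b = 1 and r = 0])
  fix p us s assume "p \<in> W 1" "us \<in> W 2" "s \<in> W 0"
  then obtain x y z where [simp]: "p = [x]" "us = [y, z]" "s = []" "x \<in> carrier H" "y \<in> carrier H" "z \<in> carrier H"
    by (auto simp: words_num)
  show "lincomb X (mult_gen K H m us) (\<lambda>w. form2 L (p @ w @ s)) =
    form3 (L \<cdot> (lid H \<boxtimes>\<^bsub>K\<^esub> m) \<cdot> lassoc K H H H) (p @ us @ s)"
    using m by (simp add: mult_gen_eval app_mem[OF L] evals)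
qed (use m L mult_gen_wf form_forms in \<open>simp_all add: eval_nat_numeral\<close>)

lemma mult_generator: "generator 2 1 (mult_gen K H m)"
proof -
  have "strand H X 2 (mult_gen K H m) 0 \<phi> \<in> F 2" if phi: "\<phi> \<in> F 1" for \<phi>
  proof -
    obtain L where L: "linear_map K L" "src L = H" "tgt L = X" "\<phi> = form1 L" using phi by (rule forms1_cases)
    show ?thesis unfolding L(4) strand_mult_form1[OF L(1-3)] by (rule form2_forms) (simp_all add: m L)
  qed
  thus ?thesis using mult_gen_wf by (auto simp: generator_def)
qed

lemma strand_mult_mult_form2:
  assumes L: "linear_map K L" "src L = T2" "tgt L = X"
  shows "strand H X 2 (mult_gen K H m) 0 (strand H X 2 (mult_gen K H m) 1 (form2 L)) = form4 (L \<cdot> (m \<boxtimes>\<^bsub>K\<^esub> m))"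
  unfolding strand_mult_form2_1[OF L]
proof (rule strand_eqI[where i = 0 and b = 1 and r = 2])
  fix p us s assume "p \<in> W 0" "us \<in> W 2" "s \<in> W 2"
  then obtain x y z w where [simp]: "p = []" "us = [x, y]" "s = [z, w]" "x \<in> carrier H" "y \<in> carrier H"
    "z \<in> carrier H" "w \<in> carrier H"
    by (auto simp: words_num)
  show "lincomb X (mult_gen K H m us) (\<lambda>w. form3 (L \<cdot> (lid H \<boxtimes>\<^bsub>K\<^esub> m) \<cdot> lassoc K H H H) (p @ w @ s)) =
    form4 (L \<cdot> (m \<boxtimes>\<^bsub>K\<^esub> m)) (p @ us @ s)"
    using m tensor_map_pure[OF m(1) m(1), of "pt x y" "pt z w"]
    by (simp add: mult_gen_eval app_mem[OF L] evals)
qed (use m L mult_gen_wf form_forms in \<open>simp_all add: eval_nat_numeral\<close>)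

end

context
  fixes S
  assumes S: "linear_map K S" "src S = H" "tgt S = H"
begin

lemma map_gen_wf: "us \<in> W 1 \<Longrightarrow> (c, w) \<in> set (map_gen K S us) \<Longrightarrow> c \<in> carrier K \<and> w \<in> W 1"
  by (auto simp: words_num map_gen_def intro!: app_mem[OF S])

lemma map_gen_eval:
  assumes "\<phi> [app S x] \<in> carrier X"
  shows "lincomb X (map_gen K S [x]) \<phi> = \<phi> [app S x]"
  using assms by (simp add: map_gen_def)

lemma strand_map_form1:
  assumes L: "linear_map K L" "src L = H" "tgt L = X"
  shows "strand H X 1 (map_gen K S) 0 (form1 L) = form1 (L \<cdot> S)"
proof (rule strand_eqI[where i = 0 and b = 1 and r = 0])
  fix p us s assume "p \<in> W 0" "us \<in> W 1" "s \<in> W 0"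
  then obtain x where [simp]: "p = []" "us = [x]" "s = []" "x \<in> carrier H"
    by (auto simp: words_num)
  show "lincomb X (map_gen K S us) (\<lambda>w. form1 L (p @ w @ s)) = form1 (L \<cdot> S) (p @ us @ s)"
    using S by (simp add: map_gen_eval app_mem[OF L] app_mem[OF S])
qed (use S L map_gen_wf form_forms in \<open>simp_all add: eval_nat_numeral\<close>)

lemma strand_map_form2_0:
  assumes L: "linear_map K L" "src L = T2" "tgt L = X"
  shows "strand H X 1 (map_gen K S) 0 (form2 L) = form2 (L \<cdot> (S \<boxtimes>\<^bsub>K\<^esub> lid H))"
proof (rule strand_eqI[where i = 0 and b = 1 and r = 1])
  fix p us s assume "p \<in> W 0" "us \<in> W 1" "s \<in> W 1"
  then obtain x y where [simp]: "p = []" "us = [x]" "s = [y]" "x \<in> carrier H" "y \<in> carrier H"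
    by (auto simp: words_num)
  show "lincomb X (map_gen K S us) (\<lambda>w. form2 L (p @ w @ s)) = form2 (L \<cdot> (S \<boxtimes>\<^bsub>K\<^esub> lid H)) (p @ us @ s)"
    using S by (simp add: map_gen_eval app_mem[OF L] app_mem[OF S] evals)
qed (use S L map_gen_wf form_forms in \<open>simp_all add: eval_nat_numeral\<close>)

lemma strand_map_form2_1:
  assumes L: "linear_map K L" "src L = T2" "tgt L = X"
  shows "strand H X 1 (map_gen K S) 1 (form2 L) = form2 (L \<cdot> (lid H \<boxtimes>\<^bsub>K\<^esub> S))"
proof (rule strand_eqI[where i = 1 and b = 1 and r = 0])
  fix p us s assume "p \<in> W 1" "us \<in> W 1" "s \<in> W 0"
  then obtain x y where [simp]: "p = [x]" "us = [y]" "s = []" "x \<in> carrier H" "y \<in> carrier H"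
    by (auto simp: words_num)
  show "lincomb X (map_gen K S us) (\<lambda>w. form2 L (p @ w @ s)) = form2 (L \<cdot> (lid H \<boxtimes>\<^bsub>K\<^esub> S)) (p @ us @ s)"
    using S by (simp add: map_gen_eval app_mem[OF L] app_mem[OF S] evals)
qed (use S L map_gen_wf form_forms in \<open>simp_all add: eval_nat_numeral\<close>)

lemma map_generator: "generator 1 1 (map_gen K S)"
proof -
  have "strand H X 1 (map_gen K S) 0 \<phi> \<in> F 1" if phi: "\<phi> \<in> F 1" for \<phi>
  proof -
    obtain L where L: "linear_map K L" "src L = H" "tgt L = X" "\<phi> = form1 L" using phi by (rule forms1_cases)
    show ?thesis unfolding L(4) strand_map_form1[OF L(1-3)] by (rule form1_forms) (simp_all add: S L)
  qed
  thus ?thesis using map_gen_wf by (auto simp: generator_def)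
qed

end

context
  fixes \<epsilon>
  assumes e: "linear_map K \<epsilon>" "src \<epsilon> = H" "tgt \<epsilon> = ground_module K"
begin

lemma counit_mem [simp]: "x \<in> carrier H \<Longrightarrow> app \<epsilon> x \<in> carrier K"
  using app_mem[OF e] by simp

lemma counit_gen_wf: "us \<in> W 1 \<Longrightarrow> (c, w) \<in> set (counit_gen \<epsilon> us) \<Longrightarrow> c \<in> carrier K \<and> w \<in> W 0"
  by (auto simp: words_num counit_gen_def)

lemma counit_gen_eval:
  assumes "x \<in> carrier H" "\<phi> [] \<in> carrier X"
  shows "lincomb X (counit_gen \<epsilon> [x]) \<phi> = app \<epsilon> x \<odot>\<^bsub>X\<^esub> \<phi> []"
  using assms by (simp add: counit_gen_def)

lemma linear_smult:
  assumes L: "linear_map K L" "src L = A" "tgt L = X" "x \<in> carrier A" "c \<in> carrier K"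
  shows "c \<odot>\<^bsub>X\<^esub> app L x = app L (c \<odot>\<^bsub>A\<^esub> x)"
  using linear_funD(3)[OF linear_map_linear[OF L(1)]] L by simp

lemma strand_counit_form1_0:
  assumes L: "linear_map K L" "src L = H" "tgt L = X"
  shows "strand H X 1 (counit_gen \<epsilon>) 0 (form1 L) = form2 (L \<cdot> lunit_l K H \<cdot> (\<epsilon> \<boxtimes>\<^bsub>K\<^esub> lid H))"
proof (rule strand_eqI[where i = 0 and b = 0 and r = 1])
  fix p us s assume "p \<in> W 0" "us \<in> W 1" "s \<in> W 1"
  then obtain x y where [simp]: "p = []" "us = [x]" "s = [y]" "x \<in> carrier H" "y \<in> carrier H"
    by (auto simp: words_num)
  show "lincomb X (counit_gen \<epsilon> us) (\<lambda>w. form1 L (p @ w @ s)) = form2 (L \<cdot> lunit_l K H \<cdot> (\<epsilon> \<boxtimes>\<^bsub>K\<^esub> lid H)) (p @ us @ s)"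
    using e by (simp add: counit_gen_eval app_mem[OF L] evals linear_smult[OF L])
qed (use e L counit_gen_wf form_forms in \<open>simp_all add: eval_nat_numeral\<close>)

lemma strand_counit_form1_1:
  assumes L: "linear_map K L" "src L = H" "tgt L = X"
  shows "strand H X 1 (counit_gen \<epsilon>) 1 (form1 L) = form2 (L \<cdot> lunit_r K H \<cdot> (lid H \<boxtimes>\<^bsub>K\<^esub> \<epsilon>))"
proof (rule strand_eqI[where i = 1 and b = 0 and r = 0])
  fix p us s assume "p \<in> W 1" "us \<in> W 1" "s \<in> W 0"
  then obtain x y where [simp]: "p = [x]" "us = [y]" "s = []" "x \<in> carrier H" "y \<in> carrier H"
    by (auto simp: words_num)
  show "lincomb X (counit_gen \<epsilon> us) (\<lambda>w. form1 L (p @ w @ s)) = form2 (L \<cdot> lunit_r K H \<cdot> (lid H \<boxtimes>\<^bsub>K\<^esub> \<epsilon>)) (p @ us @ s)"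
    using e by (simp add: counit_gen_eval app_mem[OF L] evals linear_smult[OF L])
qed (use e L counit_gen_wf form_forms in \<open>simp_all add: eval_nat_numeral\<close>)

lemma counit_generator: "generator 1 0 (counit_gen \<epsilon>)"
proof -
  have "strand H X 1 (counit_gen \<epsilon>) 0 \<phi> \<in> F 1" if \<phi>: "\<phi> \<in> F 0" for \<phi>
  proof -
    have c: "\<phi> [] \<in> carrier X" by (rule forms_closed[OF \<phi>])
    have lin: "linear_fun K H X (\<lambda>x. app \<epsilon> x \<odot>\<^bsub>X\<^esub> \<phi> [])"
    proof (rule linear_funI)
      note D = linear_funD[OF linear_map_linear[OF e(1)], unfolded e]
      show "app \<epsilon> x \<odot>\<^bsub>X\<^esub> \<phi> [] \<in> carrier X" if "x \<in> carrier H" for x using that c by simp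
      show "app \<epsilon> (x \<oplus>\<^bsub>H\<^esub> y) \<odot>\<^bsub>X\<^esub> \<phi> [] = app \<epsilon> x \<odot>\<^bsub>X\<^esub> \<phi> [] \<oplus>\<^bsub>X\<^esub> app \<epsilon> y \<odot>\<^bsub>X\<^esub> \<phi> []"
        if "x \<in> carrier H" "y \<in> carrier H" for x y
        using that c D(2)[of x y] by (simp add: ground_module_def X.smult_l_distr)
      show "app \<epsilon> (a \<odot>\<^bsub>H\<^esub> x) \<odot>\<^bsub>X\<^esub> \<phi> [] = a \<odot>\<^bsub>X\<^esub> (app \<epsilon> x \<odot>\<^bsub>X\<^esub> \<phi> [])"
        if "a \<in> carrier K" "x \<in> carrier H" for a x
        using that c D(3)[of a x] by (simp add: ground_module_def X.smult_assoc1)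
    qed
    have L: "linear_map K (mk_lmap H X (\<lambda>x. app \<epsilon> x \<odot>\<^bsub>X\<^esub> \<phi> []))" by (rule mk_lmap_linear[OF H X lin])
    have "strand H X 1 (counit_gen \<epsilon>) 0 \<phi> = form1 (mk_lmap H X (\<lambda>x. app \<epsilon> x \<odot>\<^bsub>X\<^esub> \<phi> []))"
    proof (rule strand_eqI[where i = 0 and b = 0 and r = 0])
      fix p us s assume "p \<in> W 0" "us \<in> W 1" "s \<in> W 0"
      then obtain x where [simp]: "p = []" "us = [x]" "s = []" "x \<in> carrier H" by (auto simp: words_num)
      show "lincomb X (counit_gen \<epsilon> us) (\<lambda>w. \<phi> (p @ w @ s)) =
        form1 (mk_lmap H X (\<lambda>x. app \<epsilon> x \<odot>\<^bsub>X\<^esub> \<phi> [])) (p @ us @ s)"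
        using c by (simp add: counit_gen_eval)
    qed (use \<phi> counit_gen_wf form1_forms[OF L] in simp_all)
    thus ?thesis using form1_forms[OF L] by simp
  qed
  thus ?thesis using counit_gen_wf by (auto simp: generator_def)
qed

end

context
  fixes u
  assumes u: "u \<in> carrier H"
begin

lemma unit_generator: "generator 0 1 (unit_gen K u)"
proof -
  have wf: "c \<in> carrier K \<and> w \<in> W 1" if "us \<in> W 0" "(c, w) \<in> set (unit_gen K u us)" for us c w
    using that u by (auto simp: unit_gen_def words_num)
  have "strand H X 0 (unit_gen K u) 0 \<phi> \<in> F 0" if \<phi>: "\<phi> \<in> F 1" for \<phi>
  proof (rule formsI)
    show "strand H X 0 (unit_gen K u) 0 \<phi> xs = \<zero>\<^bsub>X\<^esub>" if "xs \<notin> W 0" for xs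
      using strand_zero[where f = "unit_gen K u" and a = 0 and b = 1 and i = 0 and r = 0, OF wf] \<phi> that by simp
    show "strand H X 0 (unit_gen K u) 0 \<phi> xs \<in> carrier X" if "xs \<in> W 0" for xs
      using that forms_closed[OF \<phi>] by (simp add: words_num strand_def unit_gen_def)
  qed simp
  thus ?thesis using wf by (auto simp: generator_def)
qed

end

end

section \<open>Relations between the strand operators\<close>

text \<open>
  Strand positions are kept in the form of numerals, in which the relations below are instantiated.
\<close>

declare One_nat_def [simp del]

context forms_space
begin

lemma strand_closed:
  assumes "generator a b f" "\<phi> \<in> F n" "i + b \<le> n" "n + a = n' + b"
  shows "strand H X a f i \<phi> \<in> F n'"
  using strand_forms[OF assms(1), of \<phi> i "n - b - i"] assms(2-4) by (auto simp: algebra_simps)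

lemma interchange:
  assumes "generator a b f" "generator a' b' g" "\<phi> \<in> F n" "i + a \<le> j" "j' + a = j + b" "j' + b' \<le> n"
  shows "strand H X a f i (strand H X a' g j' \<phi>) = strand H X a' g j (strand H X a f i \<phi>)"
proof -
  define q r where "q = j - a - i" and "r = n - b' - j'"
  have j: "j = i + a + q" "j' = i + b + q" using assms(4,5) by (auto simp: q_def)
  have n: "n = i + b + q + b' + r" using assms(6) j by (auto simp: r_def)
  show ?thesis unfolding j by (rule strand_interchange[OF assms(1,2) assms(3)[unfolded n]])
qed

lemma lift_relation:
  assumes "\<phi> \<in> F n" "i + k \<le> n" "typed k ops k'" "typed k ops' k'"
    and "\<And>\<phi>. \<phi> \<in> F k \<Longrightarrow> run ops 0 \<phi> = run ops' 0 \<phi>"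
  shows "run ops i \<phi> = run ops' i \<phi>"
proof -
  have "n = i + k + (n - k - i)" using assms(2) by simp
  with assms(1) have "\<phi> \<in> F (i + k + (n - k - i))" by simp
  from run_lift[OF assms(3,4,5) this] show ?thesis .
qed

lemma relation1:
  assumes "\<phi> \<in> F n" "i + 1 \<le> n"
    and "\<And>L. linear_map K L \<Longrightarrow> src L = H \<Longrightarrow> tgt L = X \<Longrightarrow> run ops 0 (form1 L) = run ops' 0 (form1 L)"
    and "typed 1 ops k" "typed 1 ops' k"
  shows "run ops i \<phi> = run ops' i \<phi>"
  by (rule lift_relation[OF assms(1,2,4,5)]) (metis forms1_cases assms(3))

lemma relation2:
  assumes "\<phi> \<in> F n" "i + 2 \<le> n"
    and "\<And>L. linear_map K L \<Longrightarrow> src L = T2 \<Longrightarrow> tgt L = X \<Longrightarrow> run ops 0 (form2 L) = run ops' 0 (form2 L)"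
    and "typed 2 ops k" "typed 2 ops' k"
  shows "run ops i \<phi> = run ops' i \<phi>"
  by (rule lift_relation[OF assms(1,2,4,5)]) (metis forms2_cases assms(3))

lemma relation3:
  assumes "\<phi> \<in> F n" "i + 3 \<le> n"
    and "\<And>L. linear_map K L \<Longrightarrow> src L = T3 \<Longrightarrow> tgt L = X \<Longrightarrow> run ops 0 (form3 L) = run ops' 0 (form3 L)"
    and "typed 3 ops k" "typed 3 ops' k"
  shows "run ops i \<phi> = run ops' i \<phi>"
  by (rule lift_relation[OF assms(1,2,4,5)]) (metis forms3_cases assms(3))

end

text \<open>
  The operators \<open>P\<close>, \<open>Q\<close>, \<open>M\<close>, \<open>D\<close>, \<open>E\<close>, \<open>U\<close> stand for the braiding, its inverse, product, coproduct, counit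
  and unit. The target X of the forms is arbitrary: equations between maps into \<open>H \<otimes> H\<close> or H are read off
  from the universal forms with values in these spaces.
\<close>

locale braided_strands = forms_space K H X
  for K :: "('k, 'r) ring_scheme" and H :: "('k, 'h) module" and X :: "('k, 'x) module" +
  fixes m u \<Delta> \<epsilon> \<Psi>
  assumes alg: "braided_algebra K H m \<Psi>" and unit: "is_unit K H m u"
    and coalg: "braided_coalgebra K H \<Delta> \<epsilon> \<Psi>"
begin

lemma space: "braided_space K H \<Psi>" using alg by (simp add: braided_algebra_def)

sublocale crossing K H H \<Psi> by (rule braided_space_crossing[OF space])

lemma struct [simp]: "linear_map K m" "src m = T2" "tgt m = H"
  "linear_map K \<Delta>" "src \<Delta> = H" "tgt \<Delta> = T2"
  "linear_map K \<epsilon>" "src \<epsilon> = H" "tgt \<epsilon> = ground_module K"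
  "linear_map K (linv \<Psi>)" "u \<in> carrier H"
  using alg coalg unit by (simp_all add: braided_algebra_iff[OF space] braided_coalgebra_iff[OF space] is_unit_def)

definition "P = strand H X 2 (end_gen K H \<Psi>)"
definition "Q = strand H X 2 (end_gen K H (linv \<Psi>))"
definition "M = strand H X 2 (mult_gen K H m)"
definition "D = strand H X 1 (comult_gen K H \<Delta>)"
definition "E = strand H X 1 (counit_gen \<epsilon>)"
definition "U = strand H X 0 (unit_gen K u)"

lemma P_gen: "generator 2 2 (end_gen K H \<Psi>)" by (rule end_gen_generator) simp_all
lemma Q_gen: "generator 2 2 (end_gen K H (linv \<Psi>))" by (rule end_gen_generator) simp_all
lemma M_gen: "generator 2 1 (mult_gen K H m)" by (rule mult_generator) simp_all
lemma D_gen: "generator 1 2 (comult_gen K H \<Delta>)" by (rule strand_comult_generator) simp_all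
lemma E_gen: "generator 1 0 (counit_gen \<epsilon>)" by (rule counit_generator) simp_all
lemma U_gen: "generator 0 1 (unit_gen K u)" by (rule unit_generator) simp

lemmas gens = P_gen Q_gen M_gen D_gen E_gen U_gen

lemma strands_closed [simp]:
  "\<phi> \<in> F n \<Longrightarrow> i + 2 \<le> n \<Longrightarrow> P i \<phi> \<in> F n"
  "\<phi> \<in> F n \<Longrightarrow> i + 2 \<le> n \<Longrightarrow> Q i \<phi> \<in> F n"
  "\<phi> \<in> F n \<Longrightarrow> i + 1 \<le> n \<Longrightarrow> M i \<phi> \<in> F (Suc n)"
  "\<phi> \<in> F (Suc n) \<Longrightarrow> i + 1 \<le> n \<Longrightarrow> D i \<phi> \<in> F n"
  "\<phi> \<in> F n \<Longrightarrow> i \<le> n \<Longrightarrow> E i \<phi> \<in> F (Suc n)"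
  "\<phi> \<in> F (Suc n) \<Longrightarrow> i \<le> n \<Longrightarrow> U i \<phi> \<in> F n"
  by (simp_all add: P_def Q_def M_def D_def E_def U_def strand_closed[OF P_gen] strand_closed[OF Q_gen]
      strand_closed[OF M_gen] strand_closed[OF D_gen] strand_closed[OF E_gen] strand_closed[OF U_gen])

text \<open>
  Interchange of operators on disjoint blocks; \<open>j'\<close> is the position of the right-hand operator after the
  left-hand one has changed the number of strands.
\<close>

lemma P_M: "\<phi> \<in> F n \<Longrightarrow> i + 2 \<le> j \<Longrightarrow> j' + 2 = j + 2 \<Longrightarrow> j' + 1 \<le> n \<Longrightarrow>
    P i (M j' \<phi>) = M j (P i \<phi>)"
  unfolding P_def M_def by (rule interchange[OF P_gen M_gen])

lemma P_U: "\<phi> \<in> F n \<Longrightarrow> i + 2 \<le> j \<Longrightarrow> j' + 2 = j + 2 \<Longrightarrow> j' + 1 \<le> n \<Longrightarrow>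
    P i (U j' \<phi>) = U j (P i \<phi>)"
  unfolding P_def U_def by (rule interchange[OF P_gen U_gen])

lemma D_P: "\<phi> \<in> F n \<Longrightarrow> i + 1 \<le> j \<Longrightarrow> j' + 1 = j + 2 \<Longrightarrow> j' + 2 \<le> n \<Longrightarrow>
    D i (P j' \<phi>) = P j (D i \<phi>)"
  unfolding D_def P_def by (rule interchange[OF D_gen P_gen])

lemma D_D: "\<phi> \<in> F n \<Longrightarrow> i + 1 \<le> j \<Longrightarrow> j' + 1 = j + 2 \<Longrightarrow> j' + 2 \<le> n \<Longrightarrow>
    D i (D j' \<phi>) = D j (D i \<phi>)"
  unfolding D_def D_def by (rule interchange[OF D_gen D_gen])

lemma M_M: "\<phi> \<in> F n \<Longrightarrow> i + 2 \<le> j \<Longrightarrow> j' + 2 = j + 1 \<Longrightarrow> j' + 1 \<le> n \<Longrightarrow>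
    M i (M j' \<phi>) = M j (M i \<phi>)"
  unfolding M_def M_def by (rule interchange[OF M_gen M_gen])

lemma M_U: "\<phi> \<in> F n \<Longrightarrow> i + 2 \<le> j \<Longrightarrow> j' + 2 = j + 1 \<Longrightarrow> j' + 1 \<le> n \<Longrightarrow>
    M i (U j' \<phi>) = U j (M i \<phi>)"
  unfolding M_def U_def by (rule interchange[OF M_gen U_gen])

lemma E_M: "\<phi> \<in> F n \<Longrightarrow> i + 1 \<le> j \<Longrightarrow> j' + 1 = j + 0 \<Longrightarrow> j' + 1 \<le> n \<Longrightarrow>
    E i (M j' \<phi>) = M j (E i \<phi>)"
  unfolding E_def M_def by (rule interchange[OF E_gen M_gen])

lemma E_E: "\<phi> \<in> F n \<Longrightarrow> i + 1 \<le> j \<Longrightarrow> j' + 1 = j + 0 \<Longrightarrow> j' + 0 \<le> n \<Longrightarrow>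
    E i (E j' \<phi>) = E j (E i \<phi>)"
  unfolding E_def E_def by (rule interchange[OF E_gen E_gen])

lemma M_E: "\<phi> \<in> F n \<Longrightarrow> i + 2 \<le> j \<Longrightarrow> j' + 2 = j + 1 \<Longrightarrow> j' + 0 \<le> n \<Longrightarrow>
    M i (E j' \<phi>) = E j (M i \<phi>)"
  unfolding M_def E_def by (rule interchange[OF M_gen E_gen])

lemma E_D: "\<phi> \<in> F n \<Longrightarrow> i + 1 \<le> j \<Longrightarrow> j' + 1 = j + 0 \<Longrightarrow> j' + 2 \<le> n \<Longrightarrow>
    E i (D j' \<phi>) = D j (E i \<phi>)"
  unfolding E_def D_def by (rule interchange[OF E_gen D_gen])

lemma E_P: "\<phi> \<in> F n \<Longrightarrow> i + 1 \<le> j \<Longrightarrow> j' + 1 = j + 0 \<Longrightarrow> j' + 2 \<le> n \<Longrightarrow>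
    E i (P j' \<phi>) = P j (E i \<phi>)"
  unfolding E_def P_def by (rule interchange[OF E_gen P_gen])


lemmas strand_form_rules = strand_end_form2 strand_end_form3_0 strand_end_form3_1 strand_comult_form2 strand_comult_form3_0
  strand_comult_form3_1 strand_mult_form1 strand_mult_form2_0 strand_mult_form2_1 strand_counit_form1_0
  strand_counit_form1_1

text \<open>
  The axioms of a braided algebra and of a braided coalgebra at an arbitrary position. They hold at
  position 0 because the operators act there by precomposition on linear maps.
\<close>

lemma M_M_assoc:
  assumes "\<phi> \<in> F n" "i + 1 \<le> n"
  shows "M i (M i \<phi>) = M (i + 1) (M i \<phi>)"
proof -
  have "run [(2, 1, mult_gen K H m, 0), (2, 1, mult_gen K H m, 0)] i \<phi> =
    run [(2, 1, mult_gen K H m, 1), (2, 1, mult_gen K H m, 0)] i \<phi>"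
    by (rule relation1[OF assms, where k = 3])
      (use alg in \<open>simp add: strand_form_rules lcomp_assoc[of K] braided_algebra_iff[OF space]\<close>, simp_all add: gens)
  thus ?thesis by (simp add: M_def)
qed

lemma M_P_left:
  assumes "\<phi> \<in> F n" "i + 2 \<le> n"
  shows "M i (P i \<phi>) = P (i + 1) (P i (M (i + 1) \<phi>))"
proof -
  let ?m = "mult_gen K H m" and ?p = "end_gen K H \<Psi>"
  have "mult_compat_l K H H m \<Psi>" using alg by (simp add: braided_algebra_def)
  hence eq: "\<Psi> \<cdot> (m \<boxtimes>\<^bsub>K\<^esub> lid H) = (lid H \<boxtimes>\<^bsub>K\<^esub> m) \<cdot> cross_l K H H \<Psi>" by (simp add: mult_compat_l_iff)
  have "run [(2, 1, ?m, 0), (2, 2, ?p, 0)] i \<phi> = run [(2, 2, ?p, 1), (2, 2, ?p, 0), (2, 1, ?m, 1)] i \<phi>"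
    by (rule relation2[OF assms, where k = 3])
      (simp add: strand_form_rules lcomp_assoc[of K] eq, simp add: cross_l_def lcomp_assoc[of K], simp_all add: gens)
  thus ?thesis by (simp add: M_def P_def)
qed

lemma M_P_right:
  assumes "\<phi> \<in> F n" "i + 2 \<le> n"
  shows "M (i + 1) (P i \<phi>) = P i (P (i + 1) (M i \<phi>))"
proof -
  let ?m = "mult_gen K H m" and ?p = "end_gen K H \<Psi>"
  have "mult_compat_r K H H m \<Psi>" using alg by (simp add: braided_algebra_def)
  hence "\<Psi> \<cdot> (lid H \<boxtimes>\<^bsub>K\<^esub> m) = (m \<boxtimes>\<^bsub>K\<^esub> lid H) \<cdot> cross_r K H H \<Psi>" by (simp add: mult_compat_r_iff)
  hence eq: "\<Psi> \<cdot> (lid H \<boxtimes>\<^bsub>K\<^esub> m) \<cdot> lassoc K H H H = ((m \<boxtimes>\<^bsub>K\<^esub> lid H) \<cdot> cross_r K H H \<Psi>) \<cdot> lassoc K H H H"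
    by (rule lcomp_extend[where K = K]) simp_all
  have "run [(2, 1, ?m, 1), (2, 2, ?p, 0)] i \<phi> = run [(2, 2, ?p, 0), (2, 2, ?p, 1), (2, 1, ?m, 0)] i \<phi>"
    by (rule relation2[OF assms, where k = 3])
      (simp add: strand_form_rules lcomp_assoc[of K] eq, simp add: cross_r_def lcomp_assoc[of K] linv_lcomp[of K] lcomp_lid[of K], simp_all add: gens)
  thus ?thesis by (simp add: M_def P_def)
qed

lemma D_D_coassoc:
  assumes "\<phi> \<in> F n" "i + 3 \<le> n"
  shows "D i (D i \<phi>) = D i (D (i + 1) \<phi>)"
proof -
  let ?d = "comult_gen K H \<Delta>"
  have "lassoc K H H H \<cdot> (\<Delta> \<boxtimes>\<^bsub>K\<^esub> lid H) \<cdot> \<Delta> = (lid H \<boxtimes>\<^bsub>K\<^esub> \<Delta>) \<cdot> \<Delta>"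
    using coalg by (simp add: braided_coalgebra_iff[OF space])
  hence eq: "(\<Delta> \<boxtimes>\<^bsub>K\<^esub> lid H) \<cdot> \<Delta> = linv (lassoc K H H H) \<cdot> (lid H \<boxtimes>\<^bsub>K\<^esub> \<Delta>) \<cdot> \<Delta>"
    using linv_lcomp_cancel[of K "lassoc K H H H" "(\<Delta> \<boxtimes>\<^bsub>K\<^esub> lid H) \<cdot> \<Delta>"] by simp
  have "run [(1, 2, ?d, 0), (1, 2, ?d, 0)] i \<phi> = run [(1, 2, ?d, 0), (1, 2, ?d, 1)] i \<phi>"
    by (rule relation3[OF assms, where k = 1])
      (simp add: strand_form_rules lcomp_assoc[of K] eq, simp_all add: gens)
  thus ?thesis by (simp add: D_def)
qed

lemma P_D_right:
  assumes "\<phi> \<in> F n" "i + 3 \<le> n"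
  shows "P i (D (i + 1) \<phi>) = D i (P (i + 1) (P i \<phi>))"
proof -
  let ?d = "comult_gen K H \<Delta>" and ?p = "end_gen K H \<Psi>"
  have "comult_compat_l K H H \<Delta> \<epsilon> \<Psi>" using coalg by (simp add: braided_coalgebra_def)
  hence eq: "(lid H \<boxtimes>\<^bsub>K\<^esub> \<Delta>) \<cdot> \<Psi> = cross_l K H H \<Psi> \<cdot> (\<Delta> \<boxtimes>\<^bsub>K\<^esub> lid H)" by (simp add: comult_compat_l_iff)
  have "run [(2, 2, ?p, 0), (1, 2, ?d, 1)] i \<phi> = run [(1, 2, ?d, 0), (2, 2, ?p, 1), (2, 2, ?p, 0)] i \<phi>"
    by (rule relation3[OF assms, where k = 2])
      (simp add: strand_form_rules lcomp_assoc[of K] eq, simp add: cross_l_def lcomp_assoc[of K] linv_lcomp_cancel[of K], simp_all add: gens)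
  thus ?thesis by (simp add: D_def P_def)
qed

lemma P_D_left:
  assumes "\<phi> \<in> F n" "i + 3 \<le> n"
  shows "P i (D i \<phi>) = D (i + 1) (P i (P (i + 1) \<phi>))"
proof -
  let ?d = "comult_gen K H \<Delta>" and ?p = "end_gen K H \<Psi>"
  have "comult_compat_r K H H \<Delta> \<epsilon> \<Psi>" using coalg by (simp add: braided_coalgebra_def)
  hence eq: "(\<Delta> \<boxtimes>\<^bsub>K\<^esub> lid H) \<cdot> \<Psi> = cross_r K H H \<Psi> \<cdot> (lid H \<boxtimes>\<^bsub>K\<^esub> \<Delta>)" by (simp add: comult_compat_r_iff)
  have "run [(2, 2, ?p, 0), (1, 2, ?d, 0)] i \<phi> = run [(1, 2, ?d, 1), (2, 2, ?p, 0), (2, 2, ?p, 1)] i \<phi>"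
    by (rule relation3[OF assms, where k = 2])
      (simp add: strand_form_rules lcomp_assoc[of K] eq, simp add: cross_r_def lcomp_assoc[of K] linv_lcomp_cancel[of K], simp_all add: gens)
  thus ?thesis by (simp add: D_def P_def)
qed

lemma D_E_left:
  assumes "\<phi> \<in> F n" "i + 1 \<le> n"
  shows "D i (E i \<phi>) = \<phi>"
proof -
  let ?d = "comult_gen K H \<Delta>" and ?e = "counit_gen \<epsilon>"
  have "run [(1, 2, ?d, 0), (1, 0, ?e, 0)] i \<phi> = run [] i \<phi>"
    by (rule relation1[OF assms, where k = 1])
      (use coalg in \<open>simp add: strand_form_rules lcomp_assoc[of K] lcomp_lid[of K] braided_coalgebra_iff[OF space]\<close>, simp_all add: gens)
  thus ?thesis by (simp add: D_def E_def)
qed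

lemma D_E_right:
  assumes "\<phi> \<in> F n" "i + 1 \<le> n"
  shows "D i (E (i + 1) \<phi>) = \<phi>"
proof -
  let ?d = "comult_gen K H \<Delta>" and ?e = "counit_gen \<epsilon>"
  have "run [(1, 2, ?d, 0), (1, 0, ?e, 1)] i \<phi> = run [] i \<phi>"
    by (rule relation1[OF assms, where k = 1])
      (use coalg in \<open>simp add: strand_form_rules lcomp_assoc[of K] lcomp_lid[of K] braided_coalgebra_iff[OF space]\<close>, simp_all add: gens)
  thus ?thesis by (simp add: D_def E_def)
qed

lemma P_E_right:
  assumes "\<phi> \<in> F n" "i + 1 \<le> n"
  shows "P i (E (i + 1) \<phi>) = E i \<phi>"
proof -
  let ?p = "end_gen K H \<Psi>" and ?e = "counit_gen \<epsilon>"
  have c: "comult_compat_l K H H \<Delta> \<epsilon> \<Psi>" using coalg by (simp add: braided_coalgebra_def)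
  have "run [(2, 2, ?p, 0), (1, 0, ?e, 1)] i \<phi> = run [(1, 0, ?e, 0)] i \<phi>"
    by (rule relation1[OF assms, where k = 2])
      (use c in \<open>simp add: strand_form_rules lcomp_assoc[of K] comult_compat_l_iff\<close>, simp_all add: gens)
  thus ?thesis by (simp add: P_def E_def)
qed

lemma unit_word:
  assumes "p \<in> W i" "set s \<subseteq> carrier H" "\<phi> \<in> F n"
  shows "strand H X 0 (unit_gen K u) i \<phi> (p @ s) = \<phi> (p @ u # s)"
  using strand_word[OF assms(1), of "[]" 0 s "unit_gen K u" \<phi>] assms(2) forms_closed[OF assms(3)]
  by (simp add: words_def unit_gen_def)

lemma form1_unit:
  assumes "\<psi> \<in> F 2" "\<phi> \<in> F 1" "\<And>x. x \<in> carrier H \<Longrightarrow> \<psi> [u, x] = \<phi> [x]"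
  shows "strand H X 0 (unit_gen K u) 0 \<psi> = \<phi>"
proof (rule forms_eqI[OF strand_closed[OF U_gen assms(1)] assms(2)])
  fix xs assume "xs \<in> W 1"
  then obtain x where x: "xs = [x]" "x \<in> carrier H" by (auto simp: words_num One_nat_def)
  show "strand H X 0 (unit_gen K u) 0 \<psi> xs = \<phi> xs"
    using unit_word[of "[]" 0 "[x]" \<psi> 2] x assms by (simp add: words_def)
qed simp_all

lemma form1_unit':
  assumes "\<psi> \<in> F 2" "\<phi> \<in> F 1" "\<And>x. x \<in> carrier H \<Longrightarrow> \<psi> [x, u] = \<phi> [x]"
  shows "strand H X 0 (unit_gen K u) 1 \<psi> = \<phi>"
proof (rule forms_eqI[OF strand_closed[OF U_gen assms(1)] assms(2)])
  fix xs assume "xs \<in> W 1"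
  then obtain x where x: "xs = [x]" "x \<in> carrier H" by (auto simp: words_num One_nat_def)
  show "strand H X 0 (unit_gen K u) 1 \<psi> xs = \<phi> xs"
    using unit_word[of "[x]" 1 "[]" \<psi> 2] x assms by (simp add: words_def)
qed simp_all

lemma U_M:
  assumes "\<phi> \<in> F n" "i + 1 \<le> n"
  shows U_M_left: "U i (M i \<phi>) = \<phi>" and U_M_right: "U (i + 1) (M i \<phi>) = \<phi>"
proof -
  let ?m = "mult_gen K H m" and ?u = "unit_gen K u"
  have un: "app m (pt u x) = x" "app m (pt x u) = x" if "x \<in> carrier H" for x
    using unit that by (simp_all add: is_unit_def)
  have "run [(0, 1, ?u, 0), (2, 1, ?m, 0)] i \<phi> = run [] i \<phi>"
  proof (rule lift_relation[OF assms, where k' = 1])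
    fix \<phi> assume \<phi>: "\<phi> \<in> F 1"
    then obtain L where L [simp]: "linear_map K L" "src L = H" "tgt L = X" "\<phi> = form1 L" by (rule forms1_cases)
    show "run [(0, 1, ?u, 0), (2, 1, ?m, 0)] 0 \<phi> = run [] 0 \<phi>"
      using form1_unit[of "form2 (L \<cdot> m)" "form1 L"] \<phi> by (simp add: strand_form_rules form2_forms un)
  qed (simp_all add: gens)
  thus "U i (M i \<phi>) = \<phi>" by (simp add: U_def M_def)
  have "run [(0, 1, ?u, 1), (2, 1, ?m, 0)] i \<phi> = run [] i \<phi>"
  proof (rule lift_relation[OF assms, where k' = 1])
    fix \<phi> assume \<phi>: "\<phi> \<in> F 1"
    then obtain L where L [simp]: "linear_map K L" "src L = H" "tgt L = X" "\<phi> = form1 L" by (rule forms1_cases)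
    show "run [(0, 1, ?u, 1), (2, 1, ?m, 0)] 0 \<phi> = run [] 0 \<phi>"
      using form1_unit'[of "form2 (L \<cdot> m)" "form1 L"] \<phi> by (simp add: strand_form_rules form2_forms un)
  qed (simp_all add: gens)
  thus "U (i + 1) (M i \<phi>) = \<phi>" by (simp add: U_def M_def)
qed

lemma U_P:
  assumes "\<phi> \<in> F n" "i + 2 \<le> n"
  shows "U i (P i \<phi>) = U (i + 1) \<phi>"
proof -
  let ?p = "end_gen K H \<Psi>" and ?u = "unit_gen K u"
  have "mult_compat_l K H H m \<Psi>" using alg by (simp add: braided_algebra_def)
  hence un: "app \<Psi> (pt u x) = pt x u" if "x \<in> carrier H" for x
    using that unit by (simp add: mult_compat_l_def)
  have "run [(0, 1, ?u, 0), (2, 2, ?p, 0)] i \<phi> = run [(0, 1, ?u, 1)] i \<phi>"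
  proof (rule lift_relation[OF assms, where k' = 1])
    fix \<phi> assume \<phi>: "\<phi> \<in> F 2"
    then obtain L where L [simp]: "linear_map K L" "src L = T2" "tgt L = X" "\<phi> = form2 L" by (rule forms2_cases)
    have "strand H X 0 ?u 1 (form2 L) \<in> F 1" by (rule strand_closed[OF U_gen, of _ 2]) (simp_all add: form2_forms)
    moreover have "strand H X 0 ?u 1 (form2 L) [x] = app L (pt x u)" if "x \<in> carrier H" for x
      using unit_word[of "[x]" 1 "[]" "form2 L" 2] that by (simp add: words_def form2_forms)
    ultimately show "run [(0, 1, ?u, 0), (2, 2, ?p, 0)] 0 \<phi> = run [(0, 1, ?u, 1)] 0 \<phi>"
      using form1_unit[of "form2 (L \<cdot> \<Psi>)" "strand H X 0 ?u 1 (form2 L)"] by (simp add: strand_form_rules form2_forms un)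
  qed (simp_all add: gens)
  thus ?thesis by (simp add: U_def P_def)
qed

lemma P_Q:
  assumes "\<phi> \<in> F n" "i + 2 \<le> n"
  shows P_Q_cancel: "P i (Q i \<phi>) = \<phi>" and Q_P_cancel: "Q i (P i \<phi>) = \<phi>"
proof -
  let ?p = "end_gen K H \<Psi>" and ?q = "end_gen K H (linv \<Psi>)"
  have "run [(2, 2, ?p, 0), (2, 2, ?q, 0)] i \<phi> = run [] i \<phi>"
    by (rule relation2[OF assms, where k = 2])
      (simp add: strand_form_rules lcomp_assoc[of K] linv_lcomp[of K] lcomp_lid[of K], simp_all add: gens)
  thus "P i (Q i \<phi>) = \<phi>" by (simp add: P_def Q_def)
  have "run [(2, 2, ?q, 0), (2, 2, ?p, 0)] i \<phi> = run [] i \<phi>"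
    by (rule relation2[OF assms, where k = 2])
      (simp add: strand_form_rules lcomp_assoc[of K] lcomp_linv[of K] lcomp_lid[of K], simp_all add: gens)
  thus "Q i (P i \<phi>) = \<phi>" by (simp add: P_def Q_def)
qed

end

text \<open>
  The bialgebra axiom has two coproducts, a braiding of the middle strands, and two products.
\<close>

locale bialgebra_strands = braided_strands +
  assumes bialg: "\<Delta> \<cdot> m = (m \<boxtimes>\<^bsub>K\<^esub> m) \<cdot> middle_map K H \<Psi> \<cdot> (\<Delta> \<boxtimes>\<^bsub>K\<^esub> \<Delta>)"
begin

lemma M_D:
  assumes "\<phi> \<in> F n" "i + 2 \<le> n"
  shows "M i (D i \<phi>) = D i (D (i + 2) (P (i + 1) (M i (M (i + 1) \<phi>))))"
proof -
  let ?d = "comult_gen K H \<Delta>" and ?p = "end_gen K H \<Psi>" and ?m = "mult_gen K H m"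
  have "run [(2, 1, ?m, 0), (1, 2, ?d, 0)] i \<phi> =
    run [(1, 2, ?d, 0), (1, 2, ?d, 2), (2, 2, ?p, 1), (2, 1, ?m, 0), (2, 1, ?m, 1)] i \<phi>"
  proof (rule lift_relation[OF assms, where k' = 2])
    fix \<phi> assume "\<phi> \<in> F 2"
    then obtain L where L [simp]: "linear_map K L" "src L = T2" "tgt L = X" "\<phi> = form2 L" by (rule forms2_cases)
    have "strand H X 2 ?m 0 (strand H X 2 ?m 1 (form2 L)) = form4 (L \<cdot> (m \<boxtimes>\<^bsub>K\<^esub> m))"
      by (rule strand_mult_mult_form2) simp_all
    moreover have "strand H X 2 ?p 1 (form4 (L \<cdot> (m \<boxtimes>\<^bsub>K\<^esub> m))) = form4 ((L \<cdot> (m \<boxtimes>\<^bsub>K\<^esub> m)) \<cdot> middle_map K H \<Psi>)"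
      by (rule strand_end_form4_1) simp_all
    moreover have "strand H X 1 ?d 0 (strand H X 1 ?d 2 (form4 ((L \<cdot> (m \<boxtimes>\<^bsub>K\<^esub> m)) \<cdot> middle_map K H \<Psi>))) =
      form2 (((L \<cdot> (m \<boxtimes>\<^bsub>K\<^esub> m)) \<cdot> middle_map K H \<Psi>) \<cdot> (\<Delta> \<boxtimes>\<^bsub>K\<^esub> \<Delta>))"
      by (rule strand_comult_comult_form4) (simp_all add: middle_map_typing)
    ultimately show "run [(2, 1, ?m, 0), (1, 2, ?d, 0)] 0 \<phi> =
      run [(1, 2, ?d, 0), (1, 2, ?d, 2), (2, 2, ?p, 1), (2, 1, ?m, 0), (2, 1, ?m, 1)] 0 \<phi>"
      by (simp add: strand_form_rules lcomp_assoc[of K] bialg middle_map_typing)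
  qed (simp_all add: gens)
  thus ?thesis by (simp add: M_def P_def D_def)
qed

end

locale antipode_strands = braided_strands +
  fixes S
  assumes S [simp]: "linear_map K S" "src S = H" "tgt S = H"
    and antipode_left: "m \<cdot> (S \<boxtimes>\<^bsub>K\<^esub> lid H) \<cdot> \<Delta> = unit_counit H u \<epsilon>"
    and antipode_right: "m \<cdot> (lid H \<boxtimes>\<^bsub>K\<^esub> S) \<cdot> \<Delta> = unit_counit H u \<epsilon>"
begin

definition "A = strand H X 1 (map_gen K S)"

end

section \<open>String diagram calculations\<close>

context bialgebra_strands
begin

text \<open>
  \<open>P\<close> slides through both coproducts as \<open>P 1, P 0, P 2, P 1\<close>, the crossing of two strands over two.
  Its last three factors are cancelled by the inverse braidings.
\<close>

lemma P_D_D_op: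
  assumes "\<phi> \<in> F n" "2 \<le> n"
  shows "P 0 (D 0 (D 2 (Q 1 (Q 2 (Q 0 (M 0 (M 1 \<phi>))))))) = M 0 (D 0 \<phi>)"
proof -
  have "P 0 (D 0 (D 2 (Q 1 (Q 2 (Q 0 (M 0 (M 1 \<phi>))))))) = D 1 (P 0 (P 1 (D 2 (Q 1 (Q 2 (Q 0 (M 0 (M 1 \<phi>))))))))"
    using assms by (simp add: P_D_left[where n = "Suc n" and i = 0, simplified])
  also have "\<dots> = D 1 (P 0 (D 1 (P 2 (P 1 (Q 1 (Q 2 (Q 0 (M 0 (M 1 \<phi>)))))))))"
    using assms by (simp add: P_D_right[where n = "Suc (Suc n)" and i = 1, simplified])
  also have "\<dots> = D 1 (D 0 (P 1 (P 0 (P 2 (P 1 (Q 1 (Q 2 (Q 0 (M 0 (M 1 \<phi>))))))))))"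
    using assms by (simp add: P_D_right[where n = "Suc (Suc n)" and i = 0, simplified])
  also have "\<dots> = D 1 (D 0 (P 1 (P 0 (P 2 (Q 2 (Q 0 (M 0 (M 1 \<phi>))))))))"
    using assms by (simp add: P_Q_cancel[where n = "Suc (Suc n)" and i = 1, simplified])
  also have "\<dots> = D 1 (D 0 (P 1 (P 0 (Q 0 (M 0 (M 1 \<phi>))))))"
    using assms by (simp add: P_Q_cancel[where n = "Suc (Suc n)" and i = 2, simplified])
  also have "\<dots> = D 1 (D 0 (P 1 (M 0 (M 1 \<phi>))))"
    using assms by (simp add: P_Q_cancel[where n = "Suc (Suc n)" and i = 0, simplified])
  also have "\<dots> = D 0 (D 2 (P 1 (M 0 (M 1 \<phi>))))"
    using assms by (simp add: D_D[where n = "Suc (Suc n)" and i = 0 and j = 1 and j' = 2, symmetric])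
  also have "\<dots> = M 0 (D 0 \<phi>)"
    using assms by (simp add: M_D[where n = "n" and i = 0, simplified add_0, symmetric])
  finally have one: "P 0 (D 0 (D 2 (Q 1 (Q 2 (Q 0 (M 0 (M 1 \<phi>))))))) = M 0 (D 0 \<phi>)" .
  show ?thesis by (rule one)
qed

text \<open>
  Here \<open>P\<close> slides backwards through both products and its first three factors are cancelled.
\<close>

lemma D_D_cop_P:
  assumes "\<phi> \<in> F n" "2 \<le> n"
  shows "D 0 (D 2 (Q 2 (Q 0 (Q 1 (M 0 (M 1 (P 0 \<phi>))))))) = M 0 (D 0 \<phi>)"
proof -
  have "D 0 (D 2 (Q 2 (Q 0 (Q 1 (M 0 (M 1 (P 0 \<phi>))))))) = D 0 (D 2 (Q 2 (Q 0 (Q 1 (M 0 (P 0 (P 1 (M 0 \<phi>))))))))"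
    using assms by (simp add: M_P_right[where n = "n" and i = 0, simplified])
  also have "\<dots> = D 0 (D 2 (Q 2 (Q 0 (Q 1 (P 1 (P 0 (M 1 (P 1 (M 0 \<phi>)))))))))"
    using assms by (simp add: M_P_left[where n = "Suc n" and i = 0, simplified])
  also have "\<dots> = D 0 (D 2 (Q 2 (Q 0 (Q 1 (P 1 (P 0 (P 2 (P 1 (M 2 (M 0 \<phi>))))))))))"
    using assms by (simp add: M_P_left[where n = "Suc n" and i = 1, simplified])
  also have "\<dots> = D 0 (D 2 (Q 2 (Q 0 (P 0 (P 2 (P 1 (M 2 (M 0 \<phi>))))))))"
    using assms by (simp add: Q_P_cancel[where n = "Suc (Suc n)" and i = 1, simplified])
  also have "\<dots> = D 0 (D 2 (Q 2 (P 2 (P 1 (M 2 (M 0 \<phi>))))))"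
    using assms by (simp add: Q_P_cancel[where n = "Suc (Suc n)" and i = 0, simplified])
  also have "\<dots> = D 0 (D 2 (P 1 (M 2 (M 0 \<phi>))))"
    using assms by (simp add: Q_P_cancel[where n = "Suc (Suc n)" and i = 2, simplified])
  also have "\<dots> = D 0 (D 2 (P 1 (M 0 (M 1 \<phi>))))"
    using assms by (simp add: M_M[where n = "n" and i = 0 and j = 2 and j' = 1, symmetric])
  also have "\<dots> = M 0 (D 0 \<phi>)"
    using assms by (simp add: M_D[where n = "n" and i = 0, simplified add_0, symmetric])
  finally have one: "D 0 (D 2 (Q 2 (Q 0 (Q 1 (M 0 (M 1 (P 0 \<phi>))))))) = M 0 (D 0 \<phi>)" .
  show ?thesis by (rule one)
qed

end

context antipode_strands
begin

lemma A_gen: "generator 1 1 (map_gen K S)" by (rule map_generator) simp_all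

lemma A_closed [simp]: "\<phi> \<in> F n \<Longrightarrow> i + 1 \<le> n \<Longrightarrow> A i \<phi> \<in> F n"
  by (simp add: A_def strand_closed[OF A_gen])

lemma A_M: "\<phi> \<in> F n \<Longrightarrow> i + 1 \<le> j \<Longrightarrow> j' + 1 = j + 1 \<Longrightarrow> j' + 1 \<le> n \<Longrightarrow>
    A i (M j' \<phi>) = M j (A i \<phi>)"
  unfolding A_def M_def by (rule interchange[OF A_gen M_gen])

lemma A_U: "\<phi> \<in> F n \<Longrightarrow> i + 1 \<le> j \<Longrightarrow> j' + 1 = j + 1 \<Longrightarrow> j' + 1 \<le> n \<Longrightarrow>
    A i (U j' \<phi>) = U j (A i \<phi>)"
  unfolding A_def U_def by (rule interchange[OF A_gen U_gen])

lemma D_A: "\<phi> \<in> F n \<Longrightarrow> i + 1 \<le> j \<Longrightarrow> j' + 1 = j + 2 \<Longrightarrow> j' + 1 \<le> n \<Longrightarrow>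
    D i (A j' \<phi>) = A j (D i \<phi>)"
  unfolding D_def A_def by (rule interchange[OF D_gen A_gen])

lemma E_A: "\<phi> \<in> F n \<Longrightarrow> i + 1 \<le> j \<Longrightarrow> j' + 1 = j + 0 \<Longrightarrow> j' + 1 \<le> n \<Longrightarrow>
    E i (A j' \<phi>) = A j (E i \<phi>)"
  unfolding E_def A_def by (rule interchange[OF E_gen A_gen])


lemma unit_counit_typing [simp]: "linear_map K (unit_counit H u \<epsilon>)"
  "src (unit_counit H u \<epsilon>) = H" "tgt (unit_counit H u \<epsilon>) = H"
  unfolding antipode_left[symmetric] by simp_all

lemma strand_unit_counit:
  assumes L [simp]: "linear_map K L" "src L = H" "tgt L = X"
  shows "strand H X 1 (counit_gen \<epsilon>) 0 (strand H X 0 (unit_gen K u) 0 (form1 L)) = form1 (L \<cdot> unit_counit H u \<epsilon>)"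
proof (rule strand_eqI[where i = 0 and b = 0 and r = 0])
  have U0: "strand H X 0 (unit_gen K u) 0 (form1 L) \<in> F 0"
    by (rule strand_closed[OF U_gen form1_forms[OF L]]) simp_all
  thus "strand H X 0 (unit_gen K u) 0 (form1 L) \<in> F (0 + 0 + 0)" by simp
  fix p us s assume "p \<in> W 0" "us \<in> W 1" "s \<in> W 0"
  then obtain x where [simp]: "p = []" "us = [x]" "s = []" "x \<in> carrier H"
    by (auto simp: words_num One_nat_def)
  have "strand H X 0 (unit_gen K u) 0 (form1 L) [] = app L u"
    using unit_word[of "[]" 0 "[]" "form1 L" 1] by (simp add: words_def form1_forms)
  hence "lincomb X (counit_gen \<epsilon> us) (\<lambda>w. strand H X 0 (unit_gen K u) 0 (form1 L) (p @ w @ s)) =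
    app \<epsilon> x \<odot>\<^bsub>X\<^esub> app L u"
    by (simp add: counit_gen_eval app_mem[OF L])
  also have "\<dots> = form1 (L \<cdot> unit_counit H u \<epsilon>) (p @ us @ s)"
    by (simp add: unit_counit_def linear_smult[OF struct(7-9) L])
  finally show "lincomb X (counit_gen \<epsilon> us) (\<lambda>w. strand H X 0 (unit_gen K u) 0 (form1 L) (p @ w @ s)) =
    form1 (L \<cdot> unit_counit H u \<epsilon>) (p @ us @ s)" .
qed (use counit_gen_wf[OF struct(7-9)] in \<open>simp_all add: form1_forms\<close>)

lemma D_A_M:
  assumes "\<phi> \<in> F n" "i + 1 \<le> n"
  shows D_A_M_left: "D i (A i (M i \<phi>)) = E i (U i \<phi>)"
    and D_A_M_right: "D i (A (i + 1) (M i \<phi>)) = E i (U i \<phi>)"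
proof -
  let ?d = "comult_gen K H \<Delta>" and ?s = "map_gen K S" and ?m = "mult_gen K H m"
    and ?e = "counit_gen \<epsilon>" and ?u = "unit_gen K u"
  have "run [(1, 2, ?d, 0), (1, 1, ?s, 0), (2, 1, ?m, 0)] i \<phi> = run [(1, 0, ?e, 0), (0, 1, ?u, 0)] i \<phi>"
    by (rule relation1[OF assms, where k = 1])
      (simp add: strand_form_rules strand_map_form2_0 strand_unit_counit lcomp_assoc[of K] antipode_left, simp_all add: gens A_gen)
  thus "D i (A i (M i \<phi>)) = E i (U i \<phi>)" by (simp add: D_def A_def M_def E_def U_def)
  have "run [(1, 2, ?d, 0), (1, 1, ?s, 1), (2, 1, ?m, 0)] i \<phi> = run [(1, 0, ?e, 0), (0, 1, ?u, 0)] i \<phi>"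
    by (rule relation1[OF assms, where k = 1])
      (simp add: strand_form_rules strand_map_form2_1 strand_unit_counit lcomp_assoc[of K] antipode_right, simp_all add: gens A_gen)
  thus "D i (A (i + 1) (M i \<phi>)) = E i (U i \<phi>)" by (simp add: D_def A_def M_def E_def U_def)
qed

text \<open>
  The maps \<open>F * G = (id \<otimes> m) (F \<otimes> id) (id \<otimes> G) (\<Delta> \<otimes> id)\<close> define an associative convolution product of
  endomorphisms of \<open>H \<otimes> H\<close>, with unit \<open>x \<otimes> w \<mapsto> \<epsilon>(x) w \<otimes> 1\<close>. The word evaluated in two ways below is
  \<open>((id \<otimes> S) \<Psi>) * \<Psi> * (\<Psi> (S \<otimes> id))\<close>: the last two factors cancel, and so do the first two.
\<close>

lemma A_P:
  assumes "\<phi> \<in> F n" "2 \<le> n"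
  shows "P 0 (A 1 \<phi>) = A 0 (P 0 \<phi>)"
proof -
  have "D 0 (D 0 (A 2 (P 2 (P 1 (P 0 (A 1 (M 1 (M 1 \<phi>)))))))) = D 0 (D 1 (A 2 (P 2 (P 1 (P 0 (A 1 (M 1 (M 1 \<phi>))))))))"
    using assms by (simp add: D_D_coassoc[where n = "Suc (Suc n)" and i = 0, simplified])
  also have "\<dots> = D 0 (D 1 (A 2 (P 2 (P 1 (P 0 (A 1 (M 2 (M 1 \<phi>))))))))"
    using assms by (simp add: M_M_assoc[where n = "n" and i = 1, simplified])
  also have "\<dots> = D 0 (D 1 (A 2 (P 2 (P 1 (P 0 (M 2 (A 1 (M 1 \<phi>))))))))"
    using assms by (simp add: A_M[where n = "Suc n" and i = 1 and j = 2 and j' = 2])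
  also have "\<dots> = D 0 (D 1 (A 2 (P 2 (P 1 (M 2 (P 0 (A 1 (M 1 \<phi>))))))))"
    using assms by (simp add: P_M[where n = "Suc n" and i = 0 and j = 2 and j' = 2])
  also have "\<dots> = D 0 (D 1 (A 2 (M 1 (P 1 (P 0 (A 1 (M 1 \<phi>)))))))"
    using assms by (simp add: M_P_left[where n = "Suc n" and i = 1, simplified, symmetric])
  also have "\<dots> = D 0 (E 1 (U 1 (P 1 (P 0 (A 1 (M 1 \<phi>))))))"
    using assms by (simp add: D_A_M_right[where n = "Suc n" and i = 1, simplified])
  also have "\<dots> = U 1 (P 1 (P 0 (A 1 (M 1 \<phi>))))"
    using assms by (simp add: D_E_right[where n = "n" and i = 0, simplified])
  also have "\<dots> = U 2 (P 0 (A 1 (M 1 \<phi>)))"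
    using assms by (simp add: U_P[where n = "Suc n" and i = 1, simplified])
  also have "\<dots> = P 0 (U 2 (A 1 (M 1 \<phi>)))"
    using assms by (simp add: P_U[where n = "Suc n" and i = 0 and j = 2 and j' = 2, symmetric])
  also have "\<dots> = P 0 (A 1 (U 2 (M 1 \<phi>)))"
    using assms by (simp add: A_U[where n = "Suc n" and i = 1 and j = 2 and j' = 2, symmetric])
  also have "\<dots> = P 0 (A 1 \<phi>)"
    using assms by (simp add: U_M_right[where n = "n" and i = 1, simplified])
  finally have one: "D 0 (D 0 (A 2 (P 2 (P 1 (P 0 (A 1 (M 1 (M 1 \<phi>)))))))) = P 0 (A 1 \<phi>)" .
  have "D 0 (D 0 (A 2 (P 2 (P 1 (P 0 (A 1 (M 1 (M 1 \<phi>)))))))) = D 0 (A 1 (D 0 (P 2 (P 1 (P 0 (A 1 (M 1 (M 1 \<phi>))))))))"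
    using assms by (simp add: D_A[where n = "Suc (Suc n)" and i = 0 and j = 1 and j' = 2])
  also have "\<dots> = D 0 (A 1 (P 1 (D 0 (P 1 (P 0 (A 1 (M 1 (M 1 \<phi>))))))))"
    using assms by (simp add: D_P[where n = "Suc (Suc n)" and i = 0 and j = 1 and j' = 2])
  also have "\<dots> = D 0 (A 1 (P 1 (P 0 (D 1 (A 1 (M 1 (M 1 \<phi>)))))))"
    using assms by (simp add: P_D_right[where n = "Suc (Suc n)" and i = 0, simplified, symmetric])
  also have "\<dots> = D 0 (A 1 (P 1 (P 0 (E 1 (U 1 (M 1 \<phi>))))))"
    using assms by (simp add: D_A_M_left[where n = "Suc n" and i = 1, simplified])
  also have "\<dots> = D 0 (A 1 (P 1 (P 0 (E 1 \<phi>))))"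
    using assms by (simp add: U_M_left[where n = "n" and i = 1, simplified])
  also have "\<dots> = D 0 (A 1 (P 1 (E 0 \<phi>)))"
    using assms by (simp add: P_E_right[where n = "n" and i = 0, simplified])
  also have "\<dots> = D 0 (A 1 (E 0 (P 0 \<phi>)))"
    using assms by (simp add: E_P[where n = "n" and i = 0 and j = 1 and j' = 0, symmetric])
  also have "\<dots> = D 0 (E 0 (A 0 (P 0 \<phi>)))"
    using assms by (simp add: E_A[where n = "n" and i = 0 and j = 1 and j' = 0, symmetric])
  also have "\<dots> = A 0 (P 0 \<phi>)"
    using assms by (simp add: D_E_left[where n = "n" and i = 0, simplified])
  finally have two: "D 0 (D 0 (A 2 (P 2 (P 1 (P 0 (A 1 (M 1 (M 1 \<phi>)))))))) = A 0 (P 0 \<phi>)" .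
  show ?thesis using one two by simp
qed

end

locale hopf_strands = bialgebra_strands + antipode_strands
begin

text \<open>
  Without braiding: \<open>\<Delta> (x y\<^sub>1) (1 \<otimes> S y\<^sub>2) = x\<^sub>1 y\<^sub>1 \<otimes> x\<^sub>2 y\<^sub>2 S y\<^sub>3 = x\<^sub>1 y \<otimes> x\<^sub>2\<close>.
\<close>

lemma galois_identity:
  assumes "\<phi> \<in> F n" "2 \<le> n"
  shows "D 1 (A 2 (M 0 (D 0 (M 1 \<phi>)))) = D 0 (P 1 (M 0 \<phi>))"
proof -
  have "D 1 (A 2 (M 0 (D 0 (M 1 \<phi>)))) = D 1 (A 2 (D 0 (D 2 (P 1 (M 0 (M 1 (M 1 \<phi>)))))))"
    using assms by (simp add: M_D[where n = "Suc n" and i = 0, simplified add_0])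
  also have "\<dots> = D 1 (A 2 (D 0 (D 2 (P 1 (M 0 (M 2 (M 1 \<phi>)))))))"
    using assms by (simp add: M_M_assoc[where n = "n" and i = 1, simplified])
  also have "\<dots> = D 1 (A 2 (D 0 (D 2 (P 1 (M 3 (M 0 (M 1 \<phi>)))))))"
    using assms by (simp add: M_M[where n = "Suc n" and i = 0 and j = 3 and j' = 2])
  also have "\<dots> = D 1 (A 2 (D 0 (D 2 (M 3 (P 1 (M 0 (M 1 \<phi>)))))))"
    using assms by (simp add: P_M[where n = "Suc (Suc n)" and i = 1 and j = 3 and j' = 3])
  also have "\<dots> = D 1 (D 0 (A 3 (D 2 (M 3 (P 1 (M 0 (M 1 \<phi>)))))))"
    using assms by (simp add: D_A[where n = "Suc (Suc n)" and i = 0 and j = 2 and j' = 3, symmetric])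
  also have "\<dots> = D 0 (D 2 (A 3 (D 2 (M 3 (P 1 (M 0 (M 1 \<phi>)))))))"
    using assms by (simp add: D_D[where n = "Suc (Suc n)" and i = 0 and j = 1 and j' = 2, symmetric])
  also have "\<dots> = D 0 (D 2 (D 2 (A 4 (M 3 (P 1 (M 0 (M 1 \<phi>)))))))"
    using assms by (simp add: D_A[where n = "Suc (Suc (Suc n))" and i = 2 and j = 3 and j' = 4, symmetric])
  also have "\<dots> = D 0 (D 2 (D 3 (A 4 (M 3 (P 1 (M 0 (M 1 \<phi>)))))))"
    using assms by (simp add: D_D_coassoc[where n = "Suc (Suc (Suc n))" and i = 2, simplified])
  also have "\<dots> = D 0 (D 2 (E 3 (U 3 (P 1 (M 0 (M 1 \<phi>))))))"
    using assms by (simp add: D_A_M_right[where n = "Suc (Suc n)" and i = 3, simplified])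
  also have "\<dots> = D 0 (U 3 (P 1 (M 0 (M 1 \<phi>))))"
    using assms by (simp add: D_E_right[where n = "Suc n" and i = 2, simplified])
  also have "\<dots> = D 0 (P 1 (U 3 (M 0 (M 1 \<phi>))))"
    using assms by (simp add: P_U[where n = "Suc (Suc n)" and i = 1 and j = 3 and j' = 3, symmetric])
  also have "\<dots> = D 0 (P 1 (M 0 (U 2 (M 1 \<phi>))))"
    using assms by (simp add: M_U[where n = "Suc n" and i = 0 and j = 3 and j' = 2, symmetric])
  also have "\<dots> = D 0 (P 1 (M 0 \<phi>))"
    using assms by (simp add: U_M_right[where n = "n" and i = 1, simplified])
  finally have one: "D 1 (A 2 (M 0 (D 0 (M 1 \<phi>)))) = D 0 (P 1 (M 0 \<phi>))" .
  show ?thesis by (rule one)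
qed

text \<open>
  The counit is multiplicative. Applying \<open>\<epsilon> \<otimes> \<epsilon>\<close> to \<open>galois_identity\<close> gives \<open>\<epsilon>(x y)\<close> on the right, and
  \<open>\<epsilon>(x) \<epsilon>(y)\<close> on the left because \<open>(\<epsilon> \<otimes> id) \<Delta>\<close> is the identity on the product \<open>x y\<^sub>1\<close>.
\<close>

lemma M_E_counit:
  assumes "\<phi> \<in> F n" "0 \<le> n"
  shows "M 0 (E 0 \<phi>) = E 0 (E 0 \<phi>)"
proof -
  have "D 1 (A 2 (M 0 (D 0 (M 1 (E 0 (E 0 \<phi>)))))) = D 0 (P 1 (M 0 (E 0 (E 0 \<phi>))))"
    using assms by (simp add: galois_identity[where n = "Suc (Suc n)"])
  also have "\<dots> = D 0 (P 1 (M 0 (E 1 (E 0 \<phi>))))"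
    using assms by (simp add: E_E[where n = "n" and i = 0 and j = 1 and j' = 0])
  also have "\<dots> = D 0 (P 1 (E 2 (M 0 (E 0 \<phi>))))"
    using assms by (simp add: M_E[where n = "Suc n" and i = 0 and j = 2 and j' = 1])
  also have "\<dots> = D 0 (E 1 (M 0 (E 0 \<phi>)))"
    using assms by (simp add: P_E_right[where n = "Suc (Suc n)" and i = 1, simplified])
  also have "\<dots> = M 0 (E 0 \<phi>)"
    using assms by (simp add: D_E_right[where n = "Suc (Suc n)" and i = 0, simplified])
  finally have one: "D 1 (A 2 (M 0 (D 0 (M 1 (E 0 (E 0 \<phi>)))))) = M 0 (E 0 \<phi>)" .
  have "D 1 (A 2 (M 0 (D 0 (M 1 (E 0 (E 0 \<phi>)))))) = D 1 (A 2 (M 0 (D 0 (E 0 (M 0 (E 0 \<phi>))))))"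
    using assms by (simp add: E_M[where n = "Suc n" and i = 0 and j = 1 and j' = 0, symmetric])
  also have "\<dots> = D 1 (A 2 (M 0 (M 0 (E 0 \<phi>))))"
    using assms by (simp add: D_E_left[where n = "Suc (Suc n)" and i = 0, simplified])
  also have "\<dots> = D 1 (A 2 (M 1 (M 0 (E 0 \<phi>))))"
    using assms by (simp add: M_M_assoc[where n = "Suc n" and i = 0, simplified])
  also have "\<dots> = E 1 (U 1 (M 0 (E 0 \<phi>)))"
    using assms by (simp add: D_A_M_right[where n = "Suc (Suc n)" and i = 1, simplified])
  also have "\<dots> = E 1 (E 0 \<phi>)"
    using assms by (simp add: U_M_right[where n = "Suc n" and i = 0, simplified])
  also have "\<dots> = E 0 (E 0 \<phi>)"
    using assms by (simp add: E_E[where n = "n" and i = 0 and j = 1 and j' = 0, symmetric])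
  finally have two: "D 1 (A 2 (M 0 (D 0 (M 1 (E 0 (E 0 \<phi>)))))) = E 0 (E 0 \<phi>)" .
  show ?thesis using one two by simp
qed

text \<open>
  Applying \<open>m (S \<otimes> id)\<close> to \<open>galois_identity\<close> gives, without braiding, \<open>S(x\<^sub>1 y) x\<^sub>2 = \<epsilon>(x) S y\<close>.
\<close>

lemma D_P_M_A_M:
  assumes "\<phi> \<in> F n" "1 \<le> n"
  shows "D 0 (P 1 (M 0 (A 0 (M 0 \<phi>)))) = E 0 (A 0 \<phi>)"
proof -
  have one: "D 1 (A 2 (M 0 (D 0 (M 1 (A 0 (M 0 \<phi>)))))) = D 0 (P 1 (M 0 (A 0 (M 0 \<phi>))))"
    using assms by (simp add: galois_identity[where n = "Suc n"])
  have "D 1 (A 2 (M 0 (D 0 (M 1 (A 0 (M 0 \<phi>)))))) = D 1 (A 2 (M 0 (D 0 (A 0 (M 1 (M 0 \<phi>))))))"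
    using assms by (simp add: A_M[where n = "Suc n" and i = 0 and j = 1 and j' = 1, symmetric])
  also have "\<dots> = D 1 (A 2 (M 0 (D 0 (A 0 (M 0 (M 0 \<phi>))))))"
    using assms by (simp add: M_M_assoc[where n = "n" and i = 0, simplified, symmetric])
  also have "\<dots> = D 1 (A 2 (M 0 (E 0 (U 0 (M 0 \<phi>)))))"
    using assms by (simp add: D_A_M_left[where n = "Suc n" and i = 0, simplified])
  also have "\<dots> = D 1 (A 2 (M 0 (E 0 \<phi>)))"
    using assms by (simp add: U_M_left[where n = "n" and i = 0, simplified])
  also have "\<dots> = D 1 (A 2 (E 0 (E 0 \<phi>)))"
    using assms by (simp add: M_E_counit[where n = "n"])
  also have "\<dots> = D 1 (E 0 (A 1 (E 0 \<phi>)))"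
    using assms by (simp add: E_A[where n = "Suc n" and i = 0 and j = 2 and j' = 1, symmetric])
  also have "\<dots> = E 0 (D 0 (A 1 (E 0 \<phi>)))"
    using assms by (simp add: E_D[where n = "Suc n" and i = 0 and j = 1 and j' = 0, symmetric])
  also have "\<dots> = E 0 (D 0 (E 0 (A 0 \<phi>)))"
    using assms by (simp add: E_A[where n = "n" and i = 0 and j = 1 and j' = 0, symmetric])
  also have "\<dots> = E 0 (A 0 \<phi>)"
    using assms by (simp add: D_E_left[where n = "n" and i = 0, simplified])
  finally have two: "D 1 (A 2 (M 0 (D 0 (M 1 (A 0 (M 0 \<phi>)))))) = E 0 (A 0 \<phi>)" .
  show ?thesis using one two by simp
qed

text \<open>
  Multiplying \<open>S(x\<^sub>1 y) x\<^sub>2 = \<epsilon>(x) S y\<close> from the right by \<open>S x\<^sub>3\<close> yields \<open>S(x y) = S(y) S(x)\<close>, with the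
  braidings that the operators record.
\<close>

lemma M_A:
  assumes "\<phi> \<in> F n" "1 \<le> n"
  shows "M 0 (A 0 \<phi>) = A 0 (P 0 (A 0 (M 0 \<phi>)))"
proof -
  have "D 0 (D 0 (A 2 (P 2 (P 1 (M 0 (A 0 (M 0 (M 0 \<phi>)))))))) = D 0 (D 1 (A 2 (P 2 (P 1 (M 0 (A 0 (M 0 (M 0 \<phi>))))))))"
    using assms by (simp add: D_D_coassoc[where n = "Suc (Suc (Suc n))" and i = 0, simplified])
  also have "\<dots> = D 0 (D 1 (A 2 (P 2 (P 1 (M 0 (A 0 (M 1 (M 0 \<phi>))))))))"
    using assms by (simp add: M_M_assoc[where n = "n" and i = 0, simplified])
  also have "\<dots> = D 0 (D 1 (A 2 (P 2 (P 1 (M 0 (M 1 (A 0 (M 0 \<phi>))))))))"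
    using assms by (simp add: A_M[where n = "Suc n" and i = 0 and j = 1 and j' = 1])
  also have "\<dots> = D 0 (D 1 (A 2 (P 2 (P 1 (M 2 (M 0 (A 0 (M 0 \<phi>))))))))"
    using assms by (simp add: M_M[where n = "Suc n" and i = 0 and j = 2 and j' = 1])
  also have "\<dots> = D 0 (D 1 (A 2 (M 1 (P 1 (M 0 (A 0 (M 0 \<phi>)))))))"
    using assms by (simp add: M_P_left[where n = "Suc (Suc n)" and i = 1, simplified, symmetric])
  also have "\<dots> = D 0 (E 1 (U 1 (P 1 (M 0 (A 0 (M 0 \<phi>))))))"
    using assms by (simp add: D_A_M_right[where n = "Suc (Suc n)" and i = 1, simplified])
  also have "\<dots> = U 1 (P 1 (M 0 (A 0 (M 0 \<phi>))))"
    using assms by (simp add: D_E_right[where n = "Suc n" and i = 0, simplified])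
  also have "\<dots> = U 2 (M 0 (A 0 (M 0 \<phi>)))"
    using assms by (simp add: U_P[where n = "Suc (Suc n)" and i = 1, simplified])
  also have "\<dots> = M 0 (U 1 (A 0 (M 0 \<phi>)))"
    using assms by (simp add: M_U[where n = "Suc n" and i = 0 and j = 2 and j' = 1, symmetric])
  also have "\<dots> = M 0 (A 0 (U 1 (M 0 \<phi>)))"
    using assms by (simp add: A_U[where n = "Suc n" and i = 0 and j = 1 and j' = 1, symmetric])
  also have "\<dots> = M 0 (A 0 \<phi>)"
    using assms by (simp add: U_M_right[where n = "n" and i = 0, simplified])
  finally have one: "D 0 (D 0 (A 2 (P 2 (P 1 (M 0 (A 0 (M 0 (M 0 \<phi>)))))))) = M 0 (A 0 \<phi>)" .
  have "D 0 (D 0 (A 2 (P 2 (P 1 (M 0 (A 0 (M 0 (M 0 \<phi>)))))))) = D 0 (A 1 (D 0 (P 2 (P 1 (M 0 (A 0 (M 0 (M 0 \<phi>))))))))"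
    using assms by (simp add: D_A[where n = "Suc (Suc (Suc n))" and i = 0 and j = 1 and j' = 2])
  also have "\<dots> = D 0 (A 1 (P 1 (D 0 (P 1 (M 0 (A 0 (M 0 (M 0 \<phi>))))))))"
    using assms by (simp add: D_P[where n = "Suc (Suc (Suc n))" and i = 0 and j = 1 and j' = 2])
  also have "\<dots> = D 0 (A 1 (P 1 (E 0 (A 0 (M 0 \<phi>)))))"
    using assms by (simp add: D_P_M_A_M[where n = "Suc n"])
  also have "\<dots> = D 0 (A 1 (E 0 (P 0 (A 0 (M 0 \<phi>)))))"
    using assms by (simp add: E_P[where n = "Suc n" and i = 0 and j = 1 and j' = 0, symmetric])
  also have "\<dots> = D 0 (E 0 (A 0 (P 0 (A 0 (M 0 \<phi>)))))"
    using assms by (simp add: E_A[where n = "Suc n" and i = 0 and j = 1 and j' = 0, symmetric])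
  also have "\<dots> = A 0 (P 0 (A 0 (M 0 \<phi>)))"
    using assms by (simp add: D_E_left[where n = "Suc n" and i = 0, simplified])
  finally have two: "D 0 (D 0 (A 2 (P 2 (P 1 (M 0 (A 0 (M 0 (M 0 \<phi>)))))))) = A 0 (P 0 (A 0 (M 0 \<phi>)))" .
  show ?thesis using one two by simp
qed

end

section \<open>Opposite and coopposite bialgebras\<close>

context forms_space
begin

lemma form2_inject:
  assumes "linear_map K L" "linear_map K L'" "src L = T2" "src L' = T2" "tgt L = tgt L'" "form2 L = form2 L'"
  shows "L = L'"
proof (rule lmap_tensor_eqI[OF H H assms(1-5)])
  fix x y assume "x \<in> carrier H" "y \<in> carrier H"
  thus "app L (pt x y) = app L' (pt x y)" using fun_cong[OF assms(6), of "[x, y]"] by simp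
qed

end

lemma braided_bialgebra_iff:
  "braided_bialgebra K H m u \<Delta> \<epsilon> \<Psi> \<longleftrightarrow>
     braided_algebra K H m \<Psi> \<and> is_unit K H m u \<and> braided_coalgebra K H \<Delta> \<epsilon> \<Psi> \<and>
     \<Delta> \<cdot> m = (m \<boxtimes>\<^bsub>K\<^esub> m) \<cdot> middle_map K H \<Psi> \<cdot> (\<Delta> \<boxtimes>\<^bsub>K\<^esub> \<Delta>)"
  by (auto simp: braided_bialgebra_def braided_unital_algebra_def)

lemma bialgebra_strandsI:
  assumes "braided_bialgebra K H m u \<Delta> \<epsilon> \<Psi>" "module K X"
  shows "bialgebra_strands K H X m u \<Delta> \<epsilon> \<Psi>"
proof -
  have "module K H" using assms(1) by (simp add: braided_bialgebra_iff braided_algebra_def assoc_algebra_def)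
  with assms show ?thesis
    by (simp add: bialgebra_strands_def bialgebra_strands_axioms_def braided_strands_def
        braided_strands_axioms_def forms_space_def braided_bialgebra_iff)
qed

lemma braided_bialgebra_module: "braided_bialgebra K H m u \<Delta> \<epsilon> \<Psi> \<Longrightarrow> module K H"
  by (simp add: braided_bialgebra_iff braided_algebra_def assoc_algebra_def)

text \<open>
  The relation between the operators is evaluated at the universal form \<open>H \<otimes> H \<rightarrow> H \<otimes> H\<close>.
\<close>

lemma braided_bialgebra_op:
  assumes "braided_bialgebra K H m u \<Delta> \<epsilon> \<Psi>"
  shows "braided_bialgebra K H (m \<cdot> linv \<Psi>) u \<Delta> \<epsilon> (linv \<Psi>)"
proof -
  note H = braided_bialgebra_module[OF assms]
  interpret bialgebra_strands K H "tensor K H H" m u \<Delta> \<epsilon> \<Psi>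
    by (rule bialgebra_strandsI[OF assms tensor_module[OF H H]])
  let ?q = "linv \<Psi>" and ?l = "form2 (lid T2)"
  have l: "?l \<in> F 2" by (rule form2_forms) simp_all
  let ?R = "D 0 (D 2 (Q 1 (Q 2 (Q 0 (M 0 (M 1 ?l))))))"
  have "?R \<in> F 2" using l by (simp add: numeral_2_eq_2)
  \<comment> \<open>The relation between the operators computes \<open>P 0 ?R\<close>.\<close>
  hence "?R = Q 0 (P 0 ?R)" by (simp add: Q_P_cancel[where n = 2])
  also have "\<dots> = Q 0 (M 0 (D 0 ?l))" using P_D_D_op[OF l] by simp
  also have "\<dots> = form2 (\<Delta> \<cdot> m \<cdot> ?q)"
    by (simp add: Q_def M_def D_def strand_form_rules lcomp_assoc[of K] lid_lcomp[of K])
  finally have R: "?R = form2 (\<Delta> \<cdot> m \<cdot> ?q)" .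
  have "strand H T2 2 (mult_gen K H m) 0 (strand H T2 2 (mult_gen K H m) 1 ?l) = form4 (m \<boxtimes>\<^bsub>K\<^esub> m)"
    using strand_mult_mult_form2[of m "lid T2"] by (simp add: lid_lcomp[of K])
  hence "?R = form2 (((((m \<boxtimes>\<^bsub>K\<^esub> m) \<cdot> (?q \<boxtimes>\<^bsub>K\<^esub> lid T2)) \<cdot> (lid T2 \<boxtimes>\<^bsub>K\<^esub> ?q)) \<cdot> middle_map K H ?q) \<cdot> (\<Delta> \<boxtimes>\<^bsub>K\<^esub> \<Delta>))"
    by (simp add: Q_def M_def D_def strand_end_form4_0 strand_end_form4_1 strand_end_form4_2
        strand_comult_comult_form4 middle_map_typing)
  also have "((m \<boxtimes>\<^bsub>K\<^esub> m) \<cdot> (?q \<boxtimes>\<^bsub>K\<^esub> lid T2)) \<cdot> (lid T2 \<boxtimes>\<^bsub>K\<^esub> ?q) = (m \<cdot> ?q) \<boxtimes>\<^bsub>K\<^esub> (m \<cdot> ?q)"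
    by (simp add: tensor_map_lcomp lcomp_lid[of K] lid_lcomp[of K] lcomp_assoc[of K])
  finally have "form2 ((((m \<cdot> ?q) \<boxtimes>\<^bsub>K\<^esub> (m \<cdot> ?q)) \<cdot> middle_map K H ?q) \<cdot> (\<Delta> \<boxtimes>\<^bsub>K\<^esub> \<Delta>)) = form2 (\<Delta> \<cdot> m \<cdot> ?q)"
    using R by simp
  hence "(((m \<cdot> ?q) \<boxtimes>\<^bsub>K\<^esub> (m \<cdot> ?q)) \<cdot> middle_map K H ?q) \<cdot> (\<Delta> \<boxtimes>\<^bsub>K\<^esub> \<Delta>) = \<Delta> \<cdot> m \<cdot> ?q"
    by (intro form2_inject) (simp_all add: middle_map_typing)
  hence "\<Delta> \<cdot> (m \<cdot> ?q) = ((m \<cdot> ?q) \<boxtimes>\<^bsub>K\<^esub> (m \<cdot> ?q)) \<cdot> middle_map K H ?q \<cdot> (\<Delta> \<boxtimes>\<^bsub>K\<^esub> \<Delta>)"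
    by (simp add: lcomp_assoc[of K] middle_map_typing)
  thus ?thesis
    using braided_algebra_untwist[OF alg] is_unit_twist[OF braided_algebra_linv[OF alg] unit]
      braided_coalgebra_linv[OF coalg] by (simp add: braided_bialgebra_iff)
qed

lemma braided_bialgebra_cop:
  assumes "braided_bialgebra K H m u \<Delta> \<epsilon> \<Psi>"
  shows "braided_bialgebra K H m u (linv \<Psi> \<cdot> \<Delta>) \<epsilon> (linv \<Psi>)"
proof -
  note H = braided_bialgebra_module[OF assms]
  interpret bialgebra_strands K H "tensor K H H" m u \<Delta> \<epsilon> \<Psi>
    by (rule bialgebra_strandsI[OF assms tensor_module[OF H H]])
  let ?q = "linv \<Psi>" and ?l = "form2 (lid T2)"
  have l: "?l \<in> F 2" by (rule form2_forms) simp_all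
  hence q: "Q 0 ?l \<in> F 2" by simp
  let ?R = "D 0 (D 2 (Q 2 (Q 0 (Q 1 (M 0 (M 1 ?l))))))"
  \<comment> \<open>A braiding and its inverse are inserted after the products.\<close>
  have "?R = D 0 (D 2 (Q 2 (Q 0 (Q 1 (M 0 (M 1 (P 0 (Q 0 ?l))))))))"
    by (simp add: P_Q_cancel[OF l])
  also have "\<dots> = M 0 (D 0 (Q 0 ?l))" by (rule D_D_cop_P[OF q]) simp
  also have "\<dots> = form2 (?q \<cdot> \<Delta> \<cdot> m)"
    by (simp add: Q_def M_def D_def strand_form_rules lcomp_assoc[of K] lid_lcomp[of K])
  finally have R: "?R = form2 (?q \<cdot> \<Delta> \<cdot> m)" .
  have "strand H T2 2 (mult_gen K H m) 0 (strand H T2 2 (mult_gen K H m) 1 ?l) = form4 (m \<boxtimes>\<^bsub>K\<^esub> m)"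
    using strand_mult_mult_form2[of m "lid T2"] by (simp add: lid_lcomp[of K])
  hence "?R = form2 (((((m \<boxtimes>\<^bsub>K\<^esub> m) \<cdot> middle_map K H ?q) \<cdot> (?q \<boxtimes>\<^bsub>K\<^esub> lid T2)) \<cdot> (lid T2 \<boxtimes>\<^bsub>K\<^esub> ?q)) \<cdot> (\<Delta> \<boxtimes>\<^bsub>K\<^esub> \<Delta>))"
    by (simp add: Q_def M_def D_def strand_end_form4_0 strand_end_form4_1 strand_end_form4_2
        strand_comult_comult_form4 middle_map_typing)
  also have "\<dots> = form2 ((m \<boxtimes>\<^bsub>K\<^esub> m) \<cdot> middle_map K H ?q \<cdot> ((?q \<boxtimes>\<^bsub>K\<^esub> lid T2) \<cdot> (lid T2 \<boxtimes>\<^bsub>K\<^esub> ?q)) \<cdot> (\<Delta> \<boxtimes>\<^bsub>K\<^esub> \<Delta>))"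
    by (simp add: lcomp_assoc[of K] middle_map_typing)
  also have "((?q \<boxtimes>\<^bsub>K\<^esub> lid T2) \<cdot> (lid T2 \<boxtimes>\<^bsub>K\<^esub> ?q)) \<cdot> (\<Delta> \<boxtimes>\<^bsub>K\<^esub> \<Delta>) = (?q \<cdot> \<Delta>) \<boxtimes>\<^bsub>K\<^esub> (?q \<cdot> \<Delta>)"
    by (simp add: tensor_map_lcomp lcomp_lid[of K] lid_lcomp[of K])
  finally have "form2 ((m \<boxtimes>\<^bsub>K\<^esub> m) \<cdot> middle_map K H ?q \<cdot> ((?q \<cdot> \<Delta>) \<boxtimes>\<^bsub>K\<^esub> (?q \<cdot> \<Delta>))) = form2 (?q \<cdot> \<Delta> \<cdot> m)"
    using R by simp
  hence "(m \<boxtimes>\<^bsub>K\<^esub> m) \<cdot> middle_map K H ?q \<cdot> ((?q \<cdot> \<Delta>) \<boxtimes>\<^bsub>K\<^esub> (?q \<cdot> \<Delta>)) = ?q \<cdot> \<Delta> \<cdot> m"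
    by (intro form2_inject) (simp_all add: middle_map_typing)
  hence "(?q \<cdot> \<Delta>) \<cdot> m = (m \<boxtimes>\<^bsub>K\<^esub> m) \<cdot> middle_map K H ?q \<cdot> ((?q \<cdot> \<Delta>) \<boxtimes>\<^bsub>K\<^esub> (?q \<cdot> \<Delta>))"
    by (simp add: lcomp_assoc[of K])
  thus ?thesis
    using braided_algebra_linv[OF alg] unit braided_coalgebra_untwist[OF coalg]
    by (simp add: braided_bialgebra_iff)
qed

lemma braided_bialgebra_braiding:
  assumes "braided_bialgebra K H m u \<Delta> \<epsilon> \<Psi>"
  shows "linear_map K \<Psi>" "src \<Psi> = tensor K H H" "tgt \<Psi> = tensor K H H" "lbij \<Psi>" "linv (linv \<Psi>) = \<Psi>"
proof -
  interpret crossing K H H \<Psi>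
    by (rule braided_space_crossing) (use assms in \<open>simp add: braided_bialgebra_iff braided_algebra_def\<close>)
  show "linear_map K \<Psi>" "src \<Psi> = tensor K H H" "tgt \<Psi> = tensor K H H" "lbij \<Psi>" "linv (linv \<Psi>) = \<Psi>"
    by (simp_all add: linv_linv[of K])
qed

text \<open>
  The coopposite has braiding \<open>\<Psi>\<^sup>-\<^sup>1\<close>, so its opposite has product \<open>m \<Psi>\<close> and braiding \<open>\<Psi>\<close> again; the
  other order of the two moves gives the inverse twist.
\<close>

lemma braided_bialgebra_twist:
  assumes "braided_bialgebra K H m u \<Delta> \<epsilon> \<Psi>"
  shows "braided_bialgebra K H (m \<cdot> \<Psi>) u (linv \<Psi> \<cdot> \<Delta>) \<epsilon> \<Psi>"
    and "braided_bialgebra K H (m \<cdot> linv \<Psi>) u (\<Psi> \<cdot> \<Delta>) \<epsilon> \<Psi>"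
  using braided_bialgebra_op[OF braided_bialgebra_cop[OF assms]]
    braided_bialgebra_cop[OF braided_bialgebra_op[OF assms]] braided_bialgebra_braiding(5)[OF assms]
  by simp_all

section \<open>The antipode\<close>

text \<open>
  The antipode equations do not mention the braiding, so S is also a convolution inverse of the identity
  for the braided algebra and coalgebra with the inverse braiding.
\<close>

lemma hopf_strandsI:
  assumes "braided_hopf_algebra K H m u \<Delta> \<epsilon> \<Psi> S" "module K X"
  shows "hopf_strands K H X m u \<Delta> \<epsilon> \<Psi> S" "antipode_strands K H X m u \<Delta> \<epsilon> (linv \<Psi>) S"
proof -
  have b: "braided_bialgebra K H m u \<Delta> \<epsilon> \<Psi>" using assms by (simp add: braided_hopf_algebra_def)
  note H = braided_bialgebra_module[OF b]
  have S: "linear_map K S" "src S = H" "tgt S = H"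
    using assms(1) linear_mapI[OF H H, of S] by (simp_all add: braided_hopf_algebra_def)
  interpret bialgebra_strands K H X m u \<Delta> \<epsilon> \<Psi> by (rule bialgebra_strandsI[OF b assms(2)])
  show "hopf_strands K H X m u \<Delta> \<epsilon> \<Psi> S"
    by unfold_locales (use assms S in \<open>simp_all add: braided_hopf_algebra_def\<close>)
  show "antipode_strands K H X m u \<Delta> \<epsilon> (linv \<Psi>) S"
    using assms S H unit braided_algebra_linv[OF alg] braided_coalgebra_linv[OF coalg]
    by (simp add: antipode_strands_def antipode_strands_axioms_def braided_strands_def
        braided_strands_axioms_def forms_space_def braided_hopf_algebra_def)
qed

context antipode_strands
begin

lemma strand_antipode_form2:
  assumes "linear_map K L" "src L = T2" "tgt L = X"
  shows "A 0 (form2 L) = form2 (L \<cdot> (S \<boxtimes>\<^bsub>K\<^esub> lid H))" "A 1 (form2 L) = form2 (L \<cdot> (lid H \<boxtimes>\<^bsub>K\<^esub> S))"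
  using assms by (simp_all add: A_def strand_map_form2_0 strand_map_form2_1)

end

lemma antipode_braiding:
  assumes "antipode_strands K H (tensor K H H) m u \<Delta> \<epsilon> \<Psi> S"
  shows "\<Psi> \<cdot> (S \<boxtimes>\<^bsub>K\<^esub> lid H) = (lid H \<boxtimes>\<^bsub>K\<^esub> S) \<cdot> \<Psi>"
proof -
  interpret antipode_strands K H "tensor K H H" m u \<Delta> \<epsilon> \<Psi> S by fact
  have "P 0 (A 1 (form2 (lid T2))) = A 0 (P 0 (form2 (lid T2)))"
    by (rule A_P[where n = 2]) (simp_all add: form2_forms)
  hence "form2 ((lid H \<boxtimes>\<^bsub>K\<^esub> S) \<cdot> \<Psi>) = form2 (\<Psi> \<cdot> (S \<boxtimes>\<^bsub>K\<^esub> lid H))"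
    by (simp add: strand_antipode_form2 P_def strand_form_rules lid_lcomp[of K])
  thus ?thesis by (intro form2_inject) simp_all
qed

text \<open>
  The second equation is the first one for the inverse braiding, inverted.
\<close>

lemma hopf_antipode_braiding:
  assumes "braided_hopf_algebra K H m u \<Delta> \<epsilon> \<Psi> S"
  shows "\<Psi> \<cdot> (S \<boxtimes>\<^bsub>K\<^esub> lid H) = (lid H \<boxtimes>\<^bsub>K\<^esub> S) \<cdot> \<Psi>" "\<Psi> \<cdot> (lid H \<boxtimes>\<^bsub>K\<^esub> S) = (S \<boxtimes>\<^bsub>K\<^esub> lid H) \<cdot> \<Psi>"
proof -
  have b: "braided_bialgebra K H m u \<Delta> \<epsilon> \<Psi>" using assms by (simp add: braided_hopf_algebra_def)
  note H = braided_bialgebra_module[OF b]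
  note T = tensor_module[OF H H]
  interpret hopf_strands K H "tensor K H H" m u \<Delta> \<epsilon> \<Psi> S by (rule hopf_strandsI(1)[OF assms T])
  show "\<Psi> \<cdot> (S \<boxtimes>\<^bsub>K\<^esub> lid H) = (lid H \<boxtimes>\<^bsub>K\<^esub> S) \<cdot> \<Psi>" by (rule antipode_braiding) (rule antipode_strands_axioms)
  have "linv \<Psi> \<cdot> (S \<boxtimes>\<^bsub>K\<^esub> lid H) = (lid H \<boxtimes>\<^bsub>K\<^esub> S) \<cdot> linv \<Psi>"
    by (rule antipode_braiding[OF hopf_strandsI(2)[OF assms T]])
  from intertwine_linv[of K "linv \<Psi>" "linv \<Psi>", OF _ _ _ _ _ _ _ _ _ _ this]
  show "\<Psi> \<cdot> (lid H \<boxtimes>\<^bsub>K\<^esub> S) = (S \<boxtimes>\<^bsub>K\<^esub> lid H) \<cdot> \<Psi>" by (simp add: lbij_linv linv_linv[of K])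
qed

text \<open>
  In \<open>M_A\<close> the second antipode is moved past the braiding to the other factor.
\<close>

lemma antipode_antimultiplicative:
  assumes "braided_hopf_algebra K H m u \<Delta> \<epsilon> \<Psi> S"
  shows "S \<cdot> m \<cdot> linv \<Psi> = m \<cdot> (S \<boxtimes>\<^bsub>K\<^esub> S)"
proof -
  have b: "braided_bialgebra K H m u \<Delta> \<epsilon> \<Psi>" using assms by (simp add: braided_hopf_algebra_def)
  note H = braided_bialgebra_module[OF b]
  interpret hopf_strands K H H m u \<Delta> \<epsilon> \<Psi> S by (rule hopf_strandsI(1)[OF assms H])
  note comm = hopf_antipode_braiding[OF assms]
  have "M 0 (A 0 (form1 (lid H))) = A 0 (P 0 (A 0 (M 0 (form1 (lid H)))))"
    by (rule M_A[where n = 1]) (simp_all add: form1_forms)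
  moreover have "M 0 (A 0 (form1 (lid H))) = form2 (S \<cdot> m)"
    by (simp add: M_def A_def strand_map_form1 strand_form_rules lid_lcomp[of K])
  moreover have "A 0 (P 0 (A 0 (M 0 (form1 (lid H))))) = form2 (m \<cdot> (S \<boxtimes>\<^bsub>K\<^esub> lid H) \<cdot> \<Psi> \<cdot> (S \<boxtimes>\<^bsub>K\<^esub> lid H))"
    by (simp add: M_def P_def strand_antipode_form2 strand_form_rules lid_lcomp[of K] lcomp_assoc[of K])
  ultimately have "form2 (S \<cdot> m) = form2 (m \<cdot> (S \<boxtimes>\<^bsub>K\<^esub> lid H) \<cdot> \<Psi> \<cdot> (S \<boxtimes>\<^bsub>K\<^esub> lid H))" by simp
  hence "S \<cdot> m = m \<cdot> (S \<boxtimes>\<^bsub>K\<^esub> lid H) \<cdot> \<Psi> \<cdot> (S \<boxtimes>\<^bsub>K\<^esub> lid H)" by (intro form2_inject) simp_all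
  also have "\<dots> = m \<cdot> ((S \<boxtimes>\<^bsub>K\<^esub> lid H) \<cdot> (lid H \<boxtimes>\<^bsub>K\<^esub> S)) \<cdot> \<Psi>"
    by (simp add: comm(1) lcomp_assoc[of K])
  also have "(S \<boxtimes>\<^bsub>K\<^esub> lid H) \<cdot> (lid H \<boxtimes>\<^bsub>K\<^esub> S) = S \<boxtimes>\<^bsub>K\<^esub> S"
    by (simp add: tensor_map_lcomp lcomp_lid[of K] lid_lcomp[of K])
  finally have "(S \<cdot> m) \<cdot> linv \<Psi> = (m \<cdot> (S \<boxtimes>\<^bsub>K\<^esub> S) \<cdot> \<Psi>) \<cdot> linv \<Psi>" by simp
  thus ?thesis by (simp add: lcomp_assoc[of K] lcomp_linv[of K] lcomp_lid[of K])
qed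

text \<open>
  Moving S to the other factor lets the braidings of product and coproduct cancel, and exchanges the two
  antipode equations.
\<close>

lemma braided_hopf_twist:
  assumes "braided_hopf_algebra K H m u \<Delta> \<epsilon> \<Psi> S"
  shows "braided_hopf_algebra K H (m \<cdot> \<Psi>) u (linv \<Psi> \<cdot> \<Delta>) \<epsilon> \<Psi> S"
    and "braided_hopf_algebra K H (m \<cdot> linv \<Psi>) u (\<Psi> \<cdot> \<Delta>) \<epsilon> \<Psi> S"
proof -
  have b: "braided_bialgebra K H m u \<Delta> \<epsilon> \<Psi>" using assms by (simp add: braided_hopf_algebra_def)
  note H = braided_bialgebra_module[OF b]
  interpret hopf_strands K H H m u \<Delta> \<epsilon> \<Psi> S by (rule hopf_strandsI(1)[OF assms H])
  let ?S1 = "S \<boxtimes>\<^bsub>K\<^esub> lid H" and ?S2 = "lid H \<boxtimes>\<^bsub>K\<^esub> S" and ?q = "linv \<Psi>"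
  note comm = hopf_antipode_braiding[OF assms]
  have comm': "?q \<cdot> ?S2 = ?S1 \<cdot> ?q" "?q \<cdot> ?S1 = ?S2 \<cdot> ?q"
    using intertwine_linv[of K \<Psi> \<Psi>, OF _ _ _ _ _ _ _ _ _ _ comm(1)]
      intertwine_linv[of K \<Psi> \<Psi>, OF _ _ _ _ _ _ _ _ _ _ comm(2)] by simp_all
  have 1: "\<Psi> \<cdot> ?S1 \<cdot> ?q \<cdot> \<Delta> = ?S2 \<cdot> \<Delta>" "\<Psi> \<cdot> ?S2 \<cdot> ?q \<cdot> \<Delta> = ?S1 \<cdot> \<Delta>"
    using lcomp_extend[OF comm(1), of K "?q \<cdot> \<Delta>"] lcomp_extend[OF comm(2), of K "?q \<cdot> \<Delta>"]
    by (simp_all add: lcomp_assoc[of K] lcomp_linv_cancel[of K])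
  have 2: "?q \<cdot> ?S1 \<cdot> \<Psi> \<cdot> \<Delta> = ?S2 \<cdot> \<Delta>" "?q \<cdot> ?S2 \<cdot> \<Psi> \<cdot> \<Delta> = ?S1 \<cdot> \<Delta>"
    using lcomp_extend[OF comm'(2), of K "\<Psi> \<cdot> \<Delta>"] lcomp_extend[OF comm'(1), of K "\<Psi> \<cdot> \<Delta>"]
    by (simp_all add: lcomp_assoc[of K] linv_lcomp_cancel[of K])
  show "braided_hopf_algebra K H (m \<cdot> \<Psi>) u (linv \<Psi> \<cdot> \<Delta>) \<epsilon> \<Psi> S"
    "braided_hopf_algebra K H (m \<cdot> linv \<Psi>) u (\<Psi> \<cdot> \<Delta>) \<epsilon> \<Psi> S"
    using assms 1 2 antipode_left antipode_right braided_bialgebra_twist[OF b]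
    by (simp_all add: braided_hopf_algebra_def lcomp_assoc[of K])
qed

text \<open>
  Evaluate antimultiplicativity at \<open>u \<otimes> y\<close> where \<open>y\<close> is the preimage of the unit under S.
\<close>

lemma antipode_unit:
  assumes hopf: "braided_hopf_algebra K H m u \<Delta> \<epsilon> \<Psi> S" and S_bij: "lbij S"
  shows "app S u = u"
proof -
  have b: "braided_bialgebra K H m u \<Delta> \<epsilon> \<Psi>" using hopf by (simp add: braided_hopf_algebra_def)
  note H = braided_bialgebra_module[OF b]
  interpret hopf_strands K H H m u \<Delta> \<epsilon> \<Psi> S by (rule hopf_strandsI(1)[OF hopf H])
  have "braided_bialgebra K H (m \<cdot> linv \<Psi>) u \<Delta> \<epsilon> (linv \<Psi>)" by (rule braided_bialgebra_op[OF b])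
  hence u': "is_unit K H (m \<cdot> linv \<Psi>) u" by (simp add: braided_bialgebra_iff)
  define y where "y = app (linv S) u"
  have y: "y \<in> carrier H" "app S y = u"
    using linv_app_closed[OF S_bij, of u] app_linv_app[OF S_bij, of u] by (simp_all add: y_def)
  have Su: "app S u \<in> carrier H" by (rule app_mem[of K S H H]) simp_all
  have "u = app S (app (m \<cdot> linv \<Psi>) (pt u y))" using u' y by (simp add: is_unit_def)
  also have "\<dots> = app (S \<cdot> m \<cdot> linv \<Psi>) (pt u y)" using y by simp
  also have "\<dots> = app m (pt (app S u) u)"
    unfolding antipode_antimultiplicative[OF hopf]
    using tensor_map_pure[OF S(1) S(1), of u y] y by simp
  also have "\<dots> = app S u" using unit Su by (simp add: is_unit_def)
  finally show ?thesis by simp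
qed

text \<open>
  Both antipode equations may be checked after applying the injective map S, which by
  antimultiplicativity turns them into the antipode equations of H.
\<close>

lemma braided_hopf_op:
  assumes hopf: "braided_hopf_algebra K H m u \<Delta> \<epsilon> \<Psi> S" and S_bij: "lbij S"
  shows "braided_hopf_algebra K H (m \<cdot> linv \<Psi>) u \<Delta> \<epsilon> (linv \<Psi>) (linv S)"
proof -
  have b: "braided_bialgebra K H m u \<Delta> \<epsilon> \<Psi>" using hopf by (simp add: braided_hopf_algebra_def)
  note H = braided_bialgebra_module[OF b]
  interpret hopf_strands K H H m u \<Delta> \<epsilon> \<Psi> S by (rule hopf_strandsI(1)[OF hopf H])
  let ?q = "linv \<Psi>" and ?T = "linv S" and ?e = "unit_counit H u \<epsilon>"
  have T [simp]: "linear_map K ?T" using S_bij by (simp add: linv_linear)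
  have Se: "S \<cdot> ?e = ?e"
  proof (rule lmap_eqI[of K])
    fix x assume "x \<in> carrier (src ?e)"
    hence x: "x \<in> carrier H" by simp
    show "app (S \<cdot> ?e) x = app ?e x"
      using x antipode_unit[OF hopf S_bij] linear_funD(3)[OF linear_map_linear[OF S(1)], of "app \<epsilon> x" u]
      by (simp add: unit_counit_def)
  qed simp_all
  have key: "f = ?e" if f: "linear_map K f" "src f = H" "tgt f = H" "S \<cdot> f = ?e" for f
    by (rule lcomp_left_cancel[of K S]) (use f S_bij Se in simp_all)
  have anti: "S \<cdot> m \<cdot> ?q \<cdot> g = m \<cdot> (S \<boxtimes>\<^bsub>K\<^esub> S) \<cdot> g" if "linear_map K g" "tgt g = T2" for g
  proof -
    have "S \<cdot> m \<cdot> ?q \<cdot> g = (S \<cdot> m \<cdot> ?q) \<cdot> g" using that by (simp add: lcomp_assoc[of K])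
    thus ?thesis unfolding antipode_antimultiplicative[OF hopf] using that by (simp add: lcomp_assoc[of K])
  qed
  have SS: "(S \<boxtimes>\<^bsub>K\<^esub> S) \<cdot> (?T \<boxtimes>\<^bsub>K\<^esub> lid H) \<cdot> \<Delta> = (lid H \<boxtimes>\<^bsub>K\<^esub> S) \<cdot> \<Delta>"
    "(S \<boxtimes>\<^bsub>K\<^esub> S) \<cdot> (lid H \<boxtimes>\<^bsub>K\<^esub> ?T) \<cdot> \<Delta> = (S \<boxtimes>\<^bsub>K\<^esub> lid H) \<cdot> \<Delta>"
    using tensor_map_lcomp[of K S ?T S "lid H"] tensor_map_lcomp[of K S "lid H" S ?T] S_bij
    by (simp_all add: lcomp_assoc[of K, symmetric] lcomp_linv[of K] lcomp_lid[of K])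
  have "(m \<cdot> ?q) \<cdot> (?T \<boxtimes>\<^bsub>K\<^esub> lid H) \<cdot> \<Delta> = ?e"
    by (rule key) (simp_all add: lcomp_assoc[of K] anti SS antipode_right)
  moreover have "(m \<cdot> ?q) \<cdot> (lid H \<boxtimes>\<^bsub>K\<^esub> ?T) \<cdot> \<Delta> = ?e"
    by (rule key) (simp_all add: lcomp_assoc[of K] anti SS antipode_left)
  ultimately show ?thesis
    using braided_bialgebra_op[OF b] linear_map_in[of K ?T H H] by (simp add: braided_hopf_algebra_def)
qed

section \<open>Iterating the twists\<close>

lemma twisted_steps:
  assumes "braided_bialgebra K H m u \<Delta> \<epsilon> \<Psi>"
  shows "twisted_mult \<Psi> m 0 = m" "twisted_comult \<Psi> \<Delta> 0 = \<Delta>"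
    and "twisted_mult \<Psi> m (i + 1) = twisted_mult \<Psi> m i \<cdot> \<Psi>"
    and "twisted_mult \<Psi> m (i - 1) = twisted_mult \<Psi> m i \<cdot> linv \<Psi>"
    and "twisted_comult \<Psi> \<Delta> (i + 1) = \<Psi> \<cdot> twisted_comult \<Psi> \<Delta> i"
    and "twisted_comult \<Psi> \<Delta> (i - 1) = linv \<Psi> \<cdot> twisted_comult \<Psi> \<Delta> i"
proof -
  note H = braided_bialgebra_module[OF assms]
  interpret bialgebra_strands K H H m u \<Delta> \<epsilon> \<Psi> by (rule bialgebra_strandsI[OF assms H])
  have P: "linear_map K \<Psi>" "tgt \<Psi> = src \<Psi>" "lbij \<Psi>" by simp_all
  note [simp] = lpow_typing[OF P]
  show "twisted_mult \<Psi> m 0 = m" "twisted_comult \<Psi> \<Delta> 0 = \<Delta>"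
    by (simp_all add: twisted_mult_def twisted_comult_def lpow_0[OF P] lcomp_lid[of K] lid_lcomp[of K])
  show "twisted_mult \<Psi> m (i + 1) = twisted_mult \<Psi> m i \<cdot> \<Psi>"
    by (simp add: twisted_mult_def lpow_add1[OF P] lpow_commute[OF P] lcomp_assoc[of K])
  show "twisted_mult \<Psi> m (i - 1) = twisted_mult \<Psi> m i \<cdot> linv \<Psi>"
    by (simp add: twisted_mult_def lpow_diff1[OF P] lpow_commute_linv[OF P] lcomp_assoc[of K])
  show "twisted_comult \<Psi> \<Delta> (i + 1) = \<Psi> \<cdot> twisted_comult \<Psi> \<Delta> i"
    by (simp add: twisted_comult_def lpow_add1[OF P] lcomp_assoc[of K])
  show "twisted_comult \<Psi> \<Delta> (i - 1) = linv \<Psi> \<cdot> twisted_comult \<Psi> \<Delta> i"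
    by (simp add: twisted_comult_def lpow_diff1[OF P] lcomp_assoc[of K])
qed

lemma braided_bialgebra_twisted:
  assumes b: "braided_bialgebra K H m u \<Delta> \<epsilon> \<Psi>"
  shows "braided_bialgebra K H (twisted_mult \<Psi> m n) u (twisted_comult \<Psi> \<Delta> (- n)) \<epsilon> \<Psi>"
proof (induction n rule: int_induct[of _ 0])
  case base
  show ?case using b by (simp add: twisted_steps[OF b])
next
  case (step1 i)
  have "- (i + 1) = - i - 1" by simp
  thus ?case using braided_bialgebra_twist(1)[OF step1(2)]
    by (simp only: twisted_steps(3,6)[OF b])
next
  case (step2 i)
  have "- (i - 1) = - i + 1" by simp
  thus ?case using braided_bialgebra_twist(2)[OF step2(2)]
    by (simp only: twisted_steps(4,5)[OF b])
qed

lemma braided_hopf_twisted: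
  assumes h: "braided_hopf_algebra K H m u \<Delta> \<epsilon> \<Psi> S"
  shows "braided_hopf_algebra K H (twisted_mult \<Psi> m n) u (twisted_comult \<Psi> \<Delta> (- n)) \<epsilon> \<Psi> S"
proof -
  have b: "braided_bialgebra K H m u \<Delta> \<epsilon> \<Psi>" using h by (simp add: braided_hopf_algebra_def)
  show ?thesis
  proof (induction n rule: int_induct[of _ 0])
    case base
    show ?case using h by (simp add: twisted_steps[OF b])
  next
    case (step1 i)
    have "- (i + 1) = - i - 1" by simp
    thus ?case using braided_hopf_twist(1)[OF step1(2)]
      by (simp only: twisted_steps(3,6)[OF b])
  next
    case (step2 i)
    have "- (i - 1) = - i + 1" by simp
    thus ?case using braided_hopf_twist(2)[OF step2(2)]
      by (simp only: twisted_steps(4,5)[OF b])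
  qed
qed

theorem proposition3p1:
  fixes K :: "('k, 'r) ring_scheme"
    and H :: "('k, 'h) module"
    and \<Psi> :: "('k, ('h \<times> 'h \<Rightarrow> 'k) set, ('h \<times> 'h \<Rightarrow> 'k) set) lmap"
  assumes "field K"
  shows
    "(\<forall>m k. braided_algebra K H m \<Psi> \<longrightarrow>
        braided_algebra K H (twisted_mult \<Psi> m k) \<Psi> \<and>
        (\<forall>u. braided_unital_algebra K H m u \<Psi> \<longrightarrow>
             braided_unital_algebra K H (twisted_mult \<Psi> m k) u \<Psi>) \<and>
        (\<forall>(V :: ('k, 'v) module) \<Phi>.
             left_braided_space K H \<Psi> V \<Phi> \<and> mult_compat_l K H V m \<Phi> \<longrightarrow>
             mult_compat_l K H V (twisted_mult \<Psi> m k) \<Phi>) \<and>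
        (\<forall>(V :: ('k, 'v) module) \<Phi>.
             right_braided_space K H \<Psi> V \<Phi> \<and> mult_compat_r K V H m \<Phi> \<longrightarrow>
             mult_compat_r K V H (twisted_mult \<Psi> m k) \<Phi>))
     \<and>
     (\<forall>\<Delta> \<epsilon> n. braided_coalgebra K H \<Delta> \<epsilon> \<Psi> \<longrightarrow>
        braided_coalgebra K H (twisted_comult \<Psi> \<Delta> n) \<epsilon> \<Psi> \<and>
        (\<forall>(V :: ('k, 'v) module) \<Phi>.
             left_braided_space K H \<Psi> V \<Phi> \<and> comult_compat_l K H V \<Delta> \<epsilon> \<Phi> \<longrightarrow>
             comult_compat_l K H V (twisted_comult \<Psi> \<Delta> n) \<epsilon> \<Phi>) \<and>
        (\<forall>(V :: ('k, 'v) module) \<Phi>.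
             right_braided_space K H \<Psi> V \<Phi> \<and> comult_compat_r K V H \<Delta> \<epsilon> \<Phi> \<longrightarrow>
             comult_compat_r K V H (twisted_comult \<Psi> \<Delta> n) \<epsilon> \<Phi>))
     \<and>
     (\<forall>m u \<Delta> \<epsilon>. braided_bialgebra K H m u \<Delta> \<epsilon> \<Psi> \<longrightarrow>
        (\<forall>n. braided_bialgebra K H (twisted_mult \<Psi> m n) u (twisted_comult \<Psi> \<Delta> (- n)) \<epsilon> \<Psi> \<and>
             braided_bialgebra K H (twisted_mult \<Psi> m (n - 1)) u (twisted_comult \<Psi> \<Delta> (- n)) \<epsilon>
               (linv \<Psi>)))
     \<and>
     (\<forall>m u \<Delta> \<epsilon> S. braided_hopf_algebra K H m u \<Delta> \<epsilon> \<Psi> S \<longrightarrow>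
        (\<forall>n. braided_hopf_algebra K H (twisted_mult \<Psi> m n) u (twisted_comult \<Psi> \<Delta> (- n)) \<epsilon> \<Psi> S) \<and>
        (lbij S \<longrightarrow>
          (\<forall>n. braided_hopf_algebra K H (twisted_mult \<Psi> m (n - 1)) u (twisted_comult \<Psi> \<Delta> (- n)) \<epsilon>
                 (linv \<Psi>) (linv S))))"
proof (intro conjI allI impI)
  fix m u \<Delta> \<epsilon> n assume b: "braided_bialgebra K H m u \<Delta> \<epsilon> \<Psi>"
  show "braided_bialgebra K H (twisted_mult \<Psi> m (n - 1)) u (twisted_comult \<Psi> \<Delta> (- n)) \<epsilon> (linv \<Psi>)"
    unfolding twisted_steps(4)[OF b] by (rule braided_bialgebra_op[OF braided_bialgebra_twisted[OF b]])
next
  fix m u \<Delta> \<epsilon> S n assume h: "braided_hopf_algebra K H m u \<Delta> \<epsilon> \<Psi> S" and S: "lbij S"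
  have b: "braided_bialgebra K H m u \<Delta> \<epsilon> \<Psi>" using h by (simp add: braided_hopf_algebra_def)
  show "braided_hopf_algebra K H (twisted_mult \<Psi> m (n - 1)) u (twisted_comult \<Psi> \<Delta> (- n)) \<epsilon> (linv \<Psi>) (linv S)"
    unfolding twisted_steps(4)[OF b] by (rule braided_hopf_op[OF braided_hopf_twisted[OF h] S])
qed (auto simp: braided_algebra_twisted_mult braided_unital_algebra_def braided_coalgebra_twisted_comult
    twisted_mult_compat_l twisted_mult_compat_r twisted_comult_compat_l twisted_comult_compat_r
    braided_bialgebra_twisted braided_hopf_twisted)

end
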